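(* Let $d \geq 2$ be an integer. Then there exist $A \in \mathbb{R}_{>0}$ and $B \in \mathbb{R}$ such that $$\max\left\{ H_f^{(1)}, H_f^{(2)} \right\} \geq A \cdot H_f + B$$ for all $f \in \mathrm{Poly}_d(\overline{\mathbb{Q}})$. Moreover, if $d \in \{2,3\}$, then there exist $A \in \mathbb{R}_{>0}$ and $B \in \mathbb{R}$ such that $H_f^{(1)} \geq A \cdot H_f + B$ for all $f \in \mathrm{Poly}_d(\overline{\mathbb{Q}})$.
   Context: $\mathrm{Poly}_d(\overline{\mathbb{Q}})$ is the set of polynomials of degree $d$ over the algebraic closure $\overline{\mathbb{Q}}$ of $\mathbb{Q}$. The standard (absolute logarithmic Weil) height $h \colon \overline{\mathbb{Q}} \to \mathbb{R}_{\geq 0}$ is $h(t) = \frac{1}{[\mathbb{K}:\mathbb{Q}]} \sum_{p \in \mathbb{P} \cup \{\infty\}} \sum_{\sigma \colon \mathbb{K} \hookrightarrow \overline{\mathbb{Q}}_p} \log^+ |\sigma(t)|_p$, where $\mathbb{K}$ is any number field containing $t$, $\mathbb{P}$ is the set of primes, $\overline{\mathbb{Q}}_p$ is the algebraic closure of $\mathbb{Q}_p$ with its natural absolute value $|\cdot|_p$ for $p \in \mathbb{P}$, and $\overline{\mathbb{Q}}_\infty = \mathbb{C}$ with the usual absolute value. For $f \in \mathrm{Poly}_d(\overline{\mathbb{Q}})$, the canonical height is $\widehat{h}_f(z) = \lim_{n \to +\infty} \frac{1}{d^n} h(f^{\circ n}(z))$ for $z \in \overline{\mathbb{Q}}$,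 and the critical height of $f$ is $H_f = \sum_{\gamma \in \Gamma_f} \rho_\gamma \cdot \widehat{h}_f(\gamma)$, where $\Gamma_f \subseteq \overline{\mathbb{Q}}$ is the set of critical points of $f$ and $\rho_\gamma$ is the multiplicity of $\gamma$ as a critical point of $f$. The dynatomic polynomials $\Phi_f^{(p)}$ ($p \geq 1$) are the unique polynomials with $f^{\circ p}(z) - z = \prod_{k \mid p} \Phi_f^{(k)}(z)$ for all $p \geq 1$. There is a unique monic polynomial $\chi_f^{(p)}(\lambda)$ such that $\chi_f^{(p)}(\lambda)^p = \prod_{z} (\lambda - (f^{\circ p})'(z))$, the product being over the roots $z$ of $\Phi_f^{(p)}$ counted with multiplicity. $\Lambda_f^{(p)}$ is the multiset of roots of $\chi_f^{(p)}$ (generically, the multipliers of $f$ at its cycles with period $p$), and $H_f^{(p)} = \max_{\lambda \in \Lambda_f^{(p)}} h(\lambda)$. *)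

theory Defs
  imports
    "HOL-Algebra.Algebraic_Closure_Type"
    "HOL-Algebra.Embedded_Algebras"
    "HOL-Algebra.Generated_Fields"
    "HOL-Analysis.Infinite_Sum"
begin

type_synonym qbar = "rat alg_closure"

abbreviation qbar_ring :: "qbar ring" where
  "qbar_ring \<equiv> ring_of_type_algebra"

definition Poly_deg :: "nat \<Rightarrow> qbar poly set" where
  "Poly_deg d = {f. Polynomial.degree f = d}"


section \<open>The field of p-adic numbers and its algebraic closure\<close>

definition padic_abs_rat :: "nat \<Rightarrow> rat \<Rightarrow> real" where
  "padic_abs_rat p q =
     (if q = 0 then 0
      else real p powi (int (multiplicity (int p) (snd (quotient_of q)))
                        - int (multiplicity (int p) (fst (quotient_of q)))))"

definition padic_cauchy :: "nat \<Rightarrow> (nat \<Rightarrow> rat) set" where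
  "padic_cauchy p =
     {x. \<forall>\<epsilon>>0. \<exists>N. \<forall>m\<ge>N. \<forall>n\<ge>N. padic_abs_rat p (x m - x n) < \<epsilon>}"

definition padic_null :: "nat \<Rightarrow> (nat \<Rightarrow> rat) set" where
  "padic_null p = {x. (\<lambda>n. padic_abs_rat p (x n)) \<longlonglongrightarrow> 0}"

definition padic_cauchy_ring :: "nat \<Rightarrow> (nat \<Rightarrow> rat) ring" where
  "padic_cauchy_ring p =
     \<lparr>carrier = padic_cauchy p, monoid.mult = (\<lambda>x y n. x n * y n), one = (\<lambda>_. 1),
      ring.zero = (\<lambda>_. 0), add = (\<lambda>x y n. x n + y n)\<rparr>"

text \<open>The completion of the rationals: Cauchy sequences modulo null sequences.\<close>

definition Qp :: "nat \<Rightarrow> (nat \<Rightarrow> rat) set ring" where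
  "Qp p = padic_cauchy_ring p Quot padic_null p"

text \<open>All representatives of a class give the same limit.\<close>

definition Qp_abs :: "nat \<Rightarrow> (nat \<Rightarrow> rat) set \<Rightarrow> real" where
  "Qp_abs p C = (THE r. \<forall>x\<in>C. (\<lambda>n. padic_abs_rat p (x n)) \<longlonglongrightarrow> r)"

type_synonym qp_bar =
  "(((nat \<Rightarrow> rat) set list \<times> nat) multiset \<Rightarrow> (nat \<Rightarrow> rat) set)"

definition Qp_bar :: "nat \<Rightarrow> qp_bar ring" where
  "Qp_bar p = field.alg_closure (Qp p)"

definition absolute_value :: "('a, 'b) ring_scheme \<Rightarrow> ('a \<Rightarrow> real) \<Rightarrow> bool" where
  "absolute_value F v \<longleftrightarrow>
     (\<forall>x\<in>carrier F. 0 \<le> v x \<and> (v x = 0 \<longleftrightarrow> x = \<zero>\<^bsub>F\<^esub>)) \<and>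
     (\<forall>x\<in>carrier F. \<forall>y\<in>carrier F. v (x \<otimes>\<^bsub>F\<^esub> y) = v x * v y \<and> v (x \<oplus>\<^bsub>F\<^esub> y) \<le> v x + v y)"

text \<open>
  As \<^term>\<open>Qp p\<close> is complete, its absolute value has exactly one extension to the
  algebraic closure, so the choice below only affects junk values outside the carrier.
  The map \<^const>\<open>ring.indexed_const\<close> is the inclusion of a field into its algebraic closure.
\<close>

definition Qp_bar_abs :: "nat \<Rightarrow> qp_bar \<Rightarrow> real" where
  "Qp_bar_abs p =
     (SOME v. absolute_value (Qp_bar p) v \<and>
        (\<forall>x\<in>carrier (Qp p). v (ring.indexed_const (Qp p) x) = Qp_abs p x))"


section \<open>The Weil height\<close>

text \<open>Embeddings are extensional functions, so that each one is counted only once.\<close>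

definition embeddings :: "qbar set \<Rightarrow> ('b, 'c) ring_scheme \<Rightarrow> (qbar \<Rightarrow> 'b) set" where
  "embeddings K L = Ring.ring_hom (qbar_ring\<lparr>carrier := K\<rparr>) L \<inter> extensional K"

definition number_field_degree :: "qbar set \<Rightarrow> nat" where
  "number_field_degree K = ring.dim qbar_ring (range to_ac) K"

definition log_plus :: "real \<Rightarrow> real" where
  "log_plus x = ln (max 1 x)"

definition weil_height_over :: "qbar set \<Rightarrow> qbar \<Rightarrow> real" where
  "weil_height_over K t =
     ((\<Sum>\<^sub>\<infinity>p\<in>{p. prime p}. \<Sum>\<sigma>\<in>embeddings K (Qp_bar p). log_plus (Qp_bar_abs p (\<sigma> t)))
      + (\<Sum>\<sigma>\<in>embeddings K (ring_of_type_algebra :: complex ring). log_plus (cmod (\<sigma> t))))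
     / real (number_field_degree K)"

text \<open>
  The value of \<^const>\<open>weil_height_over\<close> is the same for all number fields containing
  \<open>t\<close>; we use the smallest one.
\<close>

definition weil_height :: "qbar \<Rightarrow> real" where
  "weil_height t = weil_height_over (generate_field qbar_ring {t}) t"


section \<open>Canonical and critical heights\<close>

definition canonical_height :: "qbar poly \<Rightarrow> qbar \<Rightarrow> real" where
  "canonical_height f z =
     lim (\<lambda>n. weil_height ((poly f ^^ n) z) / real (Polynomial.degree f) ^ n)"

definition critical_height :: "qbar poly \<Rightarrow> real" where
  "critical_height f =
     (\<Sum>\<gamma> | poly (pderiv f) \<gamma> = 0. real (Polynomial.order \<gamma> (pderiv f)) * canonical_height f \<gamma>)"


section \<open>Dynatomic and multiplier polynomials\<close>

definition iterate_poly :: "qbar poly \<Rightarrow> nat \<Rightarrow> qbar poly" where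
  "iterate_poly f n = (pcompose f ^^ n) [:0, 1:]"

text \<open>
  The defining relations for the divisors of \<open>p\<close> already determine the \<open>p\<close>-th dynatomic
  polynomial; see the lemma \<open>dynatomic_eqI\<close> below.
\<close>

definition dynatomic :: "qbar poly \<Rightarrow> nat \<Rightarrow> qbar poly" where
  "dynatomic f p =
     (SOME \<Phi>. \<forall>q. q dvd p \<longrightarrow> iterate_poly f q - [:0, 1:] = (\<Prod>k | k dvd q. \<Phi> k)) p"

definition multiplier_poly :: "qbar poly \<Rightarrow> nat \<Rightarrow> qbar poly" where
  "multiplier_poly f p =
     (THE \<chi>. Polynomial.lead_coeff \<chi> = 1 \<and>
        \<chi> ^ p = (\<Prod>z\<in>#proots (dynatomic f p). [:- poly (pderiv (iterate_poly f p)) z, 1:]))"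

definition multipliers :: "qbar poly \<Rightarrow> nat \<Rightarrow> qbar multiset" where
  "multipliers f p = proots (multiplier_poly f p)"

definition multiplier_height :: "qbar poly \<Rightarrow> nat \<Rightarrow> real" where
  "multiplier_height f p = Max (weil_height ` set_mset (multipliers f p))"

lemma degree_iterate_poly: "Polynomial.degree (iterate_poly f n) = Polynomial.degree f ^ n"
  by (induction n) (simp_all add: iterate_poly_def degree_pcompose)

lemma poly_iterate_poly: "poly (iterate_poly f n) z = (poly f ^^ n) z"
  by (induction n) (simp_all add: iterate_poly_def poly_pcompose)

lemma dynatomic_relations_unique:
  assumes f: "Polynomial.degree f \<ge> 2" and p: "p \<ge> 1"
    and \<Phi>: "\<forall>q. q dvd p \<longrightarrow> iterate_poly f q - [:0, 1:] = (\<Prod>k | k dvd q. \<Phi> k)"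
    and \<Psi>: "\<forall>q. q dvd p \<longrightarrow> iterate_poly f q - [:0, 1:] = (\<Prod>k | k dvd q. \<Psi> k)"
  shows "\<Phi> p = \<Psi> p"
proof -
  have "\<Phi> q = \<Psi> q" if "q dvd p" for q
    using that
  proof (induction q rule: less_induct)
    case (less q)
    have q: "q > 0" using less.prems p by (auto intro: dvd_pos_nat)
    define D where "D = {k. k dvd q} - {q}"
    have fin: "finite {k. k dvd q}" using q by simp
    have D: "finite D" "q \<notin> D" "{k. k dvd q} = insert q D"
      using fin by (auto simp: D_def)
    have eqD: "(\<Prod>k\<in>D. \<Phi> k) = (\<Prod>k\<in>D. \<Psi> k)"
    proof (rule prod.cong)
      fix k assume "k \<in> D"
      hence k: "k dvd q" "k \<noteq> q" by (auto simp: D_def)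
      hence "k < q" using q by (meson dvd_imp_le le_neq_implies_less)
      thus "\<Phi> k = \<Psi> k" using less.IH k(1) less.prems by (meson dvd_trans)
    qed simp
    have "Polynomial.degree f ^ q \<ge> 2"
    proof -
      have "Polynomial.degree f ^ 1 \<le> Polynomial.degree f ^ q"
        using f q by (intro power_increasing) auto
      thus ?thesis using f by simp
    qed
    hence "iterate_poly f q \<noteq> [:0, 1:]"
      using degree_iterate_poly[of f q] by auto
    hence nz: "(\<Prod>k | k dvd q. \<Phi> k) \<noteq> 0"
      using \<Phi> less.prems by (metis right_minus_eq)
    have "(\<Prod>k | k dvd q. \<Phi> k) = (\<Prod>k | k dvd q. \<Psi> k)"
      using \<Phi> \<Psi> less.prems by metis
    hence "\<Phi> q * (\<Prod>k\<in>D. \<Phi> k) = \<Psi> q * (\<Prod>k\<in>D. \<Phi> k)"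
      using D eqD by simp
    moreover have "(\<Prod>k\<in>D. \<Phi> k) \<noteq> 0"
      using nz D by (metis mult_zero_right prod.insert)
    ultimately show "\<Phi> q = \<Psi> q" by simp
  qed
  thus ?thesis by simp
qed

lemma dynatomic_eqI:
  assumes f: "Polynomial.degree f \<ge> 2" and p: "p \<ge> 1"
    and \<Phi>: "\<forall>q\<ge>1. iterate_poly f q - [:0, 1:] = (\<Prod>k | k dvd q. \<Phi> k)"
  shows "dynatomic f p = \<Phi> p"
proof -
  have *: "\<forall>q. q dvd p \<longrightarrow> iterate_poly f q - [:0, 1:] = (\<Prod>k | k dvd q. \<Phi> k)"
    using \<Phi> p by (metis dvd_0_left_iff less_one not_le)
  have "\<forall>q. q dvd p \<longrightarrow> iterate_poly f q - [:0, 1:] =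
          (\<Prod>k | k dvd q. (SOME \<Phi>. \<forall>q. q dvd p \<longrightarrow>
             iterate_poly f q - [:0, 1:] = (\<Prod>k | k dvd q. \<Phi> k)) k)"
    by (rule someI[where P = "\<lambda>\<Phi>. \<forall>q. q dvd p \<longrightarrow>
             iterate_poly f q - [:0, 1:] = (\<Prod>k | k dvd q. \<Phi> k)", OF *])
  from dynatomic_relations_unique[OF f p this *] show ?thesis
    unfolding dynatomic_def .
qed

end

theory Submission
  imports Defs
begin

text \<open>
  Let \<open>z\<^sub>i\<close> be the fixed points of \<open>f\<close> and \<open>\<alpha>\<^sup>d\<^sup>-\<^sup>1\<close> its leading coefficient. In the coordinate
  \<open>\<alpha> (z - z\<^sub>0)\<close> the polynomial becomes \<open>g = X + Q\<close> with \<open>Q = \<Prod>i. (X - w\<^sub>i)\<close>, \<open>w\<^sub>0 = 0\<close>, and the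
  multipliers of the fixed points are \<open>1 + Q'(w\<^sub>i)\<close>. At every place, let \<open>R\<close> be the diameter of the
  set of the \<open>w\<^sub>i\<close>. The critical points have size at most a constant times \<open>max 1 R\<close>, and the local
  escape rate of \<open>g\<close> at such points is at most \<open>ln (max 1 R)\<close> up to a constant, so it suffices to
  bound \<open>R\<close> by a multiplier.

  If \<open>R\<close> is much larger than all \<open>Q'(w\<^sub>i)\<close>, choose \<open>w\<^sub>a\<close>, \<open>w\<^sub>b\<close> at distance \<open>R\<close>. Split the roots of \<open>Q\<close>
  into those near \<open>w\<^sub>a\<close> and the others, separated by a gap in the distances to \<open>w\<^sub>a\<close>, and compare the
  traces of \<open>(X - w\<^sub>a) P'\<close> over the roots of the near factor \<open>P\<close> and of \<open>P - u\<close>: since they differ by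
  \<open>u m\<^sup>2\<close>, there is a point \<open>y\<^sub>a\<close> near \<open>w\<^sub>a\<close> with \<open>g(y\<^sub>a) \<approx> w\<^sub>b\<close> at which \<open>Q'\<close> is at least of order \<open>R\<close>.
  Together with the analogous \<open>y\<^sub>b\<close> this yields a cycle of length two whose multiplier has order at
  least \<open>R\<^sup>2\<close>. Every estimate loses only a power of the constant \<open>\<kappa>\<close> in
  \<open>|x + y| \<le> \<kappa> max |x| |y|\<close>, with exponent depending only on \<open>d\<close>, and \<open>\<kappa> = 1\<close> at the primes above
  \<open>d\<close>. Summing over all places therefore bounds the critical height by the sum of the heights of the
  multipliers of periods one and two.
\<close>

section \<open>Quasi-absolute values\<close>

text \<open>Already in degree four the fixed point multipliers do not control R: if the roots of Q
  form two tight pairs at distance R, each pair of diameter about R^-2, then all Q'(w_i) stay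
  bounded while R is arbitrarily large. In degrees two and three such clustering is impossible,
  because a third root is far from one end of the longest distance. Among the solutions near w_a of
  Q(y) = w_b - w_a a particular one may have a small derivative; only an average over all of them is
  under control, which is why a trace enters.

  The local estimates are carried out in \<open>qbar\<close> itself, with an absolute value pulled
  back from a place. This field is algebraically closed but not complete, so Newton iteration is
  replaced by an estimate for the nearest root. In return, the cycle found at a place is algebraic
  and its multiplier belongs to one finite set common to all places. The multiplier that controls R
  varies with the place; hence heights are summed over this whole set, and its cardinality enters
  the final constants.\<close>

locale quasi_abs =
  fixes v :: "'a :: field \<Rightarrow> real" and \<kappa> :: real
  assumes \<kappa>_ge_1: "1 \<le> \<kappa>"
    and nonneg [simp]: "0 \<le> v x"
    and eq_0_iff [simp]: "v x = 0 \<longleftrightarrow> x = 0"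
    and mult: "v (x * y) = v x * v y"
    and add_le: "v (x + y) \<le> \<kappa> * max (v x) (v y)"
begin

lemma zero [simp]: "v 0 = 0"
  using eq_0_iff[of 0] by blast

lemma one [simp]: "v 1 = 1"
proof -
  have "v 1 * v 1 = v 1" by (simp flip: mult)
  moreover have "v 1 \<noteq> 0" by simp
  ultimately show ?thesis by simp
qed

lemma minus [simp]: "v (- x) = v x"
proof -
  have "v (-1) * v (-1) = 1" by (simp flip: mult)
  hence "v (-1) = 1"
    using nonneg[of "-1"] by (smt (verit) mult_cancel_right1 mult_less_cancel_right1 mult_minus_left square_eq_1_iff)
  thus ?thesis using mult[of "-1" x] by simp
qed

lemma diff_commute: "v (x - y) = v (y - x)"
  using minus[of "x - y"] by simp

lemma diff_le: "v (x - y) \<le> \<kappa> * max (v x) (v y)"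
  using add_le[of x "- y"] by simp

lemma pos: "x \<noteq> 0 \<Longrightarrow> 0 < v x"
  using nonneg[of x] eq_0_iff[of x] by linarith

lemma inverse: "v (inverse x) = inverse (v x)"
proof (cases "x = 0")
  case False
  hence "v x * v (inverse x) = 1" by (simp flip: mult)
  thus ?thesis by (metis inverse_unique)
qed simp

lemma divide: "v (x / y) = v x / v y"
  by (simp add: field_class.field_divide_inverse mult inverse)

lemma power: "v (x ^ n) = v x ^ n"
  by (induction n) (auto simp: mult)

lemma prod: "v (prod f A) = (\<Prod>i\<in>A. v (f i))"
  by (induction A rule: infinite_finite_induct) (auto simp: mult)

lemma \<kappa>_pos: "0 < \<kappa>"
  using \<kappa>_ge_1 by linarith

lemma sum_le:
  assumes "finite A" "\<And>i. i \<in> A \<Longrightarrow> v (f i) \<le> M" "0 \<le> M"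
  shows "v (sum f A) \<le> \<kappa> ^ card A * M"
  using assms(1,2)
proof (induction A rule: finite_induct)
  case (insert x F)
  have "v (sum f (insert x F)) \<le> \<kappa> * max (v (f x)) (v (sum f F))"
    using insert.hyps add_le by simp
  also have "\<dots> \<le> \<kappa> * (\<kappa> ^ card F * M)"
  proof (intro mult_left_mono max.boundedI)
    have "1 * M \<le> \<kappa> ^ card F * M"
      using \<kappa>_ge_1 assms(3) by (intro mult_right_mono) auto
    thus "v (f x) \<le> \<kappa> ^ card F * M" using insert.prems[of x] by simp
  qed (use insert \<kappa>_pos in auto)
  finally show ?case using insert.hyps by simp
qed (use assms(3) in auto)

text \<open>Pigeonhole in multiplicative form: up to a constant a sum is bounded by its largest
  term, so a large trace forces a large summand.\<close>

lemma sum_le_some: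
  assumes "finite A" "A \<noteq> {}"
  obtains i where "i \<in> A" "v (sum f A) \<le> \<kappa> ^ card A * v (f i)"
proof -
  have "finite ((\<lambda>i. v (f i)) ` A)" "(\<lambda>i. v (f i)) ` A \<noteq> {}" using assms by auto
  from Max_in[OF this] obtain i where i: "i \<in> A" "Max ((\<lambda>i. v (f i)) ` A) = v (f i)" by auto
  have "v (f j) \<le> v (f i)" if "j \<in> A" for j
    using that assms(1) by (simp flip: i(2))
  thus ?thesis using that[OF i(1)] sum_le[OF assms(1), of f "v (f i)"] by simp
qed

text \<open>Substitute for the reverse triangle inequality: since \<open>a = (a + b) - b\<close>, a
  summand that exceeds \<open>\<kappa>\<close> times the other cannot be cancelled by it.\<close>

lemma dominant:
  assumes "\<kappa> * v b < v a"
  shows "v a \<le> \<kappa> * v (a + b)"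
  using diff_le[of "a + b" b] assms by (simp add: max_def split: if_splits)

text \<open>Telescoping: exchanging one factor \<open>a l\<close> for \<open>b l\<close> changes the
  product by at most \<open>\<epsilon>\<close> times the other bounds. Because every bound is at
  least \<open>m\<close>, this is a relative error of \<open>\<epsilon> / m\<close>, and each
  exchange costs one more \<open>\<kappa>\<close>.\<close>

lemma prod_diff:
  assumes "finite S" "0 < m" "0 \<le> \<epsilon>"
    and "\<And>l. l \<in> S \<Longrightarrow> v (a l) \<le> M l" "\<And>l. l \<in> S \<Longrightarrow> v (b l) \<le> M l"
    and "\<And>l. l \<in> S \<Longrightarrow> v (a l - b l) \<le> \<epsilon>" "\<And>l. l \<in> S \<Longrightarrow> m \<le> M l"
  shows "v (prod a S - prod b S) \<le> \<kappa> ^ card S * (\<epsilon> / m) * prod M S"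
  using assms(1,4-)
proof (induction S rule: finite_induct)
  case (insert x F)
  have Mpos: "0 \<le> M l" if "l \<in> insert x F" for l
    using insert.prems(4)[OF that] assms(2) by linarith
  have PM: "0 \<le> prod M F" using Mpos by (intro prod_nonneg) auto
  have eq: "prod a (insert x F) - prod b (insert x F)
      = a x * (prod a F - prod b F) + (a x - b x) * prod b F"
    using insert.hyps by (simp add: algebra_simps)
  have "v (a x * (prod a F - prod b F)) \<le> M x * (\<kappa> ^ card F * (\<epsilon> / m) * prod M F)"
    unfolding mult using insert Mpos[of x] by (intro mult_mono) auto
  moreover have "v ((a x - b x) * prod b F) \<le> \<epsilon> * prod M F"
    unfolding mult prod using insert assms(3) by (intro mult_mono prod_mono prod_nonneg) auto
  moreover have "\<epsilon> * prod M F \<le> M x * (\<kappa> ^ card F * (\<epsilon> / m) * prod M F)"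
  proof -
    have "m * \<epsilon> * 1 \<le> M x * \<epsilon> * \<kappa> ^ card F"
      using insert.prems(4)[of x] assms(2,3) \<kappa>_ge_1 by (intro mult_mono) auto
    hence "\<epsilon> \<le> M x * (\<kappa> ^ card F * (\<epsilon> / m))"
      using assms(2) by (simp add: field_simps)
    from mult_right_mono[OF this PM] show ?thesis by (simp add: mult_ac)
  qed
  ultimately have "max (v (a x * (prod a F - prod b F))) (v ((a x - b x) * prod b F))
      \<le> M x * (\<kappa> ^ card F * (\<epsilon> / m) * prod M F)" by simp
  from mult_left_mono[OF this, of \<kappa>] \<kappa>_pos
  have "v (prod a (insert x F) - prod b (insert x F)) \<le> \<kappa> * (M x * (\<kappa> ^ card F * (\<epsilon> / m) * prod M F))"
    unfolding eq using add_le order_trans by (metis (no_types, lifting) less_imp_le)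
  thus ?case using insert.hyps by (simp add: mult_ac)
qed (use assms(2,3) in auto)

end

section \<open>Products of linear factors\<close>

text \<open>Roots are indexed rather than collected in a set: they may coincide, and a factor of the
  polynomial is selected by a subset of the indices.\<close>

definition lin_prod :: "(nat \<Rightarrow> 'a :: field) \<Rightarrow> nat set \<Rightarrow> 'a poly" where
  "lin_prod w S = (\<Prod>i\<in>S. [:- w i, 1:])"

lemma poly_lin_prod: "poly (lin_prod w S) x = (\<Prod>i\<in>S. x - w i)"
  by (simp add: lin_prod_def poly_prod)

lemma lin_prod_root: "finite S \<Longrightarrow> i \<in> S \<Longrightarrow> poly (lin_prod w S) (w i) = 0"
  by (auto simp: poly_lin_prod)

lemma lin_prod_union: "finite S \<Longrightarrow> finite T \<Longrightarrow> S \<inter> T = {} \<Longrightarrow>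
    lin_prod w (S \<union> T) = lin_prod w S * lin_prod w T"
  by (simp add: lin_prod_def prod.union_disjoint)

lemma lin_prod_monic [simp]: "Polynomial.lead_coeff (lin_prod w S) = 1"
  by (simp add: lin_prod_def lead_coeff_prod)

lemma lin_prod_nz [simp]: "lin_prod w S \<noteq> 0"
  using lin_prod_monic[of w S] by (metis leading_coeff_0_iff zero_neq_one)

lemma degree_lin_prod [simp]: "Polynomial.degree (lin_prod w S) = card S"
proof (cases "finite S")
  case True
  thus ?thesis by (simp add: lin_prod_def degree_prod_eq_sum_degree)
qed (simp add: lin_prod_def)

lemma pderiv_lin_prod: "pderiv (lin_prod w S) = (\<Sum>i\<in>S. lin_prod w (S - {i}))"
  by (simp add: lin_prod_def pderiv_prod pderiv_pCons)

lemma poly_pderiv_lin_prod: "poly (pderiv (lin_prod w S)) x = (\<Sum>i\<in>S. \<Prod>j\<in>S-{i}. x - w j)"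
  by (simp add: pderiv_lin_prod poly_sum poly_lin_prod)

lemma poly_pderiv_lin_prod_root:
  assumes "finite S" "i \<in> S"
  shows "poly (pderiv (lin_prod w S)) (w i) = (\<Prod>j\<in>S-{i}. w i - w j)"
proof -
  have "(\<Sum>k\<in>S. \<Prod>j\<in>S-{k}. w i - w j) = (\<Sum>k\<in>{i}. \<Prod>j\<in>S-{k}. w i - w j)"
    using assms by (intro sum.mono_neutral_right) auto
  thus ?thesis by (simp add: poly_pderiv_lin_prod)
qed

lemma monic_splits:
  fixes p :: "'a :: alg_closed_field poly"
  assumes "Polynomial.lead_coeff p = 1"
  obtains w where "p = lin_prod w {..<Polynomial.degree p}"
proof -
  have nz: "p \<noteq> 0" using assms by auto
  obtain A where A: "size A = Polynomial.degree p" "p = Polynomial.smult (Polynomial.lead_coeff p) (\<Prod>x\<in>#A. [:-x, 1:])"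
    using alg_closed_imp_factorization[OF nz] by blast
  obtain xs where xs: "mset xs = A" using ex_mset by blast
  have "p = (\<Prod>x\<in>#A. [:-x, 1:])" using A(2) unfolding assms smult_1_left .
  also have "\<dots> = (\<Prod>x\<leftarrow>xs. [:-x, 1:])"
    unfolding xs[symmetric] by (simp flip: mset_map add: prod_mset_prod_list)
  also have "\<dots> = (\<Prod>i<length xs. [:- (xs ! i), 1:])"
    by (simp add: prod.list_conv_set_nth atLeast0LessThan)
  also have "length xs = Polynomial.degree p" using A xs by (metis size_mset)
  finally show ?thesis using that[of "\<lambda>i. xs ! i"] by (simp add: lin_prod_def)
qed

lemma coeff_mult_top:
  fixes p q :: "'a :: comm_semiring_0 poly"
  assumes "Polynomial.degree p \<le> m" "Polynomial.degree q \<le> n"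
  shows "coeff (p * q) (m + n) = coeff p m * coeff q n"
proof -
  have "(\<Sum>i\<le>m + n. coeff p i * coeff q (m + n - i)) = (\<Sum>i\<in>{m}. coeff p i * coeff q (m + n - i))"
  proof (rule sum.mono_neutral_right)
    show "\<forall>i\<in>{..m + n} - {m}. coeff p i * coeff q (m + n - i) = 0"
    proof
      fix i assume "i \<in> {..m + n} - {m}"
      hence "i > m \<or> m + n - i > n" by auto
      thus "coeff p i * coeff q (m + n - i) = 0" using assms by (auto simp: coeff_eq_0)
    qed
  qed auto
  thus ?thesis by (simp add: coeff_mult)
qed

text \<open>This reads off the partial fraction expansion of \<open>H P' / P\<close> at infinity.\<close>

lemma trace_remainder:
  fixes H :: "'a :: field poly" and x :: "nat \<Rightarrow> 'a"
  assumes "finite S" "S \<noteq> {}"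
  defines "P \<equiv> lin_prod x S"
  obtains B r where "H * pderiv P = P * B + r" "Polynomial.degree r < card S"
    "coeff r (card S - 1) = (\<Sum>i\<in>S. poly H (x i))"
proof -
  have "\<exists>D. H = [:poly H (x i):] + [:- x i, 1:] * D" for i
  proof -
    have "poly (H - [:poly H (x i):]) (x i) = 0" by simp
    hence "[:- x i, 1:] dvd H - [:poly H (x i):]" by (simp only: poly_eq_0_iff_dvd)
    then obtain D where "H - [:poly H (x i):] = [:- x i, 1:] * D" by (rule dvdE)
    hence "H = [:- x i, 1:] * D + [:poly H (x i):]" by (simp only: diff_eq_eq)
    thus ?thesis by (metis add.commute)
  qed
  then obtain D where D: "\<And>i. H = [:poly H (x i):] + [:- x i, 1:] * D i" by metis
  define r where "r = (\<Sum>i\<in>S. Polynomial.smult (poly H (x i)) (lin_prod x (S - {i})))"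
  have P: "P = [:- x i, 1:] * lin_prod x (S - {i})" if "i \<in> S" for i
    using that assms(1) by (simp add: P_def lin_prod_def prod.remove)
  have deg: "Polynomial.degree (lin_prod x (S - {i})) = card S - 1" if "i \<in> S" for i
    using that assms(1) by simp
  have "H * pderiv P = (\<Sum>i\<in>S. H * lin_prod x (S - {i}))"
    by (simp add: P_def pderiv_lin_prod sum_distrib_left)
  also have "\<dots> = (\<Sum>i\<in>S. P * D i + Polynomial.smult (poly H (x i)) (lin_prod x (S - {i})))"
  proof (rule sum.cong)
    fix i assume i: "i \<in> S"
    have "H * lin_prod x (S - {i}) = ([:poly H (x i):] + [:- x i, 1:] * D i) * lin_prod x (S - {i})"
      using arg_cong[OF D[of i], of "\<lambda>q. q * lin_prod x (S - {i})"] .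
    thus "H * lin_prod x (S - {i}) = P * D i + Polynomial.smult (poly H (x i)) (lin_prod x (S - {i}))"
      unfolding P[OF i] by (simp add: algebra_simps)
  qed simp
  also have "\<dots> = P * (\<Sum>i\<in>S. D i) + r"
    by (simp add: r_def sum.distrib sum_distrib_left)
  finally have 1: "H * pderiv P = P * (\<Sum>i\<in>S. D i) + r" .
  have cS: "card S > 0" using assms by (simp add: card_gt_0_iff)
  have "Polynomial.degree r \<le> card S - 1"
    unfolding r_def using deg assms(1) by (intro degree_sum_le) (auto intro: order_trans[OF degree_smult_le])
  hence 2: "Polynomial.degree r < card S" using cS by linarith
  have "coeff r (card S - 1) = (\<Sum>i\<in>S. poly H (x i) * coeff (lin_prod x (S - {i})) (card S - 1))"
    by (simp add: r_def coeff_sum)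
  also have "\<dots> = (\<Sum>i\<in>S. poly H (x i))"
  proof (rule sum.cong)
    fix i assume i: "i \<in> S"
    have "coeff (lin_prod x (S - {i})) (card S - 1) = 1"
      unfolding deg[OF i, symmetric] by (rule lin_prod_monic)
    thus "poly H (x i) * coeff (lin_prod x (S - {i})) (card S - 1) = poly H (x i)" by simp
  qed simp
  finally show ?thesis using that 1 2 by blast
qed

text \<open>Division of \<open>(X - c) P'^2\<close> by \<open>P\<close> leaves a remainder whose
  coefficient at \<open>X^(m-1)\<close> is the trace. Division by \<open>P - u\<close> has the same
  dividend, and by degrees also the same quotient \<open>B\<close>; so the remainder grows by
  \<open>u B\<close>, whose top coefficient is \<open>u m^2\<close>.\<close>

lemma trace_shift:
  fixes c u :: "'a :: field" and x y :: "nat \<Rightarrow> 'a"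
  assumes S: "finite S" "S \<noteq> {}" and T: "finite T" "T \<noteq> {}"
    and eq: "lin_prod y T = lin_prod x S - [:u:]"
  defines "P \<equiv> lin_prod x S"
  shows "(\<Sum>k\<in>T. (y k - c) * poly (pderiv P) (y k))
       = (\<Sum>i\<in>S. (x i - c) * poly (pderiv P) (x i)) + u * of_nat (card S) ^ 2"
proof -
  define m where "m = card S"
  have m: "m > 0" using S by (simp add: m_def card_gt_0_iff)
  have mT: "card T = m"
  proof -
    have "Polynomial.degree (P - [:u:]) = m"
      using m degree_add_eq_left[of "- [:u:]" P] unfolding P_def m_def
      by (metis ab_group_add_class.ab_diff_conv_add_uminus degree_lin_prod degree_minus degree_pCons_0)
    thus ?thesis by (metis degree_lin_prod eq P_def)
  qed
  define H where "H = [:- c, 1:] * pderiv P"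
  have pd: "pderiv (lin_prod y T) = pderiv P"
    by (simp add: eq P_def pderiv_diff pderiv_pCons)
  obtain B r where B: "H * pderiv P = P * B + r" "Polynomial.degree r < m"
      "coeff r (m - 1) = (\<Sum>i\<in>S. poly H (x i))"
    using trace_remainder[OF S, of H x] by (auto simp: P_def m_def)
  obtain B' r' where B': "H * pderiv P = lin_prod y T * B' + r'" "Polynomial.degree r' < m"
      "coeff r' (m - 1) = (\<Sum>i\<in>T. poly H (y i))"
    using trace_remainder[OF T, of H y] mT by (auto simp: pd)
  have dP: "Polynomial.degree P = m" "coeff P m = 1"
    using lin_prod_monic[of x S] by (simp_all add: P_def m_def)
  have dP': "Polynomial.degree (pderiv P) \<le> m - 1" "coeff (pderiv P) (m - 1) = of_nat m"
    using dP m by (auto simp: coeff_pderiv coeff_eq_0 intro!: degree_le)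
  have dH: "Polynomial.degree (H * pderiv P) \<le> 2 * m - 1"
  proof -
    have "Polynomial.degree (H * pderiv P) \<le> 1 + (m - 1) + (m - 1)"
      unfolding H_def using dP'(1) degree_mult_le[of "[:- c, 1:] * pderiv P" "pderiv P"]
        degree_mult_le[of "[:- c, 1:]" "pderiv P"] by simp
    thus ?thesis using m by linarith
  qed
  have dB: "Polynomial.degree B \<le> m - 1"
  proof (cases "B = 0")
    case False
    have "Polynomial.degree (P * B) = Polynomial.degree (H * pderiv P - r)" by (simp add: B(1))
    also have "\<dots> \<le> 2 * m - 1" using dH B(2) m by (intro degree_diff_le) auto
    finally have "m + Polynomial.degree B \<le> 2 * m - 1"
      using False dP by (subst (asm) degree_mult_eq) (auto simp: P_def)
    thus ?thesis by linarith
  qed simp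
  have cB: "coeff B (m - 1) = of_nat m ^ 2"
  proof -
    have "coeff (P * B) (m + (m - 1)) = coeff B (m - 1)"
      using coeff_mult_top[of P m B "m - 1"] dP dB by simp
    moreover have "coeff (H * pderiv P) (m + (m - 1)) = of_nat m ^ 2"
    proof -
      have "coeff H m = of_nat m"
        using m dP'(2) coeff_eq_0[of "pderiv P" m] dP'(1) unfolding H_def
        by (cases m) (auto simp: coeff_pCons)
      moreover have "Polynomial.degree H \<le> m"
        unfolding H_def using dP'(1) m degree_mult_le[of "[:- c, 1:]" "pderiv P"] by auto
      moreover have "coeff (H * pderiv P) (m + (m - 1)) = coeff H m * coeff (pderiv P) (m - 1)"
        if "Polynomial.degree H \<le> m"
        using that dP'(1) by (rule coeff_mult_top)
      ultimately show ?thesis using dP'(2) by (simp add: power2_eq_square)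
    qed
    moreover have "coeff r (m + (m - 1)) = 0" using B(2) by (intro coeff_eq_0) auto
    ultimately show ?thesis using arg_cong[OF B(1), of "\<lambda>p. coeff p (m + (m - 1))"] by simp
  qed
  have PB: "P * (B - B') = r' - r - Polynomial.smult u B'"
  proof -
    have "P * B + r = (P - [:u:]) * B' + r'" using B(1) B'(1) by (simp only: eq P_def)
    thus ?thesis by (simp add: algebra_simps)
  qed
  have "P * (B' - B) - Polynomial.smult u (B' - B) = r - r' + Polynomial.smult u B"
    using PB by (simp add: algebra_simps smult_diff_right)
  hence eq2: "lin_prod y T * (B' - B) = r - r' + Polynomial.smult u B"
    by (simp add: eq P_def algebra_simps)
  have "Polynomial.degree (r - r' + Polynomial.smult u B) < m"
    using B(2) B'(2) dB m
    by (intro degree_add_less degree_diff_less) (auto intro: order.strict_trans1[OF degree_smult_le])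
  hence "B' - B = 0"
    using eq2 mT degree_mult_eq[of "lin_prod y T" "B' - B"] by (auto simp: not_less)
  hence "r + Polynomial.smult u B - r' = 0" using eq2 by (simp add: algebra_simps)
  hence "r' = r + Polynomial.smult u B" by simp
  hence "(\<Sum>i\<in>T. poly H (y i)) = (\<Sum>i\<in>S. poly H (x i)) + u * of_nat m ^ 2"
    using B(3) B'(3) cB by simp
  thus ?thesis by (simp add: H_def m_def algebra_simps)
qed

section \<open>Radii and gaps in the configuration of roots\<close>

lemma less_power_cancel:
  fixes t x y :: real
  assumes "1 \<le> t" "0 \<le> x" "x * t ^ B < y * t ^ j" "j + k \<le> B"
  shows "x * t ^ k < y"
proof -
  have "x * t ^ (k + j) \<le> x * t ^ B" using assms by (intro mult_left_mono power_increasing) auto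
  with assms(3) have "(x * t ^ k) * t ^ j < y * t ^ j" by (simp add: power_add mult_ac)
  thus ?thesis using assms(1) by simp
qed

text \<open>Up to powers of \<open>\<kappa>\<close> the product is the generic size of Q at distance
  \<open>\<rho>\<close> from the root \<open>w a\<close>, as read off from a Newton polygon. It runs
  continuously from 0 at \<open>\<rho> = 0\<close> to at least \<open>R\<close> at
  \<open>\<rho> = R\<close>. A radius above 1 is excluded, because the factors of \<open>a\<close>
  and \<open>b\<close> alone would then contribute \<open>\<rho> R\<close>.\<close>

lemma max_prod_radius:
  fixes \<delta> :: "nat \<Rightarrow> real"
  assumes d: "2 \<le> d" and a: "a < d" "\<delta> a = 0" and b: "b < d" "\<delta> b = R" and R: "1 < R"
    and \<delta>: "\<And>i. i < d \<Longrightarrow> 0 \<le> \<delta> i"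
  obtains \<rho> where "0 < \<rho>" "\<rho> \<le> 1" "(\<Prod>i<d. max \<rho> (\<delta> i)) = R"
proof -
  let ?\<phi> = "\<lambda>\<rho>. \<Prod>i<d. max \<rho> (\<delta> i)"
  have ab: "a \<noteq> b" using a b R by auto
  have "?\<phi> 0 = 0" using a by (intro prod_zero bexI[of _ a]) auto
  moreover have "R \<le> ?\<phi> R"
  proof -
    have "R ^ 1 \<le> R ^ d" using d R by (intro power_increasing) auto
    also have "R ^ d = (\<Prod>i<d. R)" by simp
    also have "\<dots> \<le> ?\<phi> R" using R by (intro prod_mono) auto
    finally show ?thesis by simp
  qed
  moreover have "continuous_on {0..R} ?\<phi>" by (intro continuous_intros)
  ultimately obtain \<rho> where \<rho>: "0 \<le> \<rho>" "\<rho> \<le> R" "?\<phi> \<rho> = R"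
    using IVT'[of ?\<phi> 0 R R] R by (metis less_eq_real_def order_trans zero_le_one)
  have "\<rho> \<noteq> 0" using \<rho>(3) \<open>?\<phi> 0 = 0\<close> R by (metis less_numeral_extra(4) not_one_less_zero)
  moreover have "\<rho> \<le> 1"
  proof (rule ccontr)
    assume "\<not> \<rho> \<le> 1"
    hence \<rho>1: "1 < \<rho>" by simp
    have "?\<phi> \<rho> = max \<rho> (\<delta> a) * (\<Prod>i\<in>{..<d} - {a}. max \<rho> (\<delta> i))"
      using a by (intro prod.remove) auto
    also have "(\<Prod>i\<in>{..<d} - {a}. max \<rho> (\<delta> i)) = max \<rho> (\<delta> b) * (\<Prod>i\<in>{..<d} - {a} - {b}. max \<rho> (\<delta> i))"
      using b ab by (intro prod.remove) auto
    finally have eq: "R = \<rho> * (max \<rho> R * (\<Prod>i\<in>{..<d} - {a} - {b}. max \<rho> (\<delta> i)))"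
      using \<rho>(1,3) a b by simp
    have "1 \<le> (\<Prod>i\<in>{..<d} - {a} - {b}. max \<rho> (\<delta> i))" using \<rho>1 by (intro prod_ge_1) auto
    hence "R * 1 \<le> max \<rho> R * (\<Prod>i\<in>{..<d} - {a} - {b}. max \<rho> (\<delta> i))"
      using R by (intro mult_mono) auto
    hence "\<rho> * R \<le> \<rho> * (max \<rho> R * (\<Prod>i\<in>{..<d} - {a} - {b}. max \<rho> (\<delta> i)))"
      using \<rho>1 by (intro mult_left_mono) auto
    hence "\<rho> * R \<le> R" using eq by simp
    thus False using \<rho>1 R by simp
  qed
  ultimately show ?thesis using that \<rho> by force
qed

text \<open>Pigeonhole: \<open>d\<close> distances cannot meet all of \<open>d + 1\<close> disjoint intervals.\<close>

lemma gap_exists: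
  fixes \<delta> :: "nat \<Rightarrow> real" and \<kappa> \<rho> :: real
  assumes "1 \<le> \<kappa>" "0 < \<rho>" "1 \<le> B"
  obtains j where "j \<le> d" "\<And>i. i < d \<Longrightarrow> \<delta> i \<le> \<rho> * \<kappa> ^ (B ^ j) \<or> \<rho> * \<kappa> ^ (B ^ Suc j) < \<delta> i"
proof (cases "\<exists>j\<le>d. \<forall>i<d. \<delta> i \<le> \<rho> * \<kappa> ^ (B ^ j) \<or> \<rho> * \<kappa> ^ (B ^ Suc j) < \<delta> i")
  case True
  thus ?thesis using that by blast
next
  case False
  have "\<exists>i. i < d \<and> \<rho> * \<kappa> ^ (B ^ j) < \<delta> i \<and> \<delta> i \<le> \<rho> * \<kappa> ^ (B ^ Suc j)" if "j \<le> d" for j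
  proof -
    from False that obtain i where "i < d" "\<not> (\<delta> i \<le> \<rho> * \<kappa> ^ (B ^ j) \<or> \<rho> * \<kappa> ^ (B ^ Suc j) < \<delta> i)"
      by blast
    thus ?thesis by (intro exI[of _ i]) (simp add: not_le not_less del: power_Suc)
  qed
  then obtain c where c: "\<And>j. j \<le> d \<Longrightarrow> c j < d \<and> \<rho> * \<kappa> ^ (B ^ j) < \<delta> (c j) \<and> \<delta> (c j) \<le> \<rho> * \<kappa> ^ (B ^ Suc j)"
    by metis
  have "c j \<noteq> c j'" if "j < j'" "j' \<le> d" for j j'
  proof
    assume eq: "c j = c j'"
    have "\<rho> * \<kappa> ^ (B ^ Suc j) \<le> \<rho> * \<kappa> ^ (B ^ j')"
    proof -
      have "B ^ Suc j \<le> B ^ j'" using that(1) assms(3) by (intro power_increasing) auto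
      from power_increasing[OF this assms(1)] show ?thesis using assms(2) by simp
    qed
    thus False using c[of j] c[of j'] that eq by (auto simp del: power_Suc)
  qed
  hence "inj_on c {..d}" by (intro linorder_inj_onI) auto
  moreover have "c ` {..d} \<subseteq> {..<d}" using c by auto
  ultimately have "card {..d} \<le> card {..<d}" by (metis card_inj_on_le finite_lessThan)
  thus ?thesis by simp
qed

context quasi_abs
begin

text \<open>Stands in for Newton's method. Let \<open>z\<close> be the nearest root. In each summand
  of the product rule for \<open>p'(y)\<close> the missing factor \<open>y - x k\<close> is at least
  as large as \<open>y - z\<close>, so after multiplication by \<open>y - z\<close> every summand is
  bounded by \<open>p(y)\<close>.\<close>

lemma root_near:
  assumes "poly (pderiv p) y \<noteq> 0" "p = lin_prod x {..<n}"
  obtains z where "poly p z = 0" "v (y - z) * v (poly (pderiv p) y) \<le> \<kappa> ^ n * v (poly p y)"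
proof -
  have n: "n \<noteq> 0" using assms by (cases n) (auto simp: lin_prod_def)
  have "finite ((\<lambda>i. v (y - x i)) ` {..<n})" "(\<lambda>i. v (y - x i)) ` {..<n} \<noteq> {}" using n by auto
  from Min_in[OF this] obtain i where i: "i < n" "Min ((\<lambda>i. v (y - x i)) ` {..<n}) = v (y - x i)" by auto
  have min: "v (y - x i) \<le> v (y - x j)" if "j < n" for j
    using that by (simp flip: i(2))
  have "(y - x i) * poly (pderiv p) y = (\<Sum>k<n. (y - x i) * (\<Prod>j\<in>{..<n}-{k}. y - x j))"
    by (simp add: assms(2) poly_pderiv_lin_prod sum_distrib_left)
  moreover have "v (\<Sum>k<n. (y - x i) * (\<Prod>j\<in>{..<n}-{k}. y - x j)) \<le> \<kappa> ^ card {..<n} * v (poly p y)"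
  proof (rule sum_le)
    fix k assume k: "k \<in> {..<n}"
    have "v (y - x i) * (\<Prod>j\<in>{..<n}-{k}. v (y - x j)) \<le> v (y - x k) * (\<Prod>j\<in>{..<n}-{k}. v (y - x j))"
      using min k by (intro mult_right_mono prod_nonneg) auto
    also have "\<dots> = v (poly p y)"
      using k prod.remove[of "{..<n}" k "\<lambda>j. v (y - x j)"] by (simp add: assms(2) poly_lin_prod prod)
    finally show "v ((y - x i) * (\<Prod>j\<in>{..<n}-{k}. y - x j)) \<le> v (poly p y)"
      by (simp add: mult prod)
  qed auto
  ultimately have "v (y - x i) * v (poly (pderiv p) y) \<le> \<kappa> ^ n * v (poly p y)"
    by (metis card_lessThan mult)
  moreover have "poly p (x i) = 0" using i(1) by (auto simp: assms(2) intro!: lin_prod_root)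
  ultimately show ?thesis using that by blast
qed

end

section \<open>Fixed points and cycles of length two\<close>

locale quasi_abs_closed = quasi_abs v \<kappa> for v :: "'a :: alg_closed_field \<Rightarrow> real" and \<kappa>

context quasi_abs_closed
begin

text \<open>
  An approximate solution \<open>y\<close> of \<open>Q = u\<close> close to the root \<open>c\<close>, at which \<open>Q'\<close> is large;
  \<open>\<rho>\<close> is the radius on which \<open>Q\<close> takes values of size \<open>R\<close>.
\<close>

definition good_preimage :: "'a poly \<Rightarrow> nat \<Rightarrow> nat \<Rightarrow> real \<Rightarrow> real \<Rightarrow> real \<Rightarrow> 'a \<Rightarrow> 'a \<Rightarrow> 'a \<Rightarrow> bool" where
  "good_preimage Q d B R t \<rho> c u y \<longleftrightarrow>
     \<kappa> \<le> t \<and> 0 < \<rho> \<and> \<rho> \<le> 1 \<and> v (y - c) \<le> t ^ 2 * \<rho> \<and>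
     v (poly Q y - u) * t ^ B < R * t ^ (2 * d + 1) \<and>
     R \<le> t ^ (2 * d + 6) * \<rho> * v (poly (pderiv Q) y) \<and>
     (\<forall>z z'. v (z - c) \<le> t ^ 3 * \<rho> \<longrightarrow> v (z' - c) \<le> t ^ 3 * \<rho> \<longrightarrow>
        v (poly Q z - poly Q z') * \<rho> \<le> t ^ (6 * d) * R * v (z - z') \<and>
        v (poly (pderiv Q) z - poly (pderiv Q) z') * \<rho> ^ 2 \<le> t ^ (6 * d) * R * v (z - z'))"

lemma pow_le_pow: "1 \<le> (t :: real) \<Longrightarrow> \<kappa> \<le> t \<Longrightarrow> m \<le> n \<Longrightarrow> \<kappa> ^ m \<le> t ^ n"
  by (meson \<kappa>_ge_1 dual_order.trans nonneg power_increasing power_mono zero_le_one)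

text \<open>On the disc of radius \<open>t ^ 3 * \<rho>\<close> each factor is at most
  \<open>t ^ 4 * max \<rho> (v (c - w i))\<close>, so the product is at most
  \<open>t ^ (4 d) * R\<close>, and telescoping gives relative changes of size
  \<open>v (z - z') / \<rho>\<close>. In the derivative one factor is omitted; its bound is at least
  \<open>\<rho>\<close>, which costs the second power of \<open>\<rho>\<close>. The remaining
  \<open>2 d\<close> in the exponent absorb the powers of \<open>\<kappa>\<close>.\<close>

lemma lipschitz_lin_prod:
  fixes w :: "nat \<Rightarrow> 'a"
  assumes t: "\<kappa> \<le> t" and \<rho>: "0 < \<rho>"
    and R: "(\<Prod>i<d. max \<rho> (v (c - w i))) = R"
    and z: "v (z - c) \<le> t ^ 3 * \<rho>" "v (z' - c) \<le> t ^ 3 * \<rho>"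
  defines "Q \<equiv> lin_prod w {..<d}"
  shows "v (poly Q z - poly Q z') * \<rho> \<le> t ^ (6 * d) * R * v (z - z')"
    and "v (poly (pderiv Q) z - poly (pderiv Q) z') * \<rho> ^ 2 \<le> t ^ (6 * d) * R * v (z - z')"
proof -
  have t1: "1 \<le> t" using t \<kappa>_ge_1 by linarith
  have t6: "t ^ (2 * d) * x * (t ^ (4 * d) * y) = t ^ (6 * d) * y * x" for x y :: real
    using power_add[of t "2 * d" "4 * d"] by simp
  define M where "M l = t ^ 4 * max \<rho> (v (c - w l))" for l
  have M: "v (x - w l) \<le> M l" if "v (x - c) \<le> t ^ 3 * \<rho>" for x l
  proof -
    have "v (x - w l) = v ((x - c) + (c - w l))" by simp
    also have "\<dots> \<le> \<kappa> * max (v (x - c)) (v (c - w l))" by (rule add_le)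
    also have "\<dots> \<le> t * (t ^ 3 * max \<rho> (v (c - w l)))"
    proof (intro mult_mono max.boundedI)
      have "t ^ 3 * \<rho> \<le> t ^ 3 * max \<rho> (v (c - w l))" using t1 by (intro mult_left_mono) auto
      thus "v (x - c) \<le> t ^ 3 * max \<rho> (v (c - w l))" using that by linarith
      have "1 * v (c - w l) \<le> t ^ 3 * max \<rho> (v (c - w l))"
        using t1 by (intro mult_mono) (auto simp: one_le_power)
      thus "v (c - w l) \<le> t ^ 3 * max \<rho> (v (c - w l))" by simp
    qed (use t t1 in \<open>auto simp: le_max_iff_disj\<close>)
    also have "\<dots> = M l" by (simp add: M_def power_Suc[symmetric] mult_ac eval_nat_numeral)
    finally show ?thesis .
  qed
  have \<rho>M: "\<rho> \<le> M l" for l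
  proof -
    have "1 * \<rho> \<le> t ^ 4 * max \<rho> (v (c - w l))"
      using t1 \<rho> by (intro mult_mono) (auto simp: one_le_power)
    thus ?thesis by (simp add: M_def)
  qed
  have pd: "v ((\<Prod>i\<in>S. z - w i) - (\<Prod>i\<in>S. z' - w i)) \<le> \<kappa> ^ card S * (v (z - z') / \<rho>) * prod M S"
    if "finite S" for S
    using that \<rho> M[OF z(1)] M[OF z(2)] \<rho>M by (intro prod_diff) auto
  have PM: "prod M {..<d} = t ^ (4 * d) * R"
    by (simp add: M_def prod.distrib R power_mult)
  have R0: "0 \<le> R" unfolding R[symmetric] using \<rho> by (intro prod_nonneg) auto
  have "v (poly Q z - poly Q z') \<le> \<kappa> ^ d * (v (z - z') / \<rho>) * (t ^ (4 * d) * R)"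
    using pd[of "{..<d}"] by (simp add: Q_def poly_lin_prod PM)
  hence "v (poly Q z - poly Q z') * \<rho> \<le> \<kappa> ^ d * v (z - z') * (t ^ (4 * d) * R)"
    using \<rho> by (simp add: field_simps)
  also have "\<dots> \<le> t ^ (2 * d) * v (z - z') * (t ^ (4 * d) * R)"
    using t t1 R0 by (intro mult_mono pow_le_pow) auto
  also have "\<dots> = t ^ (6 * d) * R * v (z - z')" by (simp add: t6)
  finally show "v (poly Q z - poly Q z') * \<rho> \<le> t ^ (6 * d) * R * v (z - z')" .
  have term_le: "v ((\<Prod>j\<in>{..<d}-{i}. z - w j) - (\<Prod>j\<in>{..<d}-{i}. z' - w j)) \<le>
      \<kappa> ^ d * (v (z - z') / \<rho>) * (t ^ (4 * d) * R / \<rho>)" if i: "i < d" for i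
  proof -
    have "prod M {..<d} = M i * prod M ({..<d} - {i})" using i by (intro prod.remove) auto
    moreover have "\<rho> * prod M ({..<d} - {i}) \<le> M i * prod M ({..<d} - {i})"
      using \<rho>M \<rho> by (intro mult_right_mono prod_nonneg) (auto intro: order_trans[of 0 \<rho>])
    ultimately have 1: "prod M ({..<d} - {i}) \<le> t ^ (4 * d) * R / \<rho>"
      using \<rho> by (simp add: PM field_simps)
    have "card ({..<d} - {i}) \<le> d" by (metis card_Diff1_le card_lessThan finite_lessThan)
    hence 2: "\<kappa> ^ card ({..<d} - {i}) \<le> \<kappa> ^ d" using \<kappa>_ge_1 by (intro power_increasing) auto
    have "v ((\<Prod>j\<in>{..<d}-{i}. z - w j) - (\<Prod>j\<in>{..<d}-{i}. z' - w j))
        \<le> \<kappa> ^ card ({..<d} - {i}) * (v (z - z') / \<rho>) * prod M ({..<d} - {i})"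
      by (rule pd) simp
    also have "\<dots> \<le> \<kappa> ^ d * (v (z - z') / \<rho>) * (t ^ (4 * d) * R / \<rho>)"
      using 1 2 \<rho> \<rho>M \<kappa>_ge_1 by (intro mult_mono prod_nonneg) (auto intro: order_trans[of 0 \<rho>])
    finally show ?thesis .
  qed
  have "poly (pderiv Q) z - poly (pderiv Q) z' =
      (\<Sum>i<d. (\<Prod>j\<in>{..<d}-{i}. z - w j) - (\<Prod>j\<in>{..<d}-{i}. z' - w j))"
    by (simp add: Q_def poly_pderiv_lin_prod sum_subtractf)
  also have "v \<dots> \<le> \<kappa> ^ card {..<d} * (\<kappa> ^ d * (v (z - z') / \<rho>) * (t ^ (4 * d) * R / \<rho>))"
    using term_le \<rho> R0 t1 \<kappa>_ge_1 by (intro sum_le) auto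
  finally have "v (poly (pderiv Q) z - poly (pderiv Q) z') * \<rho> ^ 2 \<le> (\<kappa> ^ d * \<kappa> ^ d) * v (z - z') * (t ^ (4 * d) * R)"
    using \<rho> by (simp add: field_simps power2_eq_square)
  also have "\<kappa> ^ d * \<kappa> ^ d \<le> t ^ (2 * d)"
    using pow_le_pow[OF t1 t, of "d + d" "2 * d"] by (simp add: power_add)
  hence "(\<kappa> ^ d * \<kappa> ^ d) * v (z - z') * (t ^ (4 * d) * R) \<le> t ^ (2 * d) * v (z - z') * (t ^ (4 * d) * R)"
    using t1 R0 by (intro mult_right_mono) auto
  also have "\<dots> = t ^ (6 * d) * R * v (z - z')" by (simp add: t6)
  finally show "v (poly (pderiv Q) z - poly (pderiv Q) z') * \<rho> ^ 2 \<le> t ^ (6 * d) * R * v (z - z')" .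
qed

text \<open>The far factor is frozen at its value \<open>q\<close> in \<open>w a\<close>, so the
  equation that is solved exactly is \<open>P = u / q\<close> for the near factor \<open>P\<close>.
  The gap makes the error of this replacement small, and the trace identity, in which the smallness
  of the multipliers removes the contribution of the original roots, provides one solution with a
  large derivative. The scale depends on the configuration and is bounded only through
  \<open>j \<le> d\<close>.\<close>

lemma approx_preimage:
  fixes w :: "nat \<Rightarrow> 'a"
  assumes d: "2 \<le> d" and a: "a < d" and b: "b < d"
    and R: "1 < R" "v u = R" "v (w a - w b) = R" "\<And>i. i < d \<Longrightarrow> v (w a - w i) \<le> R"
    and int: "\<And>n. 1 \<le> n \<Longrightarrow> n \<le> d \<Longrightarrow> 1 \<le> \<kappa> * v (of_nat n)"
    and B: "4 * d + 8 \<le> B" and N: "(2 * d + 6) * B ^ d \<le> N"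
  defines "Q \<equiv> lin_prod w {..<d}"
  assumes small: "\<And>i. i < d \<Longrightarrow> v (poly (pderiv Q) (w i)) * \<kappa> ^ N < R"
  obtains j \<rho> y where "j \<le> d" "good_preimage Q d B R (\<kappa> ^ (B ^ j)) \<rho> (w a) u y"
proof -
  define \<delta> where "\<delta> i = v (w a - w i)" for i
  have \<delta>0: "0 \<le> \<delta> i" for i by (simp add: \<delta>_def)
  obtain \<rho> where \<rho>: "0 < \<rho>" "\<rho> \<le> 1" and phi: "(\<Prod>i<d. max \<rho> (\<delta> i)) = R"
    using max_prod_radius[of d a \<delta> b R] d a b R(1,3) by (auto simp: \<delta>_def)
  obtain j where j: "j \<le> d" and gap0: "\<And>i. i < d \<Longrightarrow> \<delta> i \<le> \<rho> * \<kappa> ^ (B ^ j) \<or> \<rho> * \<kappa> ^ (B ^ Suc j) < \<delta> i"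
    using gap_exists[of \<kappa> \<rho> B d \<delta>] \<kappa>_ge_1 \<rho>(1) B by auto
  \<comment> \<open>In terms of \<open>t\<close> the gap says that no root has distance between
    \<open>\<rho> * t\<close> and \<open>\<rho> * t ^ B\<close> from \<open>w a\<close>. As
    \<open>\<kappa> \<le> t\<close>, powers of \<open>\<kappa>\<close> may be traded for powers of
    \<open>t\<close>.\<close>
  define t where "t = \<kappa> ^ (B ^ j)"
  have B1: "1 \<le> B ^ j" using B by (intro one_le_power) auto
  have \<kappa>t: "\<kappa> \<le> t" unfolding t_def using power_increasing[OF B1 \<kappa>_ge_1] by simp
  have t1: "1 \<le> t" using \<kappa>t \<kappa>_ge_1 by linarith
  have gap: "\<delta> i \<le> \<rho> * t \<or> \<rho> * t ^ B < \<delta> i" if "i < d" for i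
    using gap0[OF that] by (simp add: t_def mult.commute flip: power_mult)
  have t_N: "t ^ (2 * d + 6) \<le> \<kappa> ^ N"
  proof -
    have "B ^ j * (2 * d + 6) \<le> N"
      using N power_increasing[OF j, of B] B by (smt (verit) dual_order.trans le_add2 le_add_same_cancel1 le_numeral_extra(4) mult.commute mult_le_mono1 one_le_mult_iff power_0 trans_le_add1 add_leD1 add_leE one_le_numeral)
    thus ?thesis unfolding t_def using \<kappa>_ge_1 by (simp flip: power_mult add: power_increasing)
  qed
  have tle: "t ^ m \<le> t ^ n" if "m \<le> n" for m n using that t1 by (intro power_increasing) auto
  have \<kappa>le: "\<kappa> ^ m \<le> t ^ n" if "m \<le> n" for m n using that t1 \<kappa>t by (intro pow_le_pow)
  have t2d: "t ^ (2 * d) = t ^ d * t ^ d" by (simp add: mult_2 power_add)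
  define I where "I = {i. i < d \<and> \<delta> i \<le> \<rho> * t}"
  define O' where "O' = {i. i < d \<and> \<not> \<delta> i \<le> \<rho> * t}"
  have fin: "finite I" "finite O'" by (auto simp: I_def O'_def)
  have IO: "I \<inter> O' = {}" "{..<d} = I \<union> O'" by (auto simp: I_def O'_def)
  have out: "\<rho> * t ^ B < \<delta> i" if "i \<in> O'" for i using that gap by (auto simp: O'_def)
  have out3: "\<rho> * t ^ 3 < \<delta> i" if "i \<in> O'" for i
  proof -
    have "\<rho> * t ^ 3 \<le> \<rho> * t ^ B" using \<rho>(1) tle[of 3 B] B by (intro mult_left_mono) auto
    thus ?thesis using out[OF that] by linarith
  qed
  have aI: "a \<in> I" using a \<rho>(1) t1 by (simp add: I_def \<delta>_def)
  define m where "m = card I"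
  have m: "1 \<le> m" "m \<le> d"
  proof -
    show "1 \<le> m" using aI fin by (auto simp: m_def card_gt_0_iff Suc_le_eq)
    have "I \<subseteq> {..<d}" by (auto simp: I_def)
    from card_mono[OF _ this] show "m \<le> d" by (simp add: m_def)
  qed
  have cO: "card O' \<le> d" 
  proof -
    have "O' \<subseteq> {..<d}" by (auto simp: O'_def)
    from card_mono[OF _ this] show ?thesis by simp
  qed
  define q where "q = poly (lin_prod w O') (w a)"
  have vq: "v q = (\<Prod>i\<in>O'. \<delta> i)" by (simp add: q_def poly_lin_prod prod \<delta>_def)
  have \<delta>out: "0 < \<delta> i" if "i \<in> O'" for i
    using out[OF that] \<rho> t1 by (smt (verit) mult_pos_pos zero_less_power)
  have vq_pos: "0 < v q" unfolding vq using \<delta>out by (intro prod_pos) auto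
  \<comment> \<open>\<open>R\<close> splits into the share \<open>f\<close> of the near roots and
    the share \<open>v q\<close> of the far roots; in the latter the maximum with
    \<open>\<rho>\<close> is irrelevant because of the gap.\<close>
  define f where "f = (\<Prod>i\<in>I. max \<rho> (\<delta> i))"
  have fq: "f * v q = R"
  proof -
    have "(\<Prod>i\<in>O'. max \<rho> (\<delta> i)) = v q"
      unfolding vq
    proof (rule prod.cong)
      fix i assume "i \<in> O'"
      have "\<rho> * 1 \<le> \<rho> * t ^ B" using \<rho> t1 by (intro mult_left_mono) auto
      thus "max \<rho> (\<delta> i) = \<delta> i" using out[OF \<open>i \<in> O'\<close>] by simp
    qed simp
    thus ?thesis using phi IO fin by (simp add: prod.union_disjoint f_def)
  qed
  have f_pos: "0 < f" unfolding f_def using \<rho> by (intro prod_pos) auto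
  have f_le: "f \<le> (\<rho> * t) ^ m"
  proof -
    have "\<rho> * 1 \<le> \<rho> * t" using \<rho> t1 by (intro mult_left_mono) auto
    hence "f \<le> (\<Prod>i\<in>I. \<rho> * t)" unfolding f_def using \<rho> by (intro prod_mono) (auto simp: I_def)
    thus ?thesis by (simp add: m_def)
  qed
  have q0: "q \<noteq> 0" using vq_pos by auto
  \<comment> \<open>Chosen so that \<open>P = u0\<close> implies \<open>Q \<approx> u\<close>; its
    size is exactly the share \<open>f\<close> of the near roots.\<close>
  define u0 where "u0 = u / q"
  have vu0: "v u0 = f" using R(2) fq q0 by (simp add: u0_def divide field_simps)
  define P where "P = lin_prod w I"
  define PO where "PO = lin_prod w O'"
  have QP: "Q = P * PO" unfolding Q_def P_def PO_def IO(2) by (rule lin_prod_union) (use fin IO in auto)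
  have Q': "poly (pderiv Q) x = poly (pderiv P) x * poly PO x + poly P x * poly (pderiv PO) x" for x
    by (simp add: QP pderiv_mult mult_ac add.commute)
  have dPu: "Polynomial.degree (P - [:u0:]) = m"
    using m(1) degree_add_eq_left[of "- [:u0:]" P] unfolding P_def m_def
    by (metis ab_group_add_class.ab_diff_conv_add_uminus degree_lin_prod degree_minus degree_pCons_0 less_eq_Suc_le One_nat_def)
  have "Polynomial.lead_coeff (P - [:u0:]) = 1"
    using lin_prod_monic[of w I] m(1) unfolding dPu by (cases m) (auto simp: P_def m_def)
  from monic_splits[OF this] obtain y where y: "P - [:u0:] = lin_prod y {..<m}"
    unfolding dPu by blast
  have Py: "poly P (y k) = u0" if "k < m" for k
    using lin_prod_root[of "{..<m}" k y] that by (simp flip: y)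
  \<comment> \<open>Otherwise \<open>y k\<close> would be farther than \<open>\<rho> * t\<close>
    from every near root, and \<open>P\<close> would exceed \<open>(\<rho> * t) ^ m \<ge> f\<close>
    there.\<close>
  have yw: "v (y k - w a) \<le> \<kappa> * (\<rho> * t)" if k: "k < m" for k
  proof (rule ccontr)
    assume "\<not> v (y k - w a) \<le> \<kappa> * (\<rho> * t)"
    hence far: "\<kappa> * (\<rho> * t) < v (y k - w a)" by simp
    have far_i: "\<rho> * t < v (y k - w i)" if i: "i \<in> I" for i
    proof (rule ccontr)
      assume "\<not> \<rho> * t < v (y k - w i)"
      hence "max (v (y k - w i)) (v (w i - w a)) \<le> \<rho> * t"
        using i diff_commute[of "w i"] by (simp add: I_def \<delta>_def)
      hence "\<kappa> * max (v (y k - w i)) (v (w i - w a)) \<le> \<kappa> * (\<rho> * t)"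
        using \<kappa>_ge_1 by (intro mult_left_mono) auto
      moreover have "v (y k - w a) \<le> \<kappa> * max (v (y k - w i)) (v (w i - w a))"
        using add_le[of "y k - w i" "w i - w a"] by simp
      ultimately show False using far by linarith
    qed
    hence "(\<Prod>i\<in>I. \<rho> * t) < (\<Prod>i\<in>I. v (y k - w i))"
    proof -
      have pos: "0 < \<rho> * t" using \<rho> t1 by simp
      have le: "\<rho> * t \<le> v (y k - w i)" "0 < v (y k - w i)" if "i \<in> I" for i
        using far_i[OF that] pos by (simp_all del: eq_0_iff)
      show ?thesis
        using far_i[OF aI] fin pos le
        by (intro prod_mono_strict[OF aI]) (auto simp del: eq_0_iff)
    qed
    also have "\<dots> = f" using Py[OF k] vu0 by (simp add: P_def poly_lin_prod flip: prod)
    finally show False using f_le by (simp add: m_def)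
  qed
  have pow3: "\<kappa> * (\<kappa> * (\<rho> * t)) \<le> \<rho> * t ^ 3"
  proof -
    have "\<kappa> ^ 2 * (\<rho> * t) \<le> t ^ 2 * (\<rho> * t)" using \<rho> t1 by (intro mult_right_mono \<kappa>le) auto
    thus ?thesis by (simp add: power2_eq_square power3_eq_cube mult_ac)
  qed
  have out_lower: "\<delta> l \<le> \<kappa> * v (x - w l)" if "l \<in> O'" "\<kappa> * v (x - w a) \<le> \<rho> * t ^ 3" for l x
  proof -
    have "\<kappa> * v (x - w a) < v (w a - w l)" using that out3[of l] by (simp add: \<delta>_def)
    from dominant[OF this] show ?thesis by (simp add: \<delta>_def)
  qed
  have PO_lower: "v q \<le> \<kappa> ^ d * v (poly PO x)" if "\<kappa> * v (x - w a) \<le> \<rho> * t ^ 3" for x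
  proof -
    have "v q \<le> (\<Prod>l\<in>O'. \<kappa> * v (x - w l))"
      unfolding vq using out_lower[OF _ that] \<delta>0 by (intro prod_mono) auto
    also have "\<dots> = \<kappa> ^ card O' * v (poly PO x)"
      by (simp add: prod.distrib PO_def poly_lin_prod prod)
    also have "\<dots> \<le> \<kappa> ^ d * v (poly PO x)"
      using \<kappa>_ge_1 cO by (intro mult_right_mono power_increasing) auto
    finally show ?thesis .
  qed
  have near_in: "\<kappa> * v (w i - w a) \<le> \<rho> * t ^ 3" if "i \<in> I" for i
  proof -
    have "v (w i - w a) \<le> 1 * (\<rho> * t)" using that diff_commute[of "w i"] by (simp add: I_def \<delta>_def)
    also have "\<dots> \<le> \<kappa> * (\<rho> * t)" using \<kappa>_ge_1 \<rho> t1 by (intro mult_right_mono) auto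
    finally have "\<kappa> * v (w i - w a) \<le> \<kappa> * (\<kappa> * (\<rho> * t))" using \<kappa>_ge_1 by (intro mult_left_mono) auto
    thus ?thesis using pow3 by linarith
  qed
  define Sw where "Sw = (\<Sum>i\<in>I. (w i - w a) * poly (pderiv P) (w i))"
  define Sy where "Sy = (\<Sum>k<m. (y k - w a) * poly (pderiv P) (y k))"
  have tr: "Sy = Sw + u0 * of_nat m ^ 2"
    unfolding Sw_def Sy_def P_def m_def
  proof (rule trace_shift)
    show "I \<noteq> {}" using aI by blast
    thus "{..<card I} \<noteq> {}" using fin by (auto simp: lessThan_empty_iff)
  qed (use fin y in \<open>auto simp: P_def m_def\<close>)
  \<comment> \<open>At a near root the product rule leaves \<open>Q' = P' * PO\<close>, and
    \<open>PO\<close> is about \<open>q\<close> there. So \<open>P' * q\<close> inherits the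
    smallness assumed for \<open>Q'\<close>, while \<open>f * v q = R\<close>.\<close>
  have Sw_small: "\<kappa> * v (- Sw) < v (u0 * of_nat m ^ 2)"
  proof -
    obtain i where i: "i \<in> I" and le: "v Sw \<le> \<kappa> ^ m * v ((w i - w a) * poly (pderiv P) (w i))"
      unfolding Sw_def m_def using sum_le_some[OF fin(1)] aI by blast
    define L where "L = v (poly (pderiv Q) (w i))"
    have "i < d" using i by (simp add: I_def)
    have "L = v (poly (pderiv P) (w i)) * v (poly PO (w i))"
      unfolding L_def Q' using i fin by (simp add: P_def lin_prod_root mult)
    moreover have "v (poly (pderiv P) (w i)) * v q \<le> v (poly (pderiv P) (w i)) * (\<kappa> ^ d * v (poly PO (w i)))"
      using PO_lower[OF near_in[OF i]] by (intro mult_left_mono) auto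
    ultimately have 1: "v (poly (pderiv P) (w i)) * v q \<le> \<kappa> ^ d * L" by (simp add: mult_ac)
    have "v (w i - w a) \<le> \<rho> * t" using i diff_commute[of "w i"] by (simp add: I_def \<delta>_def)
    also have "\<dots> \<le> 1 * t" using \<rho> t1 by (intro mult_right_mono) auto
    finally have 2: "v (w i - w a) \<le> t" by simp
    have "v Sw * v q \<le> \<kappa> ^ m * (v (w i - w a) * (v (poly (pderiv P) (w i)) * v q))"
      using mult_right_mono[OF le, of "v q"] by (simp add: mult mult_ac)
    also have "\<dots> \<le> t ^ d * (t * (t ^ d * L))"
    proof -
      have A: "v (poly (pderiv P) (w i)) * v q \<le> t ^ d * L"
        using 1 mult_right_mono[OF \<kappa>le[of d d], of L] by (simp add: L_def)
      have "v (w i - w a) * (v (poly (pderiv P) (w i)) * v q) \<le> t * (t ^ d * L)"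
        using t1 by (intro mult_mono[OF 2 A]) auto
      from mult_mono[OF \<kappa>le[OF m(2)] this] show ?thesis using t1 by simp
    qed
    also have "\<dots> = L * t ^ (2 * d + 1)" by (simp add: mult_2 power_add)
    finally have 3: "v Sw * v q \<le> L * t ^ (2 * d + 1)" .
    have "\<kappa> ^ 3 * (v Sw * v q) \<le> t ^ 3 * (L * t ^ (2 * d + 1))"
      using mult_mono[OF \<kappa>le[of 3 3] 3] t1 by simp
    also have "\<dots> = L * t ^ (2 * d + 4)" by (simp add: power_add eval_nat_numeral)
    also have "\<dots> \<le> L * \<kappa> ^ N"
      using tle[of "2 * d + 4" "2 * d + 6"] t_N by (intro mult_left_mono) (auto simp: L_def)
    also have "\<dots> < R" using small[OF \<open>i < d\<close>] by (simp add: L_def)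
    finally have "\<kappa> ^ 3 * v Sw * v q < f * v q" by (simp add: fq)
    hence "\<kappa> ^ 3 * v Sw < f" using vq_pos by simp
    \<comment> \<open>The integer \<open>m\<close> need not be a unit at this place; the assumption
      on integers bounds the loss from \<open>m^2\<close> by \<open>\<kappa> ^ 2\<close>.\<close>
    also have "f = f * 1" by simp
    also have "\<dots> \<le> f * (\<kappa> * v (of_nat m)) ^ 2"
      using f_pos int[OF m] by (intro mult_left_mono one_le_power) auto
    finally have "\<kappa> ^ 2 * (\<kappa> * v Sw) < \<kappa> ^ 2 * v (u0 * of_nat m ^ 2)"
      by (simp add: mult power vu0 power_mult_distrib power2_eq_square power3_eq_cube mult_ac)
    thus ?thesis using \<kappa>_ge_1 by simp
  qed
  have Sy_big: "f \<le> \<kappa> ^ 3 * v Sy"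
  proof -
    have "v (u0 * of_nat m ^ 2) \<le> \<kappa> * v (u0 * of_nat m ^ 2 - (- Sw))"
      using dominant[OF Sw_small] by (smt (verit) Sw_small add.commute diff_conv_add_uminus dominant minus)
    also have "u0 * of_nat m ^ 2 - (- Sw) = Sy" by (simp add: tr)
    finally have "\<kappa> ^ 2 * v (u0 * of_nat m ^ 2) \<le> \<kappa> ^ 2 * (\<kappa> * v Sy)"
      using \<kappa>_ge_1 by (intro mult_left_mono) auto
    moreover have "f * 1 \<le> f * (\<kappa> * v (of_nat m)) ^ 2"
      using f_pos int[OF m] by (intro mult_left_mono one_le_power) auto
    ultimately show ?thesis
      by (simp add: mult power vu0 power_mult_distrib power2_eq_square power3_eq_cube mult_ac)
  qed
  \<comment> \<open>A single summand accounts for the size of the trace; its \<open>y k\<close> is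
    the point sought. Since \<open>y k\<close> is within \<open>t ^ 2 * \<rho>\<close> of
    \<open>w a\<close>, the other factor \<open>P'\<close> must be large.\<close>
  obtain k where k: "k < m" and "v Sy \<le> \<kappa> ^ m * v ((y k - w a) * poly (pderiv P) (y k))"
  proof -
    have "{..<m} \<noteq> {}" using m(1) by (simp add: lessThan_empty_iff)
    from sum_le_some[OF finite_lessThan this] show thesis
      using that unfolding Sy_def card_lessThan lessThan_iff by blast
  qed
  hence yk: "v Sy \<le> \<kappa> ^ m * (v (y k - w a) * v (poly (pderiv P) (y k)))" by (simp add: mult)
  have yt: "v (y k - w a) \<le> t * (\<rho> * t)"
    using \<rho> t1 by (intro order_trans[OF yw[OF k] mult_right_mono[OF \<kappa>t]]) auto
  have P'y: "f \<le> t ^ (d + 5) * \<rho> * v (poly (pderiv P) (y k))"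
  proof -
    have "f \<le> \<kappa> ^ 3 * (\<kappa> ^ m * (v (y k - w a) * v (poly (pderiv P) (y k))))"
      using Sy_big yk \<kappa>_ge_1 by (meson mult_left_mono order_trans zero_le_power zero_le_one)
    also have "\<dots> \<le> t ^ 3 * (t ^ d * ((t * (\<rho> * t)) * v (poly (pderiv P) (y k))))"
    proof (rule mult_mono[OF \<kappa>le])
      show "\<kappa> ^ m * (v (y k - w a) * v (poly (pderiv P) (y k)))
          \<le> t ^ d * ((t * (\<rho> * t)) * v (poly (pderiv P) (y k)))"
        using yt \<rho> t1 m(2) by (intro mult_mono[OF \<kappa>le] mult_right_mono) auto
    qed (use t1 \<kappa>_ge_1 in auto)
    also have "\<dots> = t ^ (d + 5) * \<rho> * v (poly (pderiv P) (y k))"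
      by (simp add: power_add eval_nat_numeral)
    finally show ?thesis .
  qed
  have near_y: "\<kappa> * v (y k - w a) \<le> \<rho> * t ^ 3"
    using mult_left_mono[OF yw[OF k], of \<kappa>] \<kappa>_ge_1 pow3 by linarith
  have out_upper: "v (x - w l) \<le> \<kappa> * \<delta> l" if "l \<in> O'" "v (x - w a) \<le> \<rho> * t ^ 3" for x l
  proof -
    have "max (v (x - w a)) (v (w a - w l)) \<le> \<delta> l" using that out3[of l] by (simp add: \<delta>_def)
    hence "\<kappa> * max (v (x - w a)) (v (w a - w l)) \<le> \<kappa> * \<delta> l"
      using \<kappa>_ge_1 by (intro mult_left_mono) auto
    moreover have "v (x - w l) \<le> \<kappa> * max (v (x - w a)) (v (w a - w l))"
      using add_le[of "x - w a" "w a - w l"] by simp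
    ultimately show ?thesis by linarith
  qed
  have near_y': "v (y k - w a) \<le> \<rho> * t ^ 3"
    using near_y mult_right_mono[OF \<kappa>_ge_1, of "v (y k - w a)"] by simp
  \<comment> \<open>The summand \<open>P' * PO\<close> of \<open>Q'\<close>, which carries the lower
    bound.\<close>
  have first: "R \<le> t ^ (2 * d + 5) * \<rho> * v (poly (pderiv P) (y k) * poly PO (y k))"
  proof -
    have "R = f * v q" by (simp add: fq)
    also have "\<dots> \<le> (t ^ (d + 5) * \<rho> * v (poly (pderiv P) (y k))) * (t ^ d * v (poly PO (y k)))"
    proof (intro mult_mono P'y)
      show "v q \<le> t ^ d * v (poly PO (y k))"
        using PO_lower[OF near_y] mult_right_mono[OF \<kappa>le[of d d], of "v (poly PO (y k))"] by simp
    qed (use \<rho> t1 in auto)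
    also have "\<dots> = t ^ (2 * d + 5) * \<rho> * v (poly (pderiv P) (y k) * poly PO (y k))"
      unfolding mult power_add t2d by (simp only: mult_ac)
    finally show ?thesis .
  qed
  have prod_out: "(\<Prod>l\<in>O'. \<kappa> * \<delta> l) \<le> t ^ d * v q"
  proof -
    have "(\<Prod>l\<in>O'. \<kappa> * \<delta> l) = \<kappa> ^ card O' * v q" by (simp add: prod.distrib vq)
    also have "\<dots> \<le> t ^ d * v q" using \<kappa>le[OF cO] by (intro mult_right_mono) auto
    finally show ?thesis .
  qed
  \<comment> \<open>The summand \<open>P * PO'\<close> of \<open>Q'\<close>: differentiating the far
    factor amounts to division by a distance greater than \<open>\<rho> * t ^ B\<close>, so this
    term loses a factor \<open>t ^ B\<close> against the first.\<close>
  have second: "v (poly P (y k) * poly (pderiv PO) (y k)) * \<rho> * t ^ B < R * t ^ (2 * d)"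
  proof (cases "O' = {}")
    case True
    thus ?thesis using R(1) t1 by (simp add: PO_def lin_prod_def pderiv_1)
  next
    case False
    obtain l where l: "l \<in> O'" and le: "v (poly (pderiv PO) (y k)) \<le> \<kappa> ^ card O' * v (\<Prod>j\<in>O'-{l}. y k - w j)"
        by (rule sum_le_some[OF fin(2) False, of "\<lambda>l. \<Prod>j\<in>O'-{l}. y k - w j"])
        (auto simp: PO_def poly_pderiv_lin_prod)
    have "v (\<Prod>j\<in>O'-{l}. y k - w j) * (\<rho> * t ^ B) < t ^ d * v q"
    proof -
      have "v (\<Prod>j\<in>O'-{l}. y k - w j) * (\<rho> * t ^ B) \<le> (\<Prod>j\<in>O'-{l}. \<kappa> * \<delta> j) * (\<rho> * t ^ B)"
        unfolding prod using out_upper near_y' \<rho> t1 by (intro mult_right_mono prod_mono) auto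
      also have "\<dots> < (\<Prod>j\<in>O'-{l}. \<kappa> * \<delta> j) * (\<kappa> * \<delta> l)"
      proof (intro mult_strict_left_mono prod_pos)
        have "1 * \<delta> l \<le> \<kappa> * \<delta> l" using \<kappa>_ge_1 \<delta>0 by (intro mult_right_mono) auto
        thus "\<rho> * t ^ B < \<kappa> * \<delta> l" using out[OF l] by simp
      qed (use \<delta>out \<kappa>_pos in auto)
      also have "\<dots> = (\<Prod>j\<in>O'. \<kappa> * \<delta> j)" using l fin prod.remove[of O' l "\<lambda>j. \<kappa> * \<delta> j"] by simp
      also note prod_out
      finally show ?thesis .
    qed
    hence "f * (t ^ d * (v (\<Prod>j\<in>O'-{l}. y k - w j) * (\<rho> * t ^ B))) < f * (t ^ d * (t ^ d * v q))"
      using f_pos t1 by simp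
    moreover have "v (poly (pderiv PO) (y k)) \<le> t ^ d * v (\<Prod>j\<in>O'-{l}. y k - w j)"
      using le mult_right_mono[OF \<kappa>le[OF cO], of "v (\<Prod>j\<in>O'-{l}. y k - w j)"] by simp
    hence "f * (v (poly (pderiv PO) (y k)) * (\<rho> * t ^ B)) \<le> f * (t ^ d * v (\<Prod>j\<in>O'-{l}. y k - w j) * (\<rho> * t ^ B))"
      using f_pos \<rho> t1 by (intro mult_left_mono mult_right_mono) auto
    ultimately show ?thesis using Py[OF k] vu0
      unfolding t2d by (simp add: mult mult_ac flip: fq)
  qed
  have deriv: "R \<le> t ^ (2 * d + 6) * \<rho> * v (poly (pderiv Q) (y k))"
  proof -
    define A where "A = poly (pderiv P) (y k) * poly PO (y k)"
    define C where "C = poly P (y k) * poly (pderiv PO) (y k)"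
    have "v C * \<rho> * t ^ (2 * d + 6) < R"
    proof (rule less_power_cancel[OF t1 _ second[folded C_def]])
      show "2 * d + (2 * d + 6) \<le> B" using B by linarith
    qed (use \<rho> in auto)
    also note first
    finally have "(\<rho> * t ^ (2 * d + 5)) * (t * v C) < (\<rho> * t ^ (2 * d + 5)) * v A"
      by (simp add: A_def mult_ac power_add eval_nat_numeral)
    hence "t * v C < v A" using \<rho> t1 by simp
    hence "\<kappa> * v C < v A" using mult_right_mono[OF \<kappa>t, of "v C"] by simp
    from dominant[OF this] have "v A \<le> t * v (A + C)" using mult_right_mono[OF \<kappa>t, of "v (A + C)"] by simp
    hence "(\<rho> * t ^ (2 * d + 5)) * v A \<le> (\<rho> * t ^ (2 * d + 5)) * (t * v (A + C))"
      using \<rho> t1 by (intro mult_left_mono) auto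
    thus ?thesis using first unfolding Q' by (simp add: A_def C_def mult_ac power_add eval_nat_numeral)
  qed
  have val_le: "v (poly Q (y k) - u) * t ^ B < R * t ^ (2 * d + 1)"
  proof (cases "O' = {}")
    case True
    hence "poly Q (y k) = u" using Py[OF k] by (simp add: QP PO_def lin_prod_def u0_def q_def)
    thus ?thesis using R(1) t1 by simp
  next
    case False
    \<comment> \<open>The relative variation of the far factor between \<open>w a\<close> and
      \<open>y k\<close> is about \<open>\<rho> * t / \<mu>\<close>, and the gap gives
      \<open>\<rho> * t ^ B < \<mu>\<close>. This is the whole error, since
      \<open>Q(y) - u = u0 * (PO(y) - q)\<close>.\<close>
    define \<mu> where "\<mu> = Min (\<delta> ` O')"
    have \<mu>: "\<rho> * t ^ B < \<mu>" "\<And>l. l \<in> O' \<Longrightarrow> \<mu> \<le> \<delta> l" unfolding \<mu>_def using False fin out by auto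
    have \<mu>0: "0 < \<mu>" using \<mu>(1) \<rho> t1 by (smt (verit) mult_pos_pos zero_less_power)
    have "v ((\<Prod>l\<in>O'. y k - w l) - (\<Prod>l\<in>O'. w a - w l))
        \<le> \<kappa> ^ card O' * (\<kappa> * (\<rho> * t) / (\<kappa> * \<mu>)) * (\<Prod>l\<in>O'. \<kappa> * \<delta> l)"
    proof (rule prod_diff)
      fix l assume l: "l \<in> O'"
      show "v (y k - w l) \<le> \<kappa> * \<delta> l" using out_upper[OF l near_y'] .
      show "v (w a - w l) \<le> \<kappa> * \<delta> l" using mult_right_mono[OF \<kappa>_ge_1 \<delta>0[of l]] by (simp add: \<delta>_def)
      show "v (y k - w l - (w a - w l)) \<le> \<kappa> * (\<rho> * t)" using yw[OF k] by simp
      show "\<kappa> * \<mu> \<le> \<kappa> * \<delta> l" using \<mu>(2)[OF l] \<kappa>_pos by simp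
    qed (use fin \<mu>0 \<kappa>_pos \<rho> t1 in auto)
    also have "\<dots> \<le> t ^ d * (\<rho> * t / \<mu>) * (t ^ d * v q)"
      using \<kappa>_pos \<rho> t1 \<mu>0 prod_out \<kappa>le[OF cO] \<delta>0 by (intro mult_mono prod_nonneg) auto
    finally have "v (poly PO (y k) - q) * \<mu> \<le> t ^ d * (\<rho> * t) * (t ^ d * v q)"
      using \<mu>0 by (simp add: PO_def q_def poly_lin_prod field_simps)
    hence "f * (v (poly PO (y k) - q) * \<mu>) \<le> f * (t ^ d * (\<rho> * t) * (t ^ d * v q))"
      using f_pos by simp
    also have "\<dots> = R * t ^ (2 * d + 1) * \<rho>" 
      unfolding power_add t2d by (simp add: mult_ac flip: fq)
    finally have 1: "f * v (poly PO (y k) - q) * \<mu> \<le> R * t ^ (2 * d + 1) * \<rho>" by (simp add: mult_ac)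
    have "poly Q (y k) - u = u0 * (poly PO (y k) - q)"
      using q0 Py[OF k] by (simp add: QP u0_def right_diff_distrib)
    hence eq: "v (poly Q (y k) - u) = f * v (poly PO (y k) - q)" by (simp add: mult vu0)
    show ?thesis
    proof (cases "v (poly Q (y k) - u) = 0")
      case True
      thus ?thesis using R(1) t1 by simp
    next
      case False
      hence "v (poly Q (y k) - u) * (\<rho> * t ^ B) < v (poly Q (y k) - u) * \<mu>"
        using \<mu>(1) by (intro mult_strict_left_mono pos) auto
      also have "\<dots> \<le> R * t ^ (2 * d + 1) * \<rho>" using 1 by (simp add: eq)
      finally have "\<rho> * (v (poly Q (y k) - u) * t ^ B) < \<rho> * (R * t ^ (2 * d + 1))" by (simp add: mult_ac)
      thus ?thesis using \<rho> by simp
    qed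
  qed
  have "v (y k - w a) \<le> t ^ 2 * \<rho>"
    using yt by (simp add: power2_eq_square mult_ac)
  hence "good_preimage Q d B R t \<rho> (w a) u (y k)"
    unfolding good_preimage_def
    using \<kappa>t \<rho> val_le deriv lipschitz_lin_prod[OF \<kappa>t \<rho>(1) phi[unfolded \<delta>_def]] by (auto simp: Q_def)
  thus ?thesis using that j by (auto simp: t_def)
qed

end

section \<open>From approximate preimages to a cycle of length two\<close>

context quasi_abs_closed
begin

text \<open>\<open>8 d + 8\<close> is the sum of \<open>6 d\<close> from the Lipschitz bound for
  \<open>Q'\<close> and of \<open>2 d + 8\<close>. On this smaller disc \<open>Q'\<close> changes by
  too little to cancel its value at \<open>y\<close>, and the lower bound on \<open>R\<close> lets
  it dominate the summand 1 as well.\<close>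

lemma good_preimage_near:
  assumes gp: "good_preimage Q d B R t \<rho> c u y"
    and z: "v (z - y) * t ^ (8 * d + 8) < \<rho>" and R: "t ^ (2 * d + 8) < R"
  shows "v (z - c) \<le> t ^ 3 * \<rho>" "R \<le> t ^ (2 * d + 8) * \<rho> * v (1 + poly (pderiv Q) z)"
proof -
  have \<kappa>t: "\<kappa> \<le> t" and \<rho>: "0 < \<rho>" "\<rho> \<le> 1" and yc: "v (y - c) \<le> t ^ 2 * \<rho>"
    and big: "R \<le> t ^ (2 * d + 6) * \<rho> * v (poly (pderiv Q) y)"
    using gp by (auto simp: good_preimage_def)
  have t1: "1 \<le> t" using \<kappa>t \<kappa>_ge_1 by linarith
  have R0: "0 < R" using R t1 by (smt (verit) one_le_power)
  have "v (z - y) * 1 \<le> v (z - y) * t ^ (8 * d + 8)" using t1 by (intro mult_left_mono one_le_power) auto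
  moreover have "1 * \<rho> \<le> t ^ 2 * \<rho>" using t1 \<rho> by (intro mult_right_mono one_le_power) auto
  ultimately have "v (z - y) \<le> t ^ 2 * \<rho>" using z by linarith
  hence "max (v (z - y)) (v (y - c)) \<le> t ^ 2 * \<rho>" using yc by simp
  hence "\<kappa> * max (v (z - y)) (v (y - c)) \<le> t * (t ^ 2 * \<rho>)"
    using \<kappa>t t1 by (intro mult_mono) (auto simp: le_max_iff_disj)
  moreover have "v (z - c) \<le> \<kappa> * max (v (z - y)) (v (y - c))" using add_le[of "z - y" "y - c"] by simp
  ultimately show zc: "v (z - c) \<le> t ^ 3 * \<rho>" by (simp add: eval_nat_numeral mult_ac)
  have yc3: "v (y - c) \<le> t ^ 3 * \<rho>"
  proof -
    have "t ^ 2 * \<rho> \<le> t ^ 3 * \<rho>" using t1 \<rho> by (intro mult_right_mono power_increasing) auto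
    thus ?thesis using yc by linarith
  qed
  define D where "D = poly (pderiv Q) z - poly (pderiv Q) y"
  have "v D * \<rho> ^ 2 \<le> t ^ (6 * d) * R * v (z - y)"
    using gp zc yc3 by (auto simp: good_preimage_def D_def)
  hence "v D * \<rho> ^ 2 * t ^ (2 * d + 8) \<le> t ^ (6 * d) * R * v (z - y) * t ^ (2 * d + 8)"
    using t1 by (intro mult_right_mono) auto
  also have "\<dots> = R * (v (z - y) * t ^ (8 * d + 8))"
    using power_add[of t "6 * d" "2 * d + 8"] by simp
  also have "\<dots> < R * \<rho>" using z R0 by simp
  finally have "\<rho> * (v D * \<rho> * t ^ (2 * d + 8)) < \<rho> * R" by (simp add: power2_eq_square mult_ac)
  hence "v D * \<rho> * t ^ (2 * d + 8) < R" using \<rho> by simp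
  also note big
  finally have "(t ^ (2 * d + 6) * \<rho>) * (t ^ 2 * v D) < (t ^ (2 * d + 6) * \<rho>) * v (poly (pderiv Q) y)"
    by (simp add: power_add eval_nat_numeral mult_ac)
  hence "t ^ 2 * v D < v (poly (pderiv Q) y)" using \<rho> t1 by simp
  moreover have "\<kappa> * v D \<le> t ^ 2 * v D"
    using \<kappa>t t1 by (intro mult_right_mono order_trans[OF \<kappa>t]) (auto simp: power2_eq_square)
  ultimately have "\<kappa> * v D < v (poly (pderiv Q) y)" by linarith
  from dominant[OF this] have "v (poly (pderiv Q) y) \<le> \<kappa> * v (poly (pderiv Q) z)" by (simp add: D_def)
  also have "\<dots> \<le> t * v (poly (pderiv Q) z)" using \<kappa>t by (intro mult_right_mono) auto
  finally have "(t ^ (2 * d + 6) * \<rho>) * v (poly (pderiv Q) y) \<le> (t ^ (2 * d + 6) * \<rho>) * (t * v (poly (pderiv Q) z))"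
    using \<rho> t1 by (intro mult_left_mono) auto
  hence 1: "R \<le> t ^ (2 * d + 7) * \<rho> * v (poly (pderiv Q) z)"
    using big by (simp add: power_add eval_nat_numeral mult_ac)
  have "t ^ (2 * d + 7) * t < R" using R by (simp add: power_add eval_nat_numeral mult_ac)
  also note 1
  also have "t ^ (2 * d + 7) * \<rho> * v (poly (pderiv Q) z) \<le> t ^ (2 * d + 7) * 1 * v (poly (pderiv Q) z)"
    using \<rho> t1 by (intro mult_right_mono mult_left_mono) auto
  finally have "t ^ (2 * d + 7) * t < t ^ (2 * d + 7) * v (poly (pderiv Q) z)" by simp
  hence "t < v (poly (pderiv Q) z)" using t1 by simp
  hence "\<kappa> * v 1 < v (poly (pderiv Q) z)" using \<kappa>t by simp
  from dominant[OF this] have "v (poly (pderiv Q) z) \<le> \<kappa> * v (1 + poly (pderiv Q) z)" by (simp add: add.commute)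
  also have "\<dots> \<le> t * v (1 + poly (pderiv Q) z)" using \<kappa>t by (intro mult_right_mono) auto
  finally have "(t ^ (2 * d + 7) * \<rho>) * v (poly (pderiv Q) z) \<le> (t ^ (2 * d + 7) * \<rho>) * (t * v (1 + poly (pderiv Q) z))"
    using \<rho> t1 by (intro mult_left_mono) auto
  thus "R \<le> t ^ (2 * d + 8) * \<rho> * v (1 + poly (pderiv Q) z)"
    using 1 by (simp add: power_add eval_nat_numeral mult_ac)
qed

lemma add3_less:
  assumes "v x * s < M" "v y * s < M" "v z * s < M" "0 \<le> s" "\<kappa> \<le> t"
  shows "v (x + y + z) * s < t ^ 2 * M"
proof -
  have M: "0 < M" using assms(1,4) nonneg[of x] by (smt (verit) mult_nonneg_nonneg)
  have 1: "v (x + y) * s \<le> \<kappa> * M'" if "v x * s \<le> M'" "v y * s \<le> M'" for x y M'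
  proof -
    have "v (x + y) * s \<le> \<kappa> * max (v x) (v y) * s" using assms(4) by (intro mult_right_mono add_le)
    also have "\<dots> = \<kappa> * max (v x * s) (v y * s)" using assms(4) by (simp add: max_mult_distrib_right)
    also have "\<dots> \<le> \<kappa> * M'" using that \<kappa>_ge_1 by (intro mult_left_mono) auto
    finally show ?thesis .
  qed
  define M' where "M' = max (v x * s) (max (v y * s) (v z * s))"
  have M'M: "M' < M" using assms by (simp add: M'_def)
  have M'0: "0 \<le> M'" using assms(4) by (simp add: M'_def le_max_iff_disj)
  have "v (x + y) * s \<le> \<kappa> * M'" by (rule 1) (auto simp: M'_def)
  moreover have "v z * s \<le> \<kappa> * M'"
  proof -
    have "v z * s \<le> 1 * M'" by (simp add: M'_def)
    also have "\<dots> \<le> \<kappa> * M'" using \<kappa>_ge_1 M'0 by (intro mult_right_mono)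
    finally show ?thesis .
  qed
  ultimately have "v (x + y + z) * s \<le> \<kappa> * (\<kappa> * M')" by (rule 1)
  also have "\<dots> < \<kappa> * (\<kappa> * M)" using M'M \<kappa>_ge_1 by simp
  also have "\<dots> \<le> t * (t * M)"
    using assms(5) M \<kappa>_ge_1 by (intro mult_mono) auto
  finally show ?thesis by (simp add: power2_eq_square)
qed

text \<open>\<open>root_near\<close> is applied twice. It first corrects \<open>ya\<close> to an
  exact preimage \<open>z0\<close> of \<open>yb\<close>, so that \<open>z0\<close> is nearly fixed
  by \<open>g o g\<close> and the derivative of \<open>g o g - X\<close> at \<open>z0\<close> is
  \<open>g'(z0) * g'(yb) - 1\<close>. It then corrects \<open>z0\<close> to a point of period
  dividing two, still so close to \<open>ya\<close>, with image so close to \<open>yb\<close>, that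
  both derivatives remain large. By \<open>ta \<le> tb\<close> all losses can be expressed in
  \<open>tb\<close>.\<close>

lemma period_two_point:
  fixes w :: "nat \<Rightarrow> 'a" and ca cb :: 'a
  assumes d: "2 \<le> d" and B: "d ^ 2 + 20 * d + 30 \<le> B"
  defines "Q \<equiv> lin_prod w {..<d}"
  defines "g \<equiv> \<lambda>x. x + poly Q x" and "g' \<equiv> \<lambda>x. 1 + poly (pderiv Q) x"
  assumes ga: "good_preimage Q d B R ta \<rho>a ca (cb - ca) ya"
    and gb: "good_preimage Q d B R tb \<rho>b cb (ca - cb) yb"
    and tab: "ta \<le> tb" and R: "tb ^ (B + 4) < R"
  obtains \<zeta> where "g (g \<zeta>) = \<zeta>" "R ^ 2 \<le> tb ^ (4 * d + 16) * v (g' \<zeta> * g' (g \<zeta>))"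
    "R \<le> tb ^ (2 * d + 8) * v (g' \<zeta>)"
proof -
  have \<kappa>t: "\<kappa> \<le> ta" and \<rho>a: "0 < \<rho>a" "\<rho>a \<le> 1" and ya: "v (ya - ca) \<le> ta ^ 2 * \<rho>a"
      "v (poly Q ya - (cb - ca)) * ta ^ B < R * ta ^ (2 * d + 1)"
    using ga by (auto simp: good_preimage_def)
  have \<rho>b: "0 < \<rho>b" "\<rho>b \<le> 1" and yb: "v (yb - cb) \<le> tb ^ 2 * \<rho>b"
      "v (poly Q yb - (ca - cb)) * tb ^ B < R * tb ^ (2 * d + 1)"
    using gb by (auto simp: good_preimage_def)
  have ta1: "1 \<le> ta" using \<kappa>t \<kappa>_ge_1 by linarith
  have tb1: "1 \<le> tb" using tab ta1 by linarith
  have \<kappa>tb: "\<kappa> \<le> tb" using \<kappa>t tab by linarith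
  have tatb: "ta ^ m \<le> tb ^ n" if "m \<le> n" for m n
    using power_mono[OF tab, of m] power_increasing[OF that tb1] ta1 by linarith
  have \<kappa>ta: "\<kappa> ^ m \<le> ta ^ n" if "m \<le> n" for m n using that ta1 \<kappa>t by (intro pow_le_pow)
  have \<kappa>tb': "\<kappa> ^ m \<le> tb ^ n" if "m \<le> n" for m n using that tb1 \<kappa>tb by (intro pow_le_pow)
  have Rt: "tb ^ m < R" if "m \<le> B + 4" for m
    using R power_increasing[OF that tb1] by linarith
  have R1: "1 < R" using Rt[of 0] by simp
  have Ra: "ta ^ (2 * d + 8) < R" using tatb[of "2 * d + 8" "2 * d + 8"] Rt[of "2 * d + 8"] B by linarith
  have Rb: "tb ^ (2 * d + 8) < R" using Rt[of "2 * d + 8"] B by linarith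
  have grow: "R \<le> R * s ^ m" if "1 \<le> s" for s m
    using R1 that mult_left_mono[OF one_le_power[OF that, of m], of R] by simp
  define gp where "gp = [:0, 1:] + Q"
  have gp: "poly gp x = g x" for x by (simp add: gp_def g_def)
  have gp': "poly (pderiv gp) x = g' x" for x by (simp add: gp_def g'_def pderiv_add pderiv_pCons)
  have dQ: "Polynomial.degree Q = d" "coeff Q d = 1"
    using lin_prod_monic[of w "{..<d}"] by (simp_all add: Q_def)
  have dgp: "Polynomial.degree gp = d" unfolding gp_def using d dQ
    by (subst degree_add_eq_right) auto
  have lgp: "Polynomial.lead_coeff gp = 1" unfolding dgp using d dQ by (auto simp: gp_def coeff_pCons split: nat.splits)
  define F where "F = gp - [:yb:]"
  have dF: "Polynomial.degree F = d"
    unfolding F_def diff_conv_add_uminus by (subst degree_add_eq_left) (use dgp d in auto)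
  have lF: "Polynomial.lead_coeff F = 1" 
    unfolding dF using lgp d unfolding dgp by (cases d) (auto simp: F_def)
  obtain xF where xF: "F = lin_prod xF {..<d}" using monic_splits[OF lF] dF by metis
  have Fya: "v (poly F ya) * ta ^ B < R * ta ^ (2 * d + 3)"
  proof -
    have "poly F ya = (ya - ca) + (poly Q ya - (cb - ca)) + (cb - yb)"
      by (simp add: F_def gp g_def)
    also have "v \<dots> * ta ^ B < ta ^ 2 * (R * ta ^ (2 * d + 1))"
    proof (rule add3_less)
      have "v (ya - ca) * ta ^ B \<le> (ta ^ 2 * 1) * ta ^ B"
        using ya(1) \<rho>a ta1 by (intro mult_right_mono order_trans[OF ya(1)] mult_left_mono) auto
      also have "\<dots> \<le> tb ^ (B + 2)" using tatb[of "B + 2" "B + 2"] by (simp add: power_add mult_ac power2_eq_square)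
      also have "\<dots> < R" by (rule Rt) simp
      also have "\<dots> \<le> R * ta ^ (2 * d + 1)" by (rule grow[OF ta1])
      finally show "v (ya - ca) * ta ^ B < R * ta ^ (2 * d + 1)" .
      have "v (cb - yb) * ta ^ B \<le> (tb ^ 2 * 1) * tb ^ B"
        using yb(1) \<rho>b tb1 ta1 tatb[of B B] diff_commute[of cb yb]
        by (intro mult_mono order_trans[OF _ mult_left_mono[of \<rho>b 1 "tb ^ 2"]]) auto
      also have "\<dots> = tb ^ (B + 2)" by (simp only: power_add mult_1_right mult.commute)
      also have "\<dots> < R" by (rule Rt) simp
      also have "\<dots> \<le> R * ta ^ (2 * d + 1)" by (rule grow[OF ta1])
      finally show "v (cb - yb) * ta ^ B < R * ta ^ (2 * d + 1)" .
    qed (use ya \<kappa>t ta1 in auto)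
    finally show ?thesis by (simp add: power_add eval_nat_numeral mult_ac)
  qed
  have F'ya: "R \<le> ta ^ (2 * d + 8) * \<rho>a * v (poly (pderiv F) ya)"
    using good_preimage_near(2)[OF ga, of ya] \<rho>a Ra
    by (simp add: F_def pderiv_diff gp' pderiv_pCons g'_def)
  have "poly (pderiv F) ya \<noteq> 0" using F'ya R1 by auto
  from root_near[OF this xF] obtain z0 where z0: "poly F z0 = 0"
    and "v (ya - z0) * v (poly (pderiv F) ya) \<le> \<kappa> ^ d * v (poly F ya)" by blast
  hence z0': "v (ya - z0) * v (poly (pderiv F) ya) \<le> ta ^ d * v (poly F ya)"
    using mult_right_mono[OF \<kappa>ta[of d d], of "v (poly F ya)"] by simp
  have "v (ya - z0) * R * ta ^ B \<le> v (ya - z0) * (ta ^ (2 * d + 8) * \<rho>a * v (poly (pderiv F) ya)) * ta ^ B"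
    using F'ya ta1 by (intro mult_right_mono mult_left_mono) auto
  also have "\<dots> = (ta ^ (2 * d + 8) * \<rho>a * ta ^ B) * (v (ya - z0) * v (poly (pderiv F) ya))" by (simp add: mult_ac)
  also have "\<dots> \<le> (ta ^ (2 * d + 8) * \<rho>a * ta ^ B) * (ta ^ d * v (poly F ya))"
    using \<rho>a ta1 by (intro mult_left_mono z0') auto
  also have "\<dots> = (ta ^ (2 * d + 8) * \<rho>a * ta ^ d) * (v (poly F ya) * ta ^ B)" by (simp add: mult_ac)
  also have "\<dots> < (ta ^ (2 * d + 8) * \<rho>a * ta ^ d) * (R * ta ^ (2 * d + 3))"
    using Fya \<rho>a ta1 by (intro mult_strict_left_mono) auto
  also have "\<dots> = R * (\<rho>a * ta ^ ((2 * d + 8) + d + (2 * d + 3)))" by (simp only: power_add mult_ac)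
  finally have "R * (v (ya - z0) * ta ^ B) < R * (\<rho>a * ta ^ ((2 * d + 8) + d + (2 * d + 3)))" by (simp add: mult_ac)
  hence "v (ya - z0) * ta ^ B < \<rho>a * ta ^ ((2 * d + 8) + d + (2 * d + 3))" using R1 by simp
  \<comment> \<open>One power of \<open>ta\<close> more than \<open>good_preimage_near\<close> asks
    for; it pays for adding \<open>\<zeta> - z0\<close> later.\<close>
  hence z0ya: "v (ya - z0) * ta ^ (8 * d + 9) < \<rho>a"
    by (rule less_power_cancel[OF ta1 nonneg]) (use B in linarith)
  have "v (z0 - ya) * ta ^ (8 * d + 8) \<le> v (ya - z0) * ta ^ (8 * d + 9)"
    unfolding diff_commute[of z0] using ta1 by (intro mult_left_mono power_increasing) auto
  hence near0: "v (z0 - ya) * ta ^ (8 * d + 8) < \<rho>a" using z0ya by linarith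
  note n0 = good_preimage_near[OF ga near0 Ra]
  have gz0: "g z0 = yb" using z0 by (simp add: F_def gp)
  have n0': "R \<le> tb ^ (2 * d + 8) * \<rho>a * v (g' z0)"
  proof -
    have "ta ^ (2 * d + 8) * \<rho>a * v (g' z0) \<le> tb ^ (2 * d + 8) * \<rho>a * v (g' z0)"
      using tatb \<rho>a by (intro mult_right_mono) auto
    thus ?thesis using n0(2) unfolding g'_def by linarith
  qed
  have nb: "R \<le> tb ^ (2 * d + 8) * \<rho>b * v (g' yb)"
    using good_preimage_near(2)[OF gb, of yb] \<rho>b Rb by (simp add: g'_def)
  define G where "G = pcompose gp gp - [:0, 1:]"
  have G: "poly G x = g (g x) - x" for x by (simp add: G_def poly_pcompose gp)
  have G': "poly (pderiv G) x = g' (g x) * g' x - 1" for x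
    by (simp add: G_def pderiv_diff pderiv_pcompose poly_pcompose gp gp' pderiv_pCons)
  have d4: "1 < d * d" using d by (metis less_1_mult less_le_trans one_less_numeral_iff semiring_norm(76))
  have dpc: "Polynomial.degree (pcompose gp gp) = d * d" by (simp add: degree_pcompose dgp)
  have dG: "Polynomial.degree G = d * d"
    unfolding G_def diff_conv_add_uminus by (subst degree_add_eq_left) (use dpc d4 in auto)
  have lG: "Polynomial.lead_coeff G = 1"
  proof -
    have "coeff (pcompose gp gp) (d * d) = 1"
      using lead_coeff_comp[of gp gp] d dgp lgp dpc by simp
    moreover have "coeff [:0, 1 :: 'a:] (d * d) = 0" using d4 by (simp add: coeff_eq_0)
    ultimately show ?thesis unfolding dG by (simp add: G_def)
  qed
  obtain xG where xG: "G = lin_prod xG {..<d * d}" using monic_splits[OF lG] dG by metis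
  have Gz0: "v (poly G z0) * tb ^ B < R * tb ^ (2 * d + 3)"
  proof -
    have "poly G z0 = (yb - cb) + (poly Q yb - (ca - cb)) + (ca - z0)"
      by (simp add: G gz0) (simp add: g_def)
    also have "v \<dots> * tb ^ B < tb ^ 2 * (R * tb ^ (2 * d + 1))"
    proof (rule add3_less)
      have "v (yb - cb) * tb ^ B \<le> (tb ^ 2 * 1) * tb ^ B"
        using yb(1) \<rho>b tb1 by (intro mult_right_mono order_trans[OF yb(1)] mult_left_mono) auto
      also have "\<dots> = tb ^ (B + 2)" by (simp only: power_add mult_1_right mult.commute)
      also have "\<dots> < R" by (rule Rt) simp
      also have "\<dots> \<le> R * tb ^ (2 * d + 1)" by (rule grow[OF tb1])
      finally show "v (yb - cb) * tb ^ B < R * tb ^ (2 * d + 1)" .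
      have "ta ^ 3 * \<rho>a \<le> tb ^ 3 * 1" using tatb[of 3 3] \<rho>a tb1 by (intro mult_mono) auto
      hence "v (ca - z0) \<le> tb ^ 3 * 1" using n0(1) diff_commute[of ca z0] by linarith
      hence "v (ca - z0) * tb ^ B \<le> (tb ^ 3 * 1) * tb ^ B"
        using tb1 by (intro mult_right_mono) auto
      also have "\<dots> = tb ^ (B + 3)" by (simp only: power_add mult_1_right mult.commute)
      also have "\<dots> < R" by (rule Rt) simp
      also have "\<dots> \<le> R * tb ^ (2 * d + 1)" by (rule grow[OF tb1])
      finally show "v (ca - z0) * tb ^ B < R * tb ^ (2 * d + 1)" .
    qed (use yb \<kappa>tb tb1 in auto)
    finally show ?thesis by (simp add: power_add eval_nat_numeral mult_ac)
  qed
  define T where "T = tb ^ (2 * d + 8) * tb ^ (2 * d + 8)"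
  have T: "T = tb ^ (4 * d + 16)" by (simp add: T_def flip: power_add)
  have T0: "0 < T" using tb1 by (simp add: T_def)
  have RR: "R * R \<le> T * (\<rho>a * \<rho>b) * v (g' z0 * g' yb)"
  proof -
    have "R * R \<le> (tb ^ (2 * d + 8) * \<rho>a * v (g' z0)) * (tb ^ (2 * d + 8) * \<rho>b * v (g' yb))"
      using n0' nb R1 by (intro mult_mono) (auto intro: order_trans[of 0 R])
    thus ?thesis by (simp add: T_def mult mult_ac)
  qed
  \<comment> \<open>The summand -1 is harmless: \<open>R ^ 2\<close> exceeds \<open>T * tb\<close>,
    so the product of the two derivatives exceeds \<open>tb\<close> and dominates.\<close>
  have G'z0: "R * R \<le> T * tb * (\<rho>a * \<rho>b) * v (poly (pderiv G) z0)"
  proof -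
    have "T * tb < R * 1" using Rt[of "4 * d + 17"] B by (simp add: T power_add eval_nat_numeral mult_ac)
    also have "\<dots> \<le> R * R" using R1 by (intro mult_left_mono) auto
    also note RR
    also have "T * (\<rho>a * \<rho>b) * v (g' z0 * g' yb) \<le> T * 1 * v (g' z0 * g' yb)"
      using \<rho>a \<rho>b T0 by (intro mult_right_mono mult_left_mono) (auto simp: mult_le_one)
    finally have "tb < v (g' z0 * g' yb)" using T0 by simp
    hence "\<kappa> * v (-1) < v (g' z0 * g' yb)" using \<kappa>tb by simp
    from dominant[OF this] have "v (g' z0 * g' yb) \<le> \<kappa> * v (poly (pderiv G) z0)"
      by (simp add: G' gz0 mult.commute)
    also have "\<dots> \<le> tb * v (poly (pderiv G) z0)" using \<kappa>tb by (intro mult_right_mono) auto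
    finally have "T * (\<rho>a * \<rho>b) * v (g' z0 * g' yb) \<le> T * (\<rho>a * \<rho>b) * (tb * v (poly (pderiv G) z0))"
      using \<rho>a \<rho>b T0 by (intro mult_left_mono) auto
    thus ?thesis using RR by (simp add: mult_ac)
  qed
  have "poly (pderiv G) z0 \<noteq> 0"
  proof
    assume "poly (pderiv G) z0 = 0"
    hence "R * R \<le> 0" using G'z0 by simp
    moreover have "0 < R * R" using R1 by simp
    ultimately show False by linarith
  qed
  from root_near[OF this xG] obtain \<zeta> where \<zeta>: "poly G \<zeta> = 0"
    and "v (z0 - \<zeta>) * v (poly (pderiv G) z0) \<le> \<kappa> ^ (d * d) * v (poly G z0)" by blast
  hence \<zeta>': "v (z0 - \<zeta>) * v (poly (pderiv G) z0) \<le> tb ^ (d * d) * v (poly G z0)"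
    using mult_right_mono[OF \<kappa>tb'[of "d * d" "d * d"], of "v (poly G z0)"] by simp
  define D where "D = v (z0 - \<zeta>)"
  have D0: "0 \<le> D" by (simp add: D_def)
  have DR: "0 \<le> D * R" using D0 R1 by simp
  have "D * (R * R) * tb ^ B \<le> D * (T * tb * (\<rho>a * \<rho>b) * v (poly (pderiv G) z0)) * tb ^ B"
    using G'z0 tb1 D0 by (intro mult_right_mono mult_left_mono) auto
  also have "\<dots> = (T * tb * (\<rho>a * \<rho>b) * tb ^ B) * (v (z0 - \<zeta>) * v (poly (pderiv G) z0))"
    by (simp add: mult_ac D_def)
  also have "\<dots> \<le> (T * tb * (\<rho>a * \<rho>b) * tb ^ B) * (tb ^ (d * d) * v (poly G z0))"
    using \<rho>a \<rho>b tb1 T0 by (intro mult_left_mono \<zeta>') auto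
  also have "\<dots> = (T * tb * (\<rho>a * \<rho>b) * tb ^ (d * d)) * (v (poly G z0) * tb ^ B)" by (simp add: mult_ac)
  also have "\<dots> < (T * tb * (\<rho>a * \<rho>b) * tb ^ (d * d)) * (R * tb ^ (2 * d + 3))"
    using Gz0 \<rho>a \<rho>b tb1 T0 by (intro mult_strict_left_mono) auto
  also have "\<dots> = R * ((\<rho>a * \<rho>b) * tb ^ ((4 * d + 16) + 1 + d * d + (2 * d + 3)))"
    by (simp only: power_add mult_ac T power_one_right)
  finally have "R * ((D * R) * tb ^ B) < R * ((\<rho>a * \<rho>b) * tb ^ ((4 * d + 16) + 1 + d * d + (2 * d + 3)))"
    by (simp add: mult_ac)
  hence "(D * R) * tb ^ B < (\<rho>a * \<rho>b) * tb ^ ((4 * d + 16) + 1 + d * d + (2 * d + 3))" using R1 by simp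
  \<comment> \<open>Here the size of \<open>B\<close> is decided: the exponents
    \<open>(4 d + 16) + 1 + d^2 + (2 d + 3)\<close> and \<open>14 d + 9\<close> add up to
    \<open>d^2 + 20 d + 29\<close>. The term \<open>d^2\<close> is the number of roots of
    \<open>G\<close> in \<open>root_near\<close>.\<close>
  hence Dk: "(D * R) * tb ^ (14 * d + 9) < \<rho>a * \<rho>b"
    by (rule less_power_cancel[OF tb1 DR]) (use B[unfolded power2_eq_square] in linarith)
  have neara: "v (\<zeta> - ya) * ta ^ (8 * d + 8) < \<rho>a"
  proof -
    have "D * ta ^ (8 * d + 9) \<le> (D * R) * tb ^ (14 * d + 9)"
      using D0 R1 ta1 tatb[of "8 * d + 9" "14 * d + 9"] by (intro mult_mono) (auto simp: mult_le_cancel_left1)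
    also note Dk
    also have "\<rho>a * \<rho>b \<le> \<rho>a * 1" using \<rho>a \<rho>b by (intro mult_left_mono) auto
    finally have 1: "D * ta ^ (8 * d + 9) < \<rho>a" by simp
    have "v (\<zeta> - ya) \<le> \<kappa> * max D (v (ya - z0))"
      using add_le[of "\<zeta> - z0" "z0 - ya"] diff_commute[of \<zeta> z0] diff_commute[of ya z0] by (simp add: D_def)
    also have "\<dots> \<le> ta * max D (v (ya - z0))" using \<kappa>t D0 by (intro mult_right_mono) auto
    finally have "v (\<zeta> - ya) * ta ^ (8 * d + 8) \<le> ta * max D (v (ya - z0)) * ta ^ (8 * d + 8)"
      using ta1 by (intro mult_right_mono) auto
    also have "\<dots> = max D (v (ya - z0)) * ta ^ (8 * d + 9)" by (simp add: power_add eval_nat_numeral mult_ac)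
    also have "\<dots> < \<rho>a" using 1 z0ya by (simp add: max_def)
    finally show ?thesis .
  qed
  note na = good_preimage_near[OF ga neara Ra]
  \<comment> \<open>Between \<open>z0\<close> and \<open>\<zeta>\<close> the map \<open>Q\<close>
    expands by a factor of about \<open>R / \<rho>a\<close>. This is why \<open>D * R\<close> was
    compared with \<open>\<rho>a * \<rho>b\<close> above, and
    \<open>14 d + 9 = 1 + 6 d + (8 d + 8)\<close> collects the powers that are spent.\<close>
  have nearb: "v (g \<zeta> - yb) * tb ^ (8 * d + 8) < \<rho>b"
  proof -
    have "v (poly Q \<zeta> - poly Q z0) * \<rho>a \<le> ta ^ (6 * d) * R * v (\<zeta> - z0)"
      using ga na(1) n0(1) by (auto simp: good_preimage_def)
    also have "\<dots> \<le> tb ^ (6 * d) * R * D"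
      unfolding D_def diff_commute[of \<zeta>] using tatb R1 by (intro mult_right_mono) auto
    finally have 1: "v (poly Q \<zeta> - poly Q z0) * \<rho>a \<le> tb ^ (6 * d) * R * D" .
    have "D * \<rho>a \<le> (R * D) * 1" using D0 R1 \<rho>a by (intro mult_mono) (auto simp: mult_le_cancel_right1)
    also have "\<dots> \<le> (R * D) * tb ^ (6 * d)" using D0 R1 tb1 by (intro mult_left_mono) auto
    finally have 2: "D * \<rho>a \<le> tb ^ (6 * d) * R * D" by (simp add: mult_ac)
    have "v (g \<zeta> - yb) \<le> \<kappa> * max D (v (poly Q \<zeta> - poly Q z0))"
      using add_le[of "\<zeta> - z0" "poly Q \<zeta> - poly Q z0"] diff_commute[of \<zeta> z0]
      by (simp add: D_def g_def flip: gz0) (simp add: algebra_simps)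
    also have "\<dots> \<le> tb * max D (v (poly Q \<zeta> - poly Q z0))" using \<kappa>tb D0 by (intro mult_right_mono) auto
    finally have "v (g \<zeta> - yb) * \<rho>a \<le> tb * max D (v (poly Q \<zeta> - poly Q z0)) * \<rho>a"
      using \<rho>a by (intro mult_right_mono) auto
    also have "\<dots> = tb * max (D * \<rho>a) (v (poly Q \<zeta> - poly Q z0) * \<rho>a)"
      using \<rho>a by (simp add: max_mult_distrib_right)
    also have "\<dots> \<le> tb * (tb ^ (6 * d) * R * D)" using 1 2 tb1 by (intro mult_left_mono) auto
    finally have "v (g \<zeta> - yb) * \<rho>a * tb ^ (8 * d + 8) \<le> tb * (tb ^ (6 * d) * R * D) * tb ^ (8 * d + 8)"
      using tb1 by (intro mult_right_mono) auto
    also have "\<dots> = (D * R) * tb ^ (1 + 6 * d + (8 * d + 8))" by (simp only: power_add mult_ac power_one_right)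
    also have "1 + 6 * d + (8 * d + 8) = 14 * d + 9" by simp
    also note Dk
    finally have "\<rho>a * (v (g \<zeta> - yb) * tb ^ (8 * d + 8)) < \<rho>a * \<rho>b" by (simp add: mult_ac)
    thus ?thesis using \<rho>a by simp
  qed
  note nb' = good_preimage_near[OF gb nearb Rb]
  have na': "R \<le> tb ^ (2 * d + 8) * v (g' \<zeta>)"
  proof -
    have "R \<le> ta ^ (2 * d + 8) * \<rho>a * v (g' \<zeta>)" using na(2) by (simp add: g'_def)
    also have "\<dots> \<le> tb ^ (2 * d + 8) * 1 * v (g' \<zeta>)"
      using tatb[of "2 * d + 8" "2 * d + 8"] \<rho>a ta1 tb1 by (intro mult_right_mono mult_mono) auto
    finally show ?thesis by simp
  qed
  have nb'': "R \<le> tb ^ (2 * d + 8) * v (g' (g \<zeta>))"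
  proof -
    have "R \<le> tb ^ (2 * d + 8) * \<rho>b * v (g' (g \<zeta>))" using nb'(2) by (simp add: g'_def)
    also have "\<dots> \<le> tb ^ (2 * d + 8) * 1 * v (g' (g \<zeta>))"
      using \<rho>b tb1 by (intro mult_right_mono mult_left_mono) auto
    finally show ?thesis by simp
  qed
  have "R * R \<le> (tb ^ (2 * d + 8) * v (g' \<zeta>)) * (tb ^ (2 * d + 8) * v (g' (g \<zeta>)))"
    using na' nb'' R1 by (intro mult_mono) (auto intro: order_trans[of 0 R])
  hence "R ^ 2 \<le> tb ^ (4 * d + 16) * v (g' \<zeta> * g' (g \<zeta>))"
    unfolding T[symmetric] T_def by (simp add: power2_eq_square mult mult_ac)
  moreover have "g (g \<zeta>) = \<zeta>" using \<zeta> by (simp add: G)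
  ultimately show ?thesis using that na' by blast
qed

lemma multiplier_lower:
  assumes "v (1 + x) * \<kappa> ^ Suc n < R" "\<kappa> ^ Suc n < R"
  shows "v x * \<kappa> ^ n < R"
proof -
  have "v x \<le> \<kappa> * max (v (1 + x)) (v 1)" using diff_le[of "1 + x" 1] by simp
  hence "v x * \<kappa> ^ n \<le> \<kappa> * max (v (1 + x)) (v 1) * \<kappa> ^ n" using \<kappa>_ge_1 by (intro mult_right_mono) auto
  also have "\<dots> = max (v (1 + x)) 1 * \<kappa> ^ Suc n" by simp
  also have "\<dots> < R" using assms by (simp add: max_def)
  finally show ?thesis .
qed

text \<open>Origin of \<open>N\<close>: the largest possible scale is
  \<open>\<kappa> ^ (B ^ d)\<close> with \<open>B = d^2 + 20 d + 30\<close>, and no estimate uses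
  more than its \<open>2 B\<close>-th power, which gives \<open>2 * B ^ Suc d\<close>. The final 1
  is lost in passing from the multiplier \<open>1 + Q'\<close> to \<open>Q'\<close>.\<close>

theorem spread_bound:
  fixes w :: "nat \<Rightarrow> 'a"
  assumes d: "2 \<le> d" and ab: "a < d" "b < d"
    and max: "\<And>i j. i < d \<Longrightarrow> j < d \<Longrightarrow> v (w i - w j) \<le> v (w a - w b)"
    and int: "\<And>n. 1 \<le> n \<Longrightarrow> n \<le> d \<Longrightarrow> 1 \<le> \<kappa> * v (of_nat n)"
  defines "Q \<equiv> lin_prod w {..<d}"
  defines "g \<equiv> \<lambda>x. x + poly Q x" and "g' \<equiv> \<lambda>x. 1 + poly (pderiv Q) x"
  defines "N \<equiv> 2 * (d ^ 2 + 20 * d + 30) ^ Suc d + 1"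
  shows "(\<exists>i<d. v (w a - w b) \<le> \<kappa> ^ N * max 1 (v (g' (w i)))) \<or>
    (\<exists>\<zeta>. g (g \<zeta>) = \<zeta> \<and> g \<zeta> \<noteq> \<zeta> \<and> v (w a - w b) \<le> \<kappa> ^ N * max 1 (v (g' \<zeta> * g' (g \<zeta>))))"
proof (cases "\<exists>i<d. v (w a - w b) \<le> \<kappa> ^ N * max 1 (v (g' (w i)))")
  case False
  define R where "R = v (w a - w b)"
  define B where "B = d ^ 2 + 20 * d + 30"
  have NB: "N = 2 * (B * B ^ d) + 1" by (simp add: N_def B_def)
  from False have F: "\<kappa> ^ N * max 1 (v (g' (w i))) < R" if "i < d" for i
    using that by (auto simp: R_def not_le)
  have \<kappa>N1: "1 \<le> \<kappa> ^ N" using \<kappa>_ge_1 by simp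
  have R: "\<kappa> ^ N < R"
  proof -
    have "\<kappa> ^ N * 1 \<le> \<kappa> ^ N * max 1 (v (g' (w a)))" using \<kappa>N1 by (intro mult_left_mono) auto
    thus ?thesis using F[OF ab(1)] by simp
  qed
  have small: "v (poly (pderiv Q) (w i)) * \<kappa> ^ (2 * (B * B ^ d)) < R" if "i < d" for i
  proof (rule multiplier_lower)
    have "v (1 + poly (pderiv Q) (w i)) * \<kappa> ^ N \<le> \<kappa> ^ N * max 1 (v (g' (w i)))"
      unfolding g'_def mult.commute[of "v _"] using \<kappa>N1 by (intro mult_left_mono) auto
    thus "v (1 + poly (pderiv Q) (w i)) * \<kappa> ^ Suc (2 * (B * B ^ d)) < R"
      using F[OF that] by (simp add: NB)
    show "\<kappa> ^ Suc (2 * (B * B ^ d)) < R" using R by (simp add: NB)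
  qed
  have R1: "1 < R" using R \<kappa>N1 by linarith
  have B4: "4 * d + 8 \<le> B" by (simp add: B_def)
  have NN: "(2 * d + 6) * B ^ d \<le> 2 * (B * B ^ d)"
  proof -
    have "(2 * d + 6) * B ^ d \<le> (2 * B) * B ^ d" by (intro mult_right_mono) (auto simp: B_def)
    thus ?thesis by (simp only: mult.assoc)
  qed
  obtain ja \<rho>a ya where ja: "ja \<le> d" "good_preimage Q d B R (\<kappa> ^ (B ^ ja)) \<rho>a (w a) (w b - w a) ya"
    unfolding Q_def
    by (rule approx_preimage[OF d ab R1 _ _ _ int B4 NN small[unfolded Q_def], of "w b - w a"])
       (use max[OF ab(1)] in \<open>auto simp: R_def intro: diff_commute\<close>)
  obtain jb \<rho>b yb where jb: "jb \<le> d" "good_preimage Q d B R (\<kappa> ^ (B ^ jb)) \<rho>b (w b) (w a - w b) yb"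
    unfolding Q_def
    by (rule approx_preimage[OF d ab(2,1) R1 _ _ _ int B4 NN small[unfolded Q_def], of "w a - w b"])
       (use max[OF ab(2)] in \<open>auto simp: R_def intro: diff_commute\<close>)
  have tN: "\<kappa> ^ (B ^ j * m) \<le> \<kappa> ^ N" if "j \<le> d" "m \<le> 2 * B" for j m
  proof -
    have "B ^ j * m \<le> B ^ d * (2 * B)" using that B4 by (intro mult_mono power_increasing) auto
    thus ?thesis using \<kappa>_ge_1 by (intro power_increasing) (auto simp: NB mult_ac)
  qed
  \<comment> \<open>Stated for arbitrary centres because \<open>period_two_point\<close> starts at
    the one with the smaller scale, which may be either \<open>w a\<close> or
    \<open>w b\<close>.\<close>
  have key: "\<exists>\<zeta>. g (g \<zeta>) = \<zeta> \<and> g \<zeta> \<noteq> \<zeta> \<and> R \<le> \<kappa> ^ N * max 1 (v (g' \<zeta> * g' (g \<zeta>)))"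
    if ga: "good_preimage Q d B R (\<kappa> ^ (B ^ j)) \<rho> c (c' - c) y"
      and gb: "good_preimage Q d B R (\<kappa> ^ (B ^ j')) \<rho>' c' (c - c') y'"
      and jj: "j \<le> j'" "j' \<le> d" for j j' \<rho> \<rho>' c c' y y'
  proof -
    have tt: "\<kappa> ^ (B ^ j) \<le> \<kappa> ^ (B ^ j')"
      using jj B4 \<kappa>_ge_1 by (intro power_increasing) auto
    have "(\<kappa> ^ (B ^ j')) ^ (B + 4) \<le> \<kappa> ^ N"
      unfolding power_mult[symmetric] using jj B4 by (intro tN) auto
    hence tR: "(\<kappa> ^ (B ^ j')) ^ (B + 4) < R" using R by linarith
    obtain \<zeta> where \<zeta>: "g (g \<zeta>) = \<zeta>"
      "R ^ 2 \<le> (\<kappa> ^ (B ^ j')) ^ (4 * d + 16) * v (g' \<zeta> * g' (g \<zeta>))"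
      "R \<le> (\<kappa> ^ (B ^ j')) ^ (2 * d + 8) * v (g' \<zeta>)"
      using period_two_point[of d B w, folded Q_def, OF d _ ga gb tt tR]
      by (auto simp: B_def g_def g'_def)
    have le: "(\<kappa> ^ (B ^ j')) ^ m \<le> \<kappa> ^ N" if "m \<le> 2 * B" for m
      unfolding power_mult[symmetric] using jj that by (intro tN) auto
    \<comment> \<open>A fixed point would be some \<open>w i\<close> whose multiplier is too large
      for \<open>F\<close>; the separate bound for \<open>g' \<zeta>\<close> in
      \<open>period_two_point\<close> serves this purpose.\<close>
    have "g \<zeta> \<noteq> \<zeta>"
    proof
      assume "g \<zeta> = \<zeta>"
      hence "poly Q \<zeta> = 0" by (simp add: g_def)
      then obtain i where i: "i < d" "\<zeta> = w i" by (auto simp: Q_def poly_lin_prod)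
      have "R \<le> (\<kappa> ^ (B ^ j')) ^ (2 * d + 8) * max 1 (v (g' \<zeta>))"
        using \<kappa>_ge_1 by (intro order_trans[OF \<zeta>(3)] mult_left_mono) auto
      also have "\<dots> \<le> \<kappa> ^ N * max 1 (v (g' \<zeta>))"
        by (intro mult_right_mono le) (auto simp: B_def)
      finally show False using F[OF i(1)] i(2) by simp
    qed
    moreover have "R \<le> \<kappa> ^ N * max 1 (v (g' \<zeta> * g' (g \<zeta>)))"
    proof -
      have "R \<le> R ^ 2" using R1 by (simp add: power2_eq_square)
      also note \<zeta>(2)
      also have "(\<kappa> ^ (B ^ j')) ^ (4 * d + 16) * v (g' \<zeta> * g' (g \<zeta>)) \<le> \<kappa> ^ N * max 1 (v (g' \<zeta> * g' (g \<zeta>)))"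
        using \<kappa>N1 by (intro mult_mono le) (auto simp: B_def)
      finally show ?thesis .
    qed
    ultimately show ?thesis using \<zeta>(1) by blast
  qed
  have "\<exists>\<zeta>. g (g \<zeta>) = \<zeta> \<and> g \<zeta> \<noteq> \<zeta> \<and> R \<le> \<kappa> ^ N * max 1 (v (g' \<zeta> * g' (g \<zeta>)))"
    using key[OF ja(2) jb(2)] key[OF jb(2) ja(2)] ja(1) jb(1) by (cases "ja \<le> jb") auto
  thus ?thesis by (simp add: R_def)
qed simp

end

section \<open>Degrees two and three, critical points, and growth along orbits\<close>

context quasi_abs
begin

text \<open>The third root cannot be close to both ends of the distance \<open>R\<close>, so at one
  end \<open>Q'\<close> is the product of \<open>R\<close> and another distance of order
  \<open>R\<close>. One \<open>\<kappa>\<close> comes from comparing the distances, the other from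
  removing the summand 1.\<close>

lemma spread_bound_le_3:
  fixes w :: "nat \<Rightarrow> 'a"
  assumes d: "d \<in> {2, 3}" and ab: "a < d" "b < d"
  defines "Q \<equiv> lin_prod w {..<d}"
  shows "\<exists>i<d. v (w a - w b) \<le> \<kappa> ^ 2 * max 1 (v (1 + poly (pderiv Q) (w i)))"
proof (cases "v (w a - w b) \<le> 1")
  case True
  have "1 * 1 \<le> \<kappa> ^ 2 * max 1 (v (1 + poly (pderiv Q) (w a)))"
    using \<kappa>_ge_1 by (intro mult_mono one_le_power) auto
  thus ?thesis using True ab by (intro exI[of _ a]) auto
next
  case False
  define R where "R = v (w a - w b)"
  have R: "1 < R" using False by (simp add: R_def)
  hence neq: "a \<noteq> b" by (auto simp: R_def)
  have Q': "poly (pderiv Q) (w i) = (\<Prod>j\<in>{..<d}-{i}. w i - w j)" if "i < d" for i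
    unfolding Q_def by (rule poly_pderiv_lin_prod_root) (use that in auto)
  have "\<exists>i<d. R \<le> \<kappa> * v (poly (pderiv Q) (w i))"
  proof (cases "d = 2")
    case True
    hence "{..<d} - {a} = {b}" using ab neq by auto
    hence "v (poly (pderiv Q) (w a)) = R" using Q'[OF ab(1)] by (simp add: R_def)
    moreover have "1 * R \<le> \<kappa> * R" using \<kappa>_ge_1 R by (intro mult_right_mono) auto
    ultimately show ?thesis using ab by auto
  next
    case False
    hence d3: "d = 3" using d by simp
    define c where "c = 3 - a - b"
    have c: "c < 3" "c \<noteq> a" "c \<noteq> b" "{..<3} = {a, b, c}" 
    proof -
      have "a = 0 \<or> a = 1 \<or> a = 2" "b = 0 \<or> b = 1 \<or> b = 2" using ab d3 by auto
      thus "c < 3" "c \<noteq> a" "c \<noteq> b" "{..<3} = {a, b, c}" using neq by (auto simp: c_def)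
    qed
    have "R \<le> \<kappa> * max (v (w a - w c)) (v (w c - w b))"
      using add_le[of "w a - w c" "w c - w b"] by (simp add: R_def)
    hence "R \<le> \<kappa> * v (w a - w c) \<or> R \<le> \<kappa> * v (w b - w c)"
      using diff_commute[of "w c" "w b"] by (auto simp: max_def split: if_splits)
    moreover have "R \<le> \<kappa> * (R * x)" if "R \<le> \<kappa> * x" for x
    proof -
      have "1 * R \<le> R * (\<kappa> * x)" using that R by (intro mult_mono) auto
      thus ?thesis by (simp add: mult_ac)
    qed
    moreover have "v (poly (pderiv Q) (w a)) = R * v (w a - w c)"
    proof -
      have "{..<d} - {a} = {b, c}" using c neq d3 by auto
      thus ?thesis using Q'[OF ab(1)] c by (simp add: mult R_def)
    qed
    moreover have "v (poly (pderiv Q) (w b)) = R * v (w b - w c)"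
    proof -
      have "{..<d} - {b} = {a, c}" using c neq d3 by auto
      thus ?thesis using Q'[OF ab(2)] c diff_commute[of "w b" "w a"] by (simp add: mult R_def)
    qed
    ultimately show ?thesis using ab by metis
  qed
  then obtain i where i: "i < d" "R \<le> \<kappa> * v (poly (pderiv Q) (w i))" by blast
  have "v (poly (pderiv Q) (w i)) \<le> \<kappa> * max (v (1 + poly (pderiv Q) (w i))) (v 1)"
    using diff_le[of "1 + poly (pderiv Q) (w i)" 1] by simp
  hence "\<kappa> * v (poly (pderiv Q) (w i)) \<le> \<kappa> * (\<kappa> * max 1 (v (1 + poly (pderiv Q) (w i))))"
    using \<kappa>_ge_1 by (intro mult_left_mono) (auto simp: max.commute)
  thus ?thesis using i by (intro exI[of _ i]) (auto simp: R_def power2_eq_square)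
qed

text \<open>Far from all roots \<open>Q'(x)\<close> is \<open>d x^(d-1)\<close> with an error
  smaller by the factor \<open>M / v x\<close>. Then \<open>1 + Q'(x) = 0\<close> forces
  \<open>v (d x^(d-1)) \<le> \<kappa>\<close>, which is too small for such an \<open>x\<close>. In
  the exponent, \<open>d\<close> counts the summands, \<open>2 d\<close> comes from the products and
  2 from the comparison.\<close>

lemma critical_point_bound:
  fixes w :: "nat \<Rightarrow> 'a"
  assumes d: "2 \<le> d" and w: "\<And>i. i < d \<Longrightarrow> v (w i) \<le> R" and M: "1 \<le> M" "R \<le> M"
    and int: "1 \<le> \<kappa> * v (of_nat d)"
    and x: "1 + poly (pderiv (lin_prod w {..<d})) x = 0"
  shows "v x \<le> \<kappa> ^ (3 * d + 2) * M"
proof (rule ccontr)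
  assume "\<not> ?thesis"
  hence far: "\<kappa> ^ (3 * d + 2) * M < v x" by simp
  have \<kappa>1: "1 \<le> \<kappa> ^ n" for n using \<kappa>_ge_1 by simp
  have "1 * M \<le> \<kappa> ^ (3 * d + 2) * M" using \<kappa>1[of "3 * d + 2"] M by (intro mult_right_mono) auto
  hence vx: "M < v x" using far by linarith
  have vx0: "0 < v x" using vx M by linarith
  define E where "E = (\<Sum>i<d. (\<Prod>j\<in>{..<d}-{i}. x - w j) - (\<Prod>j\<in>{..<d}-{i}. x))"
  have card: "card ({..<d} - {i}) = d - 1" if "i < d" for i using that by simp
  have eq: "- 1 = of_nat d * x ^ (d - 1) + E"
  proof -
    have "poly (pderiv (lin_prod w {..<d})) x = (\<Sum>i<d. \<Prod>j\<in>{..<d}-{i}. x) + E"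
      by (simp add: poly_pderiv_lin_prod E_def sum_subtractf)
    also have "(\<Sum>i<d. \<Prod>j\<in>{..<d}-{i}. x) = (\<Sum>i<d. x ^ (d - 1))"
      using card by (intro sum.cong) auto
    also have "\<dots> = of_nat d * x ^ (d - 1)" by simp
    finally have "poly (pderiv (lin_prod w {..<d})) x = of_nat d * x ^ (d - 1) + E" .
    moreover have "poly (pderiv (lin_prod w {..<d})) x = - 1"
      using x by (simp add: eq_neg_iff_add_eq_0 add.commute)
    ultimately show ?thesis by metis
  qed
  have E: "v E \<le> \<kappa> ^ card {..<d} * (\<kappa> ^ (2 * d) * M * v x ^ (d - 2))"
    unfolding E_def
  proof (rule sum_le)
    fix i assume "i \<in> {..<d}"
    hence i: "i < d" by simp
    have "v ((\<Prod>j\<in>{..<d}-{i}. x - w j) - (\<Prod>j\<in>{..<d}-{i}. x))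
        \<le> \<kappa> ^ card ({..<d} - {i}) * (M / v x) * (\<Prod>j\<in>{..<d}-{i}. \<kappa> * v x)"
    proof (rule prod_diff)
      fix j assume "j \<in> {..<d} - {i}"
      hence wj: "v (w j) \<le> M" using w[of j] M by auto
      have "\<kappa> * max (v x) (v (w j)) \<le> \<kappa> * v x" using wj vx \<kappa>_ge_1 by (intro mult_left_mono) auto
      thus "v (x - w j) \<le> \<kappa> * v x" using diff_le[of x "w j"] by linarith
      have "1 * v x \<le> \<kappa> * v x" using \<kappa>_ge_1 by (intro mult_right_mono) auto
      thus "v x \<le> \<kappa> * v x" "v x \<le> \<kappa> * v x" by simp_all
      show "v (x - w j - x) \<le> M" using wj by simp
    qed (use M vx0 in auto)
    also have "\<dots> = \<kappa> ^ (2 * (d - 1)) * M * (v x ^ (d - 1) / v x)"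
      using card[OF i] by (simp add: power_mult_distrib mult_2 power_add)
    also have "v x ^ (d - 1) / v x = v x ^ (d - 2)"
    proof -
      have "d - 1 = Suc (d - 2)" using d by simp
      thus ?thesis using vx0 by (simp del: eq_0_iff)
    qed
    also have "\<kappa> ^ (2 * (d - 1)) * M * v x ^ (d - 2) \<le> \<kappa> ^ (2 * d) * M * v x ^ (d - 2)"
      using \<kappa>_ge_1 M by (intro mult_right_mono power_increasing) auto
    finally show "v ((\<Prod>j\<in>{..<d}-{i}. x - w j) - (\<Prod>j\<in>{..<d}-{i}. x)) \<le> \<kappa> ^ (2 * d) * M * v x ^ (d - 2)" .
  qed (use M \<kappa>_ge_1 in auto)
  have split: "v x ^ (d - 1) = v x * v x ^ (d - 2)"
  proof -
    have "d - 1 = Suc (d - 2)" using d by simp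
    thus ?thesis by simp
  qed
  have big: "v x ^ (d - 1) \<le> \<kappa> * v (of_nat d * x ^ (d - 1))"
    using mult_right_mono[OF int, of "v x ^ (d - 1)"] by (simp add: mult power mult_ac)
  have "\<kappa> * (\<kappa> * v E) \<le> \<kappa> * (\<kappa> * (\<kappa> ^ card {..<d} * (\<kappa> ^ (2 * d) * M * v x ^ (d - 2))))"
    using E \<kappa>_ge_1 by (intro mult_left_mono) auto
  also have "\<dots> = \<kappa> ^ (3 * d + 2) * M * v x ^ (d - 2)"
    using power_add[of \<kappa> d "2 * d"] by (simp add: mult_ac)
  also have "\<dots> < v x * v x ^ (d - 2)" using far vx0 by simp
  also note split[symmetric]
  also note big
  finally have "\<kappa> * v E < v (of_nat d * x ^ (d - 1))" using \<kappa>_pos by simp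
  from dominant[OF this] have 1: "v (of_nat d * x ^ (d - 1)) \<le> \<kappa>" unfolding eq[symmetric] by simp
  have "\<kappa> ^ 2 * 1 \<le> \<kappa> ^ (3 * d + 2) * M" using \<kappa>_ge_1 M by (intro mult_mono power_increasing) auto
  hence "\<kappa> ^ 2 < v x" using far by simp
  moreover have "v x * 1 \<le> v x * v x ^ (d - 2)" using vx M by (intro mult_left_mono one_le_power) auto
  ultimately have "\<kappa> ^ 2 < v x ^ (d - 1)" unfolding split by linarith
  also note big
  also have "\<kappa> * v (of_nat d * x ^ (d - 1)) \<le> \<kappa> * \<kappa>" using 1 \<kappa>_ge_1 by (intro mult_left_mono) auto
  finally show False by (simp add: power2_eq_square)
qed

text \<open>\<open>M\<close> keeps the quantity from falling below the size of the roots. One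
  application of the map costs additional powers of \<open>\<kappa>\<close>, which the prefactor
  absorbs because \<open>2 (d + 1) \<le> d (d + 1)\<close>. Hence the logarithm grows at most by the
  factor \<open>d\<close> in each step, with no additive error to accumulate.\<close>

lemma growth_step:
  fixes w :: "nat \<Rightarrow> 'a"
  assumes d: "2 \<le> d" and w: "\<And>i. i < d \<Longrightarrow> v (w i) \<le> M" and M: "1 \<le> M"
  shows "\<kappa> ^ Suc d * max M (v (x + poly (lin_prod w {..<d}) x)) \<le> (\<kappa> ^ Suc d * max M (v x)) ^ d"
proof -
  define Y where "Y = max M (v x)"
  have Y1: "1 \<le> Y" using M by (simp add: Y_def)
  have YY: "Y \<le> Y ^ d" using Y1 d by (intro self_le_power) auto
  have \<kappa>1: "1 \<le> \<kappa> ^ n" for n using \<kappa>_ge_1 by simp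
  have "v (poly (lin_prod w {..<d}) x) \<le> (\<Prod>i<d. \<kappa> * Y)"
    unfolding poly_lin_prod prod
  proof (intro prod_mono conjI)
    fix i assume "i \<in> {..<d}"
    hence "\<kappa> * max (v x) (v (w i)) \<le> \<kappa> * Y"
      using \<kappa>_ge_1 w[of i] by (intro mult_left_mono) (auto simp: Y_def)
    thus "v (x - w i) \<le> \<kappa> * Y" using diff_le[of x "w i"] by linarith
  qed simp
  hence 1: "v (poly (lin_prod w {..<d}) x) \<le> \<kappa> ^ d * Y ^ d" by (simp add: power_mult_distrib)
  have 2: "Y \<le> \<kappa> ^ d * Y ^ d"
  proof -
    have "1 * Y \<le> \<kappa> ^ d * Y ^ d" using \<kappa>1[of d] YY Y1 \<kappa>_ge_1 by (intro mult_mono) auto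
    thus ?thesis by simp
  qed
  have 3: "\<kappa> ^ d * Y ^ d \<le> \<kappa> * (\<kappa> ^ d * Y ^ d)"
    using mult_right_mono[OF \<kappa>_ge_1, of "\<kappa> ^ d * Y ^ d"] Y1 \<kappa>_ge_1 by simp
  have "v (x + poly (lin_prod w {..<d}) x) \<le> \<kappa> * max (v x) (v (poly (lin_prod w {..<d}) x))" by (rule add_le)
  also have "\<dots> \<le> \<kappa> * (\<kappa> ^ d * Y ^ d)"
    using 1 2 \<kappa>_ge_1 by (intro mult_left_mono) (auto simp: Y_def)
  finally have "max M (v (x + poly (lin_prod w {..<d}) x)) \<le> \<kappa> * (\<kappa> ^ d * Y ^ d)"
    using 2 3 by (auto simp: Y_def)
  hence "\<kappa> ^ Suc d * max M (v (x + poly (lin_prod w {..<d}) x)) \<le> \<kappa> ^ Suc d * (\<kappa> * (\<kappa> ^ d * Y ^ d))"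
    using \<kappa>_ge_1 by (intro mult_left_mono) auto
  also have "\<dots> = \<kappa> ^ (2 * Suc d) * Y ^ d" by (simp add: power_add mult_2)
  also have "\<dots> \<le> \<kappa> ^ (Suc d * d) * Y ^ d"
  proof -
    have "2 * Suc d \<le> Suc d * d" using mult_le_mono2[OF d, of "Suc d"] by linarith
    thus ?thesis using \<kappa>_ge_1 Y1 by (intro mult_right_mono power_increasing) auto
  qed
  also have "\<dots> = (\<kappa> ^ Suc d * Y) ^ d" by (simp only: power_mult power_mult_distrib)
  finally show ?thesis by (simp add: Y_def)
qed

end

section \<open>Multiplier polynomials of periods one and two\<close>

lemma iterate_poly_1: "iterate_poly f 1 = f"
  by (simp add: iterate_poly_def)

lemma iterate_poly_2: "iterate_poly f 2 = pcompose f f"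
  by (simp add: iterate_poly_def numeral_2_eq_2)

text \<open>For \<open>q = f\<close> and \<open>r = X\<close> this makes \<open>f - X\<close> a
  divisor of \<open>f o f - X\<close>, so that the second dynatomic polynomial exists.\<close>

lemma diff_dvd_pcompose_diff:
  fixes p q r :: "'a :: comm_ring_1 poly"
  shows "q - r dvd pcompose p q - pcompose p r"
proof (induction p)
  case (pCons a p)
  have "pcompose (pCons a p) q - pcompose (pCons a p) r
      = q * (pcompose p q - pcompose p r) + (q - r) * pcompose p r"
    by (simp add: pcompose_pCons algebra_simps)
  thus ?case using pCons.IH by (simp add: dvd_add)
qed simp

text \<open>Taylor expansion to second order with a polynomial remainder. It is used with
  \<open>h = f o f - X\<close> to follow orders along cycles, and with \<open>h = f - X\<close> at
  fixed points.\<close>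

lemma taylor_pcompose:
  fixes p h :: "'a :: idom poly"
  obtains s where "pcompose p ([:0, 1:] + h) = p + h * pderiv p + h ^ 2 * s"
proof (induction p arbitrary: thesis)
  case 0
  show ?case by (rule 0[of 0]) simp
next
  case (pCons a p)
  obtain s where s: "pcompose p ([:0, 1:] + h) = p + h * pderiv p + h ^ 2 * s" using pCons.IH by blast
  have X: "[:0, 1:] * q = pCons 0 q" for q :: "'a poly" by simp
  have "pcompose (pCons a p) ([:0, 1:] + h) = [:a:] + ([:0, 1:] + h) * (p + h * pderiv p + h ^ 2 * s)"
    by (simp add: pcompose_pCons s del: mult_pCons_left)
  also have "\<dots> = ([:a:] + [:0, 1:] * p) + h * (p + [:0, 1:] * pderiv p)
      + h ^ 2 * (pderiv p + ([:0, 1:] + h) * s)"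
    by (simp add: algebra_simps power2_eq_square del: mult_pCons_left mult_pCons_right)
  also have "\<dots> = pCons a p + h * pderiv (pCons a p) + h ^ 2 * (pderiv p + ([:0, 1:] + h) * s)"
    unfolding X by (simp add: pderiv_pCons)
  finally show ?case by (rule pCons.prems)
qed

lemma dynatomic_1: "dynatomic f 1 = f - [:0, 1:]"
proof -
  define \<Phi> where "\<Phi> = (SOME \<Phi>. \<forall>q. q dvd 1 \<longrightarrow> iterate_poly f q - [:0, 1:] = (\<Prod>k | k dvd q. \<Phi> k))"
  have "\<forall>q. q dvd 1 \<longrightarrow> iterate_poly f q - [:0, 1:] = (\<Prod>k | k dvd q. \<Phi> k)"
    unfolding \<Phi>_def
    by (rule someI[of _ "\<lambda>_. f - [:0, 1:]"]) (simp add: iterate_poly_1[unfolded One_nat_def])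
  from this[rule_format, of 1] show ?thesis
    by (simp add: dynatomic_def \<Phi>_def iterate_poly_1[unfolded One_nat_def])
qed

lemma divisors_2: "{k :: nat. k dvd 2} = {1, 2}"
proof -
  have "k = 1 \<or> k = 2" if "k dvd 2" for k :: nat
    using prime_nat_iff two_is_prime_nat that by blast
  thus ?thesis by auto
qed

lemma dynatomic_2: "(f - [:0, 1:]) * dynatomic f 2 = pcompose f f - [:0, 1:]"
proof -
  have "f - [:0, 1:] dvd (pcompose f f - pcompose f [:0, 1:]) + (f - [:0, 1:])"
    by (intro dvd_add diff_dvd_pcompose_diff) simp
  moreover have "a - b + (b - c) = a - c" for a b c :: "qbar poly" by simp
  ultimately have "f - [:0, 1:] dvd pcompose f f - [:0, 1:]" by (simp only: pcompose_idR)
  then obtain D where D: "pcompose f f - [:0, 1:] = (f - [:0, 1:]) * D" by (elim dvdE)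
  define \<Phi> where "\<Phi> = (SOME \<Phi>. \<forall>q. q dvd 2 \<longrightarrow> iterate_poly f q - [:0, 1:] = (\<Prod>k | k dvd q. \<Phi> k))"
  have *: "\<forall>q. q dvd 2 \<longrightarrow> iterate_poly f q - [:0, 1:] = (\<Prod>k | k dvd q. \<Phi> k)"
    unfolding \<Phi>_def
  \<comment> \<open>Only the divisors of 2 are constrained, so the witness may take the value
    \<open>D\<close> everywhere off 1.\<close>
  proof (rule someI[of _ "\<lambda>k. if k = 1 then f - [:0, 1:] else D"], intro allI impI)
    fix q :: nat assume "q dvd 2"
    hence "q = 1 \<or> q = 2" using divisors_2 by blast
    thus "iterate_poly f q - [:0, 1:] = (\<Prod>k | k dvd q. if k = 1 then f - [:0, 1:] else D)"
      using D by (auto simp: iterate_poly_1[unfolded One_nat_def] iterate_poly_2 divisors_2)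
  qed
  have "\<Phi> 1 = f - [:0, 1:]" using *[rule_format, of 1] by (simp add: iterate_poly_1[unfolded One_nat_def])
  moreover have "\<Phi> 1 * \<Phi> 2 = pcompose f f - [:0, 1:]"
    using *[rule_format, of 2] by (simp add: iterate_poly_2 divisors_2)
  ultimately show ?thesis by (simp add: dynatomic_def \<Phi>_def)
qed

text \<open>Pairs \<open>{z, \<phi> z}\<close> contribute twice a common weight. The weights will be
  multiplicities of roots of the second dynatomic polynomial, and \<open>\<phi>\<close> will be
  \<open>f\<close>.\<close>

lemma even_sum_involution:
  fixes w :: "'a \<Rightarrow> nat"
  assumes "finite S" "\<And>z. z \<in> S \<Longrightarrow> \<phi> z \<in> S \<and> \<phi> (\<phi> z) = z \<and> w (\<phi> z) = w z \<and> (\<phi> z = z \<longrightarrow> even (w z))"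
  shows "even (sum w S)"
  using assms
proof (induction "card S" arbitrary: S rule: less_induct)
  case less
  show ?case
  proof (cases "S = {}")
    case False
    then obtain z where z: "z \<in> S" by blast
    define S' where "S' = S - {z, \<phi> z}"
    have S': "finite S'" "card S' < card S" using less.prems(1) z by (auto simp: S'_def intro!: psubset_card_mono)
    have inv: "\<phi> y \<in> S' \<and> \<phi> (\<phi> y) = y \<and> w (\<phi> y) = w y \<and> (\<phi> y = y \<longrightarrow> even (w y))" if "y \<in> S'" for y
    proof -
      have y: "y \<in> S" "y \<noteq> z" "y \<noteq> \<phi> z" using that by (auto simp: S'_def)
      have "\<phi> y \<noteq> z" "\<phi> y \<noteq> \<phi> z" using less.prems(2)[OF y(1)] less.prems(2)[OF z] y by metis+
      thus ?thesis using less.prems(2)[OF y(1)] by (simp add: S'_def)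
    qed
    have ev: "even (sum w S')" using less.hyps[OF S'(2,1) inv] .
    have "S = {z, \<phi> z} \<union> S'" using z less.prems(2)[OF z] by (auto simp: S'_def)
    hence "sum w S = sum w ({z, \<phi> z} \<union> S')" by simp
    also have "\<dots> = sum w {z, \<phi> z} + sum w S'"
      using S'(1) by (intro sum.union_disjoint) (auto simp: S'_def)
    finally show ?thesis using ev less.prems(2)[OF z] by (cases "\<phi> z = z") auto
  qed simp
qed

lemma even_mset_half:
  assumes "\<And>x. even (count M x)"
  obtains M' where "M = M' + M'"
  using assms
proof (induction "size M" arbitrary: M thesis rule: less_induct)
  case less
  show ?case
  proof (cases "M = {#}")
    case True
    thus ?thesis by (intro less.prems(1)[of "{#}"]) simp
  next
    case False
    then obtain x where x: "x \<in># M" by blast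
    hence "count M x \<ge> 2" using less.prems(2)[of x] by (metis count_greater_zero_iff dvd_imp_le)
    hence sub: "{#x, x#} \<subseteq># M" by (auto simp: subseteq_mset_def)
    define N where "N = M - {#x, x#}"
    have M: "M = N + {#x, x#}" unfolding N_def by (rule subset_mset.diff_add[OF sub, symmetric])
    have "even (count N y)" for y using less.prems(2)[of y] unfolding M by (auto split: if_splits)
    moreover have "size N < size M" by (simp add: M)
    ultimately obtain N' where "N = N' + N'" using less.hyps[of N] by blast
    thus ?thesis using M by (intro less.prems(1)[of "N' + {#x#}"]) simp
  qed
qed

lemma pcompose_power: "pcompose (p ^ n) q = pcompose p q ^ n" for p q :: "'a :: comm_ring_1 poly"
  by (induction n) (simp_all add: pcompose_mult pcompose_1)

section \<open>Multiplicities along cycles of length two\<close>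

context
  fixes f :: "qbar poly"
  assumes deg: "2 \<le> Polynomial.degree f"
begin

abbreviation "fixed_poly \<equiv> f - [:0, 1:]"
abbreviation "second_poly \<equiv> pcompose f f - [:0, 1:]"

lemma fixed_poly_nz: "fixed_poly \<noteq> 0" and second_poly_nz: "second_poly \<noteq> 0" and dyn_nz: "dynatomic f 2 \<noteq> 0"
proof -
  show "fixed_poly \<noteq> 0" using deg by auto
  have "Polynomial.degree (pcompose f f) = Polynomial.degree f * Polynomial.degree f" by (rule degree_pcompose)
  moreover have "2 * 1 \<le> Polynomial.degree f * Polynomial.degree f" using deg by (intro mult_mono) auto
  ultimately show second_poly: "second_poly \<noteq> 0" by auto
  thus "dynatomic f 2 \<noteq> 0" using dynatomic_2[of f] by (metis mult_zero_right)
qed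

lemma poly_second_poly: "poly second_poly z = poly f (poly f z) - z"
  by (simp add: poly_pcompose)

lemma pderiv_second_poly: "poly (pderiv second_poly) z = poly (pderiv f) (poly f z) * poly (pderiv f) z - 1"
  by (simp add: pderiv_diff pderiv_pcompose poly_pcompose pderiv_pCons)

lemma order_eq_1:
  fixes p :: "qbar poly"
  assumes "poly p z = 0" "poly (pderiv p) z \<noteq> 0"
  shows "Polynomial.order z p = 1"
proof -
  have "p \<noteq> 0" using assms(2) by auto
  moreover from this have "Polynomial.order z p \<noteq> 0" using assms(1) by (simp add: order_root)
  moreover have "Polynomial.order z (pderiv p) = 0" using assms(2) order_root by blast
  ultimately show ?thesis using order_pderiv[of p z] assms by (cases "pderiv p = 0") (auto simp: order_root)
qed

text \<open>With \<open>G = f o f - X\<close> the left-hand side is \<open>f o (X + G) - f\<close>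
  by associativity of composition, and the Taylor expansion exhibits the factor
  \<open>G\<close>.\<close>

lemma second_poly_pcompose:
  obtains s where "pcompose second_poly f = second_poly * (pderiv f + second_poly * s)"
proof -
  obtain s where s: "pcompose f ([:0, 1:] + second_poly) = f + second_poly * pderiv f + second_poly ^ 2 * s"
    by (rule taylor_pcompose)
  have "pcompose second_poly f = pcompose (pcompose f f) f - f" by (simp add: pcompose_diff pcompose_pCons)
  also have "pcompose (pcompose f f) f = pcompose f ([:0, 1:] + second_poly)" by (simp add: pcompose_assoc)
  finally have "pcompose second_poly f = second_poly * (pderiv f + second_poly * s)"
    unfolding s by (simp add: algebra_simps power2_eq_square)
  thus ?thesis by (rule that)
qed

text \<open>If \<open>f'(z) = 0\<close>, both points are simple zeros, since the derivative of
  \<open>f o f - X\<close> is -1 at each. Otherwise \<open>f\<close> is a local coordinate at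
  \<open>z\<close>, so composing with \<open>f\<close> turns the order at \<open>f(z)\<close> into
  the order at \<open>z\<close>, while the other factor in \<open>second_poly_pcompose\<close> takes
  the nonzero value \<open>f'(z)\<close>.\<close>

lemma order_second_poly_shift:
  assumes z: "poly second_poly z = 0"
  shows "Polynomial.order (poly f z) second_poly = Polynomial.order z second_poly"
proof -
  define b where "b = poly f z"
  have fb: "poly f b = z" using z by (simp add: poly_pcompose b_def)
  have Gb: "poly second_poly b = 0" by (simp only: poly_second_poly fb) (simp add: b_def)
  show ?thesis
  proof (cases "poly (pderiv f) z = 0")
    case True
    have "poly (pderiv second_poly) z = - 1" "poly (pderiv second_poly) b = - 1"
      using True by (simp_all only: pderiv_second_poly fb) simp_all
    thus ?thesis using order_eq_1[OF z] order_eq_1[OF Gb] by (simp add: b_def)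
  next
    case False
    obtain s where s: "pcompose second_poly f = second_poly * (pderiv f + second_poly * s)" by (rule second_poly_pcompose)
    define n where "n = Polynomial.order b second_poly"
    obtain H where H: "second_poly = [:- b, 1:] ^ n * H" "\<not> [:- b, 1:] dvd H"
      using order_decomp[OF second_poly_nz, of b] by (auto simp: n_def)
    have Hb: "poly H b \<noteq> 0" using H(2) by (simp add: poly_eq_0_iff_dvd)
    have "pcompose ([:- b, 1:] ^ n) f = (f - [:b:]) ^ n"
      by (simp add: pcompose_power pcompose_pCons) (simp add: diff_conv_add_uminus add.commute)
    hence cG: "pcompose second_poly f = (f - [:b:]) ^ n * pcompose H f" by (subst H(1)) (simp only: pcompose_mult)
    have o1: "Polynomial.order z (f - [:b:]) = 1"
      by (rule order_eq_1) (use False in \<open>simp_all add: b_def pderiv_diff pderiv_pCons\<close>)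
    have fb0: "f - [:b:] \<noteq> 0" using deg by auto
    have opow: "Polynomial.order z ((f - [:b:]) ^ n) = n" for n
      using fb0 o1 by (induction n) (simp_all add: order_mult)
    have "pcompose second_poly f \<noteq> 0" using second_poly_nz deg by (simp add: pcompose_eq_0_iff)
    have "pcompose H f \<noteq> 0" using Hb by (metis b_def poly_0 poly_pcompose)
    moreover have "Polynomial.order z (pcompose H f) = 0"
      using Hb by (intro order_0I) (simp add: poly_pcompose b_def)
    ultimately have "Polynomial.order z (pcompose second_poly f) = n"
      unfolding cG using fb0 by (simp add: order_mult opow)
    moreover have "Polynomial.order z (pcompose second_poly f) = Polynomial.order z second_poly"
    proof -
      have "poly (pderiv f + second_poly * s) z \<noteq> 0" using False z by (simp del: poly_diff)
      hence "Polynomial.order z (pderiv f + second_poly * s) = 0" "pderiv f + second_poly * s \<noteq> 0"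
        by (blast intro: order_0I, metis poly_0)
      thus ?thesis unfolding s using second_poly_nz by (simp add: order_mult)
    qed
    ultimately show ?thesis by (simp add: n_def b_def)
  qed
qed

lemma order_dynatomic_shift:
  assumes z: "poly second_poly z = 0" "poly f z \<noteq> z"
  shows "Polynomial.order (poly f z) (dynatomic f 2) = Polynomial.order z (dynatomic f 2)"
proof -
  have eq: "Polynomial.order y (dynatomic f 2) = Polynomial.order y second_poly" if "poly f y \<noteq> y" for y
  proof -
    have "Polynomial.order y second_poly = Polynomial.order y fixed_poly + Polynomial.order y (dynatomic f 2)"
      unfolding dynatomic_2[symmetric] using fixed_poly_nz dyn_nz by (intro order_mult) simp
    moreover have "Polynomial.order y fixed_poly = 0" using that by (intro order_0I) simp
    ultimately show ?thesis by simp
  qed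
  have "poly f (poly f z) \<noteq> poly f z" using z by (simp add: poly_pcompose)
  thus ?thesis using eq order_second_poly_shift[OF z(1)] z(2) by simp
qed

text \<open>
  At a fixed point with multiplier \<open>-1\<close>, comparing leading terms in
  \<open>f\<^sup>2 \<circ> f = f \<circ> f\<^sup>2\<close> shows that \<open>f\<^sup>2 - X\<close> vanishes to odd order.
\<close>

lemma even_order_dynatomic_fixed:
  assumes z: "poly (dynatomic f 2) z = 0" "poly f z = z"
  shows "even (Polynomial.order z (dynatomic f 2))"
proof -
  obtain s where s: "pcompose f ([:0, 1:] + fixed_poly) = f + fixed_poly * pderiv f + fixed_poly ^ 2 * s" by (rule taylor_pcompose)
  have "x + (f - x) = f" for x by simp
  hence XQ: "[:0, 1:] + fixed_poly = f" by blast
  have factor: "f + (f - x) * a + (f - x)\<^sup>2 * b - x = (f - x) * (1 + a + (f - x) * b)" for a b x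
    by (simp add: algebra_simps power2_eq_square)
  \<comment> \<open>Expanding \<open>f o (X + (f - X))\<close> identifies the second dynatomic
    polynomial with \<open>1 + f'\<close> modulo \<open>f - X\<close>; hence its zeros at fixed
    points have multiplier -1.\<close>
  have "second_poly = fixed_poly * (1 + pderiv f + fixed_poly * s)" by (simp only: s[unfolded XQ] factor)
  hence "fixed_poly * dynatomic f 2 = fixed_poly * (1 + pderiv f + fixed_poly * s)" by (simp only: dynatomic_2)
  hence "dynatomic f 2 = 1 + pderiv f + fixed_poly * s" using fixed_poly_nz by (metis mult_left_cancel)
  hence "1 + poly (pderiv f) z = 0" using z by simp
  hence f': "poly (pderiv f) z = - 1" by (simp add: eq_neg_iff_add_eq_0 add.commute)
  have Gz: "poly second_poly z = 0" by (simp only: poly_second_poly z(2)) simp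
  have "Polynomial.order z fixed_poly = 1"
    by (rule order_eq_1) (use z f' in \<open>simp_all add: pderiv_diff pderiv_pCons\<close>)
  moreover define n where "n = Polynomial.order z second_poly"
  moreover have "Polynomial.order z second_poly = Polynomial.order z fixed_poly + Polynomial.order z (dynatomic f 2)"
    unfolding dynatomic_2[symmetric] using fixed_poly_nz dyn_nz by (intro order_mult) simp
  ultimately have n: "n = Suc (Polynomial.order z (dynatomic f 2))" by simp
  obtain H where H: "second_poly = [:- z, 1:] ^ n * H" "\<not> [:- z, 1:] dvd H"
    using order_decomp[OF second_poly_nz, of z] by (auto simp: n_def)
  have Hz: "poly H z \<noteq> 0" using H(2) by (simp add: poly_eq_0_iff_dvd)
  have "poly (f - [:z:]) z = 0" using z by simp
  hence "[:- z, 1:] dvd f - [:z:]" by (simp only: poly_eq_0_iff_dvd)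
  then obtain E where E: "f - [:z:] = [:- z, 1:] * E" by (elim dvdE)
  have "pderiv f = pderiv (f - [:z:])" by (simp add: pderiv_diff pderiv_pCons)
  hence "pderiv f = pderiv ([:- z, 1:] * E)" by (simp only: E)
  hence Ez: "poly E z = - 1" using f' unfolding pderiv_mult by (simp add: pderiv_pCons)
  obtain s' where s': "pcompose second_poly f = second_poly * (pderiv f + second_poly * s')" by (rule second_poly_pcompose)
  have "pcompose ([:- z, 1:] ^ n) f = (f - [:z:]) ^ n"
      by (simp add: pcompose_power pcompose_pCons) (simp add: diff_conv_add_uminus add.commute)
  hence "pcompose second_poly f = ([:- z, 1:] * E) ^ n * pcompose H f" by (subst H(1)) (simp only: pcompose_mult E)
  hence "second_poly * (pderiv f + second_poly * s') = [:- z, 1:] ^ n * (E ^ n * pcompose H f)"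
    unfolding s' power_mult_distrib by (simp only: mult.assoc)
  moreover have "second_poly * (pderiv f + second_poly * s') = [:- z, 1:] ^ n * (H * (pderiv f + second_poly * s'))"
    by (subst (1) H(1)) (simp only: mult.assoc)
  ultimately have "[:- z, 1:] ^ n * (E ^ n * pcompose H f) = [:- z, 1:] ^ n * (H * (pderiv f + second_poly * s'))"
    by metis
  \<comment> \<open>With \<open>(X - z)^n\<close> cancelled, evaluation at \<open>z\<close> compares
    the leading coefficients: \<open>E(z) = f'(z) = -1\<close> gives
    \<open>(-1)^n H(z) = - H(z)\<close>.\<close>
  hence "E ^ n * pcompose H f = H * (pderiv f + second_poly * s')" by simp
  from arg_cong[OF this, of "\<lambda>p. poly p z"] have "(- 1) ^ n * poly H z = - poly H z"
    using Gz f' Ez z(2) by (simp add: poly_pcompose del: poly_diff)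
  hence "odd n" using Hz by (cases "even n") auto
  thus ?thesis by (simp add: n)
qed

text \<open>The involution \<open>z \<mapsto> f(z)\<close> on the roots preserves multiplicities and
  multipliers, and its fixed points have even multiplicity. So each value occurs an even number of
  times, and the product is a square of a monic product.\<close>

lemma multiplier_square:
  obtains \<chi> where "Polynomial.lead_coeff \<chi> = 1"
    "\<chi> ^ 2 = (\<Prod>z\<in>#proots (dynatomic f 2). [:- poly (pderiv (iterate_poly f 2)) z, 1:])"
proof -
  define \<mu> where "\<mu> z = poly (pderiv (iterate_poly f 2)) z" for z
  have \<mu>: "\<mu> z = poly (pderiv f) (poly f z) * poly (pderiv f) z" for z
    by (simp add: \<mu>_def iterate_poly_2 pderiv_pcompose poly_pcompose)
  define P where "P = proots (dynatomic f 2)"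
  have P: "z \<in># P \<longleftrightarrow> poly (dynatomic f 2) z = 0" "count P z = Polynomial.order z (dynatomic f 2)" for z
    using dyn_nz by (simp_all add: P_def)
  have second0: "poly second_poly z = 0" if "z \<in># P" for z
    using that P(1) arg_cong[OF dynatomic_2[of f], of "\<lambda>p. poly p z"] by simp
  have "even (count (image_mset \<mu> P) x)" for x
  proof -
    have "even (\<Sum>z\<in>\<mu> -` {x} \<inter> set_mset P. count P z)"
    proof (rule even_sum_involution[where \<phi> = "poly f"])
      fix z assume z: "z \<in> \<mu> -` {x} \<inter> set_mset P"
      hence zP: "z \<in># P" by simp
      have ffz: "poly f (poly f z) = z" using second0[OF zP] by (simp add: poly_pcompose)
      have ord: "count P (poly f z) = count P z"
        using order_dynatomic_shift[OF second0[OF zP]] by (cases "poly f z = z") (auto simp: P(2))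
      hence "poly f z \<in># P" using zP by (metis count_eq_zero_iff)
      moreover have "\<mu> (poly f z) = \<mu> z" unfolding \<mu> ffz by (simp add: mult.commute)
      moreover have "even (count P z)" if "poly f z = z"
        using even_order_dynatomic_fixed[OF _ that] zP by (simp add: P)
      ultimately show "poly f z \<in> \<mu> -` {x} \<inter> set_mset P \<and> poly f (poly f z) = z \<and>
          count P (poly f z) = count P z \<and> (poly f z = z \<longrightarrow> even (count P z))"
        using z ffz ord by auto
    qed simp
    thus ?thesis by (simp add: count_image_mset)
  qed
  then obtain M where M: "image_mset \<mu> P = M + M" by (rule even_mset_half)
  define \<chi> where "\<chi> = (\<Prod>x\<in>#M. [:- x, 1:])"
  have "\<chi> ^ 2 = (\<Prod>x\<in>#image_mset \<mu> P. [:- x, 1:])" by (simp add: M \<chi>_def power2_eq_square)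
  also have "\<dots> = (\<Prod>z\<in>#P. [:- \<mu> z, 1:])" by (simp add: image_mset.compositionality comp_def)
  finally have "\<chi> ^ 2 = (\<Prod>z\<in>#proots (dynatomic f 2). [:- poly (pderiv (iterate_poly f 2)) z, 1:])"
    by (simp add: P_def \<mu>_def)
  moreover have "Polynomial.lead_coeff \<chi> = 1" unfolding \<chi>_def by (induction M) (simp_all add: lead_coeff_mult del: mult_pCons_left)
  ultimately show ?thesis using that by blast
qed

text \<open>The only other square root is \<open>- \<chi>\<close>, whose leading coefficient -1
  differs from 1; hence the definite description is meaningful.\<close>

lemma multiplier_poly_2:
  "Polynomial.lead_coeff (multiplier_poly f 2) = 1"
  "multiplier_poly f 2 ^ 2 = (\<Prod>z\<in>#proots (dynatomic f 2). [:- poly (pderiv (iterate_poly f 2)) z, 1:])"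
proof -
  obtain \<chi> where \<chi>: "Polynomial.lead_coeff \<chi> = 1"
    "\<chi> ^ 2 = (\<Prod>z\<in>#proots (dynatomic f 2). [:- poly (pderiv (iterate_poly f 2)) z, 1:])"
    by (rule multiplier_square)
  have uniq: "\<psi> = \<chi>" if \<psi>: "Polynomial.lead_coeff \<psi> = 1" "\<psi> ^ 2 = \<chi> ^ 2" for \<psi>
  proof -
    have "\<psi> = \<chi> \<or> \<psi> = - \<chi>" using \<psi>(2) by (simp add: power2_eq_iff)
    moreover have "\<psi> \<noteq> - \<chi>" using \<psi>(1) \<chi>(1) by auto
    ultimately show ?thesis by blast
  qed
  have "multiplier_poly f 2 = \<chi>"
    unfolding multiplier_poly_def \<chi>(2)[symmetric] by (rule the_equality) (use \<chi>(1) uniq in blast)+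
  thus "Polynomial.lead_coeff (multiplier_poly f 2) = 1"
    "multiplier_poly f 2 ^ 2 = (\<Prod>z\<in>#proots (dynatomic f 2). [:- poly (pderiv (iterate_poly f 2)) z, 1:])"
    using \<chi> by simp_all
qed

lemma multipliers_2:
  "set_mset (multipliers f 2) = (\<lambda>z. poly (pderiv f) z * poly (pderiv f) (poly f z)) ` {z. poly (dynatomic f 2) z = 0}"
proof -
  have nz: "multiplier_poly f 2 \<noteq> 0" using multiplier_poly_2(1) by auto
  have "x \<in># multipliers f 2 \<longleftrightarrow> poly (multiplier_poly f 2 ^ 2) x = 0" for x
    using nz by (simp add: multipliers_def)
  also have "poly (multiplier_poly f 2 ^ 2) x = 0 \<longleftrightarrow>
      (\<exists>z. poly (dynatomic f 2) z = 0 \<and> x = poly (pderiv (iterate_poly f 2)) z)" for x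
    unfolding multiplier_poly_2(2) using dyn_nz
    by (auto simp: poly_prod_mset prod_mset_zero_iff image_iff)
  finally have "set_mset (multipliers f 2) = {x. \<exists>z. poly (dynatomic f 2) z = 0 \<and> x = poly (pderiv (iterate_poly f 2)) z}"
    by blast
  moreover have "poly (pderiv (iterate_poly f 2)) z = poly (pderiv f) z * poly (pderiv f) (poly f z)" for z
    by (simp add: iterate_poly_2 pderiv_pcompose poly_pcompose)
  ultimately show ?thesis by auto
qed

lemma multipliers_1: "set_mset (multipliers f 1) = poly (pderiv f) ` {z. poly f z = z}"
proof -
  define \<chi> where "\<chi> = (\<Prod>z\<in>#proots fixed_poly. [:- poly (pderiv f) z, 1:])"
  have lead: "Polynomial.lead_coeff (\<Prod>z\<in>#M. [:- g z, 1:]) = 1" for M and g :: "qbar \<Rightarrow> qbar"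
    by (induction M) (simp_all add: lead_coeff_mult del: mult_pCons_left)
  have "multiplier_poly f 1 = \<chi>"
    unfolding multiplier_poly_def dynatomic_1 iterate_poly_1
    by (rule the_equality) (auto simp: \<chi>_def lead)
  moreover have "\<chi> \<noteq> 0" using lead[of "poly (pderiv f)" "proots fixed_poly"] by (auto simp: \<chi>_def)
  ultimately have "x \<in># multipliers f 1 \<longleftrightarrow> poly \<chi> x = 0" for x by (simp add: multipliers_def)
  also have "poly \<chi> x = 0 \<longleftrightarrow> (\<exists>z. poly f z = z \<and> x = poly (pderiv f) z)" for x
    unfolding \<chi>_def using fixed_poly_nz by (auto simp: poly_prod_mset prod_mset_zero_iff image_iff)
  finally show ?thesis by auto
qed

lemma dynatomic_2_root: "poly f (poly f z) = z \<Longrightarrow> poly f z \<noteq> z \<Longrightarrow> poly (dynatomic f 2) z = 0"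
  using arg_cong[OF dynatomic_2[of f], of "\<lambda>p. poly p z"] by (simp add: poly_pcompose)

end

section \<open>Embeddings of the algebraic numbers\<close>

definition field_hom :: "('a :: field \<Rightarrow> 'b :: field) \<Rightarrow> bool" where
  "field_hom \<sigma> \<longleftrightarrow> \<sigma> 1 = 1 \<and> (\<forall>x y. \<sigma> (x + y) = \<sigma> x + \<sigma> y \<and> \<sigma> (x * y) = \<sigma> x * \<sigma> y)"

lemma field_homD:
  assumes "field_hom \<sigma>"
  shows "\<sigma> 1 = 1" "\<sigma> (x + y) = \<sigma> x + \<sigma> y" "\<sigma> (x * y) = \<sigma> x * \<sigma> y" "\<sigma> 0 = 0"
    "\<sigma> (- x) = - \<sigma> x" "\<sigma> (x - y) = \<sigma> x - \<sigma> y" "\<sigma> (x ^ n) = \<sigma> x ^ n" "\<sigma> (of_nat k) = of_nat k"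
    "\<sigma> (sum f I) = (\<Sum>i\<in>I. \<sigma> (f i))" "\<sigma> (prod f I) = (\<Prod>i\<in>I. \<sigma> (f i))"
proof -
  show 1: "\<sigma> 1 = 1" and add: "\<sigma> (x + y) = \<sigma> x + \<sigma> y" and mult: "\<sigma> (x * y) = \<sigma> x * \<sigma> y" for x y
    using assms by (auto simp: field_hom_def)
  show 0: "\<sigma> 0 = 0" using add[of 0 0] by (metis add.right_neutral add_left_imp_eq)
  show minus: "\<sigma> (- x) = - \<sigma> x" for x using add[of x "- x"] 0 by (simp add: eq_neg_iff_add_eq_0 add.commute)
  show "\<sigma> (x - y) = \<sigma> x - \<sigma> y" using add[of x "- y"] minus by simp
  show "\<sigma> (x ^ n) = \<sigma> x ^ n" by (induction n) (auto simp: 1 mult)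
  show "\<sigma> (of_nat k) = of_nat k" by (induction k) (auto simp: 0 1 add)
  show "\<sigma> (sum f I) = (\<Sum>i\<in>I. \<sigma> (f i))"
    by (induction I rule: infinite_finite_induct) (auto simp: 0 add)
  show "\<sigma> (prod f I) = (\<Prod>i\<in>I. \<sigma> (f i))"
    by (induction I rule: infinite_finite_induct) (auto simp: 1 mult)
qed

lemma field_hom_eq_0_iff: "field_hom \<sigma> \<Longrightarrow> \<sigma> x = 0 \<longleftrightarrow> x = 0"
  by (metis field_homD(1,3,4) right_inverse mult_zero_left zero_neq_one)

lemma field_hom_inj:
  assumes "field_hom \<sigma>"
  shows "inj \<sigma>"
proof (rule injI)
  fix x y assume "\<sigma> x = \<sigma> y"
  hence "\<sigma> (x - y) = 0" using field_homD(6)[OF assms, of x y] by simp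
  thus "x = y" using field_hom_eq_0_iff[OF assms, of "x - y"] by simp
qed

lemma field_hom_inverse:
  assumes "field_hom \<sigma>"
  shows "\<sigma> (inverse x) = inverse (\<sigma> x)"
proof (cases "x = 0")
  case False
  hence "\<sigma> x * \<sigma> (inverse x) = 1" by (simp add: field_homD(1)[OF assms] flip: field_homD(3)[OF assms])
  from inverse_unique[OF this] show ?thesis by simp
qed (simp add: field_homD[OF assms])

lemma field_hom_of_int: "field_hom \<sigma> \<Longrightarrow> \<sigma> (of_int k) = of_int k"
  by (cases k rule: int_cases2) (simp_all add: field_homD)

lemma field_hom_of_rat:
  fixes \<sigma> :: "'a :: field_char_0 \<Rightarrow> 'b :: field_char_0"
  assumes "field_hom \<sigma>"
  shows "\<sigma> (of_rat r) = of_rat r"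
proof (cases r)
  case (Fract a b)
  hence r: "r = of_int a / of_int b" by (simp add: Fract_of_int_quotient)
  \<comment> \<open>The dummy variable keeps the fact polymorphic, so that it can be used in the
    source and in the target field.\<close>
  have "of_rat r = (of_int a * inverse (of_int b) :: 'c)" for dummy :: "'c :: field_char_0"
    unfolding r of_rat_divide by (simp add: field_class.field_divide_inverse)
  hence "(of_rat r :: 'a) = of_int a * inverse (of_int b)" "(of_rat r :: 'b) = of_int a * inverse (of_int b)"
    by blast+
  thus ?thesis
    by (simp add: field_homD(3)[OF assms] field_hom_inverse[OF assms] field_hom_of_int[OF assms])
qed

lemma field_hom_poly_of_rat:
  fixes \<sigma> :: "'a :: field_char_0 \<Rightarrow> 'b :: field_char_0"
  assumes "field_hom \<sigma>"
  shows "\<sigma> (poly (map_poly of_rat q) x) = poly (map_poly of_rat q) (\<sigma> x)"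
  by (induction q) (simp_all add: map_poly_pCons field_homD[OF assms] field_hom_of_rat[OF assms])

lemma to_ac_rat: "to_ac r = (of_rat r :: qbar)"
proof (cases r)
  case (Fract a b)
  hence "r = of_int a / of_int b" by (simp add: Fract_of_int_quotient)
  thus ?thesis by (simp add: of_rat_divide)
qed

lemma qbar_algebraic:
  fixes x :: qbar
  obtains q :: "rat poly" where "q \<noteq> 0" "poly (map_poly of_rat q) x = 0"
  using alg_closure_algebraic[of x] unfolding to_ac_rat[abs_def] by blast

text \<open>Graphs of homomorphisms from subrings of the algebraic numbers containing the rationals.\<close>

definition hom_graph :: "(qbar \<times> 'b :: field_char_0) set \<Rightarrow> bool" where
  "hom_graph G \<longleftrightarrow> (\<forall>r. (of_rat r, of_rat r) \<in> G) \<and>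
     (\<forall>a b c d. (a, b) \<in> G \<longrightarrow> (c, d) \<in> G \<longrightarrow> (a + c, b + d) \<in> G \<and> (a * c, b * d) \<in> G) \<and>
     (\<forall>b. (0, b) \<in> G \<longrightarrow> b = 0)"

text \<open>A relation instead of a coefficientwise map: the images of coefficients are only
  available as pairs in the graph.\<close>

definition lifts :: "(qbar \<times> 'b :: field_char_0) set \<Rightarrow> qbar poly \<Rightarrow> 'b poly \<Rightarrow> bool" where
  "lifts G p p' \<longleftrightarrow> (\<forall>i. (coeff p i, coeff p' i) \<in> G)"

context
  fixes G :: "(qbar \<times> 'b :: field_char_0) set"
  assumes G: "hom_graph G"
begin

lemma graph_rat: "(of_rat r, of_rat r) \<in> G"
  and graph_add: "(a, b) \<in> G \<Longrightarrow> (c, d) \<in> G \<Longrightarrow> (a + c, b + d) \<in> G"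
  and graph_mult: "(a, b) \<in> G \<Longrightarrow> (c, d) \<in> G \<Longrightarrow> (a * c, b * d) \<in> G"
  and graph_zero: "(0, b) \<in> G \<Longrightarrow> b = 0"
  using G unfolding hom_graph_def by blast+

lemma graph_0: "(0, 0) \<in> G" and graph_1: "(1, 1) \<in> G"
  using graph_rat[of 0] graph_rat[of 1] by auto

lemma graph_minus: "(a, b) \<in> G \<Longrightarrow> (- a, - b) \<in> G"
  using graph_mult[OF graph_rat[of "-1"], of a b] by (simp add: of_rat_minus)

lemma graph_diff: "(a, b) \<in> G \<Longrightarrow> (c, d) \<in> G \<Longrightarrow> (a - c, b - d) \<in> G"
  using graph_add[OF _ graph_minus[of c d], of a b] by simp

lemma graph_unique: "(a, b) \<in> G \<Longrightarrow> (a, c) \<in> G \<Longrightarrow> b = c"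
  using graph_diff[of a b a c] graph_zero[of "b - c"] by simp

lemma graph_sum: "(\<And>i. i \<in> I \<Longrightarrow> (f i, g i) \<in> G) \<Longrightarrow> (sum f I, sum g I) \<in> G"
  by (induction I rule: infinite_finite_induct) (auto intro: graph_0 graph_add)

lemma lifts_0: "lifts G 0 p' \<Longrightarrow> p' = 0"
  using graph_zero by (auto simp: lifts_def poly_eq_iff)

lemma lifts_rat: "lifts G (map_poly of_rat q) (map_poly of_rat q)"
  by (simp add: lifts_def coeff_map_poly graph_rat)

lemma lifts_add: "lifts G p p' \<Longrightarrow> lifts G q q' \<Longrightarrow> lifts G (p + q) (p' + q')"
  by (simp add: lifts_def graph_add)

lemma lifts_diff: "lifts G p p' \<Longrightarrow> lifts G q q' \<Longrightarrow> lifts G (p - q) (p' - q')"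
  by (simp add: lifts_def graph_diff)

lemma lifts_mult: "lifts G p p' \<Longrightarrow> lifts G q q' \<Longrightarrow> lifts G (p * q) (p' * q')"
  by (auto simp: lifts_def coeff_mult intro!: graph_sum graph_mult)

lemma lifts_monom: "(a, b) \<in> G \<Longrightarrow> lifts G (Polynomial.monom a n) (Polynomial.monom b n)"
  by (simp add: lifts_def graph_0)

lemma graph_poly: "lifts G p p' \<Longrightarrow> (x, y) \<in> G \<Longrightarrow> (poly p x, poly p' y) \<in> G"
proof (induction p arbitrary: p')
  case 0
  thus ?case using lifts_0[of p'] graph_0 by simp
next
  case (pCons a p)
  obtain b q where p': "p' = pCons b q" by (cases p')
  have "(coeff (pCons a p) i, coeff (pCons b q) i) \<in> G" for i
    using pCons.prems(1) p' by (simp add: lifts_def)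
  from this[of 0] this[of "Suc i" for i] have "(a, b) \<in> G" "lifts G p q" by (auto simp: lifts_def)
  thus ?case using pCons.IH[of q] pCons.prems(2) by (auto simp: p' intro: graph_add graph_mult)
qed

text \<open>The domain is only assumed to be a ring. It contains inverses because its elements are
  algebraic: a rational relation of least degree has nonzero constant term \<open>r\<close>, and
  \<open>a * s(a) = - r\<close> exhibits the inverse of \<open>a\<close> as a polynomial in
  \<open>a\<close>.\<close>

lemma graph_inverse:
  assumes "(a, b) \<in> G" "a \<noteq> 0"
  obtains c where "(inverse a, c) \<in> G" "c * b = 1"
proof -
  define P where "P q \<longleftrightarrow> q \<noteq> 0 \<and> poly (map_poly of_rat q) a = 0" for q :: "rat poly"
  obtain q0 where "P q0" using qbar_algebraic[of a] unfolding P_def by blast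
  then obtain q where q: "P q" and min: "\<And>q'. P q' \<Longrightarrow> Polynomial.degree q \<le> Polynomial.degree q'"
    using ex_has_least_nat[of P _ Polynomial.degree] by blast
  obtain r s where rs: "q = pCons r s" by (cases q)
  have r0: "r \<noteq> 0"
  proof
    assume r: "r = 0"
    hence "s \<noteq> 0" "poly (map_poly of_rat s) a = 0"
      using q assms(2) by (auto simp: P_def rs map_poly_pCons)
    thus False using min[of s] r by (simp add: P_def rs)
  qed
  define s' where "s' = Polynomial.smult (- inverse r) s"
  have "of_rat r + a * poly (map_poly of_rat s) a = 0" using q by (simp add: P_def rs map_poly_pCons)
  hence as: "a * poly (map_poly of_rat s) a = - of_rat r" by (simp add: add_eq_0_iff)
  have "map_poly of_rat s' = Polynomial.smult (of_rat (- inverse r)) (map_poly of_rat s :: qbar poly)"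
    by (rule poly_eqI) (simp add: s'_def coeff_map_poly of_rat_mult of_rat_minus)
  hence "a * poly (map_poly of_rat s') a = of_rat (- inverse r) * (a * poly (map_poly of_rat s) a)" by simp
  also have "\<dots> = 1" unfolding as using r0 by (simp add: of_rat_minus flip: of_rat_mult)
  finally have "a * poly (map_poly of_rat s') a = 1" .
  hence inv: "inverse a = poly (map_poly of_rat s') a" by (metis inverse_unique)
  hence c: "(inverse a, poly (map_poly of_rat s') b) \<in> G"
    using graph_poly[OF lifts_rat assms(1)] by metis
  from graph_mult[OF this assms(1)] have "(1, poly (map_poly of_rat s') b * b) \<in> G" using assms(2) by simp
  from graph_unique[OF this graph_1] show ?thesis using that c by blast
qed

end

text \<open>One step of the extension of embeddings. \<open>m\<close> is a liftable polynomial of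
  least degree with root \<open>x\<close>, and \<open>y\<close> is any root of its lift
  \<open>m'\<close>. The assignment \<open>p(x) \<mapsto> p'(y)\<close> is well defined since
  division by \<open>m\<close> shows that every liftable relation for \<open>x\<close> also holds
  for \<open>y\<close>.\<close>

lemma graph_adjoin:
  fixes G :: "(qbar \<times> 'b :: {alg_closed_field, field_char_0}) set"
  assumes G: "hom_graph G"
  obtains G' y where "hom_graph G'" "G \<subseteq> G'" "(x, y) \<in> G'"
proof -
  define P where "P p \<longleftrightarrow> fst p \<noteq> 0 \<and> poly (fst p) x = 0 \<and> lifts G (fst p) (snd p)" for p :: "qbar poly \<times> 'b poly"
  obtain q where "q \<noteq> 0" "poly (map_poly of_rat q) x = 0" by (rule qbar_algebraic)
  hence "P (map_poly of_rat q, map_poly of_rat q)"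
    using lifts_rat[OF G] by (simp add: P_def map_poly_eq_0_iff)
  then obtain mm where mm: "P mm" and min: "\<And>p. P p \<Longrightarrow> Polynomial.degree (fst mm) \<le> Polynomial.degree (fst p)"
    using ex_has_least_nat[of P _ "\<lambda>p. Polynomial.degree (fst p)"] by blast
  define m m' where "m = fst mm" and "m' = snd mm"
  have m: "m \<noteq> 0" "poly m x = 0" "lifts G m m'" using mm by (simp_all add: P_def m_def m'_def)
  define n where "n = Polynomial.degree m"
  have n: "n > 0"
  proof (rule ccontr)
    assume "\<not> n > 0"
    then obtain c where "m = [:c:]" unfolding n_def by (auto elim: degree_eq_zeroE)
    thus False using m by auto
  qed
  have lc: "(coeff m n, coeff m' n) \<in> G" "coeff m n \<noteq> 0" using m by (auto simp: lifts_def n_def)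
  \<comment> \<open>The image of the leading coefficient is invertible, hence nonzero; so
    \<open>m'\<close> is not constant and has a root.\<close>
  obtain i where i: "(inverse (coeff m n), i) \<in> G" "i * coeff m' n = 1"
    using graph_inverse[OF G lc] by blast
  have "n \<le> Polynomial.degree m'" using i(2) by (intro le_degree) auto
  then obtain y where y: "poly m' y = 0" using alg_closed_imp_poly_has_root[of m'] n by auto
  have key: "poly p' y = 0" if "lifts G p p'" "poly p x = 0" for p p'
    using that
  \<comment> \<open>Polynomial division by \<open>m\<close>, with the multiplier of \<open>m\<close>
    tracked on both sides. The zero polynomial gets a measure below that of constants.\<close>
  proof (induction "if p = 0 then 0 else Suc (Polynomial.degree p)" arbitrary: p p' rule: less_induct)
    case less
    show ?case
    proof (cases "p = 0")
      case True
      thus ?thesis using lifts_0[OF G, of p'] less.prems(1) by simp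
    next
      case False
      define d where "d = Polynomial.degree p"
      have dn: "n \<le> d" using min[of "(p, p')"] less.prems False by (simp add: P_def n_def m_def d_def)
      define c where "c = coeff p d * inverse (coeff m n)"
      define c' where "c' = coeff p' d * i"
      have cG: "(c, c') \<in> G"
        unfolding c_def c'_def using less.prems(1) i(1) by (intro graph_mult[OF G]) (auto simp: lifts_def)
      define p1 p1' where "p1 = p - Polynomial.monom c (d - n) * m"
        and "p1' = p' - Polynomial.monom c' (d - n) * m'"
      have l1: "lifts G p1 p1'"
        unfolding p1_def p1'_def using less.prems(1) m(3) cG
        by (intro lifts_diff[OF G] lifts_mult[OF G] lifts_monom[OF G])
      have x1: "poly p1 x = 0" using less.prems(2) m(2) by (simp add: p1_def)
      have "Polynomial.degree p1 \<le> d"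
        unfolding p1_def
      proof (rule degree_diff_le)
        show "Polynomial.degree (Polynomial.monom c (d - n) * m) \<le> d"
          using degree_mult_le[of "Polynomial.monom c (d - n)" m] degree_monom_le[of c "d - n"] dn
          unfolding n_def by linarith
      qed (simp add: d_def)
      moreover have "coeff p1 d = 0"
        using dn lc(2) by (simp add: p1_def coeff_monom_mult c_def)
      ultimately have "p1 = 0 \<or> Polynomial.degree p1 < d" by (rule eq_zero_or_degree_less)
      hence "poly p1' y = 0"
        using less.hyps[of p1 p1'] l1 x1 False by (auto simp: d_def)
      thus ?thesis using y by (simp add: p1'_def)
    qed
  qed
  define G' where "G' = {(poly p x, poly p' y) |p p'. lifts G p p'}"
  have sub: "G \<subseteq> G'"
  proof (rule subrelI)
    fix a b assume "(a, b) \<in> G"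
    from lifts_monom[OF G this, of 0] have "lifts G [:a:] [:b:]" by (simp add: monom_0)
    thus "(a, b) \<in> G'" unfolding G'_def by (intro CollectI exI[of _ "[:a:]"] exI[of _ "[:b:]"]) auto
  qed
  have "hom_graph G'"
    unfolding hom_graph_def
  proof (intro conjI allI impI)
    show "(of_rat r, of_rat r) \<in> G'" for r using graph_rat[OF G] sub by blast
    fix a b c d assume "(a, b) \<in> G'" "(c, d) \<in> G'"
    then obtain p p' q q' where l: "lifts G p p'" "lifts G q q'" and
      eq: "a = poly p x" "b = poly p' y" "c = poly q x" "d = poly q' y" unfolding G'_def by auto
    show "(a + c, b + d) \<in> G'" "(a * c, b * d) \<in> G'"
      unfolding G'_def eq poly_add[symmetric] poly_mult[symmetric]
      using lifts_add[OF G l] lifts_mult[OF G l] by blast+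
  next
    fix b assume "(0, b) \<in> G'"
    then obtain p p' where "lifts G p p'" "0 = poly p x" "b = poly p' y" unfolding G'_def by auto
    thus "b = 0" using key by metis
  qed
  moreover have "(x, y) \<in> G'"
  proof -
    have "lifts G (Polynomial.monom 1 1) (Polynomial.monom 1 1)" by (rule lifts_monom[OF G graph_1[OF G]])
    hence "(poly (Polynomial.monom 1 1) x, poly (Polynomial.monom 1 1) y) \<in> G'" unfolding G'_def by blast
    thus ?thesis by (simp add: poly_monom)
  qed
  ultimately show ?thesis using that sub by blast
qed

text \<open>Zorn's lemma; a maximal graph is total because any missing element could be
  adjoined.\<close>

lemma hom_graph_extends:
  fixes G :: "(qbar \<times> 'b :: {alg_closed_field, field_char_0}) set"
  assumes G: "hom_graph G"
  shows "\<exists>\<sigma>. field_hom \<sigma> \<and> (\<forall>(a, b)\<in>G. \<sigma> a = b)"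
proof -
  define \<A> where "\<A> = {H. hom_graph H \<and> G \<subseteq> H}"
  have ne: "\<A> \<noteq> {}" using G by (auto simp: \<A>_def)
  have "\<exists>M\<in>\<A>. \<forall>B\<in>\<A>. M \<subseteq> B \<longrightarrow> B = M"
  proof (rule subset_Zorn_nonempty[OF ne])
    fix \<C> assume C: "\<C> \<noteq> {}" "subset.chain \<A> \<C>"
    have mem: "hom_graph H" "G \<subseteq> H" if "H \<in> \<C>" for H
      using C(2) that by (auto simp: subset_chain_def \<A>_def)
    have "hom_graph (\<Union>\<C>)"
      unfolding hom_graph_def
    proof (intro conjI allI impI)
      show "(of_rat r, of_rat r) \<in> \<Union>\<C>" for r using C(1) mem(1) graph_rat by blast
      fix a b c d assume "(a, b) \<in> \<Union>\<C>" "(c, d) \<in> \<Union>\<C>"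
      then obtain B1 B2 where "B1 \<in> \<C>" "(a, b) \<in> B1" "B2 \<in> \<C>" "(c, d) \<in> B2" by blast
      moreover from this have "B1 \<subseteq> B2 \<or> B2 \<subseteq> B1" using C(2) by (simp add: subset_chain_def)
      ultimately obtain B where B: "B \<in> \<C>" "(a, b) \<in> B" "(c, d) \<in> B" by blast
      show "(a + c, b + d) \<in> \<Union>\<C>" "(a * c, b * d) \<in> \<Union>\<C>"
        using graph_add[OF mem(1)[OF B(1)] B(2,3)] graph_mult[OF mem(1)[OF B(1)] B(2,3)] B(1) by blast+
    next
      fix b assume "(0, b) \<in> \<Union>\<C>"
      then obtain H where "H \<in> \<C>" "(0, b) \<in> H" by blast
      thus "b = 0" using graph_zero[OF mem(1)] by blast
    qed
    thus "\<Union>\<C> \<in> \<A>" using C(1) mem(2) by (auto simp: \<A>_def)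
  qed
  then obtain M where M: "hom_graph M" "G \<subseteq> M" and max: "\<And>B. hom_graph B \<Longrightarrow> M \<subseteq> B \<Longrightarrow> B = M"
    by (auto simp: \<A>_def)
  have total: "\<exists>y. (x, y) \<in> M" for x
  proof -
    obtain G' y where "hom_graph G'" "M \<subseteq> G'" "(x, y) \<in> G'" by (rule graph_adjoin[OF M(1), of x])
    thus ?thesis using max[of G'] by auto
  qed
  define \<sigma> where "\<sigma> x = (SOME y. (x, y) \<in> M)" for x
  have \<sigma>: "(x, \<sigma> x) \<in> M" for x unfolding \<sigma>_def using total by (rule someI_ex)
  have eq: "\<sigma> a = b" if "(a, b) \<in> M" for a b using graph_unique[OF M(1) \<sigma> that] .
  have "field_hom \<sigma>"
    unfolding field_hom_def
    by (intro conjI allI eq graph_1[OF M(1)] graph_add[OF M(1)] graph_mult[OF M(1)] \<sigma>)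
  moreover have "\<forall>(a, b)\<in>G. \<sigma> a = b" using eq M(2) by auto
  ultimately show ?thesis by blast
qed

lemma embedding_exists: "\<exists>\<sigma> :: qbar \<Rightarrow> 'b :: {alg_closed_field, field_char_0}. field_hom \<sigma>"
proof -
  have "hom_graph (range (\<lambda>r. (of_rat r, of_rat r)) :: (qbar \<times> 'b) set)"
    unfolding hom_graph_def by (auto simp flip: of_rat_add of_rat_mult)
  from hom_graph_extends[OF this] show ?thesis by blast
qed

section \<open>Conjugates\<close>

text \<open>The Galois orbit, given through endomorphisms of \<open>qbar\<close>; all of them are
  automorphisms by \<open>field_hom_bij\<close>.\<close>

definition conjugates :: "qbar \<Rightarrow> qbar set" where
  "conjugates t = (\<lambda>\<sigma>. \<sigma> t) ` {\<sigma>. field_hom \<sigma>}"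

lemma field_hom_id: "field_hom (\<lambda>x. x)"
  by (simp add: field_hom_def)

lemma field_hom_comp: "field_hom \<sigma> \<Longrightarrow> field_hom \<tau> \<Longrightarrow> field_hom (\<lambda>x. \<sigma> (\<tau> x))"
  by (simp add: field_hom_def)

lemma conjugates_self: "t \<in> conjugates t"
  using field_hom_id by (force simp: conjugates_def)

lemma finite_conjugates: "finite (conjugates t)"
proof -
  obtain q where q: "q \<noteq> 0" "poly (map_poly of_rat q) t = 0" by (rule qbar_algebraic)
  have "conjugates t \<subseteq> {x. poly (map_poly of_rat q) x = 0}"
    using q(2) field_hom_poly_of_rat[of _ q t] field_homD(4) by (fastforce simp: conjugates_def)
  moreover have "finite {x :: qbar. poly (map_poly of_rat q) x = 0}"
    using q(1) by (intro poly_roots_finite) (simp add: map_poly_eq_0_iff)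
  ultimately show ?thesis by (rule finite_subset)
qed

text \<open>Every number is a root of a rational polynomial, whose finite set of roots is mapped
  injectively into itself and hence onto itself.\<close>

lemma field_hom_bij:
  fixes \<sigma> :: "qbar \<Rightarrow> qbar"
  assumes "field_hom \<sigma>"
  shows "bij \<sigma>"
proof (rule bijI)
  show inj: "inj \<sigma>" by (rule field_hom_inj[OF assms])
  show "surj \<sigma>"
    unfolding surj_def
  proof
    fix y :: qbar
    obtain q where q: "q \<noteq> 0" "poly (map_poly of_rat q) y = 0" by (rule qbar_algebraic)
    define S where "S = {x :: qbar. poly (map_poly of_rat q) x = 0}"
    have "finite S" unfolding S_def using q(1) by (intro poly_roots_finite) (simp add: map_poly_eq_0_iff)
    moreover have "\<sigma> ` S \<subseteq> S"
      using field_hom_poly_of_rat[OF assms, of q, symmetric] field_homD(4)[OF assms] by (auto simp: S_def)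
    ultimately have "\<sigma> ` S = S" using inj by (intro endo_inj_surj) (auto intro: inj_on_subset)
    thus "\<exists>x. y = \<sigma> x" using q(2) by (auto simp: S_def image_def)
  qed
qed

lemma field_hom_image_conjugates:
  assumes "field_hom \<sigma>"
  shows "\<sigma> ` conjugates t = conjugates t"
proof (rule endo_inj_surj[OF finite_conjugates])
  show "\<sigma> ` conjugates t \<subseteq> conjugates t"
  proof safe
    fix c assume "c \<in> conjugates t"
    then obtain \<tau> where \<tau>: "field_hom \<tau>" "c = \<tau> t" by (auto simp: conjugates_def)
    show "\<sigma> c \<in> conjugates t"
      unfolding conjugates_def \<tau>(2)
      by (rule image_eqI[of _ _ "\<lambda>x. \<sigma> (\<tau> x)"]) (use field_hom_comp[OF assms \<tau>(1)] in auto)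
  qed
  show "inj_on \<sigma> (conjugates t)" using field_hom_inj[OF assms] by (rule inj_on_subset) auto
qed

lemma field_hom_inv:
  fixes \<sigma> :: "qbar \<Rightarrow> qbar"
  assumes "field_hom \<sigma>"
  shows "field_hom (inv_into UNIV \<sigma>)"
proof -
  have b: "bij \<sigma>" by (rule field_hom_bij[OF assms])
  have s: "\<sigma> (inv_into UNIV \<sigma> x) = x" for x using b by (simp add: bij_is_surj surj_f_inv_f)
  have i: "inv_into UNIV \<sigma> x = y" if "\<sigma> y = x" for x y using b that by (auto simp: bij_is_inj)
  show ?thesis unfolding field_hom_def
    by (intro conjI allI i) (simp_all add: field_homD[OF assms] s)
qed

lemma map_of_rat_poly:
  fixes p q :: "rat poly"
  shows "map_poly of_rat (p + q) = (map_poly of_rat p + map_poly of_rat q :: 'a :: field_char_0 poly)"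
    and "map_poly of_rat (p * q) = (map_poly of_rat p * map_poly of_rat q :: 'a :: field_char_0 poly)"
  by (rule poly_eqI; simp add: coeff_map_poly coeff_mult of_rat_add of_rat_sum of_rat_mult)+

text \<open>
  A non-rational number is moved by some automorphism: its minimal polynomial has a second root,
  since otherwise the derivative would be a smaller polynomial vanishing there.
\<close>

lemma fixed_rational:
  assumes fix_x: "\<And>\<sigma>. field_hom \<sigma> \<Longrightarrow> \<sigma> x = (x :: qbar)"
  shows "x \<in> range of_rat"
proof -
  define P where "P q \<longleftrightarrow> q \<noteq> 0 \<and> poly (map_poly of_rat q) x = 0" for q :: "rat poly"
  obtain q0 where "P q0" using qbar_algebraic[of x] unfolding P_def by blast
  then obtain q where q: "P q" and min: "\<And>q'. P q' \<Longrightarrow> Polynomial.degree q \<le> Polynomial.degree q'"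
    using ex_has_least_nat[of P _ Polynomial.degree] by blast
  define n where "n = Polynomial.degree q"
  have n0: "n > 0"
  proof (rule ccontr)
    assume "\<not> n > 0"
    then obtain c where "q = [:c:]" unfolding n_def by (auto elim: degree_eq_zeroE)
    thus False using q by (auto simp: P_def map_poly_pCons)
  qed
  define m where "m = (map_poly of_rat q :: qbar poly)"
  have dm: "Polynomial.degree m = n" unfolding m_def n_def by (rule degree_map_poly) simp
  have dvd: "q dvd p" if "poly (map_poly of_rat p) x = 0" for p
  proof -
    have "poly (map_poly of_rat (p mod q)) x = 0"
    proof -
      have "poly (map_poly of_rat (p div q * q + p mod q)) x = 0" using that by simp
      from this[unfolded map_of_rat_poly poly_add poly_mult] q show ?thesis by (simp add: P_def)
    qed
    moreover have "p mod q = 0 \<or> Polynomial.degree (p mod q) < Polynomial.degree q"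
      using q by (intro degree_mod_less) (simp add: P_def)
    moreover have "Polynomial.degree q \<le> Polynomial.degree (p mod q)" if "p mod q \<noteq> 0"
      by (rule min) (use that \<open>poly (map_poly of_rat (p mod q)) x = 0\<close> in \<open>simp add: P_def\<close>)
    ultimately have "p mod q = 0" by linarith
    thus ?thesis by (simp add: mod_eq_0_iff_dvd)
  qed
  \<comment> \<open>A second root \<open>y\<close> would give a homomorphism
    \<open>p(x) \<mapsto> p(y)\<close>, well defined because \<open>q\<close> divides every rational
    polynomial vanishing at \<open>x\<close>. Extended to \<open>qbar\<close> it would move
    \<open>x\<close>.\<close>
  have unique: "y = x" if y: "poly m y = 0" for y
  proof -
    define G :: "(qbar \<times> qbar) set" where
      "G = {(poly (map_poly of_rat p) x, poly (map_poly of_rat p) y) |p :: rat poly. True}"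
    have G: "(poly (map_poly of_rat p) x, poly (map_poly of_rat p) y) \<in> G" for p by (auto simp: G_def)
    have "hom_graph G"
      unfolding hom_graph_def
    proof (intro conjI allI impI)
      show "(of_rat r, of_rat r) \<in> G" for r using G[of "[:r:]"] by (simp add: map_poly_pCons)
      fix a b c d assume "(a, b) \<in> G" "(c, d) \<in> G"
      then obtain p p' where "a = poly (map_poly of_rat p) x" "b = poly (map_poly of_rat p) y"
        "c = poly (map_poly of_rat p') x" "d = poly (map_poly of_rat p') y" by (auto simp: G_def)
      thus "(a + c, b + d) \<in> G" "(a * c, b * d) \<in> G"
        using G[of "p + p'"] G[of "p * p'"] by (simp_all add: map_of_rat_poly)
    next
      fix b assume "(0, b) \<in> G"
      then obtain p where p: "0 = poly (map_poly of_rat p) x" "b = poly (map_poly of_rat p) y" by (auto simp: G_def)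
      then obtain k where "p = q * k" using dvd[of p] by (metis dvdE)
      thus "b = 0" using p(2) y by (simp add: map_of_rat_poly m_def)
    qed
    from hom_graph_extends[OF this] obtain \<sigma> where \<sigma>: "field_hom \<sigma>" "\<forall>(a, b)\<in>G. \<sigma> a = b" by blast
    have "(x, y) \<in> G" using G[of "[:0, 1:]"] by (simp add: map_poly_pCons)
    hence "\<sigma> x = y" using bspec[OF \<sigma>(2), of "(x, y)"] by simp
    thus ?thesis using fix_x[OF \<sigma>(1)] by simp
  qed
  have mx: "poly m x = 0" using q by (simp add: m_def P_def)
  hence "[:- x, 1:] dvd m" by (simp only: poly_eq_0_iff_dvd)
  then obtain m2 where m2: "m = [:- x, 1:] * m2" by (elim dvdE)
  have m0: "m \<noteq> 0" using dm n0 by auto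
  hence "n = Suc (Polynomial.degree m2)"
    unfolding dm[symmetric] m2 by (subst degree_mult_eq) auto
  have "n = 1"
  proof (rule ccontr)
    assume "n \<noteq> 1"
    hence "Polynomial.degree m2 > 0" using \<open>n = Suc _\<close> by simp
    then obtain y where y: "poly m2 y = 0" using alg_closed_imp_poly_has_root by blast
    hence "poly m y = 0" by (simp add: m2)
    hence "poly m2 x = 0" using unique y by metis
    hence "poly (pderiv m) x = 0" unfolding m2 pderiv_mult by (simp add: pderiv_pCons)
    moreover have "map_poly of_rat (pderiv q) = pderiv m"
      by (rule poly_eqI) (simp add: m_def coeff_map_poly coeff_pderiv of_rat_mult of_rat_add)
    ultimately have "P (pderiv q)"
      using n0 by (simp add: P_def pderiv_eq_0_iff n_def)
    from min[OF this] show False using n0 by (simp add: degree_pderiv n_def)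
  qed
  obtain a s where qs: "q = pCons a s" by (cases q)
  with \<open>n = 1\<close> have "s \<noteq> 0" "Polynomial.degree s = 0" by (auto simp: n_def split: if_splits)
  then obtain b where "q = [:a, b:]" "b \<noteq> 0" using qs by (metis degree_eq_zeroE pCons_eq_0_iff)
  hence "of_rat a + x * of_rat b = 0" using q by (simp add: P_def map_poly_pCons)
  hence "x = of_rat (- a / b)"
    using \<open>b \<noteq> 0\<close> by (simp add: of_rat_divide of_rat_minus field_simps eq_neg_iff_add_eq_0)
  thus ?thesis by blast
qed

text \<open>Automorphisms permute the conjugates and therefore fix the coefficients, which are
  rational by \<open>fixed_rational\<close>.\<close>

lemma conjugates_polynomial:
  obtains q :: "rat poly" where
    "map_poly of_rat q = (\<Prod>c\<in>conjugates t. [:- c, 1:])"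
proof -
  define P where "P = (\<Prod>c\<in>conjugates t. [:- c, 1:])"
  have "coeff P i \<in> range of_rat" for i
  proof (rule fixed_rational)
    fix \<sigma> :: "qbar \<Rightarrow> qbar" assume \<sigma>: "field_hom \<sigma>"
    have map_mult: "map_poly \<sigma> (a * b) = map_poly \<sigma> a * map_poly \<sigma> b" for a b
      by (rule poly_eqI) (simp add: coeff_map_poly coeff_mult field_homD[OF \<sigma>])
    have "map_poly \<sigma> (\<Prod>c\<in>C. [:- c, 1:]) = (\<Prod>c\<in>C. [:- \<sigma> c, 1:])" for C :: "qbar set"
      by (induction C rule: infinite_finite_induct)
         (simp_all add: map_mult map_poly_pCons field_homD[OF \<sigma>] del: mult_pCons_left)
    hence "map_poly \<sigma> P = (\<Prod>c\<in>conjugates t. [:- \<sigma> c, 1:])" by (simp add: P_def)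
    also have "\<dots> = (\<Prod>c\<in>\<sigma> ` conjugates t. [:- c, 1:])"
      using field_hom_inj[OF \<sigma>] by (subst prod.reindex) (auto intro: inj_on_subset)
    also have "\<dots> = P" by (simp add: P_def field_hom_image_conjugates[OF \<sigma>])
    finally have "map_poly \<sigma> P = P" .
    from arg_cong[OF this, of "\<lambda>p. coeff p i"] show "\<sigma> (coeff P i) = coeff P i"
      by (simp add: coeff_map_poly field_homD[OF \<sigma>])
  qed
  hence "\<forall>i. \<exists>r. coeff P i = of_rat r" by blast
  then obtain r where r: "\<And>i. coeff P i = of_rat (r i)" by metis
  define q where "q = (\<Sum>i\<le>Polynomial.degree P. Polynomial.monom (r i) i)"
  have "coeff (map_poly of_rat q) i = coeff P i" for i
  proof -
    have "coeff q i = (if i \<le> Polynomial.degree P then r i else 0)"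
      by (simp add: q_def coeff_sum if_distrib sum.delta cong: if_cong)
    thus ?thesis using r[of i] coeff_eq_0[of P i] by (auto simp: coeff_map_poly)
  qed
  hence "map_poly of_rat q = P" by (rule poly_eqI)
  thus ?thesis using that by (simp add: P_def)
qed

lemma poly_conjugates_polynomial:
  fixes \<iota> :: "qbar \<Rightarrow> 'b :: field_char_0"
  assumes \<iota>: "field_hom \<iota>" and q: "map_poly of_rat q = (\<Prod>c\<in>conjugates t. [:- c, 1:])"
  shows "poly (map_poly of_rat q) y = (\<Prod>c\<in>conjugates t. y - \<iota> c)"
proof -
  have "map_poly \<iota> (map_poly of_rat q) = map_poly of_rat q"
    by (rule poly_eqI) (simp add: coeff_map_poly field_homD[OF \<iota>] field_hom_of_rat[OF \<iota>])
  moreover have map_mult: "map_poly \<iota> (a * b) = map_poly \<iota> a * map_poly \<iota> b" for a b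
    by (rule poly_eqI) (simp add: coeff_map_poly coeff_mult field_homD[OF \<iota>])
  have "map_poly \<iota> (\<Prod>c\<in>C. [:- c, 1:]) = (\<Prod>c\<in>C. [:- \<iota> c, 1:])" for C :: "qbar set"
    by (induction C rule: infinite_finite_induct)
       (simp_all add: map_mult map_poly_pCons field_homD[OF \<iota>] del: mult_pCons_left)
  ultimately have "map_poly of_rat q = (\<Prod>c\<in>conjugates t. [:- \<iota> c, 1:])" by (simp add: q)
  thus ?thesis by (simp add: poly_prod)
qed

lemma root_in_conjugates:
  fixes \<iota> :: "qbar \<Rightarrow> 'b :: field_char_0"
  assumes "field_hom \<iota>" "map_poly of_rat q = (\<Prod>c\<in>conjugates t. [:- c, 1:])"
    and "poly (map_poly of_rat q) y = 0"
  shows "y \<in> \<iota> ` conjugates t"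
  using poly_conjugates_polynomial[OF assms(1,2), of y] assms(3) finite_conjugates by auto

section \<open>Degrees and embeddings of simple number fields\<close>

lemma qbar_ring_simps [simp]:
  "carrier qbar_ring = UNIV" "\<one>\<^bsub>qbar_ring\<^esub> = 1" "\<zero>\<^bsub>qbar_ring\<^esub> = 0"
  "x \<oplus>\<^bsub>qbar_ring\<^esub> y = x + y" "x \<otimes>\<^bsub>qbar_ring\<^esub> y = x * y"
  by (simp_all add: ring_of_type_algebra_def)

lemma qbar_ring_field: "Ring.field qbar_ring"
  by (rule field_from_type_algebra)

lemma qbar_ring_inverse [simp]:
  "\<ominus>\<^bsub>qbar_ring\<^esub> x = - x" "x \<noteq> 0 \<Longrightarrow> inv\<^bsub>qbar_ring\<^esub> x = inverse x" "x [^]\<^bsub>qbar_ring\<^esub> (n :: nat) = x ^ n"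
proof -
  interpret QB: Ring.field qbar_ring by (rule qbar_ring_field)
  have "- x \<oplus>\<^bsub>qbar_ring\<^esub> x = \<zero>\<^bsub>qbar_ring\<^esub>" by simp
  from QB.minus_equality[OF this] show "\<ominus>\<^bsub>qbar_ring\<^esub> x = - x" by simp
  show "inv\<^bsub>qbar_ring\<^esub> x = inverse x" if "x \<noteq> 0"
    using QB.inv_char[of x "inverse x"] that by simp
  show "x [^]\<^bsub>qbar_ring\<^esub> n = x ^ n" by (induction n) simp_all
qed

lemma eval_qbar_ring: "ring.eval qbar_ring p x = poly (Poly (rev p)) x"
proof (induction p)
  case Nil
  interpret QB: Ring.field qbar_ring by (rule qbar_ring_field)
  show ?case by simp
next
  case (Cons a p)
  interpret QB: Ring.field qbar_ring by (rule qbar_ring_field)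
  show ?case using Cons by (simp add: Poly_append poly_monom monom_altdef mult.commute)
qed

lemma rationals_subfield: "subfield (range to_ac) qbar_ring"
proof -
  interpret QB: Ring.field qbar_ring by (rule qbar_ring_field)
  show ?thesis
  proof (rule QB.subfieldI')
  show "subring (range to_ac) qbar_ring"
  proof (rule QB.subringI)
    show "\<one>\<^bsub>qbar_ring\<^esub> \<in> range to_ac" using to_ac_1 by (metis qbar_ring_simps(2) rangeI)
  qed (auto simp flip: to_ac_minus to_ac_add to_ac_mult)
  fix k assume "k \<in> range to_ac - {\<zero>\<^bsub>qbar_ring\<^esub>}"
  thus "inv\<^bsub>qbar_ring\<^esub> k \<in> range to_ac" by (auto simp flip: to_ac_inverse)
  qed
qed

abbreviation number_field :: "qbar \<Rightarrow> qbar set" where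
  "number_field t \<equiv> generate_field qbar_ring {t}"

lemma poly_ring_rationals:
  "p \<in> carrier ((range to_ac)[X]\<^bsub>qbar_ring\<^esub>) \<longleftrightarrow> set p \<subseteq> range of_rat \<and> (p \<noteq> [] \<longrightarrow> hd p \<noteq> 0)"
  unfolding univ_poly_carrier[symmetric] polynomial_def using to_ac_rat by auto

lemma rev_coeffs_rational:
  assumes "P \<noteq> 0" "\<And>i. coeff P i \<in> range of_rat"
  shows "rev (coeffs P) \<in> carrier ((range to_ac)[X]\<^bsub>qbar_ring\<^esub>)"
proof -
  have "set (coeffs P) \<subseteq> range of_rat" using assms by (auto simp: coeffs_def)
  moreover have "hd (rev (coeffs P)) \<noteq> 0"
    using last_coeffs_eq_coeff_degree[OF assms(1)] assms(1) by (simp add: hd_rev)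
  ultimately show ?thesis unfolding poly_ring_rationals by simp
qed

lemma qbar_algebraic_over: "(ring.algebraic qbar_ring over (range to_ac)) t"
proof -
  interpret QB: Ring.field qbar_ring by (rule qbar_ring_field)
  obtain q where q: "q \<noteq> 0" "poly (map_poly of_rat q) t = 0" by (rule qbar_algebraic)
  define p where "p = rev (coeffs (map_poly of_rat q :: qbar poly))"
  have nz: "map_poly of_rat q \<noteq> (0 :: qbar poly)" using q(1) by (simp add: map_poly_eq_0_iff)
  have "p \<in> carrier ((range to_ac)[X]\<^bsub>qbar_ring\<^esub>)"
    unfolding p_def by (rule rev_coeffs_rational[OF nz]) (simp add: coeff_map_poly)
  moreover have "p \<noteq> []" using nz by (simp add: p_def)
  moreover have "QB.eval p t = \<zero>\<^bsub>qbar_ring\<^esub>" using q(2) by (simp add: eval_qbar_ring p_def)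
  ultimately show ?thesis by (rule QB.algebraicI)
qed

text \<open>Heights use the generated field, whereas the dimension formula is available for simple
  extensions; the two agree because \<open>t\<close> is algebraic.\<close>

lemma simple_extension_number_field: "ring.simple_extension qbar_ring (range to_ac) t = number_field t"
proof
  interpret QB: Ring.field qbar_ring by (rule qbar_ring_field)
  have K: "subring (range to_ac) qbar_ring" using rationals_subfield by (rule subfieldE(1))
  have rat: "range to_ac \<subseteq> number_field t"
  proof safe
    fix r :: rat
    have sf: "subfield (number_field t) qbar_ring" by (rule QB.generate_field_is_subfield) simp
    note sr = subringE[OF subfieldE(1)[OF sf]]
    have nat: "of_nat n \<in> number_field t" for n
      by (induction n) (use sr(2,3,7) in \<open>auto\<close>)
    have int: "of_int k \<in> number_field t" for k
      by (cases k rule: int_cases2) (use nat sr(5) in \<open>auto\<close>)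
    have inv: "inverse x \<in> number_field t" if "x \<in> number_field t" for x
      using generate_field.m_inv[OF that] sr(2) by (cases "x = 0") auto
    obtain a b where "r = Rat.Fract a b" by (cases r)
    hence "r = of_int a / of_int b" by (simp add: Fract_of_int_quotient)
    hence "to_ac r = of_int a * inverse (of_int b)" by (simp add: field_class.field_divide_inverse)
    thus "to_ac r \<in> number_field t" using sr(6)[OF int[of a] inv[OF int[of b]]] by simp
  qed
  show "QB.simple_extension (range to_ac) t \<subseteq> number_field t"
  proof (rule QB.simple_extension_subring_incl)
    show "subring (number_field t) qbar_ring"
      by (rule subfieldE(1)[OF QB.generate_field_is_subfield]) simp
    show "t \<in> number_field t" by (rule generate_field.incl) simp
  qed (rule rat)
  show "number_field t \<subseteq> QB.simple_extension (range to_ac) t"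
  proof (rule QB.generate_field_min_subfield1)
    show "subfield (QB.simple_extension (range to_ac) t) qbar_ring"
      using QB.simple_extension_is_subfield[OF rationals_subfield] qbar_algebraic_over by simp
    show "{t} \<subseteq> QB.simple_extension (range to_ac) t"
      using QB.simple_extension_mem[OF K] by simp
  qed simp
qed

text \<open>The degree is that of the irreducible polynomial \<open>I\<close> of \<open>t\<close>.
  All conjugates are roots of \<open>I\<close>, which bounds their number by the degree; conversely
  \<open>I\<close> divides the rational product over the conjugates.\<close>

lemma number_field_degree: "number_field_degree (number_field t) = card (conjugates t)"
proof -
  interpret QB: Ring.field qbar_ring by (rule qbar_ring_field)
  define K where "K = (range to_ac :: qbar set)"
  note alg = rationals_subfield[folded K_def] UNIV_I[of t, folded qbar_ring_simps(1)] qbar_algebraic_over[of t, folded K_def]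
  define I where "I = QB.Irr K t"
  have I: "I \<in> carrier (K[X]\<^bsub>qbar_ring\<^esub>)" "pirreducible\<^bsub>qbar_ring\<^esub> K I" "QB.eval I t = 0"
    "Polynomials.lead_coeff I = 1"
    using QB.IrrE[OF alg] by (simp_all add: I_def)
  have Ine: "I \<noteq> []" using I(2) by (auto simp: ring_irreducible_def univ_poly_zero)
  define P where "P = Poly (rev I)"
  have coI: "coeffs P = rev I"
  proof -
    obtain a J where "I = a # J" using Ine by (cases I) auto
    thus ?thesis using I(4) by (simp add: P_def)
  qed
  have dP: "Polynomial.degree P = Polynomials.degree I" by (simp add: degree_eq_length_coeffs coI)
  have P0: "P \<noteq> 0" using coI Ine by auto
  have rat: "coeff P i \<in> range of_rat" for i
  proof (cases "i < length (coeffs P)")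
    case True
    hence "coeff P i \<in> set (rev I)"
      unfolding coI[symmetric] by (metis nth_default_coeffs_eq nth_default_nth nth_mem)
    thus ?thesis using I(1) unfolding K_def poly_ring_rationals by auto
  next
    case False
    hence "coeff P i = of_rat 0" by (metis nth_default_beyond nth_default_coeffs_eq not_less of_rat_0)
    thus ?thesis by blast
  qed
  hence "\<forall>i. \<exists>r. coeff P i = of_rat r" by blast
  then obtain c where c: "\<And>i. coeff P i = of_rat (c i)" by metis
  have root: "poly P (\<sigma> t) = 0" if \<sigma>: "field_hom \<sigma>" for \<sigma>
  proof -
    have "\<sigma> (poly P t) = poly P (\<sigma> t)"
      unfolding poly_altdef by (simp add: field_homD[OF \<sigma>] c field_hom_of_rat[OF \<sigma>])
    moreover have "poly P t = 0" using I(3) by (simp add: eval_qbar_ring P_def)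
    ultimately show ?thesis using field_homD(4)[OF \<sigma>] by simp
  qed
  have "card (conjugates t) \<le> card {x. poly P x = 0}"
    using root P0 by (intro card_mono poly_roots_finite) (auto simp: conjugates_def)
  also have "\<dots> \<le> Polynomial.degree P" by (rule card_poly_roots_bound[OF P0])
  finally have le: "card (conjugates t) \<le> Polynomials.degree I" by (simp add: dP)
  obtain q where q: "map_poly of_rat q = (\<Prod>c\<in>conjugates t. [:- c, 1:])" by (rule conjugates_polynomial)
  define M where "M = (map_poly of_rat q :: qbar poly)"
  have dM: "Polynomial.degree M = card (conjugates t)"
    unfolding M_def q by (simp add: degree_prod_eq_sum_degree)
  have M0: "M \<noteq> 0" unfolding M_def q using finite_conjugates by simp
  define p where "p = rev (coeffs M)"
  have pK: "p \<in> carrier (K[X]\<^bsub>qbar_ring\<^esub>)"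
    unfolding K_def p_def by (rule rev_coeffs_rational[OF M0]) (simp add: coeff_map_poly M_def)
  have "QB.eval p t = \<zero>\<^bsub>qbar_ring\<^esub>"
    using conjugates_self[of t] finite_conjugates[of t] by (auto simp: eval_qbar_ring p_def M_def q poly_prod)
  from QB.Irr_minimal[OF alg pK this] have "I pdivides\<^bsub>qbar_ring\<^esub> p" by (simp add: I_def)
  hence "Polynomials.degree I \<le> Polynomials.degree p"
  proof (rule QB.pdivides_imp_degree_le[rotated 4])
    show "subring (carrier qbar_ring) qbar_ring" by (rule QB.carrier_is_subring)
    show "I \<in> carrier (poly_ring qbar_ring)" "p \<in> carrier (poly_ring qbar_ring)"
      using QB.carrier_polynomial_shell[OF subfieldE(1)[OF alg(1)]] I(1) pK by auto
    show "p \<noteq> []" using M0 by (simp add: p_def)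
  qed
  also have "Polynomials.degree p = card (conjugates t)"
    by (simp add: p_def flip: dM) (simp add: degree_eq_length_coeffs)
  finally have deg: "Polynomials.degree I = card (conjugates t)" using le by simp
  have dim: "QB.dimension (card (conjugates t)) K (number_field t)"
    using QB.dimension_simple_extension[OF alg]
    unfolding I_def[symmetric] deg simple_extension_number_field[of t, folded K_def] .
  have "QB.dim K (number_field t) = card (conjugates t)"
    unfolding QB.dim_def using QB.dimension_is_inj[OF alg(1)] dim by (intro the_equality) auto
  thus ?thesis by (simp add: number_field_degree_def K_def)
qed

section \<open>Extension of a discrete valuation to an algebraic field extension\<close>

definition closed_ring :: "'a :: field set \<Rightarrow> bool" where
  "closed_ring A \<longleftrightarrow> 1 \<in> A \<and> (\<forall>x\<in>A. \<forall>y\<in>A. x + y \<in> A \<and> x * y \<in> A \<and> - x \<in> A)"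

lemma closed_ringD:
  assumes "closed_ring A"
  shows "1 \<in> A" "x \<in> A \<Longrightarrow> y \<in> A \<Longrightarrow> x + y \<in> A" "x \<in> A \<Longrightarrow> y \<in> A \<Longrightarrow> x * y \<in> A"
    "x \<in> A \<Longrightarrow> - x \<in> A" "0 \<in> A" "x \<in> A \<Longrightarrow> y \<in> A \<Longrightarrow> x - y \<in> A" "x \<in> A \<Longrightarrow> x ^ n \<in> A"
proof -
  show 1: "1 \<in> A" and add: "x \<in> A \<Longrightarrow> y \<in> A \<Longrightarrow> x + y \<in> A"
    and mult: "x \<in> A \<Longrightarrow> y \<in> A \<Longrightarrow> x * y \<in> A" and neg: "x \<in> A \<Longrightarrow> - x \<in> A" for x y
    using assms by (auto simp: closed_ring_def)
  show "0 \<in> A" using add[OF 1 neg[OF 1]] by simp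
  show "x \<in> A \<Longrightarrow> y \<in> A \<Longrightarrow> x - y \<in> A" using add[of x "- y"] neg by simp
  show "x \<in> A \<Longrightarrow> x ^ n \<in> A" by (induction n) (auto intro: 1 mult)
qed

lemma closed_ring_sum:
  "closed_ring A \<Longrightarrow> (\<And>i. i \<in> I \<Longrightarrow> f i \<in> A) \<Longrightarrow> sum f I \<in> A"
  by (induction I rule: infinite_finite_induct) (auto intro: closed_ringD)

definition adjoin :: "'a :: field set \<Rightarrow> 'a \<Rightarrow> 'a set" where
  "adjoin A x = {poly q x |q. \<forall>i. coeff q i \<in> A}"

lemma closed_ring_adjoin:
  assumes A: "closed_ring A"
  shows "closed_ring (adjoin A x)" "A \<subseteq> adjoin A x" "x \<in> adjoin A x"
proof -
  note [intro] = closed_ringD[OF A]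
  show sub: "A \<subseteq> adjoin A x"
  proof
    fix a assume "a \<in> A"
    hence "\<forall>i. coeff [:a:] i \<in> A" by (auto simp: coeff_pCons split: nat.splits)
    thus "a \<in> adjoin A x" unfolding adjoin_def by (intro CollectI exI[of _ "[:a:]"]) auto
  qed
  have "\<forall>i. coeff [:0, 1:] i \<in> A" by (auto simp: coeff_pCons split: nat.splits)
  thus "x \<in> adjoin A x" unfolding adjoin_def by (intro CollectI exI[of _ "[:0, 1:]"]) auto
  have "y + z \<in> adjoin A x \<and> y * z \<in> adjoin A x \<and> - y \<in> adjoin A x"
    if y: "y \<in> adjoin A x" and z: "z \<in> adjoin A x" for y z
  proof -
    obtain q where q: "\<forall>i. coeff q i \<in> A" "y = poly q x" using y unfolding adjoin_def by blast
    obtain r where r: "\<forall>i. coeff r i \<in> A" "z = poly r x" using z unfolding adjoin_def by blast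
    have "\<forall>i. coeff (q + r) i \<in> A" "\<forall>i. coeff (- q) i \<in> A" using q r by auto
    moreover have "\<forall>i. coeff (q * r) i \<in> A"
      unfolding coeff_mult using q r by (auto intro!: closed_ring_sum[OF A])
    ultimately show ?thesis
      unfolding adjoin_def q(2) r(2) mem_Collect_eq poly_add[symmetric] poly_minus[symmetric] poly_mult[symmetric]
      by blast
  qed
  thus "closed_ring (adjoin A x)" using sub unfolding closed_ring_def by blast
qed

text \<open>
  A subring of the field that is maximal among those containing \<open>R\<close> but not \<open>1/\<pi>\<close> is a
  valuation ring.
\<close>

locale dvr_extension =
  fixes R :: "'a :: field set" and \<pi> :: 'a
  assumes R: "closed_ring R" and \<pi>: "\<pi> \<in> R" "\<pi> \<noteq> 0" "inverse \<pi> \<notin> R"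
    and dvr: "\<And>a. a \<in> R \<Longrightarrow> a \<noteq> 0 \<Longrightarrow> \<exists>k u. u \<in> R \<and> inverse u \<in> R \<and> u \<noteq> 0 \<and> a = \<pi> ^ k * u"
    and alg: "\<And>x. \<exists>a n. (\<forall>i. a i \<in> R) \<and> a n \<noteq> 0 \<and> (\<Sum>i\<le>n. a i * x ^ i) = 0"
begin

lemma maximal_ring:
  obtains A where "closed_ring A" "R \<subseteq> A" "inverse \<pi> \<notin> A"
    "\<And>A'. closed_ring A' \<Longrightarrow> A \<subseteq> A' \<Longrightarrow> inverse \<pi> \<notin> A' \<Longrightarrow> A' = A"
proof -
  define \<A> where "\<A> = {A. closed_ring A \<and> R \<subseteq> A \<and> inverse \<pi> \<notin> A}"
  have "R \<in> \<A>" using R \<pi> by (simp add: \<A>_def)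
  hence ne: "\<A> \<noteq> {}" by blast
  have "\<exists>M\<in>\<A>. \<forall>B\<in>\<A>. M \<subseteq> B \<longrightarrow> B = M"
  proof (rule subset_Zorn_nonempty[OF ne])
    fix \<C> assume C: "\<C> \<noteq> {}" "subset.chain \<A> \<C>"
    have mem: "closed_ring A" "R \<subseteq> A" "inverse \<pi> \<notin> A" if "A \<in> \<C>" for A
      using C(2) that by (auto simp: subset_chain_def \<A>_def)
    have "closed_ring (\<Union>\<C>)"
      unfolding closed_ring_def
    proof (intro conjI ballI)
      show "1 \<in> \<Union>\<C>" using C(1) mem(1) closed_ringD(1) by blast
      fix x y assume "x \<in> \<Union>\<C>" "y \<in> \<Union>\<C>"
      then obtain B1 B2 where "B1 \<in> \<C>" "x \<in> B1" "B2 \<in> \<C>" "y \<in> B2" by blast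
      moreover from this have "B1 \<subseteq> B2 \<or> B2 \<subseteq> B1" using C(2) by (simp add: subset_chain_def)
      ultimately obtain B where B: "B \<in> \<C>" "x \<in> B" "y \<in> B" by blast
      have "x + y \<in> B" "x * y \<in> B" "- x \<in> B"
        using closed_ringD[OF mem(1)[OF B(1)]] B(2,3) by auto
      thus "x + y \<in> \<Union>\<C>" "x * y \<in> \<Union>\<C>" "- x \<in> \<Union>\<C>" using B(1) by auto
    qed
    thus "\<Union>\<C> \<in> \<A>" using C(1) mem(2,3) by (auto simp: \<A>_def)
  qed
  then obtain M where "M \<in> \<A>" "\<forall>B\<in>\<A>. M \<subseteq> B \<longrightarrow> B = M" by blast
  thus ?thesis using that[of M] by (auto simp: \<A>_def)
qed

context
  fixes A :: "'a set"
  assumes A: "closed_ring A" "R \<subseteq> A" "inverse \<pi> \<notin> A"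
    and max: "\<And>A'. closed_ring A' \<Longrightarrow> A \<subseteq> A' \<Longrightarrow> inverse \<pi> \<notin> A' \<Longrightarrow> A' = A"
begin

lemma A_intros:
  "1 \<in> A" "0 \<in> A" "x \<in> A \<Longrightarrow> y \<in> A \<Longrightarrow> x + y \<in> A" "x \<in> A \<Longrightarrow> y \<in> A \<Longrightarrow> x * y \<in> A"
  "x \<in> A \<Longrightarrow> - x \<in> A" "x \<in> A \<Longrightarrow> y \<in> A \<Longrightarrow> x - y \<in> A" "x \<in> A \<Longrightarrow> x ^ n \<in> A" "\<pi> \<in> A"
  using closed_ringD[OF A(1)] A(2) \<pi>(1) by auto

lemma A_sum: "(\<And>i. i \<in> I \<Longrightarrow> f i \<in> A) \<Longrightarrow> sum f I \<in> A"
  using closed_ring_sum[OF A(1), of I f] by blast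

lemma one_not_multiple: "b \<in> A \<Longrightarrow> 1 \<noteq> \<pi> * b"
  using A(3) \<pi>(2) by (metis inverse_unique)

lemma adjoin_outside:
  assumes "x \<notin> A"
  obtains n a where "\<And>i. a i \<in> A" "inverse \<pi> = (\<Sum>i\<le>n. a i * x ^ i)"
proof -
  have "inverse \<pi> \<in> adjoin A x"
    using max[OF closed_ring_adjoin(1,2)[OF A(1), of x]] closed_ring_adjoin(3)[OF A(1), of x] assms by blast
  then obtain q where q: "\<forall>i. coeff q i \<in> A" "inverse \<pi> = poly q x" by (auto simp: adjoin_def)
  show ?thesis using that[of "coeff q" "Polynomial.degree q"] q by (simp add: poly_altdef)
qed

text \<open>\<open>\<pi>\<close> lies in the Jacobson radical. If \<open>s = 1 - \<pi> b\<close> had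
  no inverse in \<open>A\<close>, maximality would make \<open>1/\<pi>\<close> a polynomial in
  \<open>1/s\<close>; clearing denominators by \<open>s^n\<close>, which is 1 modulo
  \<open>\<pi>\<close>, would put 1 into \<open>\<pi> A\<close>.\<close>

lemma unit_one_minus:
  assumes b: "b \<in> A"
  shows "inverse (1 - \<pi> * b) \<in> A"
proof (rule ccontr)
  define s where "s = 1 - \<pi> * b"
  have s0: "s \<noteq> 0" using one_not_multiple[OF b] by (simp add: s_def)
  assume "inverse (1 - \<pi> * b) \<notin> A"
  hence "inverse s \<notin> A" by (simp add: s_def)
  then obtain n a where a: "\<And>i. a i \<in> A" "inverse \<pi> = (\<Sum>i\<le>n. a i * inverse s ^ i)"
    using adjoin_outside by blast
  have "\<exists>b'\<in>A. s ^ k = 1 - \<pi> * b'" for k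
  proof (induction k)
    case (Suc k)
    then obtain b' where b': "b' \<in> A" "s ^ k = 1 - \<pi> * b'" by blast
    have "s ^ Suc k = 1 - \<pi> * (b' + b - \<pi> * b * b')"
      by (simp add: b'(2)) (simp add: s_def algebra_simps)
    moreover have "b' + b - \<pi> * b * b' \<in> A" using b b'(1) by (auto intro!: A_intros)
    ultimately show ?case by blast
  qed (auto intro!: bexI[of _ 0] A_intros)
  then obtain b' where b': "b' \<in> A" "s ^ n = 1 - \<pi> * b'" by blast
  have sA: "s \<in> A" using b by (auto simp: s_def intro!: A_intros)
  define a' where "a' = (\<Sum>i\<le>n. a i * s ^ (n - i))"
  have a'A: "a' \<in> A" unfolding a'_def using a(1) sA by (auto intro!: A_sum A_intros)
  have "inverse \<pi> * s ^ n = a'"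
    unfolding a(2) a'_def sum_distrib_right
  proof (intro sum.cong refl)
    fix i assume "i \<in> {..n}"
    hence "s ^ n = s ^ i * s ^ (n - i)" by (simp flip: power_add)
    thus "a i * inverse s ^ i * s ^ n = a i * s ^ (n - i)"
      using s0 by (simp add: power_inverse)
  qed
  hence "s ^ n = \<pi> * a'" using \<pi>(2) by (simp add: field_simps)
  hence "1 = \<pi> * (a' + b')" using b'(2) by (simp add: algebra_simps)
  thus False using one_not_multiple a'A b'(1) by (auto intro: A_intros)
qed

text \<open>Chevalley's elimination: because \<open>1 - \<pi> * b 0\<close> is invertible in
  \<open>A\<close>, the relation in \<open>1/x\<close> writes 1 as a combination of strictly
  negative powers of \<open>x\<close>, and this replaces the top term of the relation in
  \<open>x\<close> by lower ones.\<close>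

lemma reduce_degree:
  assumes x: "x \<noteq> 0" and a: "\<And>i. a i \<in> A" "inverse \<pi> = (\<Sum>i\<le>n. a i * x ^ i)"
    and b: "\<And>i. b i \<in> A" "inverse \<pi> = (\<Sum>i\<le>m. b i * inverse x ^ i)"
    and mn: "m \<le> n"
  shows "\<exists>n'<n. \<exists>a'. (\<forall>i. a' i \<in> A) \<and> inverse \<pi> = (\<Sum>i\<le>n'. a' i * x ^ i)"
proof -
  have "n \<noteq> 0" using a A(3) by (cases n) auto
  then obtain n' where n': "n = Suc n'" by (cases n) auto
  define s where "s = 1 - \<pi> * b 0"
  have s0: "s \<noteq> 0" using one_not_multiple[OF b(1)] by (simp add: s_def)
  have sA: "inverse s \<in> A" unfolding s_def by (rule unit_one_minus[OF b(1)])
  \<comment> \<open>Coefficient of \<open>x ^ j\<close> after the term \<open>a n * x ^ n\<close> is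
    multiplied by the expansion of 1 in powers of \<open>1/x\<close>; \<open>m \<le> n\<close> keeps
    all exponents nonnegative.\<close>
  define c where "c j = (if n - j \<le> m then \<pi> * a n * b (n - j) * inverse s else 0)" for j
  have cA: "c j \<in> A" for j using a(1) b(1) sA by (auto simp: c_def intro!: A_intros)
  have "(\<Sum>i\<le>m. b i * inverse x ^ i) = b 0 + (\<Sum>i=1..m. b i * inverse x ^ i)"
    by (simp add: sum.atLeast_Suc_atMost atMost_atLeast0)
  hence S: "s * inverse \<pi> = (\<Sum>i=1..m. b i * inverse x ^ i)"
    using b(2) \<pi>(2) by (simp add: s_def field_simps)
  have 1: "1 = \<pi> * inverse s * (\<Sum>i=1..m. b i * inverse x ^ i)"
    unfolding S[symmetric] using s0 \<pi>(2) by (simp add: field_simps)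
  have "a n * x ^ n = a n * x ^ n * (\<pi> * inverse s * (\<Sum>i=1..m. b i * inverse x ^ i))"
    using 1 by simp
  also have "\<dots> = (\<Sum>i=1..m. \<pi> * a n * b i * inverse s * x ^ (n - i))"
    unfolding sum_distrib_left
  proof (intro sum.cong refl)
    fix i assume "i \<in> {1..m}"
    hence "x ^ n = x ^ (n - i) * x ^ i" using mn by (simp flip: power_add)
    thus "a n * x ^ n * (\<pi> * inverse s * (b i * inverse x ^ i)) = \<pi> * a n * b i * inverse s * x ^ (n - i)"
      using x by (simp add: power_inverse)
  qed
  also have "\<dots> = (\<Sum>j\<in>{n - m..<n}. c j * x ^ j)"
    by (rule sum.reindex_bij_witness[of _ "\<lambda>j. n - j" "\<lambda>i. n - i"]) (use mn in \<open>auto simp: c_def\<close>)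
  also have "\<dots> = (\<Sum>j<n. c j * x ^ j)"
    by (rule sum.mono_neutral_left) (auto simp: c_def)
  finally have 2: "a n * x ^ n = (\<Sum>j\<le>n'. c j * x ^ j)" by (simp add: n' lessThan_Suc_atMost)
  have "inverse \<pi> = (\<Sum>i\<le>n'. a i * x ^ i) + a n * x ^ n"
    unfolding a(2) by (simp add: n')
  also have "\<dots> = (\<Sum>i\<le>n'. (a i + c i) * x ^ i)"
    unfolding 2 by (simp add: sum.distrib ring_distribs)
  finally have "inverse \<pi> = (\<Sum>i\<le>n'. (a i + c i) * x ^ i)" .
  moreover have "\<forall>i. a i + c i \<in> A" using a(1) cA by (auto intro: A_intros)
  moreover have "n' < n" by (simp add: n')
  ultimately show ?thesis by (intro exI[of _ n'] exI[of _ "\<lambda>i. a i + c i"] conjI)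
qed

text \<open>If neither \<open>x\<close> nor \<open>1/x\<close> were in \<open>A\<close>, maximality
  would give polynomial expressions for \<open>1/\<pi>\<close> in both, and the larger of the two
  degrees could be lowered forever.\<close>

lemma valuation_ring: "x \<in> A \<or> inverse x \<in> A"
proof (rule ccontr)
  assume no: "\<not> (x \<in> A \<or> inverse x \<in> A)"
  hence x0: "x \<noteq> 0" by (auto intro: A_intros)
  have contra: False if "\<And>i. a i \<in> A" "inverse \<pi> = (\<Sum>i\<le>n. a i * x ^ i)"
    "\<And>i. b i \<in> A" "inverse \<pi> = (\<Sum>i\<le>m. b i * inverse x ^ i)" for a b n m
    using that
  proof (induction "n + m" arbitrary: n m a b rule: less_induct)
    case less
    show False
    proof (cases "m \<le> n")
      case True
      obtain n' a' where "n' < n" "\<forall>i. a' i \<in> A" "inverse \<pi> = (\<Sum>i\<le>n'. a' i * x ^ i)"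
        using reduce_degree[OF x0 less.prems True] by blast
      thus False using less.hyps[of n' m a' b] less.prems by simp
    next
      case False
      have x0': "inverse x \<noteq> 0" using x0 by simp
      have "\<exists>m'<m. \<exists>b'. (\<forall>i. b' i \<in> A) \<and> inverse \<pi> = (\<Sum>i\<le>m'. b' i * inverse x ^ i)"
        by (rule reduce_degree[OF x0' less.prems(3,4,1)]) (use less.prems(2) False in auto)
      then obtain m' b' where "m' < m" "\<forall>i. b' i \<in> A" "inverse \<pi> = (\<Sum>i\<le>m'. b' i * inverse x ^ i)"
        by blast
      thus False using less.hyps[of n m' a b'] less.prems by simp
    qed
  qed
  obtain n a where "\<And>i. a i \<in> A" "inverse \<pi> = (\<Sum>i\<le>n. a i * x ^ i)"
    using adjoin_outside[of x] no by blast
  moreover obtain m b where "\<And>i. b i \<in> A" "inverse \<pi> = (\<Sum>i\<le>m. b i * inverse x ^ i)"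
    using adjoin_outside[of "inverse x"] no by blast
  ultimately show False using contra by blast
qed

section \<open>The rank one valuation of the maximal ring\<close>

definition unit :: "'a \<Rightarrow> bool" where "unit x \<longleftrightarrow> x \<noteq> 0 \<and> x \<in> A \<and> inverse x \<in> A"

lemma unit_mult: "unit x \<Longrightarrow> unit y \<Longrightarrow> unit (x * y)"
  by (auto simp: unit_def intro: A_intros)

lemma unit_inverse: "unit x \<Longrightarrow> unit (inverse x)"
  by (auto simp: unit_def)

lemma unit_power: "unit x \<Longrightarrow> unit (x ^ n)"
  by (auto simp: unit_def power_inverse[symmetric] intro: A_intros)

text \<open>A valuation ring is local: one of the quotients \<open>x / y\<close>,
  \<open>y / x\<close> lies in \<open>A\<close>, so a sum of two nonzero elements is a multiple of
  one of them and cannot be a unit unless that one is.\<close>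

lemma nonunit_sum:
  assumes "finite I" "\<And>i. i \<in> I \<Longrightarrow> f i \<in> A \<and> \<not> unit (f i)"
  shows "sum f I \<in> A \<and> \<not> unit (sum f I)"
  using assms
proof (induction I rule: finite_induct)
  case (insert j I)
  have key: "\<not> unit (x + y)" if "x \<in> A" "\<not> unit y" "y \<in> A" "y \<noteq> 0" "x / y \<in> A" for x y
  proof
    assume u: "unit (x + y)"
    have "inverse y = (1 + x / y) * inverse (x + y)"
      using u that(4) by (simp add: unit_def field_simps)
    hence "inverse y \<in> A" using u that(5) by (auto simp: unit_def intro!: A_intros)
    thus False using that by (auto simp: unit_def)
  qed
  define x y where "x = f j" and "y = sum f I"
  have xy: "x \<in> A" "\<not> unit x" "y \<in> A" "\<not> unit y" using insert by (auto simp: x_def y_def)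
  have "\<not> unit (x + y)"
  proof (cases "x = 0 \<or> y = 0")
    case False
    have "x / y \<in> A \<or> y / x \<in> A" using valuation_ring[of "x / y"] by simp
    thus ?thesis using key[of x y] key[of y x] xy False by (auto simp: add.commute)
  qed (use xy in auto)
  thus ?case using insert.hyps xy by (auto simp: x_def y_def intro: A_intros)
qed (auto simp: unit_def intro: A_intros)

lemma dominating_term:
  assumes "finite I" "I \<noteq> {}" "\<And>i. i \<in> I \<Longrightarrow> T i \<noteq> 0"
  shows "\<exists>j\<in>I. \<forall>i\<in>I. T i / T j \<in> A"
  using assms
  proof (induction I rule: finite_ne_induct)
    case (singleton i)
    thus ?case by (auto intro: A_intros)
  next
    case (insert k I)
    then obtain j where j: "j \<in> I" "\<forall>i\<in>I. T i / T j \<in> A" by auto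
    show ?case
    proof (cases "T k / T j \<in> A")
      case True
      thus ?thesis using j by auto
    next
      case False
      hence jk: "T j / T k \<in> A" using valuation_ring[of "T k / T j"] by simp
      have "T i / T k \<in> A" if "i \<in> I" for i
      proof -
        have "T i / T k = T i / T j * (T j / T k)" using insert.prems j(1) by simp
        moreover have "T i / T j \<in> A" using j(2) that by blast
        ultimately show ?thesis using jk A_intros(4) by metis
      qed
      moreover have "T k / T k \<in> A" using insert.prems by (auto intro: A_intros)
      ultimately show ?thesis by auto
    qed
  qed

text \<open>In an algebraic relation for \<open>x\<close> divide by a term of least valuation. The
  other quotients sum to the unit -1, so one of them is a unit, that is, two terms have equal
  valuation. Their coefficients are powers of \<open>\<pi>\<close> times units, which leaves a
  relation between powers of \<open>x\<close> and of \<open>\<pi>\<close>.\<close>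

lemma power_unit:
  assumes x: "x \<noteq> 0"
  obtains b k where "0 < b" "unit (x ^ b * \<pi> powi k)"
proof -
  obtain a n where a: "\<And>i. a i \<in> R" "a n \<noteq> 0" "(\<Sum>i\<le>n. a i * x ^ i) = 0" using alg by blast
  define I where "I = {i. i \<le> n \<and> a i \<noteq> 0}"
  define T where "T i = a i * x ^ i" for i
  have I: "finite I" "I \<noteq> {}" using a by (auto simp: I_def)
  have T0: "T i \<noteq> 0" if "i \<in> I" for i using that x by (auto simp: I_def T_def)
  have "\<exists>j\<in>I. \<forall>i\<in>I. T i / T j \<in> A" by (rule dominating_term[OF I T0])
  then obtain j where j: "j \<in> I" "\<forall>i\<in>I. T i / T j \<in> A" by blast
  have "(\<Sum>i\<in>I. T i) = (\<Sum>i\<le>n. T i)"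
    by (rule sum.mono_neutral_left) (auto simp: I_def T_def)
  hence "0 = (\<Sum>i\<in>I. T i / T j)" using a(3) by (simp add: T_def flip: sum_divide_distrib)
  also have "\<dots> = 1 + (\<Sum>i\<in>I - {j}. T i / T j)" using I j T0 by (simp add: sum.remove)
  finally have "(\<Sum>i\<in>I - {j}. T i / T j) = - 1" by (simp add: eq_neg_iff_add_eq_0 add.commute)
  hence "unit (\<Sum>i\<in>I - {j}. T i / T j)" by (auto simp: unit_def intro: A_intros)
  then obtain i where i: "i \<in> I" "i \<noteq> j" "unit (T i / T j)"
    using nonunit_sum[of "I - {j}" "\<lambda>i. T i / T j"] I j by auto
  obtain k u where u: "u \<in> R" "inverse u \<in> R" "u \<noteq> 0" "a i = \<pi> ^ k * u"
    using dvr[of "a i"] a(1) i(1) by (auto simp: I_def)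
  obtain k' u' where u': "u' \<in> R" "inverse u' \<in> R" "u' \<noteq> 0" "a j = \<pi> ^ k' * u'"
    using dvr[of "a j"] a(1) j(1) by (auto simp: I_def)
  have uu: "unit u" "unit u'" using u u' A(2) by (auto simp: unit_def)
  define z where "z = x powi (int i - int j) * \<pi> powi (int k - int k')"
  have "T i / T j * (inverse u * u') = z"
    using x \<pi>(2) u(3) u'(3) by (simp add: T_def u(4) u'(4) z_def power_int_diff field_simps)
  hence z: "unit z" using i(3) uu unit_mult unit_inverse by metis
  show ?thesis
  proof (cases "j < i")
    case True
    hence "z = x ^ (i - j) * \<pi> powi (int k - int k')"
      using of_nat_diff[of j i, where 'a = int] by (simp add: z_def flip: power_int_of_nat)
    thus ?thesis using that[of "i - j"] True z by auto
  next
    case False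
    hence ij: "i < j" using i(2) by simp
    have "inverse z = x powi (int j - int i) * \<pi> powi (int k' - int k)"
      by (simp add: z_def power_int_minus[symmetric])
    also have "\<dots> = x ^ (j - i) * \<pi> powi (int k' - int k)"
      using ij of_nat_diff[of i j, where 'a = int] by (simp flip: power_int_of_nat)
    finally show ?thesis using that[of "j - i"] ij unit_inverse[OF z] by auto
  qed
qed

lemma unit_\<pi>_powi: "unit (\<pi> powi k) \<longleftrightarrow> k = 0"
proof
  have *: "k \<le> 0" if "unit (\<pi> powi k)" for k
  proof (rule ccontr)
    assume "\<not> k \<le> 0"
    then obtain m where m: "k = int (Suc m)" by (metis not_le zero_less_imp_eq_int gr0_implies_Suc)
    hence "inverse (\<pi> ^ Suc m) \<in> A" using that by (simp add: unit_def power_int_def nat_add_distrib)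
    hence "\<pi> ^ m * inverse (\<pi> ^ Suc m) \<in> A" by (intro A_intros)
    also have "\<pi> ^ m * inverse (\<pi> ^ Suc m) = inverse \<pi>" using \<pi>(2) by (simp add: field_simps)
    finally show False using A(3) by simp
  qed
  assume u: "unit (\<pi> powi k)"
  have "unit (\<pi> powi (- k))" using unit_inverse[OF u] by (simp add: power_int_minus)
  thus "k = 0" using *[OF u] *[of "- k"] by simp
qed (auto simp: unit_def intro: A_intros)

text \<open>A unit \<open>x^b \<pi>^k\<close> means that \<open>b\<close> times the valuation of
  \<open>x\<close> plus \<open>k\<close> vanishes, in the normalisation where \<open>\<pi>\<close>
  has valuation 1.\<close>

definition ord :: "'a \<Rightarrow> real" where
  "ord x = (SOME r. \<exists>b k. 0 < b \<and> unit (x ^ b * \<pi> powi k) \<and> r = - real_of_int k / real b)"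

text \<open>Two choices give the same quotient: suitable powers of the two units differ by a power
  of \<open>\<pi>\<close>, which is a unit only for exponent 0.\<close>

lemma ord_eq:
  assumes x: "x \<noteq> 0" and b: "0 < b" "unit (x ^ b * \<pi> powi k)"
  shows "ord x = - real_of_int k / real b"
proof -
  have "\<exists>b k. 0 < b \<and> unit (x ^ b * \<pi> powi k) \<and> ord x = - real_of_int k / real b"
    unfolding ord_def by (rule someI_ex) (use b in blast)
  then obtain b' k' where b': "0 < b'" "unit (x ^ b' * \<pi> powi k')" "ord x = - real_of_int k' / real b'" by blast
  have "unit ((x ^ b * \<pi> powi k) ^ b' * inverse ((x ^ b' * \<pi> powi k') ^ b))"
    by (rule unit_mult[OF unit_power[OF b(2)] unit_inverse[OF unit_power[OF b'(2)]]])
  also have "(x ^ b * \<pi> powi k) ^ b' * inverse ((x ^ b' * \<pi> powi k') ^ b) = \<pi> powi (k * int b' - k' * int b)"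
    using x \<pi>(2) by (simp add: power_mult_distrib power_int_diff power_int_mult power_int_of_nat
        mult.commute[of b'] flip: power_mult) (simp add: field_simps)
  finally have "k * int b' = k' * int b" by (simp add: unit_\<pi>_powi)
  hence "real_of_int k * real b' = real_of_int k' * real b"
    by (metis of_int_mult of_int_of_nat_eq)
  hence "real_of_int k / real b = real_of_int k' / real b'" using b(1) b'(1) by (simp add: field_simps)
  thus ?thesis using b'(3) by simp
qed

lemma ord_mult:
  assumes "x \<noteq> 0" "y \<noteq> 0"
  shows "ord (x * y) = ord x + ord y"
proof -
  obtain b k where b: "0 < b" "unit (x ^ b * \<pi> powi k)" using power_unit[OF assms(1)] by blast
  obtain b' k' where b': "0 < b'" "unit (y ^ b' * \<pi> powi k')" using power_unit[OF assms(2)] by blast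
  have "unit ((x ^ b * \<pi> powi k) ^ b' * (y ^ b' * \<pi> powi k') ^ b)"
    by (rule unit_mult[OF unit_power[OF b(2)] unit_power[OF b'(2)]])
  also have "(x ^ b * \<pi> powi k) ^ b' * (y ^ b' * \<pi> powi k') ^ b
      = (x * y) ^ (b * b') * \<pi> powi (k * int b' + k' * int b)"
  proof -
    have "(\<pi> powi k) ^ b' = \<pi> powi (k * int b')" "(\<pi> powi k') ^ b = \<pi> powi (k' * int b)"
      by (simp_all add: power_int_mult)
    moreover have "(x ^ b) ^ b' = x ^ (b * b')" "(y ^ b') ^ b = y ^ (b * b')"
      by (simp_all add: mult.commute flip: power_mult)
    moreover have "\<pi> powi (k * int b' + k' * int b) = \<pi> powi (k * int b') * \<pi> powi (k' * int b)"
      using \<pi>(2) by (simp add: power_int_add)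
    ultimately show ?thesis by (simp only: power_mult_distrib mult_ac)
  qed
  finally have "ord (x * y) = - real_of_int (k * int b' + k' * int b) / real (b * b')"
    using assms b(1) b'(1) by (intro ord_eq) auto
  also have "\<dots> = - real_of_int k / real b + - real_of_int k' / real b'"
    using b(1) b'(1) by (simp add: field_simps)
  finally show ?thesis using ord_eq[OF assms(1) b] ord_eq[OF assms(2) b'] by simp
qed

text \<open>The value only speaks about a power \<open>x ^ b\<close>. The step back to
  \<open>x\<close> is integral closedness: for \<open>x\<close> outside \<open>A\<close> the inverse
  lies in \<open>A\<close>, and \<open>x = x^b (1/x)^(b-1)\<close>.\<close>

lemma ord_nonneg_iff:
  assumes x: "x \<noteq> 0"
  shows "0 \<le> ord x \<longleftrightarrow> x \<in> A"
proof -
  obtain b k where b: "0 < b" "unit (x ^ b * \<pi> powi k)" using power_unit[OF x] by blast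
  have ord: "ord x = - real_of_int k / real b" by (rule ord_eq[OF x b])
  have pow: "\<pi> powi (int m) \<in> A" for m by (auto intro: A_intros)
  show ?thesis
  proof
    assume "0 \<le> ord x"
    hence "k \<le> 0" using b(1) by (simp add: ord field_simps)
    then obtain m where m: "k = - int m" using nonpos_int_cases by blast
    have eq: "x ^ b = (x ^ b * \<pi> powi k) * \<pi> ^ m" using \<pi>(2) by (simp add: m power_int_minus)
    have "x ^ b * \<pi> powi k \<in> A" using b(2) by (simp add: unit_def)
    hence "(x ^ b * \<pi> powi k) * \<pi> ^ m \<in> A" by (rule A_intros(4)[OF _ A_intros(7)[OF A_intros(8)]])
    hence xb: "x ^ b \<in> A" unfolding eq[symmetric] .
    show "x \<in> A"
    proof (rule ccontr)
      assume nx: "x \<notin> A"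
      hence ix: "inverse x \<in> A" using valuation_ring by blast
      have "x = x ^ b * inverse x ^ (b - 1)"
        using x b(1) by (cases b) (auto simp: power_inverse)
      thus False using nx xb ix by (metis A_intros(4,7))
    qed
  next
    assume xA: "x \<in> A"
    show "0 \<le> ord x"
    proof (rule ccontr)
      assume "\<not> 0 \<le> ord x"
      hence "0 < k" using b(1) by (simp add: ord field_simps)
      then obtain m where m: "k = int (Suc m)" by (metis zero_less_imp_eq_int gr0_implies_Suc)
      have "inverse (x ^ b * \<pi> powi k) * (x ^ b * \<pi> ^ m) \<in> A"
        using b(2) xA by (auto simp: unit_def intro: A_intros)
      also have "inverse (x ^ b * \<pi> powi k) * (x ^ b * \<pi> ^ m) = inverse \<pi>"
        using x \<pi>(2) by (simp add: m power_int_def nat_add_distrib field_simps)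
      finally show False using A(3) by simp
    qed
  qed
qed

lemma ord_add:
  assumes "x \<noteq> 0" "y \<noteq> 0" "x + y \<noteq> 0"
  shows "min (ord x) (ord y) \<le> ord (x + y)"
proof -
  have *: "ord y \<le> ord (x + y)" if "x \<noteq> 0" "y \<noteq> 0" "x + y \<noteq> 0" "x / y \<in> A" for x y
  proof -
    have "1 + x / y \<in> A" using that(4) by (auto intro: A_intros)
    moreover have eq: "x + y = y * (1 + x / y)" using that(2) by (simp add: field_simps)
    moreover have "1 + x / y \<noteq> 0" using eq that(3) by (metis mult_zero_right)
    ultimately show ?thesis using that ord_mult[of y "1 + x / y"] ord_nonneg_iff by simp
  qed
  have "x / y \<in> A \<or> y / x \<in> A" using valuation_ring[of "x / y"] by simp
  thus ?thesis using *[of x y] *[of y x] assms by (auto simp: add.commute min_def)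
qed

lemma ord_dvr:
  assumes "u \<in> R" "inverse u \<in> R" "u \<noteq> 0"
  shows "ord (\<pi> powi k * u) = k"
proof -
  have "unit ((\<pi> powi k * u) ^ 1 * \<pi> powi (- k))"
  proof -
    have "(\<pi> powi k * u) ^ 1 * \<pi> powi (- k) = u" using \<pi>(2) by (simp add: power_int_minus)
    show ?thesis unfolding \<open>_ = u\<close> unit_def using assms A(2) by auto
  qed
  from ord_eq[OF _ _ this] show ?thesis using assms \<pi>(2) by simp
qed

end

theorem extends_to_absolute_value:
  assumes c: "0 < c" "c < (1 :: real)"
  obtains v :: "'a \<Rightarrow> real" where
    "\<And>x. 0 \<le> v x" "\<And>x. v x = 0 \<longleftrightarrow> x = 0" "\<And>x y. v (x * y) = v x * v y"
    "\<And>x y. v (x + y) \<le> max (v x) (v y)"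
    "\<And>u k. u \<in> R \<Longrightarrow> inverse u \<in> R \<Longrightarrow> u \<noteq> 0 \<Longrightarrow> v (\<pi> powi k * u) = c powi k"
proof -
  obtain A where A: "closed_ring A" "R \<subseteq> A" "inverse \<pi> \<notin> A"
    "\<And>A'. closed_ring A' \<Longrightarrow> A \<subseteq> A' \<Longrightarrow> inverse \<pi> \<notin> A' \<Longrightarrow> A' = A" using maximal_ring by blast
  define v where "v x = (if x = 0 then 0 else c powr (ord A x))" for x
  show ?thesis
  proof
    show "0 \<le> v x" for x by (simp add: v_def)
    show "v x = 0 \<longleftrightarrow> x = 0" for x using c by (simp add: v_def)
    show "v (x * y) = v x * v y" for x y
      using ord_mult[OF A] by (auto simp: v_def powr_add)
    show "v (x + y) \<le> max (v x) (v y)" for x y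
    proof (cases "x = 0 \<or> y = 0 \<or> x + y = 0")
      case False
      have "ord A x \<le> ord A (x + y) \<or> ord A y \<le> ord A (x + y)"
        using ord_add[OF A, of x y] False by (auto simp: min_def split: if_splits)
      thus ?thesis using False c powr_mono'[of "ord A x" "ord A (x + y)" c] powr_mono'[of "ord A y" "ord A (x + y)" c]
        by (auto simp: v_def)
    qed (auto simp: v_def le_max_iff_disj)
    fix u k assume u: "u \<in> R" "inverse u \<in> R" "u \<noteq> 0"
    show "v (\<pi> powi k * u) = c powi k"
      using ord_dvr[OF A u] u \<pi>(2) c by (simp add: v_def powr_real_of_int')
  qed
qed

end

section \<open>The field of p-adic numbers\<close>

text \<open>The difference of multiplicities is unchanged by cross multiplication, so fractions need
  not be reduced as those of \<open>quotient_of\<close> are.\<close>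

lemma padic_abs_rat_frac:
  assumes "prime p" "a \<noteq> 0" "b \<noteq> 0"
  shows "padic_abs_rat p (of_int a / of_int b)
    = real p powi (int (multiplicity (int p) b) - int (multiplicity (int p) a))"
proof -
  define q where "q = (of_int a / of_int b :: rat)"
  obtain a' b' where ab': "quotient_of q = (a', b')" by force
  have b': "b' > 0" using quotient_of_denom_pos[OF ab'] .
  have q: "q = of_int a' / of_int b'" by (rule quotient_of_div[OF ab'])
  have q0: "q \<noteq> 0" using assms by (simp add: q_def)
  hence a': "a' \<noteq> 0" using q by auto
  have "of_int (a * b') = (of_int (a' * b) :: rat)"
    using q assms(3) b' by (simp add: q_def field_simps)
  hence eq: "a * b' = a' * b" by (simp only: of_int_eq_iff)
  have pr: "prime_elem (int p)" using assms(1) by simp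
  have "multiplicity (int p) a + multiplicity (int p) b' = multiplicity (int p) a' + multiplicity (int p) b"
    using arg_cong[OF eq, of "multiplicity (int p)"] assms a' b'
    by (simp add: prime_elem_multiplicity_mult_distrib[OF pr])
  hence "int (multiplicity (int p) b') - int (multiplicity (int p) a')
    = int (multiplicity (int p) b) - int (multiplicity (int p) a)" by linarith
  thus ?thesis using q0 by (simp add: padic_abs_rat_def ab' flip: q_def)
qed

lemma rat_frac_cases:
  obtains a b where "(x :: rat) = of_int a / of_int b" "b \<noteq> 0"
proof -
  obtain a b where "quotient_of x = (a, b)" by force
  thus ?thesis using that quotient_of_div quotient_of_denom_pos by (metis less_irrefl)
qed

context
  fixes p :: nat
  assumes p: "prime p"
begin

abbreviation nrm :: "rat \<Rightarrow> real" where "nrm \<equiv> padic_abs_rat p"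

lemma p_gt_1: "1 < real p"
  using prime_gt_1_nat[OF p] by simp

lemma nrm_0 [simp]: "nrm 0 = 0"
  by (simp add: padic_abs_rat_def)

lemma nrm_pos: "x \<noteq> 0 \<Longrightarrow> 0 < nrm x"
  using p_gt_1 by (auto simp: padic_abs_rat_def intro!: zero_less_power_int)

lemma nrm_nonneg [simp]: "0 \<le> nrm x"
  using nrm_pos[of x] by (cases "x = 0") auto

lemma nrm_eq_0_iff [simp]: "nrm x = 0 \<longleftrightarrow> x = 0"
  using nrm_pos[of x] by (cases "x = 0") auto

lemma nrm_value: "x \<noteq> 0 \<Longrightarrow> \<exists>k. nrm x = real p powi k"
  by (auto simp: padic_abs_rat_def)

lemma nrm_mult: "nrm (x * y) = nrm x * nrm y"
proof (cases "x = 0 \<or> y = 0")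
  case False
  obtain a b where x: "x = of_int a / of_int b" "b \<noteq> 0" by (rule rat_frac_cases)
  obtain c d where y: "y = of_int c / of_int d" "d \<noteq> 0" by (rule rat_frac_cases)
  have ac: "a \<noteq> 0" "c \<noteq> 0" using False x y by auto
  have pr: "prime_elem (int p)" using p by simp
  have xy: "x * y = of_int (a * c) / of_int (b * d)" by (simp add: x y)
  have "a * c \<noteq> 0" "b * d \<noteq> 0" using ac x(2) y(2) by auto
  from padic_abs_rat_frac[OF p this]
  have "nrm (x * y) = real p powi ((int (multiplicity (int p) b) - int (multiplicity (int p) a))
      + (int (multiplicity (int p) d) - int (multiplicity (int p) c)))"
    unfolding xy using ac x(2) y(2) by (simp add: prime_elem_multiplicity_mult_distrib[OF pr] algebra_simps)
  also have "\<dots> = nrm x * nrm y"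
    unfolding x(1) y(1) using padic_abs_rat_frac[OF p ac(1) x(2)] padic_abs_rat_frac[OF p ac(2) y(2)] p_gt_1
    by (simp add: power_int_add)
  finally show ?thesis .
qed auto

lemma nrm_int_le_1: "nrm (of_int a) \<le> 1"
proof (cases "a = 0")
  case False
  have "nrm (of_int a / of_int 1) = real p powi (- int (multiplicity (int p) a))"
    using padic_abs_rat_frac[OF p False, of 1] by simp
  also have "\<dots> \<le> 1" using p_gt_1 by (simp add: power_int_minus one_le_power inverse_le_1_iff)
  finally show ?thesis by simp
qed simp

lemma nrm_1 [simp]: "nrm 1 = 1"
  using padic_abs_rat_frac[OF p, of 1 1] by simp

lemma nrm_minus [simp]: "nrm (- x) = nrm x"
proof -
  have "nrm (- 1) * nrm (- 1) = 1" by (simp flip: nrm_mult)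
  hence "nrm (- 1) = 1" using nrm_nonneg[of "-1"] by (smt (verit) mult_cancel_right1 square_eq_1_iff)
  thus ?thesis using nrm_mult[of "-1" x] by simp
qed

lemma nrm_add: "nrm (x + y) \<le> max (nrm x) (nrm y)"
proof (cases "x = 0 \<or> y = 0 \<or> x + y = 0")
  case False
  obtain a b where x: "x = of_int a / of_int b" "b \<noteq> 0" by (rule rat_frac_cases)
  obtain c d where y: "y = of_int c / of_int d" "d \<noteq> 0" by (rule rat_frac_cases)
  define A C D where "A = a * d" and "C = c * b" and "D = b * d"
  have D0: "D \<noteq> 0" using x y by (simp add: D_def)
  have "x = of_int A / of_int D" using y(2) by (simp add: x(1) A_def D_def)
  moreover have "y = of_int C / of_int D" using x(2) by (simp add: y(1) C_def D_def)
  moreover have "(of_int (A + C) :: rat) / of_int D = of_int A / of_int D + of_int C / of_int D"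
    by (simp add: add_divide_distrib)
  ultimately have eqs: "x = of_int A / of_int D" "y = of_int C / of_int D" "x + y = of_int (A + C) / of_int D"
    by simp_all
  have nz: "A \<noteq> 0" "C \<noteq> 0" "A + C \<noteq> 0"
    using False eqs by auto
  define m where "m = min (multiplicity (int p) A) (multiplicity (int p) C)"
  have "int p ^ m dvd A" "int p ^ m dvd C"
    by (simp_all add: m_def multiplicity_dvd')
  hence "int p ^ m dvd A + C" by simp
  hence "m \<le> multiplicity (int p) (A + C)"
  proof (intro multiplicity_geI)
    show "\<not> is_unit (int p)" using p not_prime_unit by (metis prime_nat_int_transfer)
  qed (use nz(3) in auto)
  hence "multiplicity (int p) A \<le> multiplicity (int p) (A + C) \<or> multiplicity (int p) C \<le> multiplicity (int p) (A + C)"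
    by (auto simp: m_def min_def split: if_splits)
  moreover have "nrm x = real p powi (int (multiplicity (int p) D) - int (multiplicity (int p) A))"
    unfolding eqs(1) by (rule padic_abs_rat_frac[OF p nz(1) D0])
  moreover have "nrm y = real p powi (int (multiplicity (int p) D) - int (multiplicity (int p) C))"
    unfolding eqs(2) by (rule padic_abs_rat_frac[OF p nz(2) D0])
  moreover have "nrm (x + y) = real p powi (int (multiplicity (int p) D) - int (multiplicity (int p) (A + C)))"
    unfolding eqs(3) by (rule padic_abs_rat_frac[OF p nz(3) D0])
  ultimately show ?thesis
    using p_gt_1 by (auto simp: le_max_iff_disj intro!: power_int_increasing)
qed (auto simp: le_max_iff_disj)

lemma nrm_diff: "nrm (x - y) \<le> max (nrm x) (nrm y)"
  using nrm_add[of x "- y"] by simp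

lemma nrm_eq_of_close: "nrm (x - y) < nrm y \<Longrightarrow> nrm x = nrm y"
  using nrm_add[of "x - y" y] nrm_diff[of x "x - y"] by (auto simp: max_def split: if_splits)

lemma nrm_inverse: "nrm (inverse x) = inverse (nrm x)"
proof (cases "x = 0")
  case False
  hence "nrm x * nrm (inverse x) = 1" by (simp flip: nrm_mult)
  from inverse_unique[OF this] show ?thesis by simp
qed simp

lemma nrm_p: "nrm (of_nat p) = inverse (real p)"
  using padic_abs_rat_frac[OF p, of "int p" 1] p prime_gt_1_nat[OF p]
  by (simp add: power_int_minus)

lemma nrm_p_powi: "nrm (of_nat p powi k) = real p powi (- k)"
proof -
  have nat: "nrm (of_nat p ^ n) = inverse (real p) ^ n" for n
    by (induction n) (simp_all add: nrm_mult nrm_p)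
  show ?thesis
    by (cases k rule: int_cases2) (simp_all add: nat power_int_minus nrm_inverse power_inverse)
qed

section \<open>Cauchy sequences modulo null sequences form a field\<close>

abbreviation "cauchy \<equiv> padic_cauchy p"
abbreviation "null \<equiv> padic_null p"
abbreviation "cauchy_ring \<equiv> padic_cauchy_ring p"

lemma cauchyI: "(\<And>\<epsilon>. 0 < \<epsilon> \<Longrightarrow> \<exists>M. \<forall>m\<ge>M. \<forall>n\<ge>M. nrm (x m - x n) < \<epsilon>) \<Longrightarrow> x \<in> cauchy"
  by (simp add: padic_cauchy_def)

lemma cauchyD: "x \<in> cauchy \<Longrightarrow> 0 < \<epsilon> \<Longrightarrow> \<exists>M. \<forall>m\<ge>M. \<forall>n\<ge>M. nrm (x m - x n) < \<epsilon>"
  by (simp add: padic_cauchy_def)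

lemma null_iff: "x \<in> null \<longleftrightarrow> (\<forall>\<epsilon>>0. \<exists>M. \<forall>n\<ge>M. nrm (x n) < \<epsilon>)"
  by (simp add: padic_null_def lim_sequentially)

lemma null_cauchy: "x \<in> null \<Longrightarrow> x \<in> cauchy"
proof (rule cauchyI)
  fix \<epsilon> :: real assume x: "x \<in> null" "0 < \<epsilon>"
  then obtain M where M: "\<forall>n\<ge>M. nrm (x n) < \<epsilon>" by (auto simp: null_iff)
  have "nrm (x m - x n) < \<epsilon>" if "m \<ge> M" "n \<ge> M" for m n
    using nrm_diff[of "x m" "x n"] M that by (smt (verit) max_def)
  thus "\<exists>M. \<forall>m\<ge>M. \<forall>n\<ge>M. nrm (x m - x n) < \<epsilon>" by blast
qed

text \<open>The ultrametric inequality makes the norm of a non-null Cauchy sequence eventually constant.\<close>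

lemma cauchy_norm_const:
  assumes x: "x \<in> cauchy" "x \<notin> null"
  obtains M k where "\<And>n. n \<ge> M \<Longrightarrow> nrm (x n) = real p powi k"
proof -
  obtain \<epsilon> where \<epsilon>: "0 < \<epsilon>" "\<And>M. \<exists>n\<ge>M. \<epsilon> \<le> nrm (x n)"
    using x(2) by (force simp: null_iff not_less)
  obtain M where M: "\<forall>m\<ge>M. \<forall>n\<ge>M. nrm (x m - x n) < \<epsilon>" using cauchyD[OF x(1) \<epsilon>(1)] by blast
  obtain m where m: "m \<ge> M" "\<epsilon> \<le> nrm (x m)" using \<epsilon>(2) by blast
  have "nrm (x n) = nrm (x m)" if "n \<ge> M" for n
    using M that m by (intro nrm_eq_of_close) (auto intro: less_le_trans)
  moreover have "x m \<noteq> 0" using m(2) \<epsilon>(1) by auto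
  ultimately show ?thesis using that nrm_value by metis
qed

lemma cauchy_bounded:
  assumes "x \<in> cauchy"
  obtains B where "0 < B" "\<And>n. nrm (x n) \<le> B"
proof -
  obtain M where M: "\<forall>m\<ge>M. \<forall>n\<ge>M. nrm (x m - x n) < 1" using cauchyD[OF assms, of 1] by auto
  define B where "B = Max (insert 1 ((\<lambda>n. nrm (x n)) ` {..M}))"
  have fin: "finite (insert 1 ((\<lambda>n. nrm (x n)) ` {..M}))" by simp
  have B1: "1 \<le> B" unfolding B_def by (rule Max_ge[OF fin]) simp
  have Bn: "nrm (x n) \<le> B" if "n \<le> M" for n unfolding B_def using that by (intro Max_ge[OF fin]) auto
  have "nrm (x n) \<le> B" for n
  proof (cases "n \<le> M")
    case False
    have "nrm (x n) \<le> max (nrm (x n - x M)) (nrm (x M))" using nrm_add[of "x n - x M" "x M"] by simp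
    also have "\<dots> \<le> B" using M False B1 Bn[of M] by (simp add: less_imp_le order_trans[of _ 1])
    finally show ?thesis .
  qed (rule Bn)
  thus ?thesis using that[of B] B1 by simp
qed

lemma cauchy_const: "(\<lambda>_. c) \<in> cauchy"
  by (rule cauchyI) auto

lemma cauchy_add: "x \<in> cauchy \<Longrightarrow> y \<in> cauchy \<Longrightarrow> (\<lambda>n. x n + y n) \<in> cauchy"
proof (rule cauchyI)
  fix \<epsilon> :: real assume a: "x \<in> cauchy" "y \<in> cauchy" "0 < \<epsilon>"
  obtain M where M: "\<forall>m\<ge>M. \<forall>n\<ge>M. nrm (x m - x n) < \<epsilon>" using cauchyD a by blast
  obtain M' where M': "\<forall>m\<ge>M'. \<forall>n\<ge>M'. nrm (y m - y n) < \<epsilon>" using cauchyD a by blast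
  have "nrm (x m + y m - (x n + y n)) < \<epsilon>" if "m \<ge> max M M'" "n \<ge> max M M'" for m n
  proof -
    have "x m + y m - (x n + y n) = (x m - x n) + (y m - y n)" by simp
    hence "nrm (x m + y m - (x n + y n)) \<le> max (nrm (x m - x n)) (nrm (y m - y n))"
      using nrm_add by metis
    also have "\<dots> < \<epsilon>" using M M' that by simp
    finally show ?thesis .
  qed
  thus "\<exists>K. \<forall>m\<ge>K. \<forall>n\<ge>K. nrm (x m + y m - (x n + y n)) < \<epsilon>" by blast
qed

lemma null_mult:
  assumes "x \<in> cauchy" "y \<in> null"
  shows "(\<lambda>n. x n * y n) \<in> null"
  unfolding null_iff
proof (intro allI impI)
  fix \<epsilon> :: real assume "0 < \<epsilon>"
  obtain B where B: "0 < B" "\<And>n. nrm (x n) \<le> B" using cauchy_bounded[OF assms(1)] by blast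
  then obtain M where M: "\<forall>n\<ge>M. nrm (y n) < \<epsilon> / B" using assms(2) \<open>0 < \<epsilon>\<close> unfolding null_iff by (meson divide_pos_pos)
  have "nrm (x n * y n) < \<epsilon>" if "n \<ge> M" for n
  proof -
    have "nrm (x n * y n) \<le> B * nrm (y n)" unfolding nrm_mult using B by (intro mult_right_mono) auto
    also have "\<dots> < \<epsilon>" using M that B(1) by (simp add: field_simps)
    finally show ?thesis .
  qed
  thus "\<exists>M. \<forall>n\<ge>M. nrm (x n * y n) < \<epsilon>" by blast
qed

lemma cauchy_mult:
  assumes "x \<in> cauchy" "y \<in> cauchy"
  shows "(\<lambda>n. x n * y n) \<in> cauchy"
proof (rule cauchyI)
  fix \<epsilon> :: real assume \<epsilon>: "0 < \<epsilon>"
  obtain B where B: "0 < B" "\<And>n. nrm (x n) \<le> B" using cauchy_bounded[OF assms(1)] by blast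
  obtain C where C: "0 < C" "\<And>n. nrm (y n) \<le> C" using cauchy_bounded[OF assms(2)] by blast
  obtain M where M: "\<forall>m\<ge>M. \<forall>n\<ge>M. nrm (x m - x n) < \<epsilon> / C" using cauchyD[OF assms(1)] \<epsilon> C by (meson divide_pos_pos)
  obtain M' where M': "\<forall>m\<ge>M'. \<forall>n\<ge>M'. nrm (y m - y n) < \<epsilon> / B" using cauchyD[OF assms(2)] \<epsilon> B by (meson divide_pos_pos)
  have "nrm (x m * y m - x n * y n) < \<epsilon>" if mn: "m \<ge> max M M'" "n \<ge> max M M'" for m n
  proof -
    have "x m * y m - x n * y n = x m * (y m - y n) + (x m - x n) * y n" by (simp add: algebra_simps)
    hence "nrm (x m * y m - x n * y n) \<le> max (nrm (x m * (y m - y n))) (nrm ((x m - x n) * y n))"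
      using nrm_add by metis
    moreover have "nrm (x m * (y m - y n)) \<le> B * nrm (y m - y n)"
      unfolding nrm_mult using B by (intro mult_right_mono) auto
    moreover have "B * nrm (y m - y n) < \<epsilon>" using M' mn B(1) by (simp add: field_simps)
    moreover have "nrm ((x m - x n) * y n) \<le> nrm (x m - x n) * C"
      unfolding nrm_mult using C by (intro mult_left_mono) auto
    moreover have "nrm (x m - x n) * C < \<epsilon>" using M mn C(1) by (simp add: field_simps)
    ultimately show ?thesis by linarith
  qed
  thus "\<exists>K. \<forall>m\<ge>K. \<forall>n\<ge>K. nrm (x m * y m - x n * y n) < \<epsilon>" by blast
qed

lemma cauchy_minus: "x \<in> cauchy \<Longrightarrow> (\<lambda>n. - x n) \<in> cauchy"
  using cauchy_mult[OF cauchy_const[of "-1"], of x] by simp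

lemma null_add:
  assumes "x \<in> null" "y \<in> null"
  shows "(\<lambda>n. x n + y n) \<in> null"
  unfolding null_iff
proof (intro allI impI)
  fix \<epsilon> :: real assume \<epsilon>: "0 < \<epsilon>"
  obtain M where M: "\<forall>n\<ge>M. nrm (x n) < \<epsilon>" using assms(1) \<epsilon> by (auto simp: null_iff)
  obtain M' where M': "\<forall>n\<ge>M'. nrm (y n) < \<epsilon>" using assms(2) \<epsilon> by (auto simp: null_iff)
  have "nrm (x n + y n) < \<epsilon>" if "n \<ge> max M M'" for n
    using nrm_add[of "x n" "y n"] M M' that by (smt (verit) max.bounded_iff)
  thus "\<exists>K. \<forall>n\<ge>K. nrm (x n + y n) < \<epsilon>" by blast
qed

lemma null_minus: "x \<in> null \<Longrightarrow> (\<lambda>n. - x n) \<in> null"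
  by (simp add: null_iff)

lemma null_0: "(\<lambda>_. 0) \<in> null"
  by (auto simp: null_iff)

text \<open>From some index on the norm is a fixed positive constant. Earlier terms may vanish and
  then have inverse 0, so the product with the inverse is 1 only eventually, hence modulo null
  sequences.\<close>

lemma cauchy_inverse:
  assumes "x \<in> cauchy" "x \<notin> null"
  shows "(\<lambda>n. inverse (x n)) \<in> cauchy" "(\<lambda>n. inverse (x n) * x n - 1) \<in> null"
proof -
  obtain M k where M: "\<And>n. n \<ge> M \<Longrightarrow> nrm (x n) = real p powi k" using cauchy_norm_const[OF assms] by blast
  define c where "c = real p powi k"
  have c: "0 < c" using p_gt_1 by (simp add: c_def)
  have nz: "x n \<noteq> 0" if "n \<ge> M" for n using M[OF that] c by (auto simp: c_def)
  show "(\<lambda>n. inverse (x n)) \<in> cauchy"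
  proof (rule cauchyI)
    fix \<epsilon> :: real assume \<epsilon>: "0 < \<epsilon>"
    hence "0 < \<epsilon> * c ^ 2" using c by simp
    from cauchyD[OF assms(1) this] obtain M' where M': "\<forall>m\<ge>M'. \<forall>n\<ge>M'. nrm (x m - x n) < \<epsilon> * c ^ 2" by blast
    have "nrm (inverse (x m) - inverse (x n)) < \<epsilon>" if mn: "m \<ge> max M M'" "n \<ge> max M M'" for m n
    proof -
      have eq: "inverse (x m) - inverse (x n) = (x n - x m) * (inverse (x m) * inverse (x n))"
        using nz[of m] nz[of n] mn by (simp add: field_simps)
      have "nrm (inverse (x m) - inverse (x n)) = nrm (x n - x m) / c ^ 2"
        unfolding eq nrm_mult nrm_inverse using M[of m] M[of n] mn c
        by (simp add: c_def power2_eq_square field_simps)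
      also have "\<dots> < \<epsilon>" using M' mn c by (simp add: field_simps)
      finally show ?thesis .
    qed
    thus "\<exists>K. \<forall>m\<ge>K. \<forall>n\<ge>K. nrm (inverse (x m) - inverse (x n)) < \<epsilon>" by blast
  qed
  show "(\<lambda>n. inverse (x n) * x n - 1) \<in> null"
    unfolding null_iff
  proof (intro allI impI exI)
    fix \<epsilon> :: real and n assume "0 < \<epsilon>" "M \<le> n"
    thus "nrm (inverse (x n) * x n - 1) < \<epsilon>" using nz by simp
  qed
qed

lemma cr_simps [simp]:
  "carrier cauchy_ring = cauchy" "\<one>\<^bsub>cauchy_ring\<^esub> = (\<lambda>_. 1)" "\<zero>\<^bsub>cauchy_ring\<^esub> = (\<lambda>_. 0)"
  "x \<oplus>\<^bsub>cauchy_ring\<^esub> y = (\<lambda>n. x n + y n)" "x \<otimes>\<^bsub>cauchy_ring\<^esub> y = (\<lambda>n. x n * y n)"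
  by (simp_all add: padic_cauchy_ring_def)

lemma cr_cring: "cring cauchy_ring"
proof (rule cringI)
  show "abelian_group cauchy_ring"
  proof (rule abelian_groupI)
    fix x assume "x \<in> carrier cauchy_ring"
    hence "(\<lambda>n. - x n) \<in> carrier cauchy_ring" "(\<lambda>n. - x n) \<oplus>\<^bsub>cauchy_ring\<^esub> x = \<zero>\<^bsub>cauchy_ring\<^esub>" by (simp_all add: cauchy_minus)
    thus "\<exists>y\<in>carrier cauchy_ring. y \<oplus>\<^bsub>cauchy_ring\<^esub> x = \<zero>\<^bsub>cauchy_ring\<^esub>" by blast
  qed (simp_all add: cauchy_add cauchy_const add_ac)
  show "comm_monoid cauchy_ring"
    by (rule comm_monoidI) (simp_all add: cauchy_mult cauchy_const mult_ac)
qed (simp add: algebra_simps)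

lemma cr_minus: "x \<in> cauchy \<Longrightarrow> \<ominus>\<^bsub>cauchy_ring\<^esub> x = (\<lambda>n. - x n)"
proof -
  interpret cring cauchy_ring by (rule cr_cring)
  assume x: "x \<in> cauchy"
  show ?thesis by (rule minus_equality) (use x cauchy_minus in simp_all)
qed

lemma null_ideal: "ideal null cauchy_ring"
proof (rule idealI)
  show "ring cauchy_ring" using cr_cring by (rule cring.axioms(1))
  interpret cring cauchy_ring by (rule cr_cring)
  show "subgroup null (add_monoid cauchy_ring)"
  proof (rule group.subgroupI)
    show "group (add_monoid cauchy_ring)" by (rule a_group)
    show "null \<subseteq> carrier (add_monoid cauchy_ring)" using null_cauchy by auto
    show "null \<noteq> {}" using null_0 by blast
    show "inv\<^bsub>add_monoid cauchy_ring\<^esub> x \<in> null" if "x \<in> null" for x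
      using cr_minus[OF null_cauchy[OF that]] null_minus[OF that] by (simp add: a_inv_def)
  qed (simp add: null_add)
  fix a x assume "a \<in> null" "x \<in> carrier cauchy_ring"
  thus "x \<otimes>\<^bsub>cauchy_ring\<^esub> a \<in> null" "a \<otimes>\<^bsub>cauchy_ring\<^esub> x \<in> null"
    using null_mult[of x a] by (simp_all add: mult.commute)
qed

text \<open>An ideal above the null sequences with a further element \<open>x\<close> contains the
  product of \<open>x\<close> with its termwise inverse; this differs from 1 by a null
  sequence.\<close>

lemma null_maximal: "maximalideal null cauchy_ring"
proof (rule maximalidealI[OF null_ideal])
  have "(\<lambda>_. 1) \<notin> null" by (auto simp: null_iff intro!: exI[of _ "1 :: real"])
  thus "carrier cauchy_ring \<noteq> null" using cauchy_const[of 1] by auto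
  fix J assume J: "ideal J cauchy_ring" "null \<subseteq> J" "J \<subseteq> carrier cauchy_ring"
  interpret J: ideal J cauchy_ring by (rule J(1))
  show "J = null \<or> J = carrier cauchy_ring"
  proof (cases "J \<subseteq> null")
    case False
    then obtain x where x: "x \<in> J" "x \<notin> null" by blast
    hence xc: "x \<in> cauchy" using J(3) by auto
    note inv = cauchy_inverse[OF xc x(2)]
    have 1: "(\<lambda>n. inverse (x n) * x n) \<in> J" using J.I_l_closed[OF x(1)] inv(1) by simp
    have "(\<lambda>n. - (inverse (x n) * x n - 1)) \<in> J" using null_minus[OF inv(2)] J(2) by blast
    from additive_subgroup.a_closed[OF ideal.axioms(1)[OF J(1)] this 1] have "\<one>\<^bsub>cauchy_ring\<^esub> \<in> J" by simp
    thus ?thesis using J.one_imp_carrier by blast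
  qed (use J in auto)
qed

lemma Qp_field: "Ring.field (Qp p)"
  unfolding Qp_def by (rule maximalideal.quotient_is_field[OF null_maximal cr_cring])

definition cls :: "(nat \<Rightarrow> rat) \<Rightarrow> (nat \<Rightarrow> rat) set" where
  "cls x = null +>\<^bsub>cauchy_ring\<^esub> x"

lemma cls_hom: "cls \<in> Ring.ring_hom cauchy_ring (Qp p)"
  unfolding cls_def[abs_def] Qp_def by (rule ideal.rcos_ring_hom[OF null_ideal])

lemma cls_mem: "y \<in> cls x \<longleftrightarrow> (\<exists>a\<in>null. y = (\<lambda>n. a n + x n))"
  by (auto simp: cls_def a_r_coset_def r_coset_def)

lemma carrier_Qp: "carrier (Qp p) = cls ` cauchy"
  by (auto simp: Qp_def FactRing_def A_RCOSETS_def RCOSETS_def cls_def a_r_coset_def)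

lemma cls_eq_iff:
  assumes "x \<in> cauchy" "y \<in> cauchy"
  shows "cls x = cls y \<longleftrightarrow> (\<lambda>n. x n - y n) \<in> null"
proof
  assume eq: "cls x = cls y"
  have "x \<in> cls x" unfolding cls_mem by (rule bexI[OF _ null_0]) simp
  hence "x \<in> cls y" by (simp only: eq)
  then obtain a where "a \<in> null" "x = (\<lambda>n. a n + y n)" unfolding cls_mem by auto
  thus "(\<lambda>n. x n - y n) \<in> null" by simp
next
  assume d: "(\<lambda>n. x n - y n) \<in> null"
  have sub: "cls x \<subseteq> cls y" if "(\<lambda>n. x n - y n) \<in> null" for x y
  proof
    fix z assume "z \<in> cls x"
    then obtain a where "a \<in> null" "z = (\<lambda>n. a n + x n)" unfolding cls_mem by auto
    thus "z \<in> cls y" unfolding cls_mem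
      using null_add[OF _ that, of a] by (intro bexI[of _ "\<lambda>n. a n + (x n - y n)"]) auto
  qed
  have "(\<lambda>n. y n - x n) \<in> null" using null_minus[OF d] by simp
  thus "cls x = cls y" using sub d by blast
qed

text \<open>Representatives differ by null sequences, along which the norms have the same limit;
  this makes the description in \<open>Qp_abs\<close> well defined.\<close>

lemma Qp_abs_cls:
  assumes x: "x \<in> cauchy" and lim: "(\<lambda>n. nrm (x n)) \<longlonglongrightarrow> r"
  shows "Qp_abs p (cls x) = r"
  unfolding Qp_abs_def
proof (rule the_equality)
  show "\<forall>z\<in>cls x. (\<lambda>n. nrm (z n)) \<longlonglongrightarrow> r"
  proof
    fix z assume "z \<in> cls x"
    then obtain a where a: "a \<in> null" "z = (\<lambda>n. a n + x n)" unfolding cls_mem by auto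
    have "(\<lambda>n. nrm (z n) - nrm (x n)) \<longlonglongrightarrow> 0"
    proof (rule tendsto_0_le)
      have "\<bar>nrm (z n) - nrm (x n)\<bar> \<le> nrm (a n)" for n
      proof (cases "nrm (a n) < nrm (x n)")
        case True
        have "nrm (z n - x n) < nrm (x n)" using True by (simp add: a(2))
        thus ?thesis using nrm_eq_of_close[of "z n" "x n"] by simp
      next
        case False
        have "nrm (z n) \<le> nrm (a n)" using nrm_add[of "a n" "x n"] False by (simp add: a(2))
        thus ?thesis using False nrm_nonneg[of "x n"] nrm_nonneg[of "z n"] by (simp add: abs_le_iff del: nrm_nonneg)
      qed
      thus "\<forall>\<^sub>F n in sequentially. norm (nrm (z n) - nrm (x n)) \<le> norm (nrm (a n)) * 1" by simp
      show "(\<lambda>n. nrm (a n)) \<longlonglongrightarrow> 0" using a(1) by (simp add: padic_null_def)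
    qed
    from tendsto_add[OF this lim] show "(\<lambda>n. nrm (z n)) \<longlonglongrightarrow> r" by simp
  qed
  fix r' assume "\<forall>z\<in>cls x. (\<lambda>n. nrm (z n)) \<longlonglongrightarrow> r'"
  moreover have "x \<in> cls x" unfolding cls_mem by (rule bexI[OF _ null_0]) simp
  ultimately show "r' = r" using LIMSEQ_unique lim by blast
qed

lemma cls_zero_iff: "x \<in> cauchy \<Longrightarrow> cls x = \<zero>\<^bsub>Qp p\<^esub> \<longleftrightarrow> x \<in> null"
proof -
  assume x: "x \<in> cauchy"
  have "\<zero>\<^bsub>Qp p\<^esub> = cls (\<lambda>_. 0)"
    using ring_hom_zero[OF cls_hom cring.axioms(1)[OF cr_cring]] Qp_field
    by (simp add: field.is_ring)
  thus ?thesis using cls_eq_iff[OF x cauchy_const[of 0]] by simp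
qed

end

section \<open>The algebraic closure of the p-adic numbers\<close>

text \<open>Everything about a prime that the heights require, in one predicate that mentions no
  type depending on the prime: an absolute value, so that the choice in \<open>Qp_bar_abs\<close> is
  meaningful, and an embedding through which every embedding of a simple number field can be read on
  its generator.\<close>

definition padic_model :: "nat \<Rightarrow> bool" where
  "padic_model p \<longleftrightarrow>
     (\<exists>v. absolute_value (Qp_bar p) v \<and>
        (\<forall>x\<in>carrier (Qp p). v (ring.indexed_const (Qp p) x) = Qp_abs p x)) \<and>
     (\<exists>\<iota>\<in>Ring.ring_hom qbar_ring (Qp_bar p).
        \<forall>t. \<forall>\<sigma>\<in>Ring.ring_hom (qbar_ring\<lparr>carrier := number_field t\<rparr>) (Qp_bar p). \<sigma> t \<in> \<iota> ` conjugates t)"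

text \<open>
  A type cannot depend on a prime. We therefore work over a fixed prime \<open>p0\<close>, chosen as a
  counterexample to \<^const>\<open>padic_model\<close> if there is one, so that the statement for \<open>p0\<close> implies
  it for all primes.
\<close>

definition p0 :: nat where
  "p0 = (SOME p. prime p \<and> ((\<exists>q. prime q \<and> \<not> padic_model q) \<longrightarrow> \<not> padic_model p))"

lemma p0: "prime p0" "padic_model p0 \<Longrightarrow> prime q \<Longrightarrow> padic_model q"
proof -
  have "\<exists>p. prime p \<and> ((\<exists>q. prime q \<and> \<not> padic_model q) \<longrightarrow> \<not> padic_model p)"
  proof (cases "\<exists>q. prime q \<and> \<not> padic_model q")
    case False
    thus ?thesis using two_is_prime_nat by (intro exI[of _ 2]) simp
  qed blast
  from someI_ex[OF this] have *: "prime p0 \<and> ((\<exists>q. prime q \<and> \<not> padic_model q) \<longrightarrow> \<not> padic_model p0)"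
    unfolding p0_def .
  show "prime p0" using * by blast
  show "padic_model q" if "padic_model p0" "prime q" using * that by blast
qed

lemma Qp_bar_closure: "prime p \<Longrightarrow> algebraic_closure (Qp_bar p) (ring.indexed_const (Qp p) ` carrier (Qp p))"
  and indexed_const_hom: "prime p \<Longrightarrow> ring.indexed_const (Qp p) \<in> Ring.ring_hom (Qp p) (Qp_bar p)"
  using field.alg_closureE[OF Qp_field] by (simp_all add: Qp_bar_def)

lemma Qp_bar_field: "prime p \<Longrightarrow> Ring.field (Qp_bar p)"
  using algebraic_closure.axioms(1)[OF Qp_bar_closure] .

section \<open>The algebraic closure over the fixed prime as a type\<close>

typedef padic_closure = "carrier (Qp_bar p0)"
proof -
  interpret Ring.field "Qp_bar p0" by (rule Qp_bar_field[OF p0(1)])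
  show ?thesis using zero_closed by blast
qed

setup_lifting type_definition_padic_closure

instantiation padic_closure :: field
begin

context
begin

interpretation L: Ring.field "Qp_bar p0"
  by (rule Qp_bar_field[OF p0(1)])

lift_definition zero_padic_closure :: padic_closure is "\<zero>\<^bsub>Qp_bar p0\<^esub>" by (rule L.zero_closed)
lift_definition one_padic_closure :: padic_closure is "\<one>\<^bsub>Qp_bar p0\<^esub>" by (rule L.one_closed)
lift_definition plus_padic_closure :: "padic_closure \<Rightarrow> padic_closure \<Rightarrow> padic_closure"
  is "ring.add (Qp_bar p0)" by (rule L.a_closed)
lift_definition minus_padic_closure :: "padic_closure \<Rightarrow> padic_closure \<Rightarrow> padic_closure"
  is "a_minus (Qp_bar p0)" by (rule L.minus_closed)
lift_definition times_padic_closure :: "padic_closure \<Rightarrow> padic_closure \<Rightarrow> padic_closure"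
  is "monoid.mult (Qp_bar p0)" by (rule L.m_closed)
lift_definition uminus_padic_closure :: "padic_closure \<Rightarrow> padic_closure"
  is "a_inv (Qp_bar p0)" by (rule L.a_inv_closed)
lift_definition inverse_padic_closure :: "padic_closure \<Rightarrow> padic_closure"
  is "\<lambda>x. if x = \<zero>\<^bsub>Qp_bar p0\<^esub> then \<zero>\<^bsub>Qp_bar p0\<^esub> else m_inv (Qp_bar p0) x"
  by (auto simp: L.field_Units)
lift_definition divide_padic_closure :: "padic_closure \<Rightarrow> padic_closure \<Rightarrow> padic_closure"
  is "\<lambda>x y. if y = \<zero>\<^bsub>Qp_bar p0\<^esub> then \<zero>\<^bsub>Qp_bar p0\<^esub> else monoid.mult (Qp_bar p0) x (m_inv (Qp_bar p0) y)"
  by (auto simp: L.field_Units)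

end

instance
proof -
  interpret L: Ring.field "Qp_bar p0" by (rule Qp_bar_field[OF p0(1)])
  note defs = zero_padic_closure.rep_eq one_padic_closure.rep_eq plus_padic_closure.rep_eq
    minus_padic_closure.rep_eq times_padic_closure.rep_eq uminus_padic_closure.rep_eq
    inverse_padic_closure.rep_eq divide_padic_closure.rep_eq
  note inj = Rep_padic_closure_inject[symmetric]
  have cl: "Rep_padic_closure x \<in> carrier (Qp_bar p0)" for x by (rule Rep_padic_closure)
  show "OFCLASS(padic_closure, field_class)"
  proof (standard, goal_cases)
    case 1
    show ?case unfolding inj defs by (rule L.m_assoc[OF cl cl cl])
  next
    case 2
    show ?case unfolding inj defs by (rule L.m_comm[OF cl cl])
  next
    case 3
    show ?case unfolding inj defs by (rule L.l_one[OF cl])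
  next
    case 4
    show ?case unfolding inj defs by (rule L.a_assoc[OF cl cl cl])
  next
    case 5
    show ?case unfolding inj defs by (rule L.a_comm[OF cl cl])
  next
    case 6
    show ?case unfolding inj defs by (rule L.l_zero[OF cl])
  next
    case 7
    show ?case unfolding inj defs by (rule L.l_neg[OF cl])
  next
    case 8
    show ?case unfolding inj defs by (rule a_minus_def)
  next
    case 9
    show ?case unfolding inj defs by (rule L.l_distr[OF cl cl cl])
  next
    case 10
    show ?case unfolding inj defs by (rule L.zero_not_one)
  next
    case (11 a)
    have "Rep_padic_closure a \<in> Units (Qp_bar p0)" using 11 cl[of a] unfolding inj defs by (simp add: L.field_Units)
    thus ?case using 11 unfolding inj defs by (simp add: L.Units_l_inv)
  next
    case (12 a b)
    show ?case unfolding inj defs using cl[of a] by simp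
  next
    case 13
    show ?case unfolding inj defs by simp
  qed
qed

end

lemma Rep_closed [simp]: "Rep_padic_closure x \<in> carrier (Qp_bar p0)"
  by (rule Rep_padic_closure)

lemma Abs_closed [simp]: "x \<in> carrier (Qp_bar p0) \<Longrightarrow> Rep_padic_closure (Abs_padic_closure x) = x"
  by (rule Abs_padic_closure_inverse)

lemmas Rep_simps [simp] = zero_padic_closure.rep_eq one_padic_closure.rep_eq
  plus_padic_closure.rep_eq times_padic_closure.rep_eq

lemma Abs_hom:
  assumes "x \<in> carrier (Qp_bar p0)" "y \<in> carrier (Qp_bar p0)"
  shows "Abs_padic_closure (x \<oplus>\<^bsub>Qp_bar p0\<^esub> y) = Abs_padic_closure x + Abs_padic_closure y"
    "Abs_padic_closure (x \<otimes>\<^bsub>Qp_bar p0\<^esub> y) = Abs_padic_closure x * Abs_padic_closure y"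
  using assms by (metis Abs_closed Rep_padic_closure_inverse Rep_simps(3))
                 (metis assms Abs_closed Rep_padic_closure_inverse Rep_simps(4))

lemma Abs_eq_0_iff:
  assumes "x \<in> carrier (Qp_bar p0)"
  shows "Abs_padic_closure x = 0 \<longleftrightarrow> x = \<zero>\<^bsub>Qp_bar p0\<^esub>"
  using Rep_padic_closure_inject[of "Abs_padic_closure x" 0] assms by simp

lemma Rep_pow [simp]: "Rep_padic_closure (x ^ n) = Rep_padic_closure x [^]\<^bsub>Qp_bar p0\<^esub> n"
proof -
  interpret L: Ring.field "Qp_bar p0" by (rule Qp_bar_field[OF p0(1)])
  show ?thesis by (induction n) (simp_all add: L.m_comm)
qed

text \<open>Translates between polynomials as lists with the leading coefficient first and
  polynomials over the type, whose coefficients start at the constant term.\<close>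

lemma Rep_poly:
  assumes "set xs \<subseteq> carrier (Qp_bar p0)"
  shows "ring.eval (Qp_bar p0) xs (Rep_padic_closure x)
    = Rep_padic_closure (poly (Poly (rev (map Abs_padic_closure xs))) x)"
  using assms
proof (induction xs)
  case Nil
  interpret L: Ring.field "Qp_bar p0" by (rule Qp_bar_field[OF p0(1)])
  show ?case by simp
next
  case (Cons a xs)
  interpret L: Ring.field "Qp_bar p0" by (rule Qp_bar_field[OF p0(1)])
  have "poly (Poly (rev (map Abs_padic_closure (a # xs)))) x
      = poly (Poly (rev (map Abs_padic_closure xs))) x + Abs_padic_closure a * x ^ length xs"
    by (simp add: Poly_append poly_monom monom_altdef)
  thus ?case using Cons by (simp add: L.a_comm)
qed

instance padic_closure :: alg_closed_field
proof
  interpret L: algebraic_closure "Qp_bar p0" "ring.indexed_const (Qp p0) ` carrier (Qp p0)"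
    by (rule Qp_bar_closure[OF p0(1)])
  fix p :: "padic_closure poly"
  assume p: "Polynomial.degree p > 0" "Polynomial.lead_coeff p = 1"
  define P where "P = rev (map Rep_padic_closure (coeffs p))"
  have p0': "p \<noteq> 0" using p by auto
  have deg: "Polynomials.degree P = Polynomial.degree p"
    by (simp add: P_def degree_eq_length_coeffs)
  have nz: "Rep_padic_closure y \<noteq> \<zero>\<^bsub>Qp_bar p0\<^esub>" if "y \<noteq> 0" for y
    using that by (metis Rep_padic_closure_inject Rep_simps(1))
  have sub: "set P \<subseteq> carrier (Qp_bar p0)" by (auto simp: P_def)
  have "hd P \<noteq> \<zero>\<^bsub>Qp_bar p0\<^esub>"
    using p0' p nz[of 1] by (simp add: P_def hd_rev last_map last_coeffs_eq_coeff_degree)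
  hence carrier_P: "P \<in> carrier (poly_ring (Qp_bar p0))"
    using sub by (simp add: univ_poly_def polynomial_def)
  hence "L.splitted P" using L.roots_over_carrier by blast
  hence "L.roots P \<noteq> {#}" unfolding L.splitted_def using deg p by auto
  then obtain x where "x \<in># L.roots P" by blast
  hence x: "L.is_root P x" using L.roots_mem_iff_is_root[OF carrier_P] by auto
  hence xc: "x \<in> carrier (Qp_bar p0)" "L.eval P x = \<zero>\<^bsub>Qp_bar p0\<^esub>" by (auto simp: L.is_root_def)
  have "map Abs_padic_closure P = rev (coeffs p)"
    by (simp add: P_def rev_map comp_def Rep_padic_closure_inverse)
  hence "Rep_padic_closure (poly p (Abs_padic_closure x)) = Rep_padic_closure 0"
    using Rep_poly[OF sub, of "Abs_padic_closure x"] xc by simp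
  thus "\<exists>x. poly p x = 0" unfolding Rep_padic_closure_inject by blast
qed

definition pc :: "(nat \<Rightarrow> rat) \<Rightarrow> padic_closure" where
  "pc x = Abs_padic_closure (ring.indexed_const (Qp p0) (cls p0 x))"

lemma pc_closed:
  assumes "x \<in> padic_cauchy p0"
  shows "ring.indexed_const (Qp p0) (cls p0 x) \<in> carrier (Qp_bar p0)"
  using ring_hom_closed[OF indexed_const_hom[OF p0(1)]] assms by (simp add: carrier_Qp[OF p0(1)])

lemma pc_hom:
  assumes "x \<in> padic_cauchy p0" "y \<in> padic_cauchy p0"
  shows "pc (\<lambda>n. x n + y n) = pc x + pc y" "pc (\<lambda>n. x n * y n) = pc x * pc y" "pc (\<lambda>_. 1) = 1"
proof -
  note h = cls_hom[OF p0(1)] and i = indexed_const_hom[OF p0(1)]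
  have xy: "cls p0 x \<in> carrier (Qp p0)" "cls p0 y \<in> carrier (Qp p0)"
    using assms by (auto simp: carrier_Qp[OF p0(1)])
  show "pc (\<lambda>n. x n + y n) = pc x + pc y"
    using ring_hom_add[OF h, of x y] ring_hom_add[OF i xy] assms
    by (simp add: pc_def Abs_hom pc_closed cr_simps[OF p0(1)])
  show "pc (\<lambda>n. x n * y n) = pc x * pc y"
    using ring_hom_mult[OF h, of x y] ring_hom_mult[OF i xy] assms
    by (simp add: pc_def Abs_hom pc_closed cr_simps[OF p0(1)])
  show "pc (\<lambda>_. 1) = 1"
    using ring_hom_one[OF h] ring_hom_one[OF i]
    by (simp add: pc_def cr_simps[OF p0(1)] one_padic_closure_def)
qed

lemma pc_eq_iff:
  assumes "x \<in> padic_cauchy p0" "y \<in> padic_cauchy p0"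
  shows "pc x = pc y \<longleftrightarrow> (\<lambda>n. x n - y n) \<in> padic_null p0"
proof -
  have "pc x = pc y \<longleftrightarrow>
      (ring.indexed_const (Qp p0) (cls p0 x) :: qp_bar) = ring.indexed_const (Qp p0) (cls p0 y)"
    unfolding pc_def using pc_closed assms by (intro Abs_padic_closure_inject)
  also have "\<dots> \<longleftrightarrow> cls p0 x = cls p0 y"
    by (rule ring.indexed_const_eq_iff) (simp add: field.is_ring Qp_field[OF p0(1)])
  finally show ?thesis using cls_eq_iff[OF p0(1) assms] by simp
qed

lemma pc_zero: "pc (\<lambda>_. 0) = 0"
  using pc_hom(1)[OF cauchy_const[OF p0(1), of 0] cauchy_const[OF p0(1), of 0]]
  by (simp only: add_0_left) (metis add.right_neutral add_left_imp_eq)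

lemma pc_of_nat: "pc (\<lambda>_. of_nat n) = of_nat n"
proof (induction n)
  case (Suc n)
  have "pc (\<lambda>_. 1 + of_nat n) = 1 + of_nat n"
    using pc_hom(1)[OF cauchy_const[OF p0(1), of 1] cauchy_const[OF p0(1), of "of_nat n"]]
      pc_hom(3)[OF cauchy_const[OF p0(1), of 1] cauchy_const[OF p0(1), of 1]] Suc by simp
  thus ?case by simp
qed (simp add: pc_zero)

instance padic_closure :: field_char_0
proof
  show "inj (of_nat :: nat \<Rightarrow> padic_closure)"
  proof (rule injI)
    fix m n :: nat assume "(of_nat m :: padic_closure) = of_nat n"
    hence "(\<lambda>_. of_nat m - of_nat n :: rat) \<in> padic_null p0"
      using pc_eq_iff[OF cauchy_const[OF p0(1), of "of_nat m"] cauchy_const[OF p0(1), of "of_nat n"]]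
      by (simp add: pc_of_nat)
    hence "padic_abs_rat p0 (of_nat m - of_nat n) = 0"
      by (simp add: padic_null_def LIMSEQ_const_iff)
    thus "m = n" using nrm_eq_0_iff[OF p0(1)] by simp
  qed
qed

lemma pc_power:
  assumes "x \<in> padic_cauchy p0"
  shows "(\<lambda>n. x n ^ k) \<in> padic_cauchy p0" "pc (\<lambda>n. x n ^ k) = pc x ^ k"
proof (induction k)
  case 0
  show "(\<lambda>n. x n ^ 0) \<in> padic_cauchy p0" "pc (\<lambda>n. x n ^ 0) = pc x ^ 0"
    using cauchy_const[OF p0(1), of 1] pc_hom(3)[OF assms assms] by simp_all
next
  case (Suc k)
  show "(\<lambda>n. x n ^ Suc k) \<in> padic_cauchy p0" "pc (\<lambda>n. x n ^ Suc k) = pc x ^ Suc k"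
    using cauchy_mult[OF p0(1) assms Suc(1)] pc_hom(2)[OF assms Suc(1)] Suc(2) by simp_all
qed

text \<open>The image of the p-adic integers in the closure. The bound is required only eventually,
  as finitely many terms do not affect the class.\<close>

definition padic_integers :: "padic_closure set" where
  "padic_integers = {pc x |x. x \<in> padic_cauchy p0 \<and> (\<exists>M. \<forall>n\<ge>M. padic_abs_rat p0 (x n) \<le> 1)}"

lemma pc_integer: "x \<in> padic_cauchy p0 \<Longrightarrow> (\<And>n. n \<ge> M \<Longrightarrow> padic_abs_rat p0 (x n) \<le> 1) \<Longrightarrow> pc x \<in> padic_integers"
  unfolding padic_integers_def by blast

text \<open>The norm is eventually a power \<open>p0 ^ k\<close>; multiplying by the
  \<open>k\<close>-th power of \<open>p0\<close> makes it eventually 1, and a sequence of norm 1 is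
  a unit of the integers. The exponent is returned with the opposite sign.\<close>

lemma pc_decompose:
  assumes x: "x \<in> padic_cauchy p0" "x \<notin> padic_null p0"
  obtains k M u where "\<And>n. n \<ge> M \<Longrightarrow> padic_abs_rat p0 (x n) = real p0 powi (- k)"
    "u \<in> padic_integers" "inverse u \<in> padic_integers" "u \<noteq> 0" "pc x = of_nat p0 powi k * u"
proof -
  note p = p0(1)
  obtain M k where M: "\<And>n. n \<ge> M \<Longrightarrow> padic_abs_rat p0 (x n) = real p0 powi k"
    using cauchy_norm_const[OF p x] by blast
  define c where "c = (of_nat p0 :: rat) powi k"
  have pr: "real p0 > 0" "(of_nat p0 :: rat) \<noteq> 0" using prime_gt_0_nat[OF p] by simp_all
  have c0: "c \<noteq> 0" using pr by (simp add: c_def)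
  define y where "y n = c * x n" for n
  have y: "y \<in> padic_cauchy p0"
    unfolding y_def using cauchy_mult[OF p cauchy_const[OF p, of c] x(1)] .
  have Ny: "padic_abs_rat p0 (y n) = 1" if "n \<ge> M" for n
    using M[OF that] pr by (simp add: y_def nrm_mult[OF p] c_def nrm_p_powi[OF p] power_int_minus)
  have yn: "y \<notin> padic_null p0"
  proof
    assume "y \<in> padic_null p0"
    then obtain M' where "\<forall>n\<ge>M'. padic_abs_rat p0 (y n) < 1" using null_iff[OF p, of y] by (metis zero_less_one)
    thus False using Ny[of "max M M'"] by (metis less_irrefl max.cobounded1 max.cobounded2)
  qed
  note inv = cauchy_inverse[OF p y yn]
  define z where "z n = inverse (y n)" for n
  have z: "z \<in> padic_cauchy p0" using inv(1) by (simp add: z_def[abs_def])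
  have zy: "pc z * pc y = 1"
    using inv(2) pc_eq_iff[OF cauchy_mult[OF p z y] cauchy_const[OF p, of 1]] pc_hom[OF z y]
    by (simp add: z_def)
  have iy: "pc z = inverse (pc y)" using inverse_unique[of "pc y" "pc z"] zy by (simp add: mult.commute)
  have y0: "pc y \<noteq> 0" using zy by auto
  have "pc y \<in> padic_integers" using Ny by (intro pc_integer[OF y, of M]) simp
  moreover have "inverse (pc y) \<in> padic_integers"
    unfolding iy[symmetric] by (rule pc_integer[OF z, of M]) (simp add: z_def nrm_inverse[OF p] Ny)
  moreover have "pc x = of_nat p0 powi (- k) * pc y"
  proof -
    have pw: "pc (\<lambda>_. of_nat p0 powi j) = of_nat p0 powi j" for j
    proof -
      have nat: "pc (\<lambda>_. of_nat p0 ^ m) = of_nat p0 ^ m" for m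
        using pc_power(2)[OF cauchy_const[OF p, of "of_nat p0"], of m] by (simp add: pc_of_nat)
      have neg: "pc (\<lambda>_. inverse (of_nat p0 ^ m)) = inverse (of_nat p0 ^ m)" for m
      proof -
        have "pc (\<lambda>_. inverse (of_nat p0 ^ m)) * pc (\<lambda>_. of_nat p0 ^ m) = 1"
          using pc_hom[OF cauchy_const[OF p, of "inverse (of_nat p0 ^ m)"] cauchy_const[OF p, of "of_nat p0 ^ m"]] pr
          by simp
        thus ?thesis unfolding nat by (metis inverse_unique mult.commute)
      qed
      show ?thesis by (cases j rule: int_cases2) (simp_all add: nat neg power_int_minus)
    qed
    have "pc y = of_nat p0 powi k * pc x"
      using pc_hom(2)[OF cauchy_const[OF p, of c] x(1)] by (simp add: y_def[abs_def] c_def pw)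
    moreover have "(of_nat p0 :: padic_closure) \<noteq> 0" using prime_gt_0_nat[OF p] by simp
    ultimately show ?thesis by (simp add: power_int_minus)
  qed
  ultimately show ?thesis using that[of M "- k" "pc y"] M y0 by simp
qed

lemma pc_scale_integer:
  assumes z: "z \<in> padic_cauchy p0"
  obtains e where "\<And>e'. e \<le> e' \<Longrightarrow> of_nat p0 ^ e' * pc z \<in> padic_integers"
proof -
  note p = p0(1)
  have pr: "real p0 > 1" using prime_gt_1_nat[OF p] by simp
  obtain B where B: "\<And>n. padic_abs_rat p0 (z n) \<le> B" using cauchy_bounded[OF p z] by blast
  obtain e where e: "B < real p0 ^ e" using real_arch_pow[OF pr] by blast
  have "of_nat p0 ^ e' * pc z \<in> padic_integers" if "e \<le> e'" for e'
  proof -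
    have pe: "padic_abs_rat p0 (of_nat p0 ^ e') = inverse (real p0 ^ e')"
      using nrm_p_powi[OF p, of "int e'"] by (simp add: power_int_minus)
    have "pc (\<lambda>n. of_nat p0 ^ e' * z n) \<in> padic_integers"
    proof (rule pc_integer[OF cauchy_mult[OF p cauchy_const[OF p] z], of 0])
      fix n
      have "padic_abs_rat p0 (z n) \<le> real p0 ^ e" using B[of n] e by linarith
      also have "\<dots> \<le> real p0 ^ e'" using that pr by (intro power_increasing) auto
      finally show "padic_abs_rat p0 (of_nat p0 ^ e' * z n) \<le> 1"
        using pr by (simp add: nrm_mult[OF p] pe field_simps)
    qed
    thus ?thesis
      using pc_hom(2)[OF cauchy_const[OF p, of "of_nat p0 ^ e'"] z] pc_power(2)[OF cauchy_const[OF p, of "of_nat p0"], of e']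
      by (simp add: pc_of_nat)
  qed
  thus ?thesis using that by blast
qed

lemma algebraic_over_pc:
  obtains P where "P \<noteq> 0" "poly P x = 0" "\<And>i. coeff P i \<in> pc ` padic_cauchy p0"
proof -
  define K where "K = (ring.indexed_const (Qp p0) ` carrier (Qp p0) :: qp_bar set)"
  interpret L: algebraic_closure "Qp_bar p0" K
    unfolding K_def by (rule Qp_bar_closure[OF p0(1)])
  have K: "subring K (Qp_bar p0)" by (rule subfieldE(1)) (rule L.subfield_axioms)
  have "(L.algebraic over K) (Rep_padic_closure x)" by (rule L.algebraic_extension) simp
  from L.algebraicE[OF K _ this] obtain xs where xs: "xs \<in> carrier (K[X]\<^bsub>Qp_bar p0\<^esub>)" "xs \<noteq> []"
    "L.eval xs (Rep_padic_closure x) = \<zero>\<^bsub>Qp_bar p0\<^esub>" by (metis Rep_closed)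
  have sub: "set xs \<subseteq> K" and hd: "hd xs \<noteq> \<zero>\<^bsub>Qp_bar p0\<^esub>"
    using xs(1,2) by (auto simp: univ_poly_def polynomial_def)
  have subc: "set xs \<subseteq> carrier (Qp_bar p0)" using sub subringE(1)[OF K] by blast
  define P where "P = Poly (rev (map Abs_padic_closure xs))"
  have "poly P x = 0"
    using Rep_poly[OF subc, of x] xs(3) unfolding P_def
    by (metis Rep_padic_closure_inject Rep_simps(1))
  moreover have "P \<noteq> 0"
  proof
    assume "P = 0"
    then obtain n where n: "rev (map Abs_padic_closure xs) = replicate n 0"
      unfolding P_def Poly_eq_0 by blast
    obtain a ys where axs: "xs = a # ys" using xs(2) by (cases xs) auto
    hence "Abs_padic_closure a \<in> set (rev (map Abs_padic_closure xs))" by simp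
    hence "Abs_padic_closure a = 0" unfolding n by simp
    moreover have "a \<in> carrier (Qp_bar p0)" using subc axs by simp
    ultimately have "a = \<zero>\<^bsub>Qp_bar p0\<^esub>" using Abs_eq_0_iff by blast
    thus False using hd axs by simp
  qed
  moreover have "coeff P i \<in> pc ` padic_cauchy p0" for i
  proof (cases "i < length xs")
    case True
    hence "coeff P i \<in> Abs_padic_closure ` set xs"
      unfolding P_def by (auto simp: coeff_Poly_eq nth_default_def rev_nth)
    thus ?thesis using sub by (auto simp: K_def carrier_Qp[OF p0(1)] pc_def)
  next
    case False
    hence "coeff P i = pc (\<lambda>_. 0)" by (simp add: P_def coeff_Poly_eq nth_default_def pc_zero)
    thus ?thesis using cauchy_const[OF p0(1), of 0] by blast
  qed
  ultimately show ?thesis using that by blast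
qed

lemma padic_integers_extension: "dvr_extension padic_integers (of_nat p0)"
proof
  note p = p0(1)
  have pr: "real p0 > 1" using prime_gt_1_nat[OF p] by simp
  show "closed_ring padic_integers"
    unfolding closed_ring_def
  proof (intro conjI ballI)
    show "1 \<in> padic_integers"
      using pc_integer[OF cauchy_const[OF p, of 1], of 0] pc_hom(3)[OF cauchy_const[OF p, of 1] cauchy_const[OF p, of 1]] nrm_1[OF p]
      by simp
    fix a b assume "a \<in> padic_integers" "b \<in> padic_integers"
    then obtain x y M M' where x: "a = pc x" "x \<in> padic_cauchy p0" "\<And>n. n \<ge> M \<Longrightarrow> padic_abs_rat p0 (x n) \<le> 1"
      and y: "b = pc y" "y \<in> padic_cauchy p0" "\<And>n. n \<ge> M' \<Longrightarrow> padic_abs_rat p0 (y n) \<le> 1"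
      unfolding padic_integers_def by auto
    show "a + b \<in> padic_integers"
      unfolding x(1) y(1) pc_hom(1)[OF x(2) y(2), symmetric]
    proof (rule pc_integer[OF cauchy_add[OF p x(2) y(2)], of "max M M'"])
      fix n assume "n \<ge> max M M'"
      thus "padic_abs_rat p0 (x n + y n) \<le> 1" using nrm_add[OF p, of "x n" "y n"] x(3)[of n] y(3)[of n] by simp
    qed
    show "a * b \<in> padic_integers"
      unfolding x(1) y(1) pc_hom(2)[OF x(2) y(2), symmetric]
    proof (rule pc_integer[OF cauchy_mult[OF p x(2) y(2)], of "max M M'"])
      fix n assume "n \<ge> max M M'"
      thus "padic_abs_rat p0 (x n * y n) \<le> 1"
        using x(3)[of n] y(3)[of n] nrm_nonneg[OF p] by (auto simp: nrm_mult[OF p] intro: mult_le_one)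
    qed
    have "pc (\<lambda>n. - x n) + pc x = 0"
      using pc_hom(1)[OF cauchy_minus[OF p x(2)] x(2)] by (simp add: pc_zero)
    hence "- a = pc (\<lambda>n. - x n)" by (simp add: x(1) add_eq_0_iff2)
    moreover have "pc (\<lambda>n. - x n) \<in> padic_integers"
      by (rule pc_integer[OF cauchy_minus[OF p x(2)], of M]) (simp add: nrm_minus[OF p] x(3))
    ultimately show "- a \<in> padic_integers" by simp
  qed
  show "of_nat p0 \<in> padic_integers"
    using pc_integer[OF cauchy_const[OF p, of "of_nat p0"], of 0] pr
    by (simp add: pc_of_nat nrm_p[OF p] inverse_le_1_iff)
  show nz: "(of_nat p0 :: padic_closure) \<noteq> 0" using pr by simp
  show "inverse (of_nat p0) \<notin> padic_integers"
  proof
    assume "inverse (of_nat p0) \<in> padic_integers"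
    then obtain x M where x: "inverse (of_nat p0) = pc x" "x \<in> padic_cauchy p0"
      "\<And>n. n \<ge> M \<Longrightarrow> padic_abs_rat p0 (x n) \<le> 1" unfolding padic_integers_def by auto
    have "pc (\<lambda>n. of_nat p0 * x n) = pc (\<lambda>_. 1)"
      using pc_hom[OF cauchy_const[OF p, of "of_nat p0"] x(2)] nz by (simp add: pc_of_nat flip: x(1))
    hence "(\<lambda>n. of_nat p0 * x n - 1) \<in> padic_null p0"
      using pc_eq_iff[OF cauchy_mult[OF p cauchy_const[OF p, of "of_nat p0"] x(2)] cauchy_const[OF p, of 1]] by simp
    then obtain M' where M': "\<forall>n\<ge>M'. padic_abs_rat p0 (of_nat p0 * x n - 1) < 1"
      using null_iff[OF p] by (metis zero_less_one)
    define n where "n = max M M'"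
    have "padic_abs_rat p0 (of_nat p0 * x n) < 1"
    proof -
      have "padic_abs_rat p0 (of_nat p0 * x n) \<le> inverse (real p0) * 1"
        unfolding nrm_mult[OF p] nrm_p[OF p] using x(3)[of n] by (intro mult_left_mono) (auto simp: n_def)
      also have "\<dots> < 1" using pr by (simp add: inverse_less_1_iff)
      finally show ?thesis .
    qed
    moreover have "padic_abs_rat p0 (of_nat p0 * x n - 1) < 1" using M' by (simp add: n_def)
    moreover have "padic_abs_rat p0 1 \<le> max (padic_abs_rat p0 (of_nat p0 * x n)) (padic_abs_rat p0 (of_nat p0 * x n - 1))"
      using nrm_diff[OF p, of "of_nat p0 * x n" "of_nat p0 * x n - 1"] by simp
    ultimately show False using nrm_1[OF p] by simp
  qed
  show "\<exists>k u. u \<in> padic_integers \<and> inverse u \<in> padic_integers \<and> u \<noteq> 0 \<and> a = of_nat p0 ^ k * u"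
    if a: "a \<in> padic_integers" "a \<noteq> 0" for a
  proof -
    obtain x M where x: "a = pc x" "x \<in> padic_cauchy p0" "\<And>n. n \<ge> M \<Longrightarrow> padic_abs_rat p0 (x n) \<le> 1"
      using a(1) unfolding padic_integers_def by auto
    have "x \<notin> padic_null p0"
      using a(2) pc_eq_iff[OF x(2) cauchy_const[OF p, of 0]] by (simp add: x(1) pc_zero)
    from pc_decompose[OF x(2) this] obtain k M' u where
      k: "\<And>n. n \<ge> M' \<Longrightarrow> padic_abs_rat p0 (x n) = real p0 powi (- k)"
      and u: "u \<in> padic_integers" "inverse u \<in> padic_integers" "u \<noteq> 0" "pc x = of_nat p0 powi k * u" by metis
    have "real p0 powi (- k) \<le> 1" using k[of "max M M'"] x(3)[of "max M M'"] by simp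
    have "k \<ge> 0"
    proof (rule ccontr)
      assume "\<not> k \<ge> 0"
      hence "0 < - k" by simp
      then obtain j where j: "- k = int (Suc j)" by (metis zero_less_imp_eq_int gr0_implies_Suc)
      have "real p0 powi (- k) = real p0 ^ Suc j" unfolding j by (rule power_int_of_nat)
      moreover have "1 < real p0 ^ Suc j" using pr by (intro one_less_power) auto
      ultimately show False using \<open>real p0 powi (- k) \<le> 1\<close> by linarith
    qed
    then obtain j where "k = int j" using nonneg_int_cases by blast
    thus ?thesis using u x(1) by (intro exI[of _ j] exI[of _ u]) simp
  qed
  show "\<exists>a n. (\<forall>i. a i \<in> padic_integers) \<and> a n \<noteq> 0 \<and> (\<Sum>i\<le>n. a i * x ^ i) = 0" for x
  proof -
    obtain P where P: "P \<noteq> 0" "poly P x = 0" "\<And>i. coeff P i \<in> pc ` padic_cauchy p0"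
      using algebraic_over_pc[of x] by blast
    have "\<exists>e. \<forall>e'\<ge>e. of_nat p0 ^ e' * coeff P i \<in> padic_integers" for i
    proof -
      obtain z where z: "z \<in> padic_cauchy p0" "coeff P i = pc z" using P(3)[of i] by auto
      show ?thesis using pc_scale_integer[OF z(1)] unfolding z(2) by blast
    qed
    then obtain e where e: "\<And>i e'. e i \<le> e' \<Longrightarrow> of_nat p0 ^ e' * coeff P i \<in> padic_integers" by metis
    \<comment> \<open>A common denominator: the sum dominates every \<open>e i\<close> up to the
      degree, and the later coefficients vanish.\<close>
    define E where "E = (\<Sum>i\<le>Polynomial.degree P. e i)"
    have "of_nat p0 ^ E * coeff P i \<in> padic_integers" for i
    proof (cases "i \<le> Polynomial.degree P")
      case True
      hence "e i \<le> E" unfolding E_def by (intro member_le_sum) auto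
      thus ?thesis by (rule e)
    next
      case False
      hence "coeff P i = 0" by (simp add: coeff_eq_0)
      thus ?thesis using e[of i "e i"] by simp
    qed
    moreover have "of_nat p0 ^ E * coeff P (Polynomial.degree P) \<noteq> 0" using P(1) nz by simp
    moreover have "(\<Sum>i\<le>Polynomial.degree P. of_nat p0 ^ E * coeff P i * x ^ i) = 0"
      using P(2) by (simp add: poly_altdef mult.assoc flip: sum_distrib_left)
    ultimately show ?thesis by (intro exI[of _ "\<lambda>i. of_nat p0 ^ E * coeff P i"] exI[of _ "Polynomial.degree P"]) blast
  qed
qed

text \<open>The extended valuation with base \<open>1 / p0\<close> agrees with the limit of norms
  because both take the value \<open>p0 powi (- k)\<close> on \<open>p0 powi k\<close> times a
  unit.\<close>

lemma absolute_value_p0: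
  "\<exists>v. absolute_value (Qp_bar p0) v \<and>
     (\<forall>x\<in>carrier (Qp p0). v (ring.indexed_const (Qp p0) x) = Qp_abs p0 x)"
proof -
  note p = p0(1)
  have pr: "real p0 > 1" using prime_gt_1_nat[OF p] by simp
  interpret dvr_extension padic_integers "of_nat p0" by (rule padic_integers_extension)
  obtain v where v: "\<And>x. 0 \<le> v x" "\<And>x. v x = 0 \<longleftrightarrow> x = 0" "\<And>x y. v (x * y) = v x * v y"
    "\<And>x y. v (x + y) \<le> max (v x) (v y)"
    "\<And>u k. u \<in> padic_integers \<Longrightarrow> inverse u \<in> padic_integers \<Longrightarrow> u \<noteq> 0 \<Longrightarrow> v (of_nat p0 powi k * u) = inverse (real p0) powi k"
    using extends_to_absolute_value[of "inverse (real p0)"] pr by (auto simp: inverse_less_1_iff)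
  define v' where "v' x = v (Abs_padic_closure x)" for x
  have "absolute_value (Qp_bar p0) v'"
    unfolding absolute_value_def
  proof (intro conjI ballI)
    fix x assume x: "x \<in> carrier (Qp_bar p0)"
    show "0 \<le> v' x" "v' x = 0 \<longleftrightarrow> x = \<zero>\<^bsub>Qp_bar p0\<^esub>" using v(1,2) Abs_eq_0_iff[OF x] by (simp_all add: v'_def)
    fix y assume y: "y \<in> carrier (Qp_bar p0)"
    show "v' (x \<otimes>\<^bsub>Qp_bar p0\<^esub> y) = v' x * v' y" using v(3) by (simp add: v'_def Abs_hom[OF x y])
    have "max (v' x) (v' y) \<le> v' x + v' y" using v(1) by (simp add: v'_def)
    moreover have "v' (x \<oplus>\<^bsub>Qp_bar p0\<^esub> y) \<le> max (v' x) (v' y)"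
      using v(4)[of "Abs_padic_closure x" "Abs_padic_closure y"] unfolding v'_def Abs_hom(1)[OF x y] .
    ultimately show "v' (x \<oplus>\<^bsub>Qp_bar p0\<^esub> y) \<le> v' x + v' y" by linarith
  qed
  moreover have "v' (ring.indexed_const (Qp p0) C) = Qp_abs p0 C" if C: "C \<in> carrier (Qp p0)" for C
  proof -
    obtain x where x: "C = cls p0 x" "x \<in> padic_cauchy p0" using C by (auto simp: carrier_Qp[OF p])
    have v': "v' (ring.indexed_const (Qp p0) C) = v (pc x)" by (simp add: v'_def pc_def x(1))
    show ?thesis
    proof (cases "x \<in> padic_null p0")
      case True
      have "pc x = 0" using True pc_eq_iff[OF x(2) cauchy_const[OF p, of 0]] by (simp add: pc_zero)
      moreover have "Qp_abs p0 C = 0"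
        unfolding x(1) by (rule Qp_abs_cls[OF p x(2)]) (use True in \<open>simp add: padic_null_def\<close>)
      ultimately show ?thesis using v' v(2) by simp
    next
      case False
      from pc_decompose[OF x(2) False] obtain k M u where
        M: "\<And>n. n \<ge> M \<Longrightarrow> padic_abs_rat p0 (x n) = real p0 powi (- k)"
        and u: "u \<in> padic_integers" "inverse u \<in> padic_integers" "u \<noteq> 0" "pc x = of_nat p0 powi k * u" by metis
      have "Qp_abs p0 C = real p0 powi (- k)"
        unfolding x(1)
      proof (rule Qp_abs_cls[OF p x(2)])
        have "\<forall>\<^sub>F n in sequentially. padic_abs_rat p0 (x n) = real p0 powi (- k)"
          using M by (auto simp: eventually_sequentially)
        thus "(\<lambda>n. padic_abs_rat p0 (x n)) \<longlonglongrightarrow> real p0 powi (- k)" by (rule tendsto_eventually)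
      qed
      thus ?thesis using v' v(5)[OF u(1-3), of k] u(4) by (simp add: power_int_minus power_int_inverse)
    qed
  qed
  ultimately show ?thesis by blast
qed

section \<open>Homomorphisms out of simple number fields\<close>

lemma number_field_closed:
  "of_rat r \<in> number_field t" "t \<in> number_field t" "poly (map_poly of_rat q) t \<in> number_field t"
proof -
  interpret QB: Ring.field qbar_ring by (rule qbar_ring_field)
  show rat: "of_rat r \<in> number_field t" for r
    using QB.simple_extension_incl[of "range to_ac" t] simple_extension_number_field[of t]
    by (auto simp: to_ac_rat)
  show t: "t \<in> number_field t" by (rule generate_field.incl) simp
  show "poly (map_poly of_rat q) t \<in> number_field t"
  proof (induction q)
    case 0
    show ?case using rat[of 0] by simp
  next
    case (pCons a q)
    thus ?case
      using generate_field.eng_add[OF rat generate_field.eng_mult[OF t pCons.IH], of a]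
      by (simp add: map_poly_pCons)
  qed
qed

text \<open>\<open>\<tau>\<close> respects the operations only inside the number field and is
  arbitrary elsewhere, so it is not a \<open>field_hom\<close>; its values on rational numbers are
  therefore derived within that field.\<close>

lemma generate_field_hom_poly:
  fixes \<tau> :: "qbar \<Rightarrow> 'b :: field_char_0"
  assumes 1: "\<tau> 1 = 1"
    and add: "\<And>x y. x \<in> number_field t \<Longrightarrow> y \<in> number_field t \<Longrightarrow> \<tau> (x + y) = \<tau> x + \<tau> y"
    and mult: "\<And>x y. x \<in> number_field t \<Longrightarrow> y \<in> number_field t \<Longrightarrow> \<tau> (x * y) = \<tau> x * \<tau> y"
  shows "\<tau> (poly (map_poly of_rat q) t) = poly (map_poly of_rat q) (\<tau> t)"
proof -
  note K = number_field_closed[where t = t]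
  have nf: "of_nat n \<in> number_field t" "of_int k \<in> number_field t" for n k
    using K(1)[of "of_nat n"] K(1)[of "of_int k"] by simp_all
  have "\<tau> 0 + \<tau> 0 = \<tau> 0 + 0" using add[OF nf(1)[of 0] nf(1)[of 0]] by simp
  hence 0: "\<tau> 0 = 0" by (simp only: add_left_cancel)
  have nat: "\<tau> (of_nat n) = of_nat n" for n
  proof (induction n)
    case (Suc n)
    show ?case using add[OF nf(1)[of 1] nf(1)[of n]] Suc by (simp add: 1)
  qed (simp add: 0)
  have int: "\<tau> (of_int k) = of_int k" for k
  proof (cases k rule: int_cases2)
    case (nonneg n)
    thus ?thesis by (simp add: nat)
  next
    case (nonpos n)
    have "\<tau> (- of_nat n) + \<tau> (of_nat n) = 0"
      using add[OF nf(2)[of k] nf(1)[of n]] nonpos by (simp add: 0)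
    thus ?thesis unfolding nonpos by (simp add: nat eq_neg_iff_add_eq_0)
  qed
  have rat: "\<tau> (of_rat r) = of_rat r" for r
  proof (cases r)
    case (Fract a b)
    hence r: "r = of_int a / of_int b" by (simp add: Fract_of_int_quotient)
    have b: "b \<noteq> 0" using Fract by simp
    have "of_rat r * of_int b = (of_int a :: 'c)" for dummy :: "'c :: field_char_0"
      using b unfolding r of_rat_divide by simp
    hence eq: "of_rat r * of_int b = (of_int a :: qbar)" "of_rat r * of_int b = (of_int a :: 'b)" by blast+
    have "\<tau> (of_rat r) * of_int b = of_rat r * of_int b"
      using mult[OF K(1)[of r] nf(2)[of b]] by (simp add: eq int)
    thus ?thesis using b by simp
  qed
  show ?thesis
  proof (induction q)
    case (pCons a q)
    have "\<tau> (of_rat a + t * poly (map_poly of_rat q) t)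
        = \<tau> (of_rat a) + \<tau> t * \<tau> (poly (map_poly of_rat q) t)"
      using add[OF K(1)[of a] generate_field.eng_mult[OF K(2) K(3), of q, unfolded qbar_ring_simps]]
        mult[OF K(2) K(3)[of q]] by simp
    thus ?case by (simp add: map_poly_pCons rat pCons.IH)
  qed (simp add: 0)
qed

text \<open>An embedding of a number field sends \<open>t\<close> to a root of the rational
  polynomial of its conjugates, and in the closure this polynomial has only the roots
  \<open>\<iota> c\<close>.\<close>

theorem padic_model:
  assumes "prime p"
  shows "padic_model p"
proof (rule p0(2)[OF _ assms])
  obtain \<iota> :: "qbar \<Rightarrow> padic_closure" where \<iota>: "field_hom \<iota>" using embedding_exists by blast
  show "padic_model p0"
    unfolding padic_model_def
  proof (intro conjI absolute_value_p0 bexI[of _ "\<lambda>x. Rep_padic_closure (\<iota> x)"] allI ballI)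
    show "(\<lambda>x. Rep_padic_closure (\<iota> x)) \<in> Ring.ring_hom qbar_ring (Qp_bar p0)"
      by (rule ring_hom_memI) (simp_all add: field_homD[OF \<iota>])
    fix t \<sigma> assume \<sigma>: "\<sigma> \<in> Ring.ring_hom (qbar_ring\<lparr>carrier := number_field t\<rparr>) (Qp_bar p0)"
    define \<tau> where "\<tau> x = Abs_padic_closure (\<sigma> x)" for x
    have cl: "\<sigma> x \<in> carrier (Qp_bar p0)" if "x \<in> number_field t" for x
      using ring_hom_closed[OF \<sigma>] that by simp
    have tau_hom: "\<tau> (x + y) = \<tau> x + \<tau> y" "\<tau> (x * y) = \<tau> x * \<tau> y"
      if "x \<in> number_field t" "y \<in> number_field t" for x y
      using ring_hom_add[OF \<sigma>, of x y] ring_hom_mult[OF \<sigma>, of x y] that cl by (simp_all add: \<tau>_def Abs_hom)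
    obtain q where q: "map_poly of_rat q = (\<Prod>c\<in>conjugates t. [:- c, 1:])" by (rule conjugates_polynomial)
    have "poly (map_poly of_rat q) t = 0"
      using conjugates_self[of t] finite_conjugates[of t] by (auto simp: q poly_prod)
    moreover have "\<tau> (poly (map_poly of_rat q) t) = poly (map_poly of_rat q) (\<tau> t)"
    proof (rule generate_field_hom_poly)
      show "\<tau> 1 = 1" using ring_hom_one[OF \<sigma>] by (simp add: \<tau>_def one_padic_closure_def)
    qed (rule tau_hom; assumption)+
    moreover have "\<tau> 0 = 0"
    proof -
      have "0 \<in> number_field t" using number_field_closed(1)[of 0 t] by simp
      from tau_hom(1)[OF this this] have "\<tau> 0 + \<tau> 0 = \<tau> 0 + 0" by simp
      thus ?thesis by (simp only: add_left_cancel)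
    qed
    ultimately have "\<tau> t \<in> \<iota> ` conjugates t" by (intro root_in_conjugates[OF \<iota> q]) simp
    moreover have "t \<in> number_field t" by (rule generate_field.incl) simp
    ultimately show "\<sigma> t \<in> (\<lambda>x. Rep_padic_closure (\<iota> x)) ` conjugates t"
      using cl[of t] by (auto simp: \<tau>_def) (metis Abs_closed image_iff)
  qed
qed

section \<open>Places and heights\<close>

lemma absolute_value_Qp_bar:
  assumes "prime p"
  shows "absolute_value (Qp_bar p) (Qp_bar_abs p)"
    and "x \<in> carrier (Qp p) \<Longrightarrow> Qp_bar_abs p (ring.indexed_const (Qp p) x) = Qp_abs p x"
proof -
  obtain v where "absolute_value (Qp_bar p) v \<and>
      (\<forall>x\<in>carrier (Qp p). v (ring.indexed_const (Qp p) x) = Qp_abs p x)"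
    using padic_model[OF assms] unfolding padic_model_def by blast
  from someI[of "\<lambda>v. absolute_value (Qp_bar p) v \<and>
      (\<forall>x\<in>carrier (Qp p). v (ring.indexed_const (Qp p) x) = Qp_abs p x)", OF this]
  show "absolute_value (Qp_bar p) (Qp_bar_abs p)"
    "x \<in> carrier (Qp p) \<Longrightarrow> Qp_bar_abs p (ring.indexed_const (Qp p) x) = Qp_abs p x"
    unfolding Qp_bar_abs_def by blast+
qed

definition padic_embedding :: "nat \<Rightarrow> qbar \<Rightarrow> qp_bar" where
  "padic_embedding p = (SOME \<iota>. \<iota> \<in> Ring.ring_hom qbar_ring (Qp_bar p) \<and>
     (\<forall>t. \<forall>\<sigma>\<in>Ring.ring_hom (qbar_ring\<lparr>carrier := number_field t\<rparr>) (Qp_bar p). \<sigma> t \<in> \<iota> ` conjugates t))"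

definition complex_embedding :: "qbar \<Rightarrow> complex" where
  "complex_embedding = (SOME \<iota>. field_hom \<iota>)"

lemma padic_embedding:
  assumes "prime p"
  shows "padic_embedding p \<in> Ring.ring_hom qbar_ring (Qp_bar p)"
    and "\<sigma> \<in> Ring.ring_hom (qbar_ring\<lparr>carrier := number_field t\<rparr>) (Qp_bar p)
      \<Longrightarrow> \<sigma> t \<in> padic_embedding p ` conjugates t"
proof -
  let ?P = "\<lambda>\<iota>. \<iota> \<in> Ring.ring_hom qbar_ring (Qp_bar p) \<and>
     (\<forall>t. \<forall>\<sigma>\<in>Ring.ring_hom (qbar_ring\<lparr>carrier := number_field t\<rparr>) (Qp_bar p). \<sigma> t \<in> \<iota> ` conjugates t)"
  have "\<exists>\<iota>. ?P \<iota>" using padic_model[OF assms] unfolding padic_model_def by blast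
  hence "?P (padic_embedding p)" unfolding padic_embedding_def by (rule someI_ex)
  thus "padic_embedding p \<in> Ring.ring_hom qbar_ring (Qp_bar p)"
    "\<sigma> \<in> Ring.ring_hom (qbar_ring\<lparr>carrier := number_field t\<rparr>) (Qp_bar p)
      \<Longrightarrow> \<sigma> t \<in> padic_embedding p ` conjugates t" by blast+
qed

lemma complex_embedding: "field_hom complex_embedding"
  unfolding complex_embedding_def by (rule someI_ex[OF embedding_exists])

text \<open>The index \<open>0\<close> stands for the infinite place.\<close>

definition place :: "nat \<Rightarrow> qbar \<Rightarrow> real" where
  "place n x = (if n = 0 then cmod (complex_embedding x) else Qp_bar_abs n (padic_embedding n x))"

definition places :: "nat set" where
  "places = insert 0 {p. prime p}"

lemma place_prime:
  assumes p: "prime p"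
  shows "0 \<le> place p x" "place p x = 0 \<longleftrightarrow> x = 0" "place p (x * y) = place p x * place p y"
    "place p (x + y) \<le> place p x + place p y" "place p (of_nat n) = padic_abs_rat p (of_nat n)"
proof -
  interpret L: Ring.field "Qp_bar p" by (rule Qp_bar_field[OF p])
  have p0: "p \<noteq> 0" using p by auto
  note av = absolute_value_Qp_bar(1)[OF p, unfolded absolute_value_def]
  note \<iota> = padic_embedding(1)[OF p]
  let ?\<iota> = "padic_embedding p"
  have cl: "?\<iota> z \<in> carrier (Qp_bar p)" for z using ring_hom_closed[OF \<iota>] by simp
  have add: "?\<iota> (x + y) = ?\<iota> x \<oplus>\<^bsub>Qp_bar p\<^esub> ?\<iota> y" for x y using ring_hom_add[OF \<iota>, of x y] by simp
  have mult: "?\<iota> (x * y) = ?\<iota> x \<otimes>\<^bsub>Qp_bar p\<^esub> ?\<iota> y" for x y using ring_hom_mult[OF \<iota>, of x y] by simp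
  have one: "?\<iota> 1 = \<one>\<^bsub>Qp_bar p\<^esub>" using ring_hom_one[OF \<iota>] by simp
  have zero: "?\<iota> 0 = \<zero>\<^bsub>Qp_bar p\<^esub>"
    using ring_hom_zero[OF \<iota> field.is_ring[OF qbar_ring_field] L.is_ring] by simp
  have "?\<iota> x = \<zero>\<^bsub>Qp_bar p\<^esub> \<longleftrightarrow> x = 0"
  proof
    assume x: "?\<iota> x = \<zero>\<^bsub>Qp_bar p\<^esub>"
    show "x = 0"
    proof (rule ccontr)
      assume "x \<noteq> 0"
      hence "?\<iota> x \<otimes>\<^bsub>Qp_bar p\<^esub> ?\<iota> (inverse x) = \<one>\<^bsub>Qp_bar p\<^esub>" by (simp add: one flip: mult)
      thus False using cl x by simp
    qed
  qed (simp add: zero)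
  thus "place p x = 0 \<longleftrightarrow> x = 0" using av cl p0 by (simp add: place_def)
  show "0 \<le> place p x" using av cl p0 by (simp add: place_def)
  show "place p (x * y) = place p x * place p y" using av cl p0 by (simp add: place_def mult)
  show "place p (x + y) \<le> place p x + place p y" using av cl p0 by (simp add: place_def add)
  have "?\<iota> (of_nat n) = ring.indexed_const (Qp p) (cls p (\<lambda>_. of_nat n))"
  proof (induction n)
    case 0
    interpret K: Ring.field "Qp p" by (rule Qp_field[OF p])
    have "cls p (\<lambda>_. 0) = \<zero>\<^bsub>Qp p\<^esub>"
      using cls_zero_iff[OF p cauchy_const[OF p]] null_0[OF p] by blast
    thus ?case using ring_hom_zero[OF indexed_const_hom[OF p] K.is_ring L.is_ring] by (simp add: zero)
  next
    case (Suc n)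
    have c: "(\<lambda>_. c) \<in> carrier (padic_cauchy_ring p)" "cls p (\<lambda>_. c) \<in> carrier (Qp p)" for c
      using cauchy_const[OF p] carrier_Qp[OF p] cr_simps[OF p] by auto
    have "cls p (\<lambda>_. of_nat (Suc n)) = cls p (\<lambda>_. 1) \<oplus>\<^bsub>Qp p\<^esub> cls p (\<lambda>_. of_nat n)"
      using ring_hom_add[OF cls_hom[OF p] c(1)[of 1] c(1)[of "of_nat n"]] cr_simps[OF p] by simp
    moreover have "cls p (\<lambda>_. 1) = \<one>\<^bsub>Qp p\<^esub>" using ring_hom_one[OF cls_hom[OF p]] cr_simps[OF p] by simp
    ultimately show ?case
      using ring_hom_add[OF indexed_const_hom[OF p] c(2) c(2), of 1 "of_nat n"]
        ring_hom_one[OF indexed_const_hom[OF p]] Suc by (simp add: add one)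
  qed
  moreover have "cls p (\<lambda>_. of_nat n) \<in> carrier (Qp p)"
    using cauchy_const[OF p] carrier_Qp[OF p] by auto
  moreover have "Qp_abs p (cls p (\<lambda>_. of_nat n)) = padic_abs_rat p (of_nat n)"
    by (rule Qp_abs_cls[OF p cauchy_const[OF p]]) simp
  ultimately show "place p (of_nat n) = padic_abs_rat p (of_nat n)"
    using absolute_value_Qp_bar(2)[OF p] p0 by (simp add: place_def)
qed

text \<open>\<open>absolute_value\<close> only provides the triangle inequality. The binomial
  theorem yields \<open>v (x + y) ^ n \<le> (n + 1) * M ^ n\<close>, and an exponential with base
  above 1 would outgrow \<open>n + 1\<close>.\<close>

lemma ultrametric_of_bounded_naturals:
  fixes v :: "'a :: field \<Rightarrow> real"
  assumes nonneg: "\<And>x. 0 \<le> v x" and zero: "\<And>x. v x = 0 \<longleftrightarrow> x = 0"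
    and mult: "\<And>x y. v (x * y) = v x * v y" and add: "\<And>x y. v (x + y) \<le> v x + v y"
    and nat: "\<And>n. v (of_nat n) \<le> 1"
  shows "v (x + y) \<le> max (v x) (v y)"
proof (rule ccontr)
  define M where "M = max (v x) (v y)"
  assume "\<not> ?thesis"
  hence less: "M < v (x + y)" by (simp only: M_def not_le)
  have M0: "0 < M"
  proof (rule ccontr)
    assume "\<not> 0 < M"
    hence "x = 0" "y = 0" using nonneg[of x] nonneg[of y] zero[of x] zero[of y] by (auto simp: M_def)
    thus False using less zero[of 0] nonneg[of 0] by (simp add: M_def)
  qed
  have one: "v 1 = 1" using mult[of 1 1] zero[of 1] by simp
  have power: "v (a ^ n) = v a ^ n" for a n by (induction n) (simp_all add: one mult)
  have sum: "v (\<Sum>k\<in>A. h k) \<le> (\<Sum>k\<in>A. v (h k))" for h :: "nat \<Rightarrow> 'a" and A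
  proof (induction A rule: infinite_finite_induct)
    case (insert a A)
    thus ?case using add[of "h a" "sum h A"] by simp
  qed (use zero[of 0] in auto)
  define c where "c = v (x + y) / M"
  have c: "1 < c" using less M0 by (simp add: c_def)
  have "c ^ n \<le> real n + 1" for n
  proof -
    have "v (x + y) ^ n = v (\<Sum>k\<le>n. of_nat (n choose k) * x ^ k * y ^ (n - k))"
      by (simp add: binomial_ring flip: power)
    also have "\<dots> \<le> (\<Sum>k\<le>n. v (of_nat (n choose k) * x ^ k * y ^ (n - k)))" by (rule sum)
    also have "\<dots> \<le> (\<Sum>k\<le>n. 1 * M ^ k * M ^ (n - k))"
      unfolding mult power
      by (intro sum_mono mult_mono power_mono nat) (auto simp: M_def nonneg intro!: mult_nonneg_nonneg simp: le_max_iff_disj)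
    also have "\<dots> = (real n + 1) * M ^ n" by (simp flip: power_add)
    finally show ?thesis using M0 by (simp add: c_def power_divide divide_simps)
  qed
  moreover have "(\<lambda>n. real n / c ^ n + 1 / c ^ n) \<longlonglongrightarrow> 0 + 0"
    using c by (intro tendsto_add lim_n_over_pown LIMSEQ_divide_realpow_zero) auto
  hence "eventually (\<lambda>n. real n / c ^ n + 1 / c ^ n < 1) sequentially"
    by (rule order_tendstoD) simp
  then obtain n where "real n / c ^ n + 1 / c ^ n < 1" by (auto simp: eventually_sequentially)
  hence "(real n + 1) / c ^ n < 1" by (simp add: add_divide_distrib)
  hence "real n + 1 < c ^ n" using c by (simp add: divide_simps)
  ultimately show False by (meson not_le)
qed

lemma place_nat_le_1: "prime p \<Longrightarrow> place p (of_nat n) \<le> 1"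
  using nrm_int_le_1[of p "int n"] by (simp add: place_prime(5))

lemma quasi_abs_place_prime: "prime p \<Longrightarrow> quasi_abs (place p) 1"
  by unfold_locales
    (use place_prime ultrametric_of_bounded_naturals[of "place p"] place_nat_le_1 in auto)

lemma quasi_abs_mono:
  assumes "quasi_abs v \<kappa>" "\<kappa> \<le> \<kappa>'"
  shows "quasi_abs v \<kappa>'"
proof -
  interpret quasi_abs v \<kappa> by (rule assms(1))
  show ?thesis
  proof unfold_locales
    fix x y
    have "v (x + y) \<le> \<kappa> * max (v x) (v y)" by (rule add_le)
    also have "\<dots> \<le> \<kappa>' * max (v x) (v y)" using assms(2) by (intro mult_right_mono) (auto simp: le_max_iff_disj)
    finally show "v (x + y) \<le> \<kappa>' * max (v x) (v y)" .
  qed (use assms(2) \<kappa>_ge_1 mult in auto)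
qed

lemma quasi_abs_comp:
  assumes "quasi_abs v \<kappa>" "field_hom \<sigma>"
  shows "quasi_abs (\<lambda>x. v (\<sigma> x)) \<kappa>"
proof -
  interpret quasi_abs v \<kappa> by (rule assms(1))
  show ?thesis
    by unfold_locales (use \<kappa>_ge_1 mult add_le in \<open>simp_all add: field_homD[OF assms(2)] field_hom_eq_0_iff[OF assms(2)]\<close>)
qed

text \<open>
  The constants at small primes are larger than the ultrametric inequality requires, so that
  \<open>1 \<le> \<kappa> |m|\<close> holds for all \<open>1 \<le> m \<le> d\<close>.
\<close>

definition place_const :: "nat \<Rightarrow> nat \<Rightarrow> real" where
  "place_const d n = (if n = 0 then 2 else if n \<le> d then real d else 1)"

lemma place_const_ge_1: "1 \<le> place_const d n"
  by (simp add: place_const_def)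

lemma quasi_abs_place:
  assumes "n \<in> places"
  shows "quasi_abs (place n) (place_const d n)"
proof (cases "n = 0")
  case True
  have "quasi_abs cmod 2"
    by unfold_locales (auto simp: norm_mult intro: order_trans[OF norm_triangle_ineq])
  from quasi_abs_comp[OF this complex_embedding] show ?thesis
    using True by (simp add: place_def[abs_def] place_const_def)
next
  case False
  thus ?thesis
    using assms by (intro quasi_abs_mono[OF quasi_abs_place_prime place_const_ge_1]) (simp add: places_def)
qed

text \<open>The inverse of the p-adic size of \<open>m\<close> is the power of \<open>p\<close>
  dividing \<open>m\<close>, which is at most \<open>d\<close> in general and equal to 1 for
  \<open>p > d\<close>.\<close>

lemma place_const_nat:
  assumes n: "n \<in> places" and m: "1 \<le> m" "m \<le> d"
  shows "1 \<le> place_const d n * place n (of_nat m)"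
proof (cases "n = 0")
  case True
  thus ?thesis using m by (simp add: place_const_def place_def field_homD(8)[OF complex_embedding])
next
  case False
  hence p: "prime n" using n by (simp add: places_def)
  define k where "k = multiplicity (int n) (int m)"
  have "padic_abs_rat n (of_int (int m) / of_int 1) = real n powi (- int k)"
    using padic_abs_rat_frac[OF p, of "int m" 1] m by (simp add: k_def)
  hence v: "place n (of_nat m) = inverse (real n ^ k)"
    using place_prime(5)[OF p] by (simp add: power_int_minus)
  have dvd: "n ^ k dvd m" using multiplicity_dvd[of "int n" "int m"] by (simp add: k_def flip: of_nat_power)
  hence le: "n ^ k \<le> m" using m by (intro dvd_imp_le) auto
  have n0: "0 < real n ^ k" using False by simp
  show ?thesis
  proof (cases "n \<le> d")
    case True
    have "real n ^ k \<le> real d" using le m by (metis of_nat_le_iff of_nat_power order_trans)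
    thus ?thesis using True False n0 by (simp add: v place_const_def divide_simps)
  next
    case n_gt: False
    have "k = 0"
    proof (rule ccontr)
      assume "k \<noteq> 0"
      hence "n ^ 1 \<le> n ^ k" using False by (intro power_increasing) auto
      thus False using le m n_gt by simp
    qed
    thus ?thesis using False n_gt by (simp add: v place_const_def)
  qed
qed

text \<open>In an integral relation for \<open>t\<close>, a conjugate with
  \<open>place p c > 1\<close> lets the top term dominate unless \<open>p\<close> divides the
  leading coefficient; so only these divisors can occur.\<close>

lemma finite_bad_primes: "finite {p. prime p \<and> (\<exists>c\<in>conjugates t. 1 < place p c)}"
proof -
  obtain q :: "rat poly" where q: "q \<noteq> 0" "poly (map_poly of_rat q) t = 0" by (rule qbar_algebraic)
  have "\<exists>N :: nat. N \<noteq> 0 \<and> (\<exists>a :: nat \<Rightarrow> int. \<forall>i\<le>Polynomial.degree q. of_nat N * coeff q i = of_int (a i))"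
    if "True"
  proof -
    define D where "D = (\<Prod>i\<le>Polynomial.degree q. nat (snd (quotient_of (coeff q i))))"
    have dpos: "0 < snd (quotient_of r)" for r :: rat by (metis prod.collapse quotient_of_denom_pos)
    have "D \<noteq> 0" using dpos by (simp add: D_def not_le)
    moreover have "\<exists>a :: int. of_nat D * coeff q i = of_int a" if i: "i \<le> Polynomial.degree q" for i
    proof -
      have "nat (snd (quotient_of (coeff q i))) dvd D" unfolding D_def using i by (intro dvd_prodI) auto
      then obtain k where k: "D = nat (snd (quotient_of (coeff q i))) * k" by (elim dvdE)
      have "coeff q i = of_int (fst (quotient_of (coeff q i))) / of_int (snd (quotient_of (coeff q i)))"
        by (rule quotient_of_div) simp
      hence "of_nat D * coeff q i = of_int (fst (quotient_of (coeff q i)) * int k)"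
        using dpos[of "coeff q i"] unfolding k by (simp add: divide_simps mult.commute)
      thus ?thesis by blast
    qed
    ultimately show ?thesis by metis
  qed
  then obtain D a where D: "D \<noteq> 0"
    "\<And>i. i \<le> Polynomial.degree q \<Longrightarrow> of_nat D * coeff q i = of_int (a i)" by blast
  define m where "m = Polynomial.degree q"
  have am: "a m \<noteq> 0"
  proof
    assume "a m = 0"
    hence "of_nat D * coeff q m = 0" using D(2)[of m] by (simp add: m_def)
    thus False using D(1) q(1) by (simp add: m_def)
  qed
  have eq: "(\<Sum>i\<le>m. of_int (a i) * t ^ i) = 0"
  proof -
    have "(\<Sum>i\<le>m. of_int (a i) * t ^ i) = (\<Sum>i\<le>m. of_nat D * (of_rat (coeff q i) * t ^ i))"
    proof (rule sum.cong)
      fix i assume "i \<in> {..m}"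
      hence "of_rat (of_nat D * coeff q i) = (of_rat (of_int (a i)) :: qbar)" using D(2)[of i] by (simp add: m_def)
      hence "of_nat D * of_rat (coeff q i) = (of_int (a i) :: qbar)" by (simp add: of_rat_mult)
      thus "of_int (a i) * t ^ i = of_nat D * (of_rat (coeff q i) * t ^ i)" by (simp flip: mult.assoc)
    qed simp
    also have "\<dots> = of_nat D * poly (map_poly of_rat q) t"
      by (simp add: poly_altdef coeff_map_poly degree_map_poly sum_distrib_left m_def)
    finally show ?thesis using q(2) by simp
  qed
  have "p dvd nat \<bar>a m\<bar>" if p: "prime p" and c: "c \<in> conjugates t" "1 < place p c" for p c
  proof (rule ccontr)
    assume ndvd: "\<not> p dvd nat \<bar>a m\<bar>"
    interpret V: quasi_abs "place p" 1 by (rule quasi_abs_place_prime[OF p])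
    obtain \<sigma> where \<sigma>: "field_hom \<sigma>" "c = \<sigma> t" using c(1) by (auto simp: conjugates_def)
    have abs: "place p (of_int k) = padic_abs_rat p (of_int k)" for k
      by (cases k rule: int_cases2) (simp_all add: place_prime(5)[OF p] nrm_minus[OF p])
    have am1: "place p (of_int (a m)) = 1"
    proof -
      have "\<not> int p dvd a m" using ndvd by (simp flip: int_dvd_int_iff)
      hence "multiplicity (int p) (a m) = 0" by (rule not_dvd_imp_multiplicity_0)
      thus ?thesis using padic_abs_rat_frac[OF p am, of 1] by (simp add: abs)
    qed
    have "(\<Sum>i\<le>m. of_int (a i) * c ^ i) = \<sigma> (\<Sum>i\<le>m. of_int (a i) * t ^ i)"
      by (simp add: \<sigma>(2) field_homD[OF \<sigma>(1)] field_hom_of_int[OF \<sigma>(1)])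
    hence "(\<Sum>i\<le>m. of_int (a i) * c ^ i) = 0" unfolding eq by (simp add: field_homD[OF \<sigma>(1)])
    hence "of_int (a m) * c ^ m = - (\<Sum>i<m. of_int (a i) * c ^ i)"
      by (simp add: eq_neg_iff_add_eq_0 add.commute flip: lessThan_Suc_atMost)
    hence "place p (of_int (a m) * c ^ m) = place p (\<Sum>i<m. of_int (a i) * c ^ i)" by (simp only: V.minus)
    hence main: "place p c ^ m = place p (\<Sum>i<m. of_int (a i) * c ^ i)"
      by (simp add: V.mult V.power am1)
    have m0: "m \<noteq> 0"
    proof
      assume "m = 0"
      thus False using main by simp
    qed
    have "place p (\<Sum>i\<in>A. of_int (a i) * c ^ i) \<le> place p c ^ (m - 1)" if "finite A" "A \<subseteq> {..<m}" for A
      using that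
    proof (induction A)
      case empty
      thus ?case by simp
    next
      case (insert i A)
      have "place p (of_int (a i) * c ^ i) \<le> 1 * place p c ^ (m - 1)"
        unfolding V.mult V.power using insert.prems c(2) nrm_int_le_1[OF p, of "a i"]
        by (intro mult_mono power_increasing) (auto simp: abs)
      moreover have "place p (\<Sum>i\<in>A. of_int (a i) * c ^ i) \<le> place p c ^ (m - 1)" using insert by simp
      moreover have "place p (of_int (a i) * c ^ i + (\<Sum>i\<in>A. of_int (a i) * c ^ i))
          \<le> 1 * max (place p (of_int (a i) * c ^ i)) (place p (\<Sum>i\<in>A. of_int (a i) * c ^ i))"
        by (rule V.add_le)
      ultimately show ?case using insert.hyps by simp
    qed
    from this[of "{..<m}"] have "place p c ^ m \<le> place p c ^ (m - 1)" by (simp add: main)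
    thus False using c(2) m0 power_strict_increasing[of "m - 1" m "place p c"] by simp
  qed
  hence "{p. prime p \<and> (\<exists>c\<in>conjugates t. 1 < place p c)} \<subseteq> {p. p dvd nat \<bar>a m\<bar>}" by blast
  moreover have "finite {p. p dvd nat \<bar>a m\<bar>}" using am by (intro finite_divisors_nat) simp
  ultimately show ?thesis by (rule finite_subset)
qed

section \<open>The height as a finite sum over places and conjugates\<close>

lemma ring_hom_number_field_eqI:
  fixes L (structure)
  assumes L: "Ring.field L"
    and \<sigma>: "\<sigma> \<in> Ring.ring_hom (qbar_ring\<lparr>carrier := number_field t\<rparr>) L"
    and \<tau>: "\<tau> \<in> Ring.ring_hom (qbar_ring\<lparr>carrier := number_field t\<rparr>) L"
    and eq: "\<sigma> t = \<tau> t" and x: "x \<in> number_field t"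
  shows "\<sigma> x = \<tau> x"
proof -
  interpret L: Ring.field L by (rule L)
  note K = generate_field.one[of qbar_ring "{t}"] generate_field.a_inv[of _ qbar_ring "{t}"]
    generate_field.m_inv[of _ qbar_ring "{t}"] generate_field.eng_add[of _ qbar_ring "{t}"]
    generate_field.eng_mult[of _ qbar_ring "{t}"]
  have K0: "0 \<in> number_field t" using number_field_closed(1)[of 0 t] by simp
  have hom: "\<phi> a \<in> carrier L" "\<phi> (a + b) = \<phi> a \<oplus> \<phi> b" "\<phi> (a * b) = \<phi> a \<otimes> \<phi> b" "\<phi> 1 = \<one>"
    if "\<phi> \<in> Ring.ring_hom (qbar_ring\<lparr>carrier := number_field t\<rparr>) L" "a \<in> number_field t" "b \<in> number_field t"
    for \<phi> a b
    using ring_hom_closed[OF that(1), of a] ring_hom_add[OF that(1), of a b]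
      ring_hom_mult[OF that(1), of a b] ring_hom_one[OF that(1)] that(2,3) by simp_all
  have hom0: "\<phi> 0 = \<zero>" if \<phi>: "\<phi> \<in> Ring.ring_hom (qbar_ring\<lparr>carrier := number_field t\<rparr>) L" for \<phi>
    using hom(2)[OF \<phi> K0 K0] hom(1)[OF \<phi> K0 K0] by (simp add: L.add.l_cancel_one')
  from x show ?thesis
  proof (induction x rule: generate_field.induct)
    case one
    show ?case using hom(4)[OF \<sigma> K0 K0] hom(4)[OF \<tau> K0 K0] by simp
  next
    case (incl h)
    thus ?case using eq by simp
  next
    case (a_inv h)
    have m: "- h \<in> number_field t" using K(2)[OF a_inv.hyps] by simp
    have "\<sigma> h \<oplus> \<sigma> (- h) = \<sigma> h \<oplus> \<tau> (- h)"
      using hom(2)[OF \<sigma> a_inv.hyps m] hom(2)[OF \<tau> a_inv.hyps m] a_inv.IH hom0[OF \<sigma>] hom0[OF \<tau>] by simp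
    thus ?case using hom(1)[OF \<sigma>] hom(1)[OF \<tau>] a_inv.hyps m by (simp add: L.add.l_cancel)
  next
    case (m_inv h)
    have h0: "h \<noteq> 0" using m_inv.hyps by simp
    have m: "inverse h \<in> number_field t" using K(3)[OF m_inv.hyps] h0 by simp
    have one: "\<sigma> h \<otimes> \<sigma> (inverse h) = \<one>" "\<tau> h \<otimes> \<tau> (inverse h) = \<one>"
      using hom(3,4)[OF \<sigma> m_inv.hyps(1) m] hom(3,4)[OF \<tau> m_inv.hyps(1) m] h0 by simp_all
    hence "\<sigma> h \<noteq> \<zero>" using hom(1)[OF \<sigma>] m by (metis L.l_null L.one_not_zero)
    moreover have "\<sigma> h \<otimes> \<sigma> (inverse h) = \<sigma> h \<otimes> \<tau> (inverse h)" using one m_inv.IH by simp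
    ultimately show ?case using hom(1)[OF \<sigma>] hom(1)[OF \<tau>] m_inv.hyps m h0 by (simp add: L.m_lcancel)
  next
    case (eng_add a b)
    thus ?case using hom(2)[OF \<sigma>] hom(2)[OF \<tau>] by simp
  next
    case (eng_mult a b)
    thus ?case using hom(3)[OF \<sigma>] hom(3)[OF \<tau>] by simp
  qed
qed

text \<open>An embedding is determined by the image of \<open>t\<close>. The possible images are the
  \<open>\<iota> c\<close>, each realised by restricting \<open>\<iota>\<close> composed with an
  automorphism.\<close>

lemma sum_embeddings:
  fixes L (structure) and F :: "_ \<Rightarrow> real"
  assumes L: "Ring.field L" and \<iota>: "\<iota> \<in> Ring.ring_hom qbar_ring L"
    and conj: "\<And>\<sigma>. \<sigma> \<in> Ring.ring_hom (qbar_ring\<lparr>carrier := number_field t\<rparr>) L \<Longrightarrow> \<sigma> t \<in> \<iota> ` conjugates t"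
  shows "(\<Sum>\<sigma>\<in>embeddings (number_field t) L. F (\<sigma> t)) = (\<Sum>c\<in>conjugates t. F (\<iota> c))"
proof -
  interpret L: Ring.field L by (rule L)
  have hom: "\<iota> a \<in> carrier L" "\<iota> (a + b) = \<iota> a \<oplus> \<iota> b" "\<iota> (a * b) = \<iota> a \<otimes> \<iota> b" "\<iota> 1 = \<one>" for a b
    using ring_hom_closed[OF \<iota>, of a] ring_hom_add[OF \<iota>, of a b] ring_hom_mult[OF \<iota>, of a b] ring_hom_one[OF \<iota>]
    by simp_all
  have inj: "inj \<iota>"
  proof (rule injI, rule ccontr)
    fix x y assume eq: "\<iota> x = \<iota> y" and "x \<noteq> y"
    hence "\<iota> (x - y) \<otimes> \<iota> (inverse (x - y)) = \<one>" by (simp add: hom(4) flip: hom(3))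
    moreover have "\<iota> (x - y) = \<zero>" using hom(2)[of "x - y" y] hom(1)[of "x - y"] hom(1)[of y] eq
      by (simp add: L.add.r_cancel_one')
    ultimately show False using hom(1) by simp
  qed
  have tK: "t \<in> number_field t" by (rule number_field_closed)
  have "bij_betw (\<lambda>\<sigma>. \<sigma> t) (embeddings (number_field t) L) (\<iota> ` conjugates t)"
    unfolding bij_betw_def
  proof (intro conjI inj_onI subset_antisym subsetI)
    fix \<sigma> \<tau> assume "\<sigma> \<in> embeddings (number_field t) L" "\<tau> \<in> embeddings (number_field t) L" "\<sigma> t = \<tau> t"
    thus "\<sigma> = \<tau>" unfolding embeddings_def
      by (intro extensionalityI[of \<sigma> "number_field t"] ring_hom_number_field_eqI[OF L]) auto
  next
    fix y assume "y \<in> (\<lambda>\<sigma>. \<sigma> t) ` embeddings (number_field t) L"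
    thus "y \<in> \<iota> ` conjugates t" using conj by (auto simp: embeddings_def)
  next
    fix y assume "y \<in> \<iota> ` conjugates t"
    then obtain g where g: "field_hom g" "y = \<iota> (g t)" by (auto simp: conjugates_def)
    have K: "1 \<in> number_field t" "\<And>a b. a \<in> number_field t \<Longrightarrow> b \<in> number_field t \<Longrightarrow> a + b \<in> number_field t"
      "\<And>a b. a \<in> number_field t \<Longrightarrow> b \<in> number_field t \<Longrightarrow> a * b \<in> number_field t"
      using generate_field.one[of qbar_ring "{t}"] generate_field.eng_add[of _ qbar_ring "{t}"]
        generate_field.eng_mult[of _ qbar_ring "{t}"] by simp_all
    have emb: "restrict (\<lambda>x. \<iota> (g x)) (number_field t) \<in> embeddings (number_field t) L"
      unfolding embeddings_def
    proof (intro IntI ring_hom_memI)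
    qed (use K in \<open>auto simp: hom field_homD[OF g(1)]\<close>)
    have "y = restrict (\<lambda>x. \<iota> (g x)) (number_field t) t" using tK g(2) by simp
    thus "y \<in> (\<lambda>\<sigma>. \<sigma> t) ` embeddings (number_field t) L"
      unfolding image_iff by (rule bexI[OF _ emb])
  qed
  hence "(\<Sum>\<sigma>\<in>embeddings (number_field t) L. F (\<sigma> t)) = (\<Sum>y\<in>\<iota> ` conjugates t. F y)"
    by (rule sum.reindex_bij_betw)
  also have "\<dots> = (\<Sum>c\<in>conjugates t. F (\<iota> c))"
    using inj by (subst sum.reindex) (auto intro: inj_on_subset)
  finally show ?thesis .
qed

lemma log_plus_nonneg [simp]: "0 \<le> log_plus x"
  by (simp add: log_plus_def)

lemma log_plus_eq_0: "x \<le> 1 \<Longrightarrow> log_plus x = 0"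
  by (simp add: log_plus_def)

text \<open>The sum over all primes has only finitely many nonzero terms, so it is no more than a
  finite sum over any set \<open>P\<close> containing the bad primes.\<close>

lemma weil_height_eq:
  assumes P: "finite P" "P \<subseteq> places" "0 \<in> P"
    and good: "\<And>p c. prime p \<Longrightarrow> p \<notin> P \<Longrightarrow> c \<in> conjugates t \<Longrightarrow> place p c \<le> 1"
  shows "weil_height t = (\<Sum>n\<in>P. \<Sum>c\<in>conjugates t. log_plus (place n c)) / card (conjugates t)"
proof -
  have padic: "(\<Sum>\<sigma>\<in>embeddings (number_field t) (Qp_bar p). log_plus (Qp_bar_abs p (\<sigma> t)))
      = (\<Sum>c\<in>conjugates t. log_plus (place p c))" if p: "prime p" for p
  proof -
    have "p \<noteq> 0" using p by auto
    moreover have "(\<Sum>\<sigma>\<in>embeddings (number_field t) (Qp_bar p). log_plus (Qp_bar_abs p (\<sigma> t)))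
        = (\<Sum>c\<in>conjugates t. log_plus (Qp_bar_abs p (padic_embedding p c)))"
      by (rule sum_embeddings[where F = "\<lambda>x. log_plus (Qp_bar_abs p x)",
            OF Qp_bar_field[OF p] padic_embedding(1)[OF p]]) (rule padic_embedding(2)[OF p])
    ultimately show ?thesis by (simp add: place_def)
  qed
  have complex: "(\<Sum>\<sigma>\<in>embeddings (number_field t) ring_of_type_algebra. log_plus (cmod (\<sigma> t)))
      = (\<Sum>c\<in>conjugates t. log_plus (place 0 c))"
  proof -
    let ?C = "ring_of_type_algebra :: complex ring"
    have sim: "\<one>\<^bsub>?C\<^esub> = 1" "x \<oplus>\<^bsub>?C\<^esub> y = x + y" "x \<otimes>\<^bsub>?C\<^esub> y = x * y" "carrier ?C = UNIV" for x y
      by (simp_all add: ring_of_type_algebra_def)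
    have "(\<Sum>\<sigma>\<in>embeddings (number_field t) ?C. log_plus (cmod (\<sigma> t)))
      = (\<Sum>c\<in>conjugates t. log_plus (cmod (complex_embedding c)))"
    proof (rule sum_embeddings[where F = "\<lambda>x. log_plus (cmod x)"])
      show "Ring.field ?C" by (rule field_from_type_algebra)
      show "complex_embedding \<in> Ring.ring_hom qbar_ring ?C"
        by (rule ring_hom_memI) (simp_all add: sim field_homD[OF complex_embedding])
      fix \<sigma> assume \<sigma>: "\<sigma> \<in> Ring.ring_hom (qbar_ring\<lparr>carrier := number_field t\<rparr>) ?C"
      obtain q where q: "map_poly of_rat q = (\<Prod>c\<in>conjugates t. [:- c, 1:])" by (rule conjugates_polynomial)
      have "poly (map_poly of_rat q) t = 0"
        using conjugates_self[of t] finite_conjugates[of t] by (auto simp: q poly_prod)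
      moreover have hom: "\<sigma> (x + y) = \<sigma> x + \<sigma> y" "\<sigma> (x * y) = \<sigma> x * \<sigma> y"
        if "x \<in> number_field t" "y \<in> number_field t" for x y
        using ring_hom_add[OF \<sigma>, of x y] ring_hom_mult[OF \<sigma>, of x y] that by (simp_all add: sim)
      moreover have "\<sigma> (poly (map_poly of_rat q) t) = poly (map_poly of_rat q) (\<sigma> t)"
      proof (rule generate_field_hom_poly)
        show "\<sigma> 1 = 1" using ring_hom_one[OF \<sigma>] by (simp add: sim)
      qed (rule hom; assumption)+
      moreover have "\<sigma> 0 = 0"
      proof -
        have "0 \<in> number_field t" using number_field_closed(1)[where r = 0] by simp
        from hom(1)[OF this this] have "\<sigma> 0 + \<sigma> 0 = \<sigma> 0 + 0" by simp
        thus ?thesis by (simp only: add_left_cancel)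
      qed
      ultimately show "\<sigma> t \<in> complex_embedding ` conjugates t"
        by (intro root_in_conjugates[OF complex_embedding q]) simp
    qed
    thus ?thesis by (simp add: place_def)
  qed
  have "(\<Sum>\<^sub>\<infinity>p\<in>{p. prime p}. \<Sum>\<sigma>\<in>embeddings (number_field t) (Qp_bar p). log_plus (Qp_bar_abs p (\<sigma> t)))
      = (\<Sum>\<^sub>\<infinity>p\<in>P - {0}. \<Sum>c\<in>conjugates t. log_plus (place p c))"
  proof (rule infsum_cong_neutral)
    fix p assume "p \<in> {p. prime p} - (P - {0})"
    hence p: "prime p" "p \<notin> P" by auto
    show "(\<Sum>\<sigma>\<in>embeddings (number_field t) (Qp_bar p). log_plus (Qp_bar_abs p (\<sigma> t))) = 0"
      unfolding padic[OF p(1)] using good[OF p] by (simp add: log_plus_eq_0)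
  qed (use P padic in \<open>auto simp: places_def\<close>)
  also have "\<dots> = (\<Sum>n\<in>P - {0}. \<Sum>c\<in>conjugates t. log_plus (place n c))"
    using P by simp
  finally show ?thesis
    unfolding weil_height_def weil_height_over_def complex number_field_degree
    using sum.remove[OF P(1,3), of "\<lambda>n. \<Sum>c\<in>conjugates t. log_plus (place n c)"] by (simp add: add.commute)
qed

text \<open>
  A finite set \<open>\<Gamma>\<close> of automorphisms, one for each restriction to \<open>S\<close>, replaces the Galois group
  of a number field containing \<open>S\<close>.
\<close>

definition transversal :: "qbar set \<Rightarrow> (qbar \<Rightarrow> qbar) set \<Rightarrow> bool" where
  "transversal S \<Gamma> \<longleftrightarrow> finite \<Gamma> \<and> \<Gamma> \<subseteq> {g. field_hom g} \<and>
     (\<forall>h. field_hom h \<longrightarrow> (\<exists>!g\<in>\<Gamma>. \<forall>s\<in>S. g s = h s))"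

lemma transversal_exists:
  assumes "finite S"
  obtains \<Gamma> where "transversal S \<Gamma>"
proof -
  define R where "R = (\<lambda>g :: qbar \<Rightarrow> qbar. restrict g S) ` {g. field_hom g}"
  have "R \<subseteq> (\<Pi>\<^sub>E s\<in>S. conjugates s)" by (auto simp: R_def conjugates_def)
  moreover have "finite (\<Pi>\<^sub>E s\<in>S. conjugates s)" by (rule finite_PiE[OF assms finite_conjugates])
  ultimately have R: "finite R" by (rule finite_subset)
  have "\<forall>r\<in>R. \<exists>g. field_hom g \<and> restrict g S = r" by (auto simp: R_def)
  then obtain G where G: "\<And>r. r \<in> R \<Longrightarrow> field_hom (G r) \<and> restrict (G r) S = r" by metis
  have eq_iff: "restrict g S = restrict h S \<longleftrightarrow> (\<forall>s\<in>S. g s = h s)" for g h :: "qbar \<Rightarrow> qbar"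
    by (auto simp: restrict_def fun_eq_iff)
  have "transversal S (G ` R)"
    unfolding transversal_def
  proof (intro conjI allI impI)
    show "finite (G ` R)" using R by simp
    show "G ` R \<subseteq> {g. field_hom g}" using G by blast
    fix h :: "qbar \<Rightarrow> qbar" assume h: "field_hom h"
    hence hR: "restrict h S \<in> R" by (auto simp: R_def)
    show "\<exists>!g. g \<in> G ` R \<and> (\<forall>s\<in>S. g s = h s)"
      unfolding eq_iff[symmetric]
    proof (rule ex1I[of _ "G (restrict h S)"])
      show "G (restrict h S) \<in> G ` R \<and> restrict (G (restrict h S)) S = restrict h S" using G hR by blast
      fix g assume "g \<in> G ` R \<and> restrict g S = restrict h S"
      thus "g = G (restrict h S)" using G by auto
    qed
  qed
  thus ?thesis by (rule that)
qed

text \<open>By Galois theory this says that \<open>x\<close> lies in the field generated by \<open>S\<close>.\<close>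

definition determined_by :: "qbar set \<Rightarrow> qbar \<Rightarrow> bool" where
  "determined_by S x \<longleftrightarrow> (\<forall>g h :: qbar \<Rightarrow> qbar. field_hom g \<longrightarrow> field_hom h \<longrightarrow> (\<forall>s\<in>S. g s = h s) \<longrightarrow> g x = h x)"

lemma transversal_nonempty: "transversal S \<Gamma> \<Longrightarrow> card \<Gamma> \<noteq> 0"
  using field_hom_id by (auto simp: transversal_def)

text \<open>The fibres of \<open>g \<mapsto> g x\<close> over the conjugates have equal size:
  composing with an automorphism and passing to the representative again maps one fibre injectively
  into another. No group structure on \<open>\<Gamma>\<close> is required.\<close>

lemma transversal_sum:
  fixes F :: "qbar \<Rightarrow> real"
  assumes \<Gamma>: "transversal S \<Gamma>" and x: "determined_by S x"
  shows "(\<Sum>g\<in>\<Gamma>. F (g x)) / card \<Gamma> = (\<Sum>c\<in>conjugates x. F c) / card (conjugates x)"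
proof -
  define fib where "fib c = {g\<in>\<Gamma>. g x = c}" for c
  have fin: "finite \<Gamma>" and hom: "\<And>g. g \<in> \<Gamma> \<Longrightarrow> field_hom g" using \<Gamma> by (auto simp: transversal_def)
  have rep: "\<exists>g\<in>\<Gamma>. \<forall>s\<in>S. g s = h s" if "field_hom h" for h using \<Gamma> that unfolding transversal_def by blast
  have uniq: "g = g'" if "g \<in> \<Gamma>" "g' \<in> \<Gamma>" "\<forall>s\<in>S. g s = g' s" for g g'
    using \<Gamma> hom[OF that(2)] that unfolding transversal_def by blast
  have le: "card (fib c) \<le> card (fib (h c))" if h: "field_hom h" for c h
  proof -
    have "\<forall>g\<in>\<Gamma>. \<exists>g'\<in>\<Gamma>. \<forall>s\<in>S. g' s = h (g s)" using rep[OF field_hom_comp[OF h hom]] by blast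
    then obtain \<phi> where \<phi>: "\<And>g. g \<in> \<Gamma> \<Longrightarrow> \<phi> g \<in> \<Gamma>" "\<And>g s. g \<in> \<Gamma> \<Longrightarrow> s \<in> S \<Longrightarrow> \<phi> g s = h (g s)" by metis
    have "\<phi> g x = h (g x)" if "g \<in> \<Gamma>" for g
      using x field_hom_comp[OF h hom[OF that]] hom[OF \<phi>(1)[OF that]] \<phi>(2)[OF that]
      unfolding determined_by_def by blast
    hence "\<phi> ` fib c \<subseteq> fib (h c)" using \<phi>(1) by (auto simp: fib_def)
    moreover have "inj_on \<phi> (fib c)"
    proof (rule inj_onI)
      fix g g' assume g: "g \<in> fib c" "g' \<in> fib c" "\<phi> g = \<phi> g'"
      have "g s = g' s" if "s \<in> S" for s
        using g \<phi>(2)[of g s] \<phi>(2)[of g' s] that field_hom_inj[OF h] by (auto simp: fib_def inj_def)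
      thus "g = g'" using g uniq by (auto simp: fib_def)
    qed
    ultimately show ?thesis using fin by (intro card_inj_on_le[of \<phi>]) (auto simp: fib_def)
  qed
  have card_fib: "card (fib c) = card (fib x)" if "c \<in> conjugates x" for c
  proof (rule antisym)
    obtain h where h: "field_hom h" "c = h x" using \<open>c \<in> conjugates x\<close> by (auto simp: conjugates_def)
    show "card (fib x) \<le> card (fib c)" using le[OF h(1), of x] h(2) by simp
    have "inv_into UNIV h c = x" using h field_hom_inj[OF h(1)] by simp
    thus "card (fib c) \<le> card (fib x)" using le[OF field_hom_inv[OF h(1)], of c] by simp
  qed
  have decomp: "(\<Sum>g\<in>\<Gamma>. f (g x)) = (\<Sum>c\<in>conjugates x. real (card (fib x)) * f c)" for f :: "qbar \<Rightarrow> real"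
  proof -
    have "(\<Sum>g\<in>\<Gamma>. f (g x)) = (\<Sum>c\<in>conjugates x. \<Sum>g\<in>fib c. f (g x))"
      unfolding fib_def using fin finite_conjugates hom by (intro sum.group[symmetric]) (auto simp: conjugates_def)
    also have "\<dots> = (\<Sum>c\<in>conjugates x. real (card (fib c)) * f c)" by (simp add: fib_def)
    finally show ?thesis using card_fib by simp
  qed
  have "real (card \<Gamma>) = real (card (fib x)) * card (conjugates x)" using decomp[of "\<lambda>_. 1"] by simp
  moreover have "card (fib x) \<noteq> 0" using calculation transversal_nonempty[OF \<Gamma>] by (cases "card (fib x) = 0") auto
  ultimately show ?thesis using decomp[of F] by (simp flip: sum_distrib_left)
qed

text \<open>All conjugates are included so that the bound persists after composing a place with an
  automorphism.\<close>

definition good_places :: "qbar set \<Rightarrow> nat set \<Rightarrow> bool" where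
  "good_places S P \<longleftrightarrow> finite P \<and> P \<subseteq> places \<and> 0 \<in> P \<and>
     (\<forall>p. prime p \<longrightarrow> p \<notin> P \<longrightarrow> (\<forall>s\<in>S. \<forall>c\<in>conjugates s. place p c \<le> 1))"

lemma good_places_exists:
  assumes "finite S"
  obtains P where "good_places S P"
proof -
  define P where "P = insert 0 (\<Union>s\<in>S. {p. prime p \<and> (\<exists>c\<in>conjugates s. 1 < place p c)})"
  have "finite P" unfolding P_def using assms finite_bad_primes by blast
  hence "good_places S P" by (auto simp: good_places_def P_def places_def not_less)
  thus ?thesis by (rule that)
qed

text \<open>One index set for all numbers determined by \<open>S\<close>: heights of numbers of
  different degrees can now be compared term by term.\<close>

lemma weil_height_average:
  assumes \<Gamma>: "transversal S \<Gamma>" and x: "determined_by S x" and P: "good_places {x} P"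
  shows "weil_height x = (\<Sum>n\<in>P. \<Sum>g\<in>\<Gamma>. log_plus (place n (g x))) / card \<Gamma>"
proof -
  have "weil_height x = (\<Sum>n\<in>P. \<Sum>c\<in>conjugates x. log_plus (place n c)) / card (conjugates x)"
    using P by (intro weil_height_eq) (auto simp: good_places_def)
  also have "\<dots> = (\<Sum>n\<in>P. (\<Sum>g\<in>\<Gamma>. log_plus (place n (g x))) / card \<Gamma>)"
    unfolding sum_divide_distrib[of _ P]
    by (intro sum.cong refl transversal_sum[OF \<Gamma> x, symmetric])
  finally show ?thesis by (simp add: sum_divide_distrib)
qed

lemma weil_height_nonneg: "0 \<le> weil_height x"
proof -
  obtain P where P: "good_places {x} P" by (rule good_places_exists[of "{x}"]) auto
  obtain \<Gamma> where \<Gamma>: "transversal {x} \<Gamma>" by (rule transversal_exists[of "{x}"]) auto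
  show ?thesis
    by (subst weil_height_average[OF \<Gamma> _ P]) (auto simp: determined_by_def intro!: sum_nonneg divide_nonneg_nonneg)
qed

lemma poly_determined_by:
  assumes "\<And>i. determined_by S (coeff f i)" "determined_by S x"
  shows "determined_by S (poly f x)"
  unfolding determined_by_def
proof (intro allI impI)
  fix g h :: "qbar \<Rightarrow> qbar"
  assume gh: "field_hom g" "field_hom h" "\<forall>s\<in>S. g s = h s"
  have "g (coeff f i) = h (coeff f i)" "g x = h x" for i
    using assms gh unfolding determined_by_def by blast+
  thus "g (poly f x) = h (poly f x)" by (simp add: poly_altdef field_homD[OF gh(1)] field_homD[OF gh(2)])
qed

lemma good_places_poly:
  assumes f: "\<And>i. good_places {coeff f i} P" and x: "good_places {x} P"
  shows "good_places {poly f x} P"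
  unfolding good_places_def
proof (intro conjI allI impI ballI)
  fix p s c assume p: "prime p" "p \<notin> P" and s: "s \<in> {poly f x}" and c: "c \<in> conjugates s"
  obtain g where g: "field_hom g" "c = g (poly f x)" using s c by (auto simp: conjugates_def)
  interpret V: quasi_abs "\<lambda>y. place p (g y)" 1
    by (rule quasi_abs_comp[OF quasi_abs_place_prime[OF p(1)] g(1)])
  have le1: "place p (g y) \<le> 1" if "good_places {y} P" for y
    using that p g(1) by (auto simp: good_places_def conjugates_def)
  have "place p (g (\<Sum>i\<in>I. coeff f i * x ^ i)) \<le> 1" if "finite I" for I
    using that
  proof (induction I)
    case (insert i I)
    have "place p (g (coeff f i * x ^ i)) \<le> 1"
      unfolding V.mult V.power using le1[OF f] le1[OF x] by (intro mult_le_one power_le_one) auto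
    thus ?case using insert V.add_le[of "coeff f i * x ^ i" "\<Sum>i\<in>I. coeff f i * x ^ i"] by simp
  qed simp
  thus "place p c \<le> 1" unfolding g(2) poly_altdef by simp
qed (use x in \<open>auto simp: good_places_def\<close>)

section \<open>The critical height\<close>

lemma conjugate_normal_form:
  fixes f :: "'a :: {alg_closed_field, field_char_0} poly"
  assumes d: "2 \<le> Polynomial.degree f"
  obtains \<alpha> z w where "\<alpha> \<noteq> 0" "\<And>i. w i = \<alpha> * (z i - z 0)"
    "\<And>x. \<alpha> * (poly f x - z 0) = \<alpha> * (x - z 0) + poly (lin_prod w {..<Polynomial.degree f}) (\<alpha> * (x - z 0))"
    "\<And>x. poly (pderiv f) x = 1 + poly (pderiv (lin_prod w {..<Polynomial.degree f})) (\<alpha> * (x - z 0))"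
    "\<And>i. i < Polynomial.degree f \<Longrightarrow> poly f (z i) = z i"
proof -
  define d where "d = Polynomial.degree f"
  have d2: "2 \<le> d" using d by (simp add: d_def)
  define h where "h = f - [:0, 1:]"
  define a where "a = Polynomial.lead_coeff h"
  have deg: "Polynomial.degree h = d"
    unfolding h_def diff_conv_add_uminus using d by (subst degree_add_eq_left) (auto simp: d_def)
  have a0: "a \<noteq> 0" using deg d2 by (auto simp: a_def)
  have "Polynomial.lead_coeff (Polynomial.smult (inverse a) h) = 1"
    using a0 by (simp add: a_def)
  then obtain z where "Polynomial.smult (inverse a) h = lin_prod z {..<Polynomial.degree (Polynomial.smult (inverse a) h)}"
    by (rule monic_splits)
  hence z: "Polynomial.smult (inverse a) h = lin_prod z {..<d}" using a0 deg by simp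
  have fx: "poly f x - x = a * (\<Prod>i<d. x - z i)" for x
  proof -
    have "inverse a * (poly f x - x) = (\<Prod>i<d. x - z i)"
      using arg_cong[OF z, of "\<lambda>p. poly p x"] by (simp add: h_def poly_lin_prod)
    thus ?thesis using a0 by (metis mult.assoc mult_1 right_inverse)
  qed
  obtain \<alpha> where \<alpha>: "\<alpha> ^ (d - 1) = a" using nth_root_exists[of "d - 1" a] d2 by auto
  have \<alpha>0: "\<alpha> \<noteq> 0" using \<alpha> a0 d2 by (auto simp: power_0_left)
  define w where "w i = \<alpha> * (z i - z 0)" for i
  have "\<alpha> ^ d = \<alpha> * a" using \<alpha> d2 by (cases d) auto
  hence Q: "poly (lin_prod w {..<d}) (\<alpha> * (x - z 0)) = \<alpha> * (poly f x - x)" for x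
  proof -
    have "poly (lin_prod w {..<d}) (\<alpha> * (x - z 0)) = (\<Prod>i<d. \<alpha> * (x - z i))"
      unfolding poly_lin_prod w_def by (simp add: algebra_simps)
    also have "\<dots> = \<alpha> * (a * (\<Prod>i<d. x - z i))"
      using \<open>\<alpha> ^ d = \<alpha> * a\<close> by (simp add: prod.distrib)
    finally show ?thesis by (simp add: fx)
  qed
  show ?thesis
  proof (rule that[of \<alpha> w z, folded d_def])
    show "\<alpha> * (poly f x - z 0) = \<alpha> * (x - z 0) + poly (lin_prod w {..<d}) (\<alpha> * (x - z 0))" for x
      unfolding Q by (simp add: algebra_simps)
    show "poly (pderiv f) x = 1 + poly (pderiv (lin_prod w {..<d})) (\<alpha> * (x - z 0))" for x
    proof -
      have "pcompose (lin_prod w {..<d}) [:- (\<alpha> * z 0), \<alpha>:] = Polynomial.smult \<alpha> h"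
      proof -
        have "poly (pcompose (lin_prod w {..<d}) [:- (\<alpha> * z 0), \<alpha>:]) = poly (Polynomial.smult \<alpha> h)"
        proof
          fix y
          have "- (\<alpha> * z 0) + y * \<alpha> = \<alpha> * (y - z 0)" by (simp add: algebra_simps)
          thus "poly (pcompose (lin_prod w {..<d}) [:- (\<alpha> * z 0), \<alpha>:]) y = poly (Polynomial.smult \<alpha> h) y"
            using Q[of y] by (simp add: poly_pcompose h_def)
        qed
        thus ?thesis by (simp only: poly_eq_poly_eq_iff)
      qed
      from arg_cong[OF this, of "\<lambda>p. poly (pderiv p) x"]
      have "poly (pderiv (lin_prod w {..<d})) (- (\<alpha> * z 0) + x * \<alpha>) * \<alpha> = \<alpha> * (poly (pderiv f) x - 1)"
        by (simp add: pderiv_pcompose poly_pcompose pderiv_pCons pderiv_smult pderiv_diff h_def)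
      moreover have "- (\<alpha> * z 0) + x * \<alpha> = \<alpha> * (x - z 0)" by (simp add: algebra_simps)
      ultimately have "\<alpha> * poly (pderiv (lin_prod w {..<d})) (\<alpha> * (x - z 0)) = \<alpha> * (poly (pderiv f) x - 1)"
        by (simp only: mult.commute)
      thus ?thesis using \<alpha>0 by simp
    qed
    show "poly f (z i) = z i" if "i < d" for i
    proof -
      have "poly f (z i) - z i = 0" unfolding fx using that by auto
      thus ?thesis by simp
    qed
  qed (simp_all add: w_def \<alpha>0)
qed

section \<open>Local heights along orbits\<close>

lemma log_plus_mono: "a \<le> b \<Longrightarrow> log_plus a \<le> log_plus b"
  by (simp add: log_plus_def)

lemma log_plus_mult:
  assumes "0 \<le> a" "0 \<le> b"
  shows "log_plus (a * b) \<le> log_plus a + log_plus b"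
proof -
  have "1 * 1 \<le> max 1 a * max 1 b" by (intro mult_mono) auto
  moreover have "a * b \<le> max 1 a * max 1 b" using assms by (intro mult_mono) auto
  ultimately have "ln (max 1 (a * b)) \<le> ln (max 1 a * max 1 b)" by (intro ln_mono) auto
  moreover have "max 1 a \<noteq> 0" "max 1 b \<noteq> 0" by (simp_all add: max_def)
  ultimately show ?thesis by (simp add: log_plus_def ln_mult)
qed

context quasi_abs begin

lemma log_plus_add: "log_plus (v (x + y)) \<le> ln \<kappa> + log_plus (v x) + log_plus (v y)"
proof -
  have "log_plus (v (x + y)) \<le> log_plus (\<kappa> * max (v x) (v y))" by (rule log_plus_mono[OF add_le])
  also have "\<dots> \<le> log_plus \<kappa> + log_plus (max (v x) (v y))"
    using \<kappa>_ge_1 by (intro log_plus_mult) (auto simp: le_max_iff_disj)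
  also have "log_plus (max (v x) (v y)) \<le> log_plus (v x) + log_plus (v y)"
    by (cases "v x \<le> v y") (simp_all add: max_def)
  also have "log_plus \<kappa> = ln \<kappa>" using \<kappa>_ge_1 by (simp add: log_plus_def)
  finally show ?thesis by simp
qed

lemma log_plus_prod: "log_plus (v (x * y)) \<le> log_plus (v x) + log_plus (v y)"
  unfolding mult by (rule log_plus_mult) simp_all

text \<open>Passing to the normal form changes local heights by a bounded amount, which disappears
  when the limit along the orbit is taken.\<close>

lemma affine_comparison:
  assumes "\<alpha> \<noteq> 0" "1 \<le> K" "1 \<le> M"
  shows "\<exists>D. \<forall>x. \<bar>log_plus (v x) - ln (K * max M (v (\<alpha> * (x - z))))\<bar> \<le> D"
proof (intro exI allI)
  fix x
  define y where "y = \<alpha> * (x - z)"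
  have x: "x = z + inverse \<alpha> * y" using assms(1) by (simp add: y_def flip: mult.assoc)
  have y: "y = \<alpha> * (x + (- z))" by (simp add: y_def)
  have eq: "ln (K * max M (v y)) = ln K + ln (max M (v y))" using assms by (simp add: ln_mult)
  have "ln (max 1 (v y)) \<le> ln (max M (v y))" using assms by (intro ln_mono) auto
  hence low: "log_plus (v y) \<le> ln (K * max M (v y))"
    using assms(2) unfolding eq by (simp add: log_plus_def add_increasing)
  have "ln (max M (v y)) \<le> ln M + log_plus (v y)"
  proof (cases "v y \<le> M")
    case True
    thus ?thesis by (simp add: max_def)
  next
    case False
    thus ?thesis using assms(3) by (simp add: log_plus_def max_def)
  qed
  moreover have "log_plus (v y) \<le> log_plus (v \<alpha>) + (ln \<kappa> + log_plus (v x) + log_plus (v z))"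
    using log_plus_prod[of \<alpha> "x + (- z)"] log_plus_add[of x "- z"] unfolding y by simp
  moreover have "log_plus (v x) \<le> ln \<kappa> + log_plus (v z) + (log_plus (v (inverse \<alpha>)) + log_plus (v y))"
    using log_plus_add[of z "inverse \<alpha> * y"] log_plus_prod[of "inverse \<alpha>" y] unfolding x[symmetric] by simp
  moreover have "0 \<le> ln K" "0 \<le> ln M" "0 \<le> ln \<kappa>" using assms \<kappa>_ge_1 by simp_all
  ultimately show "\<bar>log_plus (v x) - ln (K * max M (v y))\<bar>
      \<le> ln K + ln M + ln \<kappa> + log_plus (v \<alpha>) + log_plus (v z) + log_plus (v (inverse \<alpha>))"
    using low log_plus_nonneg[of "v \<alpha>"] log_plus_nonneg[of "v (inverse \<alpha>)"] log_plus_nonneg[of "v z"]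
    unfolding eq by linarith
qed

end

text \<open>\<open>Y k / d ^ k\<close> decreases, so it converges to at most \<open>Y 0\<close>; the
  bounded difference gives \<open>h k / d ^ k\<close> the same limit. In particular the limit in
  \<open>canonical_height\<close> exists.\<close>

lemma lim_dynamical_average:
  fixes h Y :: "nat \<Rightarrow> real"
  assumes d: "1 < d" and nonneg: "\<And>k. 0 \<le> Y k" and step: "\<And>k. Y (Suc k) \<le> d * Y k"
    and close: "\<And>k. \<bar>h k - Y k\<bar> \<le> D"
  shows "lim (\<lambda>k. h k / d ^ k) \<le> Y 0"
proof -
  have dec: "decseq (\<lambda>k. Y k / d ^ k)"
    using step d by (intro decseq_SucI) (simp add: divide_simps mult_ac)
  then obtain L where L: "(\<lambda>k. Y k / d ^ k) \<longlonglongrightarrow> L" "\<forall>k. L \<le> Y k / d ^ k"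
    by (rule decseq_convergent[of _ 0]) (use nonneg d in auto)
  have "(\<lambda>k. D / d ^ k) \<longlonglongrightarrow> 0" by (rule LIMSEQ_divide_realpow_zero[OF d])
  hence "(\<lambda>k. h k / d ^ k - Y k / d ^ k) \<longlonglongrightarrow> 0"
  proof (rule tendsto_0_le[where K = 1], intro always_eventually allI)
    fix k
    have "\<bar>h k / d ^ k - Y k / d ^ k\<bar> = \<bar>h k - Y k\<bar> / d ^ k"
      using d by (simp flip: diff_divide_distrib)
    also have "\<dots> \<le> D / d ^ k" using close[of k] d by (intro divide_right_mono) auto
    finally show "norm (h k / d ^ k - Y k / d ^ k) \<le> norm (D / d ^ k) * 1"
      unfolding real_norm_def by linarith
  qed
  from tendsto_add[OF this L(1)] have "(\<lambda>k. h k / d ^ k) \<longlonglongrightarrow> L" by simp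
  hence "lim (\<lambda>k. h k / d ^ k) = L" by (rule limI)
  moreover have "L \<le> Y 0" using L(2)[rule_format, of 0] by simp
  ultimately show ?thesis by simp
qed

text \<open>Bound for the total loss over all places, finite because the constants are 1 above
  \<open>d\<close>. The index 0 is the infinite place; indices that are not prime only enlarge the
  sum.\<close>

definition const_sum :: "nat \<Rightarrow> real" where
  "const_sum d = (\<Sum>n\<le>d. ln (place_const d n))"

lemma const_sum_bound:
  assumes "finite P"
  shows "(\<Sum>n\<in>P. ln (place_const d n)) \<le> const_sum d"
proof -
  have "(\<Sum>n\<in>P. ln (place_const d n)) = (\<Sum>n\<in>P \<inter> {..d}. ln (place_const d n))"
    using assms by (intro sum.mono_neutral_right) (auto simp: place_const_def)
  also have "\<dots> \<le> const_sum d"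
    unfolding const_sum_def using place_const_ge_1 by (intro sum_mono2) auto
  finally show ?thesis .
qed

text \<open>The local input is kept abstract in \<open>spread\<close>, which is instantiated once
  with the multipliers of periods one and two, and once with those of period one in low degree. In
  \<open>4 d + 3 + N\<close> the summand \<open>d + 1\<close> comes from \<open>growth_step\<close>,
  \<open>3 d + 2\<close> from \<open>critical_point_bound\<close> and \<open>N\<close> from
  \<open>spread\<close>.\<close>

lemma critical_height_bound:
  fixes f :: "qbar poly"
  assumes d: "2 \<le> d" "Polynomial.degree f = d"
    and \<alpha>: "\<alpha> \<noteq> 0" and w: "\<And>i. w i = \<alpha> * (z i - z 0)"
    and conj: "\<And>x. \<alpha> * (poly f x - z 0) = \<alpha> * (x - z 0) + poly (lin_prod w {..<d}) (\<alpha> * (x - z 0))"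
    and deriv: "\<And>x. poly (pderiv f) x = 1 + poly (pderiv (lin_prod w {..<d})) (\<alpha> * (x - z 0))"
    and \<Lambda>: "finite \<Lambda>"
    and spread: "\<And>v \<kappa> a b. quasi_abs v \<kappa> \<Longrightarrow> (\<And>n. 1 \<le> n \<Longrightarrow> n \<le> d \<Longrightarrow> 1 \<le> \<kappa> * v (of_nat n)) \<Longrightarrow>
      a < d \<Longrightarrow> b < d \<Longrightarrow> (\<And>i j. i < d \<Longrightarrow> j < d \<Longrightarrow> v (w i - w j) \<le> v (w a - w b)) \<Longrightarrow>
      \<exists>\<mu>\<in>\<Lambda>. v (w a - w b) \<le> \<kappa> ^ N * max 1 (v \<mu>)"
  shows "critical_height f \<le> (real d - 1) * (real (4 * d + 3 + N) * const_sum d + (\<Sum>\<mu>\<in>\<Lambda>. weil_height \<mu>))"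
proof -
  define crit where "crit = {\<gamma>. poly (pderiv f) \<gamma> = 0}"
  have f'0: "pderiv f \<noteq> 0" using d by (auto simp: pderiv_eq_0_iff)
  \<comment> \<open>The element 0 accounts for coefficients beyond the degree.
    \<open>\<alpha>\<close> and the \<open>w i\<close> need not be determined by \<open>S\<close>:
    they enter only through inequalities at each pair of a place and an automorphism, never through
    their heights.\<close>
  define S where "S = coeff f ` {..d} \<union> {0} \<union> crit \<union> \<Lambda>"
  have "finite S" unfolding S_def crit_def using \<Lambda> poly_roots_finite[OF f'0] by simp
  then obtain \<Gamma> P where \<Gamma>: "transversal S \<Gamma>" and P: "good_places S P"
    using transversal_exists good_places_exists by metis
  have Pf: "finite P" "\<And>n. n \<in> P \<Longrightarrow> n \<in> places" using P by (auto simp: good_places_def)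
  have \<Gamma>h: "\<And>g. g \<in> \<Gamma> \<Longrightarrow> field_hom g" using \<Gamma> by (auto simp: transversal_def)
  have detS: "determined_by S s" if "s \<in> S" for s using that by (auto simp: determined_by_def)
  have goodS: "good_places {s} P" if "s \<in> S" for s using P that by (auto simp: good_places_def)
  have coeff_S: "coeff f i \<in> S" for i
    using d by (cases "i \<le> d") (auto simp: S_def coeff_eq_0)
  define avg where "avg F = (\<Sum>n\<in>P. \<Sum>g\<in>\<Gamma>. F n g) / real (card \<Gamma>)" for F :: "nat \<Rightarrow> (qbar \<Rightarrow> qbar) \<Rightarrow> real"
  have card\<Gamma>: "card \<Gamma> \<noteq> 0" by (rule transversal_nonempty[OF \<Gamma>])
  have avg_mono: "avg F \<le> avg G" if "\<And>n g. n \<in> P \<Longrightarrow> g \<in> \<Gamma> \<Longrightarrow> F n g \<le> G n g" for F G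
    unfolding avg_def using that by (intro divide_right_mono sum_mono) auto
  have avg_cmult: "avg (\<lambda>n g. c * F n g) = c * avg F" for c F by (simp add: avg_def sum_distrib_left)
  have avg_add: "avg (\<lambda>n g. F n g + G n g) = avg F + avg G" for F G
    by (simp add: avg_def sum.distrib add_divide_distrib)
  have avg_sum: "avg (\<lambda>n g. \<Sum>i\<in>I. F i n g) = (\<Sum>i\<in>I. avg (F i))" for I :: "qbar set" and F
  proof (induction I rule: infinite_finite_induct)
    case (insert i I)
    thus ?case by (simp add: avg_add)
  qed (simp_all add: avg_def)
  have avg_const: "avg (\<lambda>n g. F n) = (\<Sum>n\<in>P. F n)" for F
    using card\<Gamma> by (simp add: avg_def flip: sum_distrib_left)
  have height: "weil_height x = avg (\<lambda>n g. log_plus (place n (g x)))"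
    if "determined_by S x" "good_places {x} P" for x
    using weil_height_average[OF \<Gamma> that] by (simp add: avg_def)
  define \<kappa> where "\<kappa> n = place_const d n" for n
  have \<kappa>1: "1 \<le> \<kappa> n" for n by (simp add: \<kappa>_def place_const_ge_1)
  have qa: "quasi_abs (\<lambda>x. place n (g x)) (\<kappa> n)" if "n \<in> P" "g \<in> \<Gamma>" for n g
    unfolding \<kappa>_def using quasi_abs_comp[OF quasi_abs_place \<Gamma>h] Pf that by blast
  have int: "1 \<le> \<kappa> n * place n (g (of_nat m))" if "n \<in> P" "g \<in> \<Gamma>" "1 \<le> m" "m \<le> d" for n g m
    using place_const_nat[of n m d] Pf(2) that field_homD(8)[OF \<Gamma>h[OF that(2)]] by (simp add: \<kappa>_def)
  \<comment> \<open>The diameter as seen by the place \<open>n\<close> after the automorphism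
    \<open>g\<close>. The multiplier bounding it may change with the pair, so the next estimate
    passes to the sum over \<open>\<Lambda>\<close>.\<close>
  define R where "R n g = Max ((\<lambda>(i, j). place n (g (w i - w j))) ` ({..<d} \<times> {..<d}))" for n g
  have R_ge: "place n (g (w i - w j)) \<le> R n g" if "i < d" "j < d" for n g i j
    unfolding R_def by (rule Max_ge) (use that in auto)
  have R_att: "\<exists>a<d. \<exists>b<d. R n g = place n (g (w a - w b))" for n g
  proof -
    have "R n g \<in> (\<lambda>(i, j). place n (g (w i - w j))) ` ({..<d} \<times> {..<d})"
      unfolding R_def by (rule Max_in) (use d in \<open>auto simp: lessThan_empty_iff\<close>)
    thus ?thesis by auto
  qed
  have R_log: "log_plus (R n g) \<le> real N * ln (\<kappa> n) + (\<Sum>\<mu>\<in>\<Lambda>. log_plus (place n (g \<mu>)))"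
    if ng: "n \<in> P" "g \<in> \<Gamma>" for n g
  proof -
    obtain a b where ab: "a < d" "b < d" "R n g = place n (g (w a - w b))" using R_att by blast
    have "\<exists>\<mu>\<in>\<Lambda>. place n (g (w a - w b)) \<le> \<kappa> n ^ N * max 1 (place n (g \<mu>))"
      using int[OF ng] R_ge[of _ _ n g] by (intro spread[OF qa[OF ng] _ ab(1,2)]) (auto simp: ab(3))
    then obtain \<mu> where \<mu>: "\<mu> \<in> \<Lambda>" "R n g \<le> \<kappa> n ^ N * max 1 (place n (g \<mu>))" by (auto simp: ab(3))
    have "log_plus (R n g) \<le> log_plus (\<kappa> n ^ N * max 1 (place n (g \<mu>)))" by (rule log_plus_mono[OF \<mu>(2)])
    also have "\<dots> \<le> log_plus (\<kappa> n ^ N) + log_plus (max 1 (place n (g \<mu>)))"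
      using \<kappa>1[of n] by (intro log_plus_mult) auto
    also have "log_plus (\<kappa> n ^ N) = real N * ln (\<kappa> n)"
      using \<kappa>1[of n] by (simp add: log_plus_def one_le_power max_absorb2 ln_realpow)
    also have "log_plus (max 1 (place n (g \<mu>))) = log_plus (place n (g \<mu>))" by (simp add: log_plus_def)
    also have "\<dots> \<le> (\<Sum>\<mu>\<in>\<Lambda>. log_plus (place n (g \<mu>)))" using \<mu>(1) \<Lambda> by (intro member_le_sum) auto
    finally show ?thesis by simp
  qed
  define B where "B = real (4 * d + 3 + N) * const_sum d + (\<Sum>\<mu>\<in>\<Lambda>. weil_height \<mu>)"
  have B0: "0 \<le> B"
    unfolding B_def const_sum_def using place_const_ge_1 weil_height_nonneg
    by (intro add_nonneg_nonneg mult_nonneg_nonneg sum_nonneg) auto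
  have canonical: "canonical_height f \<gamma> \<le> B" if \<gamma>: "\<gamma> \<in> crit" for \<gamma>
  proof -
    define x where "x k = (poly f ^^ k) \<gamma>" for k
    have xS: "determined_by S (x k)" "good_places {x k} P" for k
    proof (induction k)
      case 0
      case 1 show ?case using \<gamma> detS by (simp add: x_def S_def)
      case 2 show ?case using \<gamma> goodS by (simp add: x_def S_def)
    next
      case (Suc k)
      have "x (Suc k) = poly f (x k)" by (simp add: x_def)
      moreover case 1
      ultimately show ?case using poly_determined_by[OF detS[OF coeff_S]] Suc.IH by simp
      case 2
      show ?case using good_places_poly[OF goodS[OF coeff_S]] Suc.IH by (simp add: x_def)
    qed
    define y where "y k = \<alpha> * (x k - z 0)" for k
    have y_Suc: "y (Suc k) = y k + poly (lin_prod w {..<d}) (y k)" for k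
      using conj[of "x k"] by (simp add: y_def x_def)
    define M where "M n g = max 1 (R n g)" for n g
    \<comment> \<open>Majorant of the local height of \<open>y k\<close>, with exactly the prefactor
      for which \<open>growth_step\<close> gives \<open>U (Suc k) \<le> d * U k\<close>.\<close>
    define U where "U k n g = ln (\<kappa> n ^ Suc d * max (M n g) (place n (g (y k))))" for k n g
    have arg1: "1 \<le> \<kappa> n ^ Suc d * max (M n g) t" for n g t
      using mult_mono[of 1 "\<kappa> n ^ Suc d" 1 "max (M n g) t"] \<kappa>1[of n] by (simp add: M_def one_le_power del: power_Suc)
    have U0: "0 \<le> U k n g" for k n g unfolding U_def using arg1 by (intro ln_ge_zero)
    have w_le: "place n (g (w i)) \<le> R n g" if "i < d" for n g i
      using R_ge[of i 0 n g] w[of 0] that d by simp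
    have U_step: "U (Suc k) n g \<le> real d * U k n g" if ng: "n \<in> P" "g \<in> \<Gamma>" for k n g
    proof -
      interpret V: quasi_abs "\<lambda>x. place n (g x)" "\<kappa> n" by (rule qa[OF ng])
      have "\<kappa> n ^ Suc d * max (M n g) (place n (g (y (Suc k)))) \<le> (\<kappa> n ^ Suc d * max (M n g) (place n (g (y k)))) ^ d"
        unfolding y_Suc using d w_le[of _ n g]
        by (intro V.growth_step) (auto simp: M_def le_max_iff_disj)
      hence "U (Suc k) n g \<le> ln ((\<kappa> n ^ Suc d * max (M n g) (place n (g (y k)))) ^ d)"
        unfolding U_def using arg1[of n g] by (intro ln_mono) (auto intro: less_le_trans[OF zero_less_one])
      thus ?thesis unfolding U_def using arg1[of n g] by (simp add: ln_realpow less_le_trans[OF zero_less_one] del: power_Suc)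
    qed
    have "\<exists>D. \<forall>k. \<bar>log_plus (place n (g (x k))) - U k n g\<bar> \<le> D" if ng: "n \<in> P" "g \<in> \<Gamma>" for n g
    proof -
      interpret V: quasi_abs "\<lambda>x. place n (g x)" "\<kappa> n" by (rule qa[OF ng])
      show ?thesis
        using V.affine_comparison[OF \<alpha>, of "\<kappa> n ^ Suc d" "M n g" "z 0"] \<kappa>1[of n]
        unfolding U_def y_def by (auto simp: M_def one_le_power simp del: power_Suc)
    qed
    \<comment> \<open>The comparison constants depend on the place and the automorphism but not on
      \<open>k\<close>; only finitely many pairs occur, so their average is a legitimate bound for
      all \<open>k\<close>.\<close>
    then obtain D where D: "\<And>n g k. n \<in> P \<Longrightarrow> g \<in> \<Gamma> \<Longrightarrow> \<bar>log_plus (place n (g (x k))) - U k n g\<bar> \<le> D n g"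
      by metis
    define Y where "Y k = avg (U k)" for k
    have close: "\<bar>weil_height (x k) - Y k\<bar> \<le> avg D" for k
    proof -
      have "weil_height (x k) \<le> avg (\<lambda>n g. D n g + U k n g)"
        unfolding height[OF xS]
      proof (rule avg_mono)
        fix n g assume "n \<in> P" "g \<in> \<Gamma>"
        from D[OF this, of k] show "log_plus (place n (g (x k))) \<le> D n g + U k n g" by linarith
      qed
      moreover have "Y k \<le> avg (\<lambda>n g. D n g + log_plus (place n (g (x k))))"
        unfolding Y_def
      proof (rule avg_mono)
        fix n g assume "n \<in> P" "g \<in> \<Gamma>"
        from D[OF this, of k] show "U k n g \<le> D n g + log_plus (place n (g (x k)))" by linarith
      qed
      ultimately show ?thesis unfolding avg_add height[OF xS, symmetric] by (simp add: Y_def abs_le_iff)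
    qed
    have "canonical_height f \<gamma> \<le> Y 0"
      unfolding canonical_height_def d(2) x_def[symmetric]
    proof (rule lim_dynamical_average[where D = "avg D"])
      show "0 \<le> Y k" for k unfolding Y_def avg_def using U0 by (intro divide_nonneg_nonneg sum_nonneg) auto
      show "Y (Suc k) \<le> real d * Y k" for k
        unfolding Y_def avg_cmult[symmetric] by (rule avg_mono[OF U_step])
    qed (use d close in auto)
    also have "Y 0 \<le> avg (\<lambda>n g. real (4 * d + 3 + N) * ln (\<kappa> n) + (\<Sum>\<mu>\<in>\<Lambda>. log_plus (place n (g \<mu>))))"
      unfolding Y_def
    proof (rule avg_mono)
      fix n g assume ng: "n \<in> P" "g \<in> \<Gamma>"
      interpret V: quasi_abs "\<lambda>x. place n (g x)" "\<kappa> n" by (rule qa[OF ng])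
      have "1 + poly (pderiv (lin_prod w {..<d})) (y 0) = 0"
        using \<gamma> deriv[of \<gamma>] by (simp add: crit_def y_def x_def)
      hence y0: "place n (g (y 0)) \<le> \<kappa> n ^ (3 * d + 2) * M n g"
        using d w_le[of _ n g] int[OF ng, of d] by (intro V.critical_point_bound[where R = "R n g"]) (auto simp: M_def)
      have "1 * M n g \<le> \<kappa> n ^ (3 * d + 2) * M n g"
        using \<kappa>1[of n] by (intro mult_right_mono one_le_power) (auto simp: M_def)
      hence "\<kappa> n ^ Suc d * max (M n g) (place n (g (y 0))) \<le> \<kappa> n ^ Suc d * (\<kappa> n ^ (3 * d + 2) * M n g)"
        using y0 \<kappa>1[of n] by (intro mult_left_mono) auto
      also have "\<dots> = \<kappa> n ^ (4 * d + 3) * M n g"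
      proof -
        have "4 * d + 3 = Suc d + (3 * d + 2)" by simp
        thus ?thesis by (simp only: power_add mult.assoc)
      qed
      finally have "U 0 n g \<le> ln (\<kappa> n ^ (4 * d + 3) * M n g)"
        unfolding U_def using arg1[of n g] by (intro ln_mono) (auto intro: less_le_trans[OF zero_less_one])
      also have "\<dots> = real (4 * d + 3) * ln (\<kappa> n) + log_plus (R n g)"
        using \<kappa>1[of n] by (simp add: ln_mult ln_realpow M_def log_plus_def)
      finally show "U 0 n g \<le> real (4 * d + 3 + N) * ln (\<kappa> n) + (\<Sum>\<mu>\<in>\<Lambda>. log_plus (place n (g \<mu>)))"
        using R_log[OF ng] by (simp add: algebra_simps)
    qed
    also have "\<dots> = real (4 * d + 3 + N) * (\<Sum>n\<in>P. ln (\<kappa> n)) + (\<Sum>\<mu>\<in>\<Lambda>. weil_height \<mu>)"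
    proof -
      have "avg (\<lambda>n g. log_plus (place n (g \<mu>))) = weil_height \<mu>" if "\<mu> \<in> \<Lambda>" for \<mu>
        using height[OF detS goodS, of \<mu>] that by (simp add: S_def)
      thus ?thesis unfolding avg_add avg_cmult avg_sum avg_const by simp
    qed
    also have "\<dots> \<le> B"
      unfolding B_def \<kappa>_def by (intro add_right_mono mult_left_mono const_sum_bound Pf) simp
    finally show ?thesis .
  qed
  \<comment> \<open>The bound \<open>B\<close> is the same for every critical point, and the
    multiplicities add up to at most \<open>d - 1\<close>.\<close>
  have "critical_height f \<le> (\<Sum>\<gamma>\<in>crit. real (Polynomial.order \<gamma> (pderiv f)) * B)"
    unfolding critical_height_def crit_def[symmetric] by (intro sum_mono mult_left_mono canonical) auto
  also have "\<dots> = real (\<Sum>\<gamma>\<in>crit. Polynomial.order \<gamma> (pderiv f)) * B" by (simp add: sum_distrib_right)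
  also have "\<dots> \<le> real (d - 1) * B"
  proof (rule mult_right_mono[OF _ B0])
    have "(\<Sum>\<gamma>\<in>crit. Polynomial.order \<gamma> (pderiv f)) \<le> d - 1"
      using sum_order_le_degree[OF f'0] d(2) by (simp add: crit_def degree_pderiv)
    thus "real (\<Sum>\<gamma>\<in>crit. Polynomial.order \<gamma> (pderiv f)) \<le> real (d - 1)" by (simp only: of_nat_le_iff)
  qed
  finally show ?thesis using d by (simp add: B_def of_nat_diff)
qed

section \<open>Counting multipliers and the final constants\<close>

lemma multipliers_card:
  assumes "2 \<le> Polynomial.degree f"
  shows "card (set_mset (multipliers f 1)) \<le> Polynomial.degree f"
    and "card (set_mset (multipliers f 2)) \<le> Polynomial.degree f ^ 2"
    and "multipliers f 1 \<noteq> {#}"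
proof -
  define d where "d = Polynomial.degree f"
  have d2: "2 \<le> d" using assms by (simp add: d_def)
  have deg1: "Polynomial.degree (f - [:0, 1:]) = d"
    unfolding diff_conv_add_uminus using d2 by (subst degree_add_eq_left) (auto simp: d_def)
  have nz: "f - [:0, 1:] \<noteq> 0" using deg1 d2 by auto
  have "{z. poly f z = z} = {z. poly (f - [:0, 1:]) z = 0}" by auto
  hence fixpts: "finite {z. poly f z = z}" "card {z. poly f z = z} \<le> d"
    using poly_roots_finite[OF nz] card_poly_roots_bound[OF nz] deg1 by simp_all
  show "card (set_mset (multipliers f 1)) \<le> d"
    unfolding multipliers_1[OF assms] using card_image_le[OF fixpts(1)] fixpts(2) by (rule order_trans)
  have "\<exists>z. poly (f - [:0, 1:]) z = 0" using deg1 d2 by (intro alg_closed_imp_poly_has_root) simp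
  hence "set_mset (multipliers f 1) \<noteq> {}" unfolding multipliers_1[OF assms] by auto
  thus "multipliers f 1 \<noteq> {#}" by auto
  have nz2: "dynatomic f 2 \<noteq> 0" by (rule dyn_nz[OF assms])
  have "Polynomial.degree (f - [:0, 1:]) + Polynomial.degree (dynatomic f 2) = Polynomial.degree (pcompose f f - [:0, 1:])"
    unfolding dynatomic_2[symmetric] using nz nz2 by (simp add: degree_mult_eq)
  also have "\<dots> \<le> d ^ 2"
    using d2 by (intro degree_diff_le) (auto simp: degree_pcompose d_def power2_eq_square)
  finally have "Polynomial.degree (dynatomic f 2) \<le> d ^ 2" by simp
  hence "card {z. poly (dynatomic f 2) z = 0} \<le> d ^ 2" using card_poly_roots_bound[OF nz2] by (rule order_trans[rotated])
  thus "card (set_mset (multipliers f 2)) \<le> d ^ 2"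
    unfolding multipliers_2[OF assms] using card_image_le[OF poly_roots_finite[OF nz2]] by (rule order_trans[rotated])
qed

text \<open>\<open>spread_bound\<close> is applied over \<open>qbar\<close>, so the point
  \<open>\<zeta>\<close> it finds is algebraic. Undoing the coordinate change turns it into a root
  of the second dynatomic polynomial of \<open>f\<close>, whose multiplier lies in a set independent
  of the absolute value.\<close>

lemma critical_height_le_multipliers:
  assumes d: "2 \<le> d" and f: "f \<in> Poly_deg d"
  defines "N \<equiv> 2 * (d ^ 2 + 20 * d + 30) ^ Suc d + 1"
  shows "critical_height f \<le> (real d - 1) * (real (4 * d + 3 + N) * const_sum d
      + (\<Sum>\<mu>\<in>set_mset (multipliers f 1) \<union> set_mset (multipliers f 2). weil_height \<mu>))"
    and "d \<in> {2, 3} \<Longrightarrow> critical_height f \<le> (real d - 1) * (real (4 * d + 3 + 2) * const_sum d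
      + (\<Sum>\<mu>\<in>set_mset (multipliers f 1). weil_height \<mu>))"
proof -
  have df: "Polynomial.degree f = d" using f by (simp add: Poly_deg_def)
  hence f2: "2 \<le> Polynomial.degree f" using d by simp
  obtain \<alpha> z w where \<alpha>: "\<alpha> \<noteq> 0" and w: "\<And>i. w i = \<alpha> * (z i - z 0)"
    and conj: "\<And>x. \<alpha> * (poly f x - z 0) = \<alpha> * (x - z 0) + poly (lin_prod w {..<d}) (\<alpha> * (x - z 0))"
    and deriv: "\<And>x. poly (pderiv f) x = 1 + poly (pderiv (lin_prod w {..<d})) (\<alpha> * (x - z 0))"
    and fixed: "\<And>i. i < d \<Longrightarrow> poly f (z i) = z i"
    using conjugate_normal_form[OF f2] unfolding df by metis
  have mult1: "1 + poly (pderiv (lin_prod w {..<d})) (w i) \<in> set_mset (multipliers f 1)" if "i < d" for i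
    unfolding w deriv[symmetric] multipliers_1[OF f2] using fixed[OF that] by blast
  have mult2: "(1 + poly (pderiv (lin_prod w {..<d})) \<zeta>) * (1 + poly (pderiv (lin_prod w {..<d})) (g \<zeta>))
      \<in> set_mset (multipliers f 2)"
    if g: "\<And>x. g x = x + poly (lin_prod w {..<d}) x" and \<zeta>: "g (g \<zeta>) = \<zeta>" "g \<zeta> \<noteq> \<zeta>" for g \<zeta>
  proof -
    define x where "x = z 0 + \<zeta> / \<alpha>"
    have x: "\<zeta> = \<alpha> * (x - z 0)" using \<alpha> by (simp add: x_def)
    have gx: "g (\<alpha> * (t - z 0)) = \<alpha> * (poly f t - z 0)" for t by (simp add: g conj)
    have "\<alpha> * (poly f (poly f x) - z 0) = \<alpha> * (x - z 0)" "\<alpha> * (poly f x - z 0) \<noteq> \<alpha> * (x - z 0)"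
      using \<zeta> unfolding x gx by simp_all
    hence "poly f (poly f x) = x" "poly f x \<noteq> x" using \<alpha> by auto
    hence "poly (dynatomic f 2) x = 0" by (rule dynatomic_2_root[OF f2])
    thus ?thesis unfolding x gx deriv[symmetric] multipliers_2[OF f2] by blast
  qed
  show "critical_height f \<le> (real d - 1) * (real (4 * d + 3 + N) * const_sum d
      + (\<Sum>\<mu>\<in>set_mset (multipliers f 1) \<union> set_mset (multipliers f 2). weil_height \<mu>))"
  proof (rule critical_height_bound[OF d df \<alpha> w conj deriv])
    fix v :: "qbar \<Rightarrow> real" and \<kappa> a b
    assume v: "quasi_abs v \<kappa>" and int: "\<And>n. 1 \<le> n \<Longrightarrow> n \<le> d \<Longrightarrow> 1 \<le> \<kappa> * v (of_nat n)"
      and ab: "a < d" "b < d" and max: "\<And>i j. i < d \<Longrightarrow> j < d \<Longrightarrow> v (w i - w j) \<le> v (w a - w b)"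
    interpret V: quasi_abs_closed v \<kappa> using v by (simp add: quasi_abs_closed_def)
    define g where "g x = x + poly (lin_prod w {..<d}) x" for x
    have "(\<exists>i<d. v (w a - w b) \<le> \<kappa> ^ N * max 1 (v (1 + poly (pderiv (lin_prod w {..<d})) (w i)))) \<or>
      (\<exists>\<zeta>. g (g \<zeta>) = \<zeta> \<and> g \<zeta> \<noteq> \<zeta> \<and> v (w a - w b) \<le> \<kappa> ^ N * max 1 (v
        ((1 + poly (pderiv (lin_prod w {..<d})) \<zeta>) * (1 + poly (pderiv (lin_prod w {..<d})) (g \<zeta>)))))"
      unfolding N_def g_def by (rule V.spread_bound[OF d ab]) (rule max int; assumption)+
    thus "\<exists>\<mu>\<in>set_mset (multipliers f 1) \<union> set_mset (multipliers f 2). v (w a - w b) \<le> \<kappa> ^ N * max 1 (v \<mu>)"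
    proof (elim disjE exE conjE)
      fix i assume "i < d" "v (w a - w b) \<le> \<kappa> ^ N * max 1 (v (1 + poly (pderiv (lin_prod w {..<d})) (w i)))"
      thus ?thesis using mult1 by blast
    next
      fix \<zeta> assume "g (g \<zeta>) = \<zeta>" "g \<zeta> \<noteq> \<zeta>" "v (w a - w b) \<le> \<kappa> ^ N * max 1 (v
        ((1 + poly (pderiv (lin_prod w {..<d})) \<zeta>) * (1 + poly (pderiv (lin_prod w {..<d})) (g \<zeta>))))"
      thus ?thesis using mult2[OF g_def] by blast
    qed
  qed auto
  assume d23: "d \<in> {2, 3}"
  show "critical_height f \<le> (real d - 1) * (real (4 * d + 3 + 2) * const_sum d
      + (\<Sum>\<mu>\<in>set_mset (multipliers f 1). weil_height \<mu>))"
  proof (rule critical_height_bound[OF d df \<alpha> w conj deriv])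
    fix v :: "qbar \<Rightarrow> real" and \<kappa> a b
    assume v: "quasi_abs v \<kappa>" and ab: "a < d" "b < d"
    interpret V: quasi_abs v \<kappa> by (rule v)
    show "\<exists>\<mu>\<in>set_mset (multipliers f 1). v (w a - w b) \<le> \<kappa> ^ 2 * max 1 (v \<mu>)"
      using V.spread_bound_le_3[OF d23 ab, of w] mult1 by blast
  qed auto
qed

text \<open>Sums over multipliers become maxima at the cost of their number: at most
  \<open>d\<close> values come from fixed points and at most \<open>d^2\<close> from the second
  dynatomic polynomial.\<close>

lemma height_inequality:
  fixes C :: real
  assumes d: "2 \<le> d" and \<Lambda>: "card \<Lambda> \<le> d + d ^ 2" "\<And>\<mu>. \<mu> \<in> \<Lambda> \<Longrightarrow> weil_height \<mu> \<le> m" and m: "0 \<le> m"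
    and H: "H \<le> (real d - 1) * (C + (\<Sum>\<mu>\<in>\<Lambda>. weil_height \<mu>))"
  shows "1 / ((real d - 1) * real (d + d ^ 2)) * H + (- C / real (d + d ^ 2)) \<le> m"
proof -
  define D e where "D = real (d + d ^ 2)" and "e = real d - 1"
  have pos: "0 < D" "0 < e" using d by (auto simp: D_def e_def intro!: add_pos_pos)
  have "(\<Sum>\<mu>\<in>\<Lambda>. weil_height \<mu>) \<le> real (card \<Lambda>) * m" using \<Lambda>(2) by (rule sum_bounded_above)
  also have "\<dots> \<le> D * m"
    unfolding D_def using \<Lambda>(1) m by (intro mult_right_mono) (simp_all only: of_nat_le_iff)
  finally have "e * (C + (\<Sum>\<mu>\<in>\<Lambda>. weil_height \<mu>)) \<le> e * (C + D * m)" using pos by simp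
  hence "H \<le> e * (C + D * m)" using H by (simp add: e_def)
  hence "H / (e * D) \<le> e * (C + D * m) / (e * D)" using pos by (intro divide_right_mono) auto
  also have "\<dots> = (C + D * m) / D" using pos by simp
  also have "\<dots> = C / D + m" using pos by (simp add: add_divide_distrib)
  finally show ?thesis unfolding D_def[symmetric] e_def[symmetric] by simp
qed

theorem corollary1p2:
  fixes d :: nat
  assumes "d \<ge> 2"
  shows "(\<exists>A B :: real. A > 0 \<and>
            (\<forall>f\<in>Poly_deg d. max (multiplier_height f 1) (multiplier_height f 2)
                          \<ge> A * critical_height f + B)) \<and>
         (d \<in> {2, 3} \<longrightarrow>
            (\<exists>A B :: real. A > 0 \<and>
               (\<forall>f\<in>Poly_deg d. multiplier_height f 1 \<ge> A * critical_height f + B)))"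
proof -
  define A where "A = 1 / ((real d - 1) * real (d + d ^ 2))"
  have "0 < (real d - 1) * real (d + d ^ 2)" using assms by (intro mult_pos_pos) (auto intro!: add_pos_pos)
  hence A: "0 < A" by (simp add: A_def)
  define N where "N = 2 * (d ^ 2 + 20 * d + 30) ^ Suc d + 1"
  have le: "weil_height \<mu> \<le> multiplier_height f p" if "\<mu> \<in># multipliers f p" for f p \<mu>
    unfolding multiplier_height_def using that by (intro Max_ge) auto
  \<comment> \<open>A fixed point always exists, so this maximum is over a nonempty set;
    \<open>Max\<close> of an empty set would carry no information. Period one suffices for a lower
    bound on the maximum over both periods.\<close>
  have nonneg: "0 \<le> multiplier_height f 1" if f: "f \<in> Poly_deg d" for f
  proof -
    have "multipliers f 1 \<noteq> {#}" using f assms by (intro multipliers_card) (simp add: Poly_deg_def)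
    then obtain \<mu> where "\<mu> \<in># multipliers f 1" by blast
    thus ?thesis using le weil_height_nonneg order_trans by blast
  qed
  have card: "card (set_mset (multipliers f 1)) \<le> d" "card (set_mset (multipliers f 2)) \<le> d ^ 2"
    if f: "f \<in> Poly_deg d" for f
    using multipliers_card(1,2)[of f] f assms by (simp_all add: Poly_deg_def)
  have "A * critical_height f + (- (real (4 * d + 3 + N) * const_sum d) / real (d + d ^ 2))
      \<le> max (multiplier_height f 1) (multiplier_height f 2)" if f: "f \<in> Poly_deg d" for f
    unfolding A_def
  proof (rule height_inequality[OF assms _ _ _ critical_height_le_multipliers(1)[OF assms f, folded N_def]])
    show "card (set_mset (multipliers f 1) \<union> set_mset (multipliers f 2)) \<le> d + d ^ 2"
      using card_Un_le[of "set_mset (multipliers f 1)" "set_mset (multipliers f 2)"] card[OF f] by linarith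
    show "weil_height \<mu> \<le> max (multiplier_height f 1) (multiplier_height f 2)"
      if "\<mu> \<in> set_mset (multipliers f 1) \<union> set_mset (multipliers f 2)" for \<mu>
      using that le by (force simp: le_max_iff_disj)
    show "0 \<le> max (multiplier_height f 1) (multiplier_height f 2)" using nonneg[OF f] by (simp add: le_max_iff_disj)
  qed
  moreover have "A * critical_height f + (- (real (4 * d + 3 + 2) * const_sum d) / real (d + d ^ 2))
      \<le> multiplier_height f 1" if f: "f \<in> Poly_deg d" and d: "d \<in> {2, 3}" for f
    unfolding A_def
  proof (rule height_inequality[OF assms _ _ nonneg[OF f] critical_height_le_multipliers(2)[OF assms f d]])
    show "card (set_mset (multipliers f 1)) \<le> d + d ^ 2" using card[OF f] by linarith
  qed (rule le)
  ultimately show ?thesis using A by blast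
qed

end
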